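(* Let $1<q<2$, and let $f=f((z,t),s)$, with primitive $F((z,t),s)=\int_0^s f((z,t),\sigma)\,d\sigma$, satisfy the following structural assumptions: (1) $f((z,t),0)=0$; (2) $0<s\,f((z,t),s)\le q\,F((z,t),s)$ for $s\in(-1,1)\setminus\{0\}$; (3) $|\nabla_{(z,t)}f|\le K|f|$ and $|\nabla_{(z,t)}F|\le K F$; (4) $|f((z,t),s)|\le\kappa|s|^{p-1}$ for some $p\in(1,2)$. Let $c_0$ denote the constant in the bound $F((z,t),s)\ge c_0|s|^q$ for $s\in(-1,1)$, which follows from the structural assumptions. Then for every $\varepsilon>0$ there exists $C=C(m,k,\varepsilon,q,K,\kappa,c_0)>0$ such that for $\alpha>0$ sufficiently large, and every $u\in S^{2,2}_0(B_R\setminus\{0\})$ with $\operatorname{supp}u\subset B_R\setminus\{0\}$, one has $$\alpha^2\int\left(\rho^{-2\alpha-4+\varepsilon}\,u^2\,\psi+\rho^{-2\alpha-2+\varepsilon}\,|u|^q\,\psi^2\right)\le C R^{\varepsilon}\int\rho^{-2\alpha}\left(\mathscr{B}_\gamma u+f((z,t),u)\,\psi\right)^2\psi^{-1}.$$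
   Context: Let $m,k\ge 1$ be integers, $\gamma>0$, $N=m+k$, and write points of $\mathbb{R}^N$ as $(z,t)$ with $z\in\mathbb{R}^m$, $t\in\mathbb{R}^k$. Here $R>0$, and $K,\kappa$ are constants. Integrals are with respect to Lebesgue measure $dz\,dt$, over $B_R$. The function $f$ is real-valued, depends on the point $(z,t)$ and on a real variable $s$, and is such that the primitive $F$ and the gradients in (3) make sense; $\nabla_{(z,t)}$ is the full Euclidean gradient in the variables $(z,t)$ with $s$ fixed. Vector fields: $X_i=\partial_{z_i}$ for $i=1,\dots,m$, and $X_{m+j}=|z|^\gamma\partial_{t_j}$ for $j=1,\dots,k$. The Baouendi-Grushin operator is $\mathscr{B}_\gamma u=\sum_{i=1}^N X_i^2u=\Delta_z u+|z|^{2\gamma}\Delta_t u$. Also $Xu=(X_1u,\dots,X_Nu)$ and $|Xu|^2=\sum_{i=1}^N (X_iu)^2$. Pseudo-gauge: $\rho(z,t)=\left(|z|^{2(\gamma+1)}+(\gamma+1)^2|t|^2\right)^{\frac{1}{2(\gamma+1)}}$, and $B_r=\{(z,t)\in\mathbb{R}^N:\rho(z,t)<r\}$. Angle function: $\psi=|X\rho|^2=|z|^{2\gamma}/\rho^{2\gamma}$, so $0\le\psi\le1$. For an open set $\Omega\subset\mathbb{R}^N$, $S^{2,2}_0(\Omega)$ is the completion of $C_0^\infty(\Omega)$ with respect to the norm $\left(\int_\Omega g^2+|Xg|^2+\sum_{i,j=1}^N|X_iX_jg|^2\right)^{1/2}$. *)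

theory Defs
  imports "HOL-Analysis.Analysis"
begin

text \<open>
  Points \<open>(z,t)\<close> are elements of \<open>(real^'m) \<times> (real^'k)\<close>, whose product norm is the Euclidean one;
  \<open>m = CARD('m)\<close> and \<open>k = CARD('k)\<close>.  The \<open>N = m + k\<close> vector fields are indexed by the sum
  type \<open>'m + 'k\<close>.
\<close>

definition partial :: "'a::real_normed_vector \<Rightarrow> ('a \<Rightarrow> real) \<Rightarrow> 'a \<Rightarrow> real" where
  "partial v u p = deriv (\<lambda>h. u (p + h *\<^sub>R v)) 0"

definition Xv :: "real \<Rightarrow> 'm + 'k \<Rightarrow> ((real^'m::finite) \<times> (real^'k::finite) \<Rightarrow> real)
    \<Rightarrow> (real^'m) \<times> (real^'k) \<Rightarrow> real" where
  "Xv \<gamma> i u p = (case i of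
      Inl a \<Rightarrow> partial (axis a 1, 0) u p
    | Inr b \<Rightarrow> norm (fst p) powr \<gamma> * partial (0, axis b 1) u p)"

definition gauge_rho :: "real \<Rightarrow> (real^'m::finite) \<times> (real^'k::finite) \<Rightarrow> real" where
  "gauge_rho \<gamma> p = (norm (fst p) powr (2 * (\<gamma> + 1)) + (\<gamma> + 1)\<^sup>2 * (norm (snd p))\<^sup>2)
      powr (1 / (2 * (\<gamma> + 1)))"

definition gauge_ball :: "real \<Rightarrow> real \<Rightarrow> ((real^'m::finite) \<times> (real^'k::finite)) set" where
  "gauge_ball \<gamma> r = {p. gauge_rho \<gamma> p < r}"

definition angle_fun :: "real \<Rightarrow> (real^'m::finite) \<times> (real^'k::finite) \<Rightarrow> real" where
  "angle_fun \<gamma> p = norm (fst p) powr (2 * \<gamma>) / gauge_rho \<gamma> p powr (2 * \<gamma>)"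

lemma angle_fun_eq_norm_X_rho_sq:
  fixes p :: "(real^'m::finite) \<times> (real^'k::finite)"
  assumes g: "\<gamma> > 0" and p: "p \<noteq> 0"
  shows "angle_fun \<gamma> p = (\<Sum>i\<in>UNIV. (Xv \<gamma> i (gauge_rho \<gamma>) p)\<^sup>2)"
proof -
  obtain z t where zt: "p = (z, t)" by (cases p)
  define S where "S = norm z powr (2 * (\<gamma> + 1)) + (\<gamma> + 1)\<^sup>2 * (norm t)\<^sup>2"
  define d where "d = 1 / (2 * (\<gamma> + 1))"
  define r where "r = gauge_rho \<gamma> p"
  have S: "S > 0"
  proof (cases "z = 0")
    case True
    then have "t \<noteq> 0" using p zt by (auto simp: zero_prod_def)
    then have "(\<gamma> + 1)\<^sup>2 * (norm t)\<^sup>2 > 0" using g by simp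
    then show ?thesis unfolding S_def by (smt (verit) powr_ge_zero)
  next
    case False
    then have "norm z powr (2 * (\<gamma> + 1)) > 0" by simp
    then show ?thesis unfolding S_def by (smt (verit) mult_nonneg_nonneg zero_le_power2)
  qed
  have r: "r > 0" and r_S: "r = S powr d"
    using S by (auto simp: r_def zt gauge_rho_def S_def d_def)
  have Sr: "S = r powr (2 * \<gamma> + 2)"
    using S g by (simp add: r_S powr_powr d_def divide_simps)
  have Sd: "S powr (d - 1) = r powr (- 2 * \<gamma> - 1)"
  proof -
    have "(2 * \<gamma> + 2) * (d - 1) = - 2 * \<gamma> - 1"
      using g by (simp add: d_def field_simps)
    then show ?thesis unfolding Sr by (simp only: powr_powr)
  qed
  have chain: "((\<lambda>h. A h powr d) has_real_derivative d * S powr (d - 1) * A') (at 0)"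
    if "(A has_real_derivative A') (at 0)" "A 0 = S" for A A'
    using that S by (auto intro!: derivative_eq_intros simp: powr_diff)
  have dl: "partial (axis a 1, 0) (gauge_rho \<gamma>) p = z $ a * norm z powr (2 * \<gamma>) * r powr (- 2 * \<gamma> - 1)" for a
  proof -
    have nz: "norm (z + h *\<^sub>R axis a 1) = sqrt (norm z ^ 2 + 2 * h * z $ a + h\<^sup>2)" for h
      by (simp add: norm_eq_sqrt_inner inner_add_left inner_add_right inner_axis inner_axis'
          power2_eq_square algebra_simps)
    have "((\<lambda>h. norm (z + h *\<^sub>R axis a 1) powr (2 * (\<gamma> + 1))) has_real_derivative
        2 * (\<gamma> + 1) * (z $ a * norm z powr (2 * \<gamma>))) (at 0)"
    proof (cases "z = 0")
      case True
      have "((\<lambda>h. \<bar>h\<bar> powr (2 * \<gamma> + 1)) \<longlongrightarrow> \<bar>0\<bar> powr (2 * \<gamma> + 1)) (at (0::real))"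
        using g by (intro tendsto_intros) auto
      then have "((\<lambda>h. \<bar>h\<bar> powr (2 * \<gamma> + 1)) \<longlongrightarrow> 0) (at (0::real))" by simp
      then have "((\<lambda>h. \<bar>h\<bar> powr (2 * \<gamma> + 2) / h) \<longlongrightarrow> 0) (at (0::real))"
      proof (rule Lim_null_comparison[rotated])
        show "\<forall>\<^sub>F h in at (0::real). norm (\<bar>h\<bar> powr (2 * \<gamma> + 2) / h) \<le> \<bar>h\<bar> powr (2 * \<gamma> + 1)"
        proof (rule eventuallyI)
          fix h :: real
          have "\<bar>h\<bar> powr (2 * \<gamma> + 2) = \<bar>h\<bar> powr (2 * \<gamma> + 1) * \<bar>h\<bar>" if "h \<noteq> 0"
            using that powr_add[of "\<bar>h\<bar>" "2 * \<gamma> + 1" 1] by (simp add: add.assoc)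
          then show "norm (\<bar>h\<bar> powr (2 * \<gamma> + 2) / h) \<le> \<bar>h\<bar> powr (2 * \<gamma> + 1)"
            by (cases "h = 0") (auto simp: abs_mult)
        qed
      qed
      then have "((\<lambda>h. \<bar>h\<bar> powr (2 * \<gamma> + 2)) has_real_derivative 0) (at 0)"
        using g by (simp add: has_field_derivative_iff)
      then show ?thesis using True by (simp add: nz algebra_simps)
    next
      case False
      then have n: "(norm z)\<^sup>2 > 0" by simp
      have "((\<lambda>h. ((norm z)\<^sup>2 + 2 * h * z $ a + h\<^sup>2) powr (\<gamma> + 1)) has_real_derivative
          (\<gamma> + 1) * (norm z)\<^sup>2 powr \<gamma> * (2 * z $ a)) (at 0)"
        using n by (auto intro!: derivative_eq_intros simp: powr_diff)
      moreover have "norm (z + h *\<^sub>R axis a 1) powr (2 * (\<gamma> + 1)) = ((norm z)\<^sup>2 + 2 * h * z $ a + h\<^sup>2) powr (\<gamma> + 1)" for h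
      proof -
        have "norm (z + h *\<^sub>R axis a 1) ^ 2 = (norm z)\<^sup>2 + 2 * h * z $ a + h\<^sup>2"
          by (metis nz norm_ge_zero real_sqrt_ge_0_iff real_sqrt_pow2)
        moreover have "norm (z + h *\<^sub>R axis a 1) powr (2 * (\<gamma> + 1)) = (norm (z + h *\<^sub>R axis a 1) ^ 2) powr (\<gamma> + 1)"
          by (cases "z + h *\<^sub>R axis a 1 = 0") (auto simp: powr_powr simp flip: powr_numeral)
        ultimately show ?thesis by simp
      qed
      moreover have "(norm z)\<^sup>2 powr \<gamma> = norm z powr (2 * \<gamma>)"
        using False by (auto simp: powr_powr simp flip: powr_numeral)
      ultimately show ?thesis by (simp add: algebra_simps)
    qed
    note D = this
    have "((\<lambda>h. (norm (z + h *\<^sub>R axis a 1) powr (2 * (\<gamma> + 1)) + (\<gamma> + 1)\<^sup>2 * (norm t)\<^sup>2) powr d)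
        has_real_derivative d * S powr (d - 1) * (2 * (\<gamma> + 1) * (z $ a * norm z powr (2 * \<gamma>)))) (at 0)"
      by (rule chain) (rule DERIV_add[OF D DERIV_const, THEN DERIV_cong], simp_all add: S_def)
    moreover have "d * S powr (d - 1) * (2 * (\<gamma> + 1) * (z $ a * norm z powr (2 * \<gamma>)))
        = z $ a * norm z powr (2 * \<gamma>) * r powr (- 2 * \<gamma> - 1)"
      using g unfolding Sd by (simp add: d_def field_simps)
    ultimately have "((\<lambda>h. gauge_rho \<gamma> (p + h *\<^sub>R (axis a 1, 0)))
        has_real_derivative z $ a * norm z powr (2 * \<gamma>) * r powr (- 2 * \<gamma> - 1)) (at 0)"
      by (simp add: gauge_rho_def zt d_def)
    then show ?thesis unfolding partial_def by (rule DERIV_imp_deriv)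
  qed
  have dr: "partial (0, axis b 1) (gauge_rho \<gamma>) p = (\<gamma> + 1) * t $ b * r powr (- 2 * \<gamma> - 1)" for b
  proof -
    have nt: "norm (t + h *\<^sub>R axis b 1) ^ 2 = norm t ^ 2 + 2 * h * t $ b + h\<^sup>2" for h
      unfolding power2_norm_eq_inner
      by (simp add: inner_add_left inner_add_right inner_axis inner_axis'
          power2_eq_square algebra_simps)
    have "((\<lambda>h. (norm z powr (2 * (\<gamma> + 1)) + (\<gamma> + 1)\<^sup>2 * (norm (t + h *\<^sub>R axis b 1))\<^sup>2) powr d)
        has_real_derivative d * S powr (d - 1) * ((\<gamma> + 1)\<^sup>2 * (2 * t $ b))) (at 0)"
      unfolding nt by (rule chain) (auto intro!: derivative_eq_intros simp: S_def)
    moreover have "d * S powr (d - 1) * ((\<gamma> + 1)\<^sup>2 * (2 * t $ b)) = (\<gamma> + 1) * t $ b * r powr (- 2 * \<gamma> - 1)"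
      using g unfolding Sd by (simp add: d_def field_simps power2_eq_square)
    ultimately have "((\<lambda>h. gauge_rho \<gamma> (p + h *\<^sub>R (0, axis b 1)))
        has_real_derivative (\<gamma> + 1) * t $ b * r powr (- 2 * \<gamma> - 1)) (at 0)"
      by (simp add: gauge_rho_def zt d_def)
    then show ?thesis unfolding partial_def by (rule DERIV_imp_deriv)
  qed
  have nsum: "(norm x)\<^sup>2 = (\<Sum>i\<in>UNIV. (x $ i)\<^sup>2)" for x :: "real^'n::finite"
    by (simp add: norm_vec_def L2_set_def sum_nonneg)
  have e: "(norm z powr (2 * \<gamma>))\<^sup>2 * (norm z)\<^sup>2 = norm z powr (2 * \<gamma>) * norm z powr (2 * (\<gamma> + 1))"
    by (cases "z = 0") (auto simp: power2_eq_square powr_add distrib_left)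
  have e2: "(norm z powr \<gamma>)\<^sup>2 = norm z powr (2 * \<gamma>)"
    by (simp add: power2_eq_square flip: powr_add)
  have "(\<Sum>i\<in>UNIV. (Xv \<gamma> i (gauge_rho \<gamma>) p)\<^sup>2)
      = (\<Sum>a\<in>UNIV. (z $ a * norm z powr (2 * \<gamma>) * r powr (- 2 * \<gamma> - 1))\<^sup>2)
      + (\<Sum>b\<in>UNIV. (norm z powr \<gamma> * ((\<gamma> + 1) * t $ b * r powr (- 2 * \<gamma> - 1)))\<^sup>2)"
    unfolding UNIV_sum by (subst sum.union_disjoint) (auto simp: sum.reindex Xv_def dl[unfolded zt] dr[unfolded zt] zt)
  also have "\<dots> = (norm z powr (2 * \<gamma>))\<^sup>2 * (norm z)\<^sup>2 * (r powr (- 2 * \<gamma> - 1))\<^sup>2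
      + (norm z powr \<gamma>)\<^sup>2 * (\<gamma> + 1)\<^sup>2 * (norm t)\<^sup>2 * (r powr (- 2 * \<gamma> - 1))\<^sup>2"
    unfolding nsum by (simp only: power_mult_distrib sum_distrib_left sum_distrib_right mult_ac)
  also have "\<dots> = norm z powr (2 * \<gamma>) * (r powr (- 2 * \<gamma> - 1))\<^sup>2 * S"
    unfolding S_def e e2 by (simp only: distrib_left mult_ac)
  also have "\<dots> = norm z powr (2 * \<gamma>) * r powr (- 2 * \<gamma>)"
    unfolding Sr power2_eq_square by (simp add: mult.assoc flip: powr_add)
  also have "\<dots> = angle_fun \<gamma> p"
    by (simp add: angle_fun_def zt r_def powr_minus field_simps)
  finally show ?thesis ..
qed

text \<open>\<open>C\<^sup>\<infinity>\<close>: all iterated partial derivatives exist and are (Frechet) differentiable.\<close>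

definition smooth :: "('a::euclidean_space \<Rightarrow> real) \<Rightarrow> bool" where
  "smooth u \<longleftrightarrow> (\<forall>es. set es \<subseteq> Basis \<longrightarrow> foldr partial es u differentiable_on UNIV)"

definition test_fun :: "'a::euclidean_space set \<Rightarrow> ('a \<Rightarrow> real) \<Rightarrow> bool" where
  "test_fun \<Omega> u \<longleftrightarrow> smooth u \<and> compact (closure {p. u p \<noteq> 0}) \<and> closure {p. u p \<noteq> 0} \<subseteq> \<Omega>"

definition S22_norm_sq :: "real \<Rightarrow> ((real^'m::finite) \<times> (real^'k::finite)) set
    \<Rightarrow> ((real^'m) \<times> (real^'k) \<Rightarrow> real) \<Rightarrow> ennreal" where
  "S22_norm_sq \<gamma> \<Omega> g =
     (\<integral>\<^sup>+p\<in>\<Omega>. ennreal ((g p)\<^sup>2 + (\<Sum>i\<in>UNIV. (Xv \<gamma> i g p)\<^sup>2)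
        + (\<Sum>i\<in>UNIV. \<Sum>j\<in>UNIV. (Xv \<gamma> i (Xv \<gamma> j g) p)\<^sup>2)) \<partial>lebesgue)"

definition L2_tendsto :: "'a::euclidean_space set \<Rightarrow> (nat \<Rightarrow> 'a \<Rightarrow> real) \<Rightarrow> ('a \<Rightarrow> real) \<Rightarrow> bool" where
  "L2_tendsto \<Omega> g h \<longleftrightarrow> h \<in> borel_measurable (lebesgue_on \<Omega>) \<and>
     (\<lambda>n. \<integral>\<^sup>+p\<in>\<Omega>. ennreal ((g n p - h p)\<^sup>2) \<partial>lebesgue) \<longlonglongrightarrow> 0"

text \<open>
  The completion of \<open>C\<^sub>0\<^sup>\<infinity>(\<Omega>)\<close>: the map \<open>\<phi> \<mapsto> (\<phi>, X \<phi>, XX \<phi>)\<close> embeds the test functions isometrically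
  into a product of copies of the complete space \<open>L\<^sup>2(\<Omega>)\<close>, and \<open>S22_element \<gamma> \<Omega> u g h\<close> says that
  \<open>(u, g, h)\<close> lies in the closure of the image.  Off the null set \<open>z = 0\<close> the components \<open>g\<close>, \<open>h\<close>
  are the distributional derivatives of \<open>u\<close>, so they are determined by \<open>u\<close> up to null sets.
  For small \<open>\<gamma>\<close> the norm of a test function can be infinite (\<open>X\<^sub>iX\<^sub>j\<close> differentiates \<open>|z|\<^sup>\<gamma>\<close>); such
  test functions are left out.
\<close>

definition S22_element :: "real \<Rightarrow> ((real^'m::finite) \<times> (real^'k::finite)) set
    \<Rightarrow> ((real^'m) \<times> (real^'k) \<Rightarrow> real) \<Rightarrow> ('m + 'k \<Rightarrow> (real^'m) \<times> (real^'k) \<Rightarrow> real)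
    \<Rightarrow> ('m + 'k \<Rightarrow> 'm + 'k \<Rightarrow> (real^'m) \<times> (real^'k) \<Rightarrow> real) \<Rightarrow> bool" where
  "S22_element \<gamma> \<Omega> u g h \<longleftrightarrow> (\<exists>\<phi>. (\<forall>n. test_fun \<Omega> (\<phi> n) \<and> S22_norm_sq \<gamma> \<Omega> (\<phi> n) < \<infinity>) \<and>
     L2_tendsto \<Omega> \<phi> u \<and>
     (\<forall>i. L2_tendsto \<Omega> (\<lambda>n. Xv \<gamma> i (\<phi> n)) (g i)) \<and>
     (\<forall>i j. L2_tendsto \<Omega> (\<lambda>n. Xv \<gamma> i (Xv \<gamma> j (\<phi> n))) (h i j)))"

definition S22_0 :: "real \<Rightarrow> ((real^'m::finite) \<times> (real^'k::finite)) set
    \<Rightarrow> ((real^'m) \<times> (real^'k) \<Rightarrow> real) set" where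
  "S22_0 \<gamma> \<Omega> = {u. \<exists>g h. S22_element \<gamma> \<Omega> u g h}"

text \<open>\<open>XX \<gamma> \<Omega> u i j\<close> is a representative of the \<open>L\<^sup>2\<close> function \<open>X\<^sub>iX\<^sub>j u\<close>, for \<open>u \<in> S22_0 \<gamma> \<Omega>\<close>.\<close>

definition XX :: "real \<Rightarrow> ((real^'m::finite) \<times> (real^'k::finite)) set
    \<Rightarrow> ((real^'m) \<times> (real^'k) \<Rightarrow> real) \<Rightarrow> 'm + 'k \<Rightarrow> 'm + 'k \<Rightarrow> (real^'m) \<times> (real^'k) \<Rightarrow> real" where
  "XX \<gamma> \<Omega> u = (SOME h. \<exists>g. S22_element \<gamma> \<Omega> u g h)"

definition baouendi_grushin :: "real \<Rightarrow> ((real^'m::finite) \<times> (real^'k::finite)) set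
    \<Rightarrow> ((real^'m) \<times> (real^'k) \<Rightarrow> real) \<Rightarrow> (real^'m) \<times> (real^'k) \<Rightarrow> real" where
  "baouendi_grushin \<gamma> \<Omega> u p = (\<Sum>i\<in>UNIV. XX \<gamma> \<Omega> u i i p)"

text \<open>
  Support of the extension by zero to the whole space of (the a.e. class of) a function on \<open>\<Omega>\<close>.
  It is closed in the whole space, so for bounded \<open>\<Omega>\<close> being contained in \<open>\<Omega>\<close> makes it compact.
\<close>

definition ess_support :: "'a::euclidean_space set \<Rightarrow> ('a \<Rightarrow> real) \<Rightarrow> 'a set" where
  "ess_support \<Omega> u =
     {x. \<forall>U. open U \<longrightarrow> x \<in> U \<longrightarrow> \<not> (AE y in lebesgue. y \<in> U \<inter> \<Omega> \<longrightarrow> u y = 0)}"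

definition primitive :: "('a \<Rightarrow> real \<Rightarrow> real) \<Rightarrow> 'a \<Rightarrow> real \<Rightarrow> real" where
  "primitive f p s = (LBINT \<sigma>=0..s. f p \<sigma>)"

text \<open>The first conjunct, and the existence of the gradients, express that the primitive and the
  gradients make sense; no further regularity of \<open>f\<close> is imposed.\<close>

definition structural_assumptions :: "((real^'m::finite) \<times> (real^'k::finite)) set
    \<Rightarrow> real \<Rightarrow> real \<Rightarrow> real \<Rightarrow> ((real^'m) \<times> (real^'k) \<Rightarrow> real \<Rightarrow> real) \<Rightarrow> bool" where
  "structural_assumptions \<Omega> q K \<kappa> f \<longleftrightarrow>
     (\<forall>p\<in>\<Omega>. \<forall>s. interval_lebesgue_integrable lborel 0 (ereal s) (f p)) \<and>
     (\<forall>p\<in>\<Omega>. f p 0 = 0) \<and>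
     (\<forall>p\<in>\<Omega>. \<forall>s\<in>{-1<..<1} - {0}. 0 < s * f p s \<and> s * f p s \<le> q * primitive f p s) \<and>
     (\<forall>p\<in>\<Omega>. \<forall>s. \<exists>D. GDERIV (\<lambda>x. f x s) p :> D \<and> norm D \<le> K * \<bar>f p s\<bar>) \<and>
     (\<forall>p\<in>\<Omega>. \<forall>s. \<exists>D. GDERIV (\<lambda>x. primitive f x s) p :> D \<and> norm D \<le> K * primitive f p s) \<and>
     (\<exists>r\<in>{1<..<2}. \<forall>p\<in>\<Omega>. \<forall>s. \<bar>f p s\<bar> \<le> \<kappa> * \<bar>s\<bar> powr (r - 1))"

definition primitive_lower_bound :: "'a set \<Rightarrow> real \<Rightarrow> ('a \<Rightarrow> real \<Rightarrow> real) \<Rightarrow> real \<Rightarrow> bool" where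
  "primitive_lower_bound \<Omega> q f c \<longleftrightarrow> (\<forall>p\<in>\<Omega>. \<forall>s\<in>{-1<..<1}. primitive f p s \<ge> c * \<bar>s\<bar> powr q)"

end

theory Submission
  imports Defs
begin

text \<open>
  Let \<open>\<mu> = \<rho>\<^sup>a \<psi> dp\<close> with \<open>a = -2\<alpha> - 4\<close>, let \<open>Q = m + (\<gamma>+1)k\<close>, \<open>2\<tau> = -(Q + a)\<close> and \<open>b = 2\<alpha> + 2\<close>. The operators
  \<open>U\<^sub>h u = exp (-\<tau>h) u \<circ> \<delta>\<^sub>h\<close>, where \<open>\<delta>\<^sub>h (z,t) = (exp h z, exp ((\<gamma>+1)h) t)\<close>, are unitary on \<open>L\<^sup>2(\<mu>)\<close>, with generator \<open>D = Z - \<tau>\<close>,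
  where \<open>Z\<close> generates the dilations \<open>\<delta>\<^sub>h\<close>. The
  right-hand side of the estimate is the square of the norm of \<open>T = \<rho>\<^sup>2(\<psi>\<^sup>-\<^sup>1 B u + f)\<close> in \<open>L\<^sup>2(\<mu>)\<close>. The form
  \<open>\<integral> \<rho>\<^sup>-\<^sup>b Xu \<cdot> X(U\<^sub>h u)\<close> is an even function of \<open>h\<close>, because the weight is homogeneous; hence so is
  \<open>\<langle>\<rho>\<^sup>2 \<psi>\<^sup>-\<^sup>1 B u - b Z u, U\<^sub>h u\<rangle>\<close>, and its derivative at \<open>0\<close> vanishes. This gives \<open>\<langle>T, Du\<rangle> = b |Du|\<^sup>2 + \<langle>\<rho>\<^sup>2 f, Du\<rangle>\<close>
  without differentiating \<open>Du\<close>, and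
  \<open>|T|\<^sup>2 \<ge> 2b \<langle>T, Du\<rangle> - b\<^sup>2 |Du|\<^sup>2 = b\<^sup>2 |Du|\<^sup>2 + 2b \<langle>\<rho>\<^sup>2 f, Du\<rangle>\<close>.
  The term \<open>|Du|\<^sup>2\<close> controls \<open>\<integral> \<rho>\<^sup>\<epsilon> u\<^sup>2 d\<mu>\<close> by a Hardy inequality, and the sublinear term is bounded below by
  \<open>((2 - q) \<tau> - O(1)) \<integral> \<rho>\<^sup>2 F d\<mu>\<close>, which controls \<open>\<integral> \<rho>\<^sup>2 |u|\<^sup>q d\<mu>\<close>.
\<close>

section \<open>Square integrable functions and their convergence\<close>

text \<open>The obstacle is regularity, in three places. The function \<open>u\<close> is only a
  limit in L2, so \<open>Du\<close> exists in L2 but can neither be differentiated nor inserted into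
  a form; only the orbit of \<open>u\<close> under \<open>U\<close> is paired with fixed elements of
  L2. The nonlinearity is merely Borel in \<open>s\<close>, so its primitive along \<open>u\<close>
  is differentiated only after integration over a dilation parameter. And assumption (2) speaks of
  |s| < 1 alone: for |s| > 1/2 the nonlinearity is replaced by a signed multiple of |s|^(q-1),
  frozen beyond a level \<open>L\<close> to keep it bounded. The error is at most linear in |u| and
  is absorbed into |Du|^2; no constant of the estimate depends on \<open>L\<close>, which finally
  tends to infinity. The power \<rho>^\<epsilon> pays for the Hardy inequality: \<open>D\<close> is
  skew, so \<langle>u, Du\<rangle> = 0 says nothing about |u|, while 2 \<langle>\<rho>^\<epsilon> u,
  Du\<rangle> = - \<epsilon> \<integral> \<rho>^\<epsilon> u^2 d\<mu>. The constant is C =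
  2/\<epsilon>^2 + 1/((2-q) c0): the first summand comes from squaring the Hardy inequality, the
  second from the gain (2-q) \<tau> together with F \<ge> c0 |s|^q.\<close>

definition sqint :: "'a measure \<Rightarrow> ('a \<Rightarrow> real) \<Rightarrow> bool" where
  "sqint M f \<longleftrightarrow> f \<in> borel_measurable M \<and> integrable M (\<lambda>x. (f x)\<^sup>2)"

definition l2norm :: "'a measure \<Rightarrow> ('a \<Rightarrow> real) \<Rightarrow> real" where
  "l2norm M f = sqrt (\<integral>x. (f x)\<^sup>2 \<partial>M)"

text \<open>Square integrability is part of the notion because \<open>l2norm\<close> alone does not
  detect it: the Bochner integral of a non-integrable square is 0.\<close>

definition L2conv :: "'a measure \<Rightarrow> (nat \<Rightarrow> 'a \<Rightarrow> real) \<Rightarrow> ('a \<Rightarrow> real) \<Rightarrow> bool" where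
  "L2conv M fn f \<longleftrightarrow> (\<forall>n. sqint M (fn n)) \<and> sqint M f \<and> (\<lambda>n. l2norm M (\<lambda>x. fn n x - f x)) \<longlonglongrightarrow> 0"

lemma sqint_meas [measurable_dest]: "sqint M f \<Longrightarrow> f \<in> borel_measurable M"
  by (simp add: sqint_def)

lemma l2norm_nonneg [simp]: "0 \<le> l2norm M f"
  by (simp add: l2norm_def)

lemma l2norm_sq: "(l2norm M f)\<^sup>2 = (\<integral>x. (f x)\<^sup>2 \<partial>M)"
  by (simp add: l2norm_def)

lemma sqint_mult_integrable:
  assumes "sqint M f" "sqint M g"
  shows "integrable M (\<lambda>x. f x * g x)"
proof (rule Bochner_Integration.integrable_bound)
  show "integrable M (\<lambda>x. (f x)\<^sup>2 + (g x)\<^sup>2)"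
    using assms by (auto simp: sqint_def)
  show "(\<lambda>x. f x * g x) \<in> borel_measurable M"
    using assms by (auto simp: sqint_def)
  have "\<bar>f x * g x\<bar> \<le> (f x)\<^sup>2 + (g x)\<^sup>2" for x
  proof -
    have "2 * (\<bar>f x\<bar> * \<bar>g x\<bar>) \<le> (f x)\<^sup>2 + (g x)\<^sup>2"
      using sum_squares_bound[of "\<bar>f x\<bar>" "\<bar>g x\<bar>"] by simp
    moreover have "0 \<le> \<bar>f x\<bar> * \<bar>g x\<bar>" by simp
    ultimately show ?thesis unfolding abs_mult by linarith
  qed
  then show "AE x in M. norm (f x * g x) \<le> norm ((f x)\<^sup>2 + (g x)\<^sup>2)" by auto
qed

lemma sqint_bounded_mult:
  assumes "sqint M f" "w \<in> borel_measurable M" "\<And>x. \<bar>w x\<bar> \<le> C"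
  shows "sqint M (\<lambda>x. w x * f x)"
  unfolding sqint_def
proof
  show "(\<lambda>x. w x * f x) \<in> borel_measurable M" using assms by (auto simp: sqint_def)
  show "integrable M (\<lambda>x. (w x * f x)\<^sup>2)"
  proof (rule Bochner_Integration.integrable_bound)
    show "integrable M (\<lambda>x. C\<^sup>2 * (f x)\<^sup>2)" using assms by (auto simp: sqint_def)
    show "(\<lambda>x. (w x * f x)\<^sup>2) \<in> borel_measurable M" using assms by (auto simp: sqint_def)
    have "(w x)\<^sup>2 \<le> C\<^sup>2" for x using assms(3)[of x] by (metis abs_le_square_iff abs_of_nonneg order_trans abs_ge_zero)
    then show "AE x in M. norm ((w x * f x)\<^sup>2) \<le> norm (C\<^sup>2 * (f x)\<^sup>2)"
      by (auto simp: power_mult_distrib intro!: mult_right_mono)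
  qed
qed

lemma sqint_cmult: "sqint M f \<Longrightarrow> sqint M (\<lambda>x. c * f x)"
  by (rule sqint_bounded_mult[where C="\<bar>c\<bar>"]) auto

lemma sqint_add:
  assumes "sqint M f" "sqint M g" shows "sqint M (\<lambda>x. f x + g x)"
  using sqint_mult_integrable[OF assms] assms
  by (auto simp: sqint_def power2_sum mult.assoc)

lemma sqint_diff:
  assumes "sqint M f" "sqint M g" shows "sqint M (\<lambda>x. f x - g x)"
  using sqint_add[OF assms(1) sqint_cmult[OF assms(2), of "-1"]] by simp

lemma sqint_zero [simp]: "sqint M (\<lambda>x. 0)"
  by (simp add: sqint_def)

lemma integral_mult_le_l2norm:
  assumes "sqint M f" "sqint M g"
  shows "\<bar>\<integral>x. f x * g x \<partial>M\<bar> \<le> l2norm M f * l2norm M g"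
proof -
  define A B P where "A = (\<integral>x. (f x)\<^sup>2 \<partial>M)" "B = (\<integral>x. (g x)\<^sup>2 \<partial>M)" "P = (\<integral>x. f x * g x \<partial>M)"
  note i = sqint_mult_integrable[OF assms]
  have q: "0 \<le> A * t\<^sup>2 + 2 * P * t + B" for t
  proof -
    have "0 \<le> (\<integral>x. (t * f x + g x)\<^sup>2 \<partial>M)" by simp
    also have "\<dots> = (\<integral>x. t\<^sup>2 * (f x)\<^sup>2 + (2 * t) * (f x * g x) + (g x)\<^sup>2 \<partial>M)"
      by (rule Bochner_Integration.integral_cong) (auto simp: power2_eq_square algebra_simps)
    also have "\<dots> = A * t\<^sup>2 + 2 * P * t + B"
      using i assms unfolding A_B_P_def by (simp add: sqint_def)
    finally show ?thesis .
  qed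
  have nn: "A \<ge> 0" "B \<ge> 0" by (simp_all add: A_B_P_def)
  have "P\<^sup>2 \<le> A * B"
  proof (cases "A = 0")
    case True
    have "P = 0"
    proof (rule ccontr)
      assume "P \<noteq> 0"
      \<comment> \<open>For A = 0 the quadratic is the affine function 2 P t + B, and this t gives
        it the value -1.\<close>
      with q[of "- (B + 1) / (2 * P)"] True show False by (simp add: field_simps)
    qed
    with True show ?thesis by simp
  next
    case False
    with nn have "A > 0" by simp
    with q[of "- P / A"] show ?thesis by (simp add: field_simps power2_eq_square)
  qed
  then have "\<bar>P\<bar> \<le> sqrt (A * B)" by (metis real_sqrt_abs real_sqrt_le_iff)
  then show ?thesis by (simp add: l2norm_def A_B_P_def real_sqrt_mult)
qed

lemma integral_abs_mult_le_l2norm: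
  assumes "sqint M f" "sqint M g"
  shows "(\<integral>x. \<bar>f x\<bar> * \<bar>g x\<bar> \<partial>M) \<le> l2norm M f * l2norm M g"
proof -
  have "sqint M (\<lambda>x. \<bar>f x\<bar>)" "sqint M (\<lambda>x. \<bar>g x\<bar>)" using assms by (auto simp: sqint_def)
  from integral_mult_le_l2norm[OF this] show ?thesis by (simp add: l2norm_def)
qed

lemma l2norm_cmult: "l2norm M (\<lambda>x. c * f x) = \<bar>c\<bar> * l2norm M f"
  by (simp add: l2norm_def power_mult_distrib real_sqrt_mult)

lemma l2norm_triangle:
  assumes "sqint M f" "sqint M g"
  shows "l2norm M (\<lambda>x. f x + g x) \<le> l2norm M f + l2norm M g"
proof (rule power2_le_imp_le)
  have "(l2norm M (\<lambda>x. f x + g x))\<^sup>2 = (\<integral>x. (f x)\<^sup>2 + 2 * (f x * g x) + (g x)\<^sup>2 \<partial>M)"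
    unfolding l2norm_sq by (rule Bochner_Integration.integral_cong) (auto simp: power2_eq_square algebra_simps)
  also have "\<dots> = (l2norm M f)\<^sup>2 + 2 * (\<integral>x. f x * g x \<partial>M) + (l2norm M g)\<^sup>2"
    using sqint_mult_integrable[OF assms] assms by (simp add: sqint_def l2norm_sq)
  also have "\<dots> \<le> (l2norm M f + l2norm M g)\<^sup>2"
    using integral_mult_le_l2norm[OF assms] by (simp add: power2_sum)
  finally show "(l2norm M (\<lambda>x. f x + g x))\<^sup>2 \<le> (l2norm M f + l2norm M g)\<^sup>2" .
qed simp

lemma l2norm_mono:
  assumes "sqint M g" "f \<in> borel_measurable M" "AE x in M. \<bar>f x\<bar> \<le> \<bar>g x\<bar>"
  shows "l2norm M f \<le> l2norm M g"
  unfolding l2norm_def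
proof (rule real_sqrt_le_mono, rule Bochner_Integration.integral_mono_AE')
  show "integrable M (\<lambda>x. (g x)\<^sup>2)" using assms(1) by (simp add: sqint_def)
  show "AE x in M. (f x)\<^sup>2 \<le> (g x)\<^sup>2" using assms(3) by (auto simp: abs_le_square_iff)
qed auto

lemma L2convD: 
  assumes "L2conv M fn f"
  shows "sqint M (fn n)" "sqint M f" "sqint M (\<lambda>x. fn n x - f x)"
    "(\<lambda>n. l2norm M (\<lambda>x. fn n x - f x)) \<longlonglongrightarrow> 0"
  using assms by (auto simp: L2conv_def intro: sqint_diff)

lemma L2conv_const: "sqint M f \<Longrightarrow> L2conv M (\<lambda>_. f) f"
  by (simp add: L2conv_def l2norm_def)

lemma L2conv_bounded_mult:
  assumes c: "L2conv M fn f" and w: "w \<in> borel_measurable M" "\<And>x. \<bar>w x\<bar> \<le> C"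
  shows "L2conv M (\<lambda>n x. w x * fn n x) (\<lambda>x. w x * f x)"
  unfolding L2conv_def
proof (intro conjI allI)
  show "sqint M (\<lambda>x. w x * fn n x)" for n using L2convD(1)[OF c] w by (rule sqint_bounded_mult)
  show "sqint M (\<lambda>x. w x * f x)" using L2convD(2)[OF c] w by (rule sqint_bounded_mult)
  have C: "C \<ge> 0" using w(2) abs_ge_zero order_trans by blast
  show "(\<lambda>n. l2norm M (\<lambda>x. w x * fn n x - w x * f x)) \<longlonglongrightarrow> 0"
  proof (rule Lim_null_comparison)
    show "(\<lambda>n. C * l2norm M (\<lambda>x. fn n x - f x)) \<longlonglongrightarrow> 0"
      using tendsto_mult_left[OF L2convD(4)[OF c], of C] by simp
    have "l2norm M (\<lambda>x. w x * fn n x - w x * f x) \<le> l2norm M (\<lambda>x. C * (fn n x - f x))" for n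
    proof (rule l2norm_mono)
      show "sqint M (\<lambda>x. C * (fn n x - f x))" using L2convD(3)[OF c] by (rule sqint_cmult)
      show "(\<lambda>x. w x * fn n x - w x * f x) \<in> borel_measurable M"
        using w(1) sqint_meas[OF L2convD(1)[OF c]] sqint_meas[OF L2convD(2)[OF c]] by simp
      have "\<bar>w x * fn n x - w x * f x\<bar> \<le> \<bar>C * (fn n x - f x)\<bar>" for x
        using mult_right_mono[OF w(2), of "\<bar>fn n x - f x\<bar>" x] C
        by (simp add: abs_mult right_diff_distrib[symmetric])
      then show "AE x in M. \<bar>w x * fn n x - w x * f x\<bar> \<le> \<bar>C * (fn n x - f x)\<bar>" by simp
    qed
    then show "\<forall>\<^sub>F n in sequentially. norm (l2norm M (\<lambda>x. w x * fn n x - w x * f x)) \<le> C * l2norm M (\<lambda>x. fn n x - f x)"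
      using C by (simp add: l2norm_cmult)
  qed
qed

lemma L2conv_cmult: "L2conv M fn f \<Longrightarrow> L2conv M (\<lambda>n x. c * fn n x) (\<lambda>x. c * f x)"
  by (rule L2conv_bounded_mult[where C="\<bar>c\<bar>"]) auto

lemma L2conv_add:
  assumes c: "L2conv M fn f" "L2conv M gn g"
  shows "L2conv M (\<lambda>n x. fn n x + gn n x) (\<lambda>x. f x + g x)"
  unfolding L2conv_def
proof (intro conjI allI)
  show "sqint M (\<lambda>x. fn n x + gn n x)" for n using c by (intro sqint_add L2convD)
  show "sqint M (\<lambda>x. f x + g x)" using c by (intro sqint_add L2convD)
  show "(\<lambda>n. l2norm M (\<lambda>x. fn n x + gn n x - (f x + g x))) \<longlonglongrightarrow> 0"
  proof (rule Lim_null_comparison)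
    show "(\<lambda>n. l2norm M (\<lambda>x. fn n x - f x) + l2norm M (\<lambda>x. gn n x - g x)) \<longlonglongrightarrow> 0"
      using tendsto_add[OF L2convD(4)[OF c(1)] L2convD(4)[OF c(2)]] by simp
    show "\<forall>\<^sub>F n in sequentially. norm (l2norm M (\<lambda>x. fn n x + gn n x - (f x + g x)))
        \<le> l2norm M (\<lambda>x. fn n x - f x) + l2norm M (\<lambda>x. gn n x - g x)"
      using l2norm_triangle[OF L2convD(3)[OF c(1)] L2convD(3)[OF c(2)]]
      by (auto intro!: always_eventually simp: algebra_simps)
  qed
qed

lemma L2conv_diff:
  assumes "L2conv M fn f" "L2conv M gn g"
  shows "L2conv M (\<lambda>n x. fn n x - gn n x) (\<lambda>x. f x - g x)"
  using L2conv_add[OF assms(1) L2conv_cmult[OF assms(2), of "-1"]] by simp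

lemma L2conv_sum:
  "finite I \<Longrightarrow> (\<And>i. i \<in> I \<Longrightarrow> L2conv M (fn i) (f i)) \<Longrightarrow>
    L2conv M (\<lambda>n x. \<Sum>i\<in>I. fn i n x) (\<lambda>x. \<Sum>i\<in>I. f i x)"
  by (induction I rule: finite_induct) (auto intro!: L2conv_add L2conv_const)

lemma L2conv_integral_mult:
  assumes c: "L2conv M fn f" and Y: "sqint M Y"
  shows "(\<lambda>n. \<integral>x. Y x * fn n x \<partial>M) \<longlonglongrightarrow> (\<integral>x. Y x * f x \<partial>M)"
proof (rule LIM_zero_cancel, rule Lim_null_comparison)
  show "(\<lambda>n. l2norm M Y * l2norm M (\<lambda>x. fn n x - f x)) \<longlonglongrightarrow> 0"
    using tendsto_mult_left[OF L2convD(4)[OF c], of "l2norm M Y"] by simp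
  have "(\<integral>x. Y x * fn n x \<partial>M) - (\<integral>x. Y x * f x \<partial>M) = (\<integral>x. Y x * (fn n x - f x) \<partial>M)" for n
    using sqint_mult_integrable[OF Y L2convD(1)[OF c]] sqint_mult_integrable[OF Y L2convD(2)[OF c]]
    by (simp add: right_diff_distrib)
  then show "\<forall>\<^sub>F n in sequentially. norm ((\<integral>x. Y x * fn n x \<partial>M) - (\<integral>x. Y x * f x \<partial>M))
      \<le> l2norm M Y * l2norm M (\<lambda>x. fn n x - f x)"
    using integral_mult_le_l2norm[OF Y L2convD(3)[OF c]] by auto
qed

lemma L2conv_AE_cong:
  assumes c: "L2conv M fn f" and g: "g \<in> borel_measurable M" "AE x in M. f x = g x"
  shows "L2conv M fn g"
proof -
  have "sqint M g"
  proof -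
    have "AE x in M. (f x)\<^sup>2 = (g x)\<^sup>2" using g(2) by auto
    then show ?thesis
      using L2convD(2)[OF c] g integrable_cong_AE[of "\<lambda>x. (f x)\<^sup>2" M "\<lambda>x. (g x)\<^sup>2"] by (auto simp: sqint_def)
  qed
  moreover have "l2norm M (\<lambda>x. fn n x - g x) = l2norm M (\<lambda>x. fn n x - f x)" for n
  proof -
    have [measurable]: "f \<in> borel_measurable M" "fn n \<in> borel_measurable M" "g \<in> borel_measurable M"
      using g L2convD(1,2)[OF c] by (auto simp: sqint_def)
    show ?thesis unfolding l2norm_def using g(2)
      by (intro arg_cong[where f=sqrt] integral_cong_AE) auto
  qed
  ultimately show ?thesis using c by (auto simp: L2conv_def)
qed

section \<open>Dilations\<close>

definition dil :: "real \<Rightarrow> real \<Rightarrow> (real^'m::finite) \<times> (real^'k::finite) \<Rightarrow> (real^'m) \<times> (real^'k)" where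
  "dil \<gamma> y p = (exp y *\<^sub>R fst p, exp ((\<gamma> + 1) * y) *\<^sub>R snd p)"

lemma dil_0 [simp]: "dil \<gamma> 0 p = p"
  by (simp add: dil_def)

lemma dil_dil: "dil \<gamma> x (dil \<gamma> y p) = dil \<gamma> (x + y) p"
  by (simp add: dil_def exp_add[symmetric] algebra_simps)

lemma dil_dil_inverse [simp]: "dil \<gamma> (- y) (dil \<gamma> y p) = p" "dil \<gamma> y (dil \<gamma> (- y) p) = p"
  by (simp_all add: dil_dil)

lemma continuous_on_dil: "continuous_on UNIV (dil \<gamma> y)"
  unfolding dil_def by (intro continuous_intros)

lemma dil_measurable [measurable]: "dil \<gamma> y \<in> borel_measurable borel"
  by (intro borel_measurable_continuous_onI continuous_on_dil)

lemma continuous_on_dil2: "continuous_on UNIV (\<lambda>x. dil \<gamma> (fst x) (snd x))"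
  unfolding dil_def by (intro continuous_intros)

lemma dil_measurable2 [measurable]: "(\<lambda>x. dil \<gamma> (fst x) (snd x)) \<in> borel_measurable (borel \<Otimes>\<^sub>M borel)"
  using borel_measurable_continuous_onI[OF continuous_on_dil2] by (simp add: borel_prod)

text \<open>The homogeneous dimension: Lebesgue measure of a set grows by the factor exp (Q y) under
  \<open>dil \<gamma> y\<close>.\<close>

definition hom_dim :: "real \<Rightarrow> 'm::finite itself \<Rightarrow> 'k::finite itself \<Rightarrow> real" where
  "hom_dim \<gamma> M K = real CARD('m) + (\<gamma> + 1) * real CARD('k)"

text \<open>The dilation is a diagonal linear map with determinant exp (Q y). In the factor
  \<open>c\<close> the test \<open>fst j \<noteq> 0\<close> singles out the basis vectors of the
  z-space.\<close>

lemma nn_integral_dil_lborel: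
  fixes w :: "(real^'m::finite) \<times> (real^'k::finite) \<Rightarrow> ennreal"
  assumes [measurable]: "w \<in> borel_measurable borel"
  shows "(\<integral>\<^sup>+p. w (dil \<gamma> y p) \<partial>lborel)
    = ennreal (exp (- hom_dim \<gamma> TYPE('m) TYPE('k) * y)) * (\<integral>\<^sup>+p. w p \<partial>lborel)"
proof -
  define c :: "(real^'m) \<times> (real^'k) \<Rightarrow> real" where
    "c = (\<lambda>j. if fst j \<noteq> 0 then exp y else exp ((\<gamma> + 1) * y))"
  define Q where "Q = hom_dim \<gamma> TYPE('m) TYPE('k)"
  have B: "(Basis :: ((real^'m) \<times> (real^'k)) set) = (\<lambda>u. (u, 0)) ` Basis \<union> (\<lambda>u. (0, u)) ` Basis"
    by (simp add: Basis_prod_def)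
  have disj: "(\<lambda>u. (u, 0)) ` (Basis :: (real^'m) set) \<inter> (\<lambda>u. (0, u)) ` (Basis :: (real^'k) set) = {}"
    by auto
  have sumB: "(\<Sum>j\<in>Basis. h j) = (\<Sum>j\<in>Basis. h (j, 0)) + (\<Sum>j\<in>Basis. h (0, j))"
    for h :: "(real^'m) \<times> (real^'k) \<Rightarrow> (real^'m) \<times> (real^'k)"
    unfolding B by (subst sum.union_disjoint) (use disj in \<open>auto simp: sum.reindex inj_on_def\<close>)
  have prodB: "(\<Prod>j\<in>Basis. h j) = (\<Prod>j\<in>Basis. h (j, 0)) * (\<Prod>j\<in>Basis. h (0, j))"
    for h :: "(real^'m) \<times> (real^'k) \<Rightarrow> real"
    unfolding B by (subst prod.union_disjoint) (use disj in \<open>auto simp: prod.reindex inj_on_def\<close>)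
  have T: "0 + (\<Sum>j\<in>Basis. (c j * (x \<bullet> j)) *\<^sub>R j) = dil \<gamma> y x" for x
  proof -
    have "(\<Sum>j\<in>Basis. (c j * (x \<bullet> j)) *\<^sub>R j)
      = (\<Sum>j\<in>Basis. (exp y * (fst x \<bullet> j)) *\<^sub>R (j, 0)) + (\<Sum>j\<in>Basis. (exp ((\<gamma> + 1) * y) * (snd x \<bullet> j)) *\<^sub>R (0, j))"
      unfolding sumB by (auto simp: c_def inner_prod_def nonzero_Basis intro!: arg_cong2[where f="(+)"] sum.cong)
    also have "\<dots> = (exp y *\<^sub>R (\<Sum>j\<in>Basis. (fst x \<bullet> j) *\<^sub>R j), exp ((\<gamma> + 1) * y) *\<^sub>R (\<Sum>j\<in>Basis. (snd x \<bullet> j) *\<^sub>R j))"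
      by (rule prod_eqI) (simp_all add: fst_sum snd_sum scaleR_sum_right)
    also have "\<dots> = dil \<gamma> y x" by (simp only: euclidean_representation dil_def)
    finally show ?thesis by simp
  qed
  have P: "(\<Prod>j\<in>Basis. \<bar>c j\<bar>) = exp (Q * y)"
    unfolding prodB by (simp add: c_def nonzero_Basis Q_def hom_dim_def exp_of_nat_mult[symmetric] exp_add[symmetric] algebra_simps)
  have "lborel = density (distr lborel borel (dil \<gamma> y)) (\<lambda>_::(real^'m) \<times> (real^'k). ennreal (exp (Q * y)))"
    using lborel_affine_euclidean[of c 0] unfolding T P[symmetric] by (simp add: c_def)
  then have "(\<integral>\<^sup>+p. w p \<partial>lborel) = (\<integral>\<^sup>+p. w p \<partial>density (distr lborel borel (dil \<gamma> y)) (\<lambda>_. ennreal (exp (Q * y))))"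
    by simp
  also have "\<dots> = ennreal (exp (Q * y)) * (\<integral>\<^sup>+p. w (dil \<gamma> y p) \<partial>lborel)"
    by (simp add: nn_integral_density nn_integral_distr nn_integral_cmult)
  finally have "ennreal (exp (- Q * y)) * (\<integral>\<^sup>+p. w p \<partial>lborel)
     = (ennreal (exp (- Q * y)) * ennreal (exp (Q * y))) * (\<integral>\<^sup>+p. w (dil \<gamma> y p) \<partial>lborel)"
    by (simp add: mult.assoc)
  also have "ennreal (exp (- Q * y)) * ennreal (exp (Q * y)) = 1"
    by (simp add: ennreal_mult[symmetric] exp_minus)
  finally show ?thesis by (simp add: Q_def)
qed

section \<open>Measures that are homogeneous under dilations, and their unitary group\<close>

locale dil_measure =
  fixes \<gamma> :: real and M :: "((real^'m::finite) \<times> (real^'k::finite)) measure" and \<tau> :: real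
  assumes sets_M [measurable_cong, simp]: "sets M = sets borel"
    and nn_dil: "\<And>w y. w \<in> borel_measurable borel \<Longrightarrow>
      (\<integral>\<^sup>+p. w (dil \<gamma> y p) \<partial>M) = ennreal (exp (2 * \<tau> * y)) * (\<integral>\<^sup>+p. w p \<partial>M)"
begin

lemma space_M [simp]: "space M = UNIV"
  using sets_eq_imp_space_eq[OF sets_M] by simp

lemma measurable_M [simp]: "measurable M N = measurable borel N"
  by (rule measurable_cong_sets) auto

lemma integrable_dil:
  assumes w: "integrable M w"
  shows "integrable M (\<lambda>p. w (dil \<gamma> y p) :: real)"
proof (rule integrableI_bounded)
  have [measurable]: "w \<in> borel_measurable borel" using borel_measurable_integrable[OF w] by simp
  show "(\<lambda>p. w (dil \<gamma> y p)) \<in> borel_measurable M" by simp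
  have "(\<integral>\<^sup>+p. ennreal (norm (w (dil \<gamma> y p))) \<partial>M) = ennreal (exp (2 * \<tau> * y)) * (\<integral>\<^sup>+p. ennreal (norm (w p)) \<partial>M)"
    by (rule nn_dil) simp
  also have "\<dots> < \<infinity>"
    using w by (auto simp: integrable_iff_bounded ennreal_mult_less_top)
  finally show "(\<integral>\<^sup>+p. ennreal (norm (w (dil \<gamma> y p))) \<partial>M) < \<infinity>" .
qed

text \<open>Dilations preserve integrability in both directions, so for a non-integrable
  \<open>w\<close> both sides are the default value 0.\<close>

lemma integral_dil:
  assumes [measurable]: "w \<in> borel_measurable borel"
  shows "(\<integral>p. w (dil \<gamma> y p) \<partial>M) = exp (2 * \<tau> * y) * (\<integral>p. w p \<partial>M :: real)"
proof (cases "integrable M w")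
  case True
  have "(\<integral>p. w (dil \<gamma> y p) \<partial>M) = enn2real (ennreal (exp (2 * \<tau> * y)) * (\<integral>\<^sup>+p. ennreal (w p) \<partial>M))
     - enn2real (ennreal (exp (2 * \<tau> * y)) * (\<integral>\<^sup>+p. ennreal (- w p) \<partial>M))"
    by (subst real_lebesgue_integral_def[OF integrable_dil[OF True]])
      (simp add: nn_dil[of "\<lambda>p. ennreal (w p)"] nn_dil[of "\<lambda>p. ennreal (- w p)"])
  also have "\<dots> = exp (2 * \<tau> * y) * (\<integral>p. w p \<partial>M)"
    by (subst real_lebesgue_integral_def[OF True]) (simp add: enn2real_mult algebra_simps)
  finally show ?thesis .
next
  case False
  have "\<not> integrable M (\<lambda>p. w (dil \<gamma> y p))"
    using False integrable_dil[of "\<lambda>p. w (dil \<gamma> y p)" "- y"] by auto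
  with False show ?thesis by (simp add: not_integrable_integral_eq)
qed

definition U :: "real \<Rightarrow> ((real^'m) \<times> (real^'k) \<Rightarrow> real) \<Rightarrow> (real^'m) \<times> (real^'k) \<Rightarrow> real" where
  "U h w p = exp (- \<tau> * h) * w (dil \<gamma> h p)"

lemma U_0 [simp]: "U 0 w = w"
  by (simp add: U_def fun_eq_iff)

lemma U_U: "U x (U y w) = U (x + y) w"
  by (simp add: U_def fun_eq_iff dil_dil exp_add[symmetric] algebra_simps)

lemma U_measurable [measurable (raw)]: "w \<in> borel_measurable borel \<Longrightarrow> U h w \<in> borel_measurable borel"
  unfolding U_def by simp

lemma U_diff: "U h (\<lambda>x. v x - w x) p = U h v p - U h w p"
  by (simp add: U_def algebra_simps)

lemma U_sq: "(U h w p)\<^sup>2 = exp (- 2 * \<tau> * h) * (w (dil \<gamma> h p))\<^sup>2"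
  by (simp add: U_def power_mult_distrib exp_double[symmetric])

lemma sqint_U: "sqint M w \<Longrightarrow> sqint M (U h w)"
  unfolding sqint_def U_sq using integrable_dil[of "\<lambda>p. (w p)\<^sup>2" h] by auto

lemma l2norm_U:
  assumes [measurable]: "w \<in> borel_measurable borel"
  shows "l2norm M (U h w) = l2norm M w"
  unfolding l2norm_def U_sq using integral_dil[of "\<lambda>p. (w p)\<^sup>2" h] by (simp add: exp_add[symmetric] flip: mult.assoc)

text \<open>The adjoint of \<open>U h\<close> is \<open>U (- h)\<close>: the change of variables
  produces exp (2 \<tau> h), which turns the factor exp (- \<tau> h) into exp (\<tau> h).\<close>

lemma integral_U_mult:
  assumes [measurable]: "v \<in> borel_measurable borel" "w \<in> borel_measurable borel"
  shows "(\<integral>p. v p * U h w p \<partial>M) = (\<integral>p. U (- h) v p * w p \<partial>M)"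
proof -
  have "(\<integral>p. v p * U h w p \<partial>M) = (\<integral>p. (\<lambda>p. exp (- \<tau> * h) * (v (dil \<gamma> (- h) p) * w p)) (dil \<gamma> h p) \<partial>M)"
    by (simp add: U_def mult_ac)
  also have "\<dots> = exp (2 * \<tau> * h) * (\<integral>p. exp (- \<tau> * h) * (v (dil \<gamma> (- h) p) * w p) \<partial>M)"
    by (rule integral_dil) simp
  also have "\<dots> = (\<integral>p. exp (2 * \<tau> * h) * (exp (- \<tau> * h) * (v (dil \<gamma> (- h) p) * w p)) \<partial>M)" by simp
  also have "\<dots> = (\<integral>p. U (- h) v p * w p \<partial>M)"
  proof -
    have "exp (2 * \<tau> * h) * (exp (- \<tau> * h) * (v (dil \<gamma> (- h) p) * w p)) = U (- h) v p * w p" for p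
    proof -
      have "exp (2 * \<tau> * h) * exp (- \<tau> * h) = exp (- \<tau> * - h)" by (simp add: exp_add[symmetric])
      then show ?thesis by (simp only: U_def mult.assoc[symmetric])
    qed
    then show ?thesis by (simp only:)
  qed
  finally show ?thesis .
qed

lemma L2conv_U:
  assumes c: "L2conv M fn f"
  shows "L2conv M (\<lambda>n. U h (fn n)) (U h f)"
proof -
  have [measurable]: "f \<in> borel_measurable borel" "fn n \<in> borel_measurable borel" for n
    using L2convD(1,2)[OF c] by (simp_all add: sqint_def)
  have "l2norm M (\<lambda>x. U h (fn n) x - U h f x) = l2norm M (\<lambda>x. fn n x - f x)" for n
  proof -
    have "U h (\<lambda>x. fn n x - f x) = (\<lambda>x. U h (fn n) x - U h f x)" by (rule ext, rule U_diff)
    then show ?thesis using l2norm_U[of "\<lambda>x. fn n x - f x" h] by simp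
  qed
  with c show ?thesis by (auto simp: L2conv_def intro: sqint_U)
qed

end

section \<open>Primitives and signed measures\<close>

text \<open>The signed indicator of the oriented interval from \<open>a\<close> to \<open>b\<close>.
  Half-open intervals make \<open>sgn_interval_add\<close> exact at every point, whatever the order
  of the endpoints.\<close>

definition sgn_interval :: "real \<Rightarrow> real \<Rightarrow> real \<Rightarrow> real" where
  "sgn_interval a b s = indicator {a<..b} s - indicator {b<..a} s"

lemma sgn_interval_measurable [measurable]:
  "(\<lambda>x. sgn_interval (fst x) (fst (snd x)) (snd (snd x))) \<in> borel_measurable (borel \<Otimes>\<^sub>M borel \<Otimes>\<^sub>M borel)"
proof -
  have "(\<lambda>x. sgn_interval (fst x) (fst (snd x)) (snd (snd x)))
    = (\<lambda>x. (if fst x < snd (snd x) \<and> snd (snd x) \<le> fst (snd x) then 1 else 0)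
         - (if fst (snd x) < snd (snd x) \<and> snd (snd x) \<le> fst x then 1 else 0))"
    by (auto simp: sgn_interval_def fun_eq_iff indicator_def)
  then show ?thesis by simp
qed

lemma sgn_interval_measurable' [measurable (raw)]:
  assumes [measurable]: "f \<in> borel_measurable N" "g \<in> borel_measurable N" "h \<in> borel_measurable N"
  shows "(\<lambda>x. sgn_interval (f x) (g x) (h x)) \<in> borel_measurable N"
  using measurable_compose[OF _ sgn_interval_measurable, of "\<lambda>x. (f x, g x, h x)" N] by simp

lemma sgn_interval_add: "sgn_interval a b s + sgn_interval b c s = sgn_interval a c s"
  by (auto simp: sgn_interval_def indicator_def)

lemma abs_sgn_interval: "\<bar>sgn_interval a b s\<bar> = indicator {min a b<..max a b} s"
  by (auto simp: sgn_interval_def indicator_def min_def max_def)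

lemma integrable_mult_sgn_interval:
  assumes k: "k \<in> borel_measurable borel" "\<And>s. \<bar>k s\<bar> \<le> C"
  shows "integrable lborel (\<lambda>s. k s * sgn_interval a b s :: real)"
proof (rule Bochner_Integration.integrable_bound)
  show "integrable lborel (\<lambda>s. C * indicator {min a b<..max a b} s :: real)"
    by (intro integrable_mult_right) (simp add: min_def max_def)
  show "(\<lambda>s. k s * sgn_interval a b s) \<in> borel_measurable lborel" using k by simp
  show "AE s in lborel. norm (k s * sgn_interval a b s) \<le> norm (C * indicator {min a b<..max a b} s :: real)"
    using k(2) order_trans[OF abs_ge_zero k(2)]
    by (intro always_eventually allI) (auto simp: abs_mult abs_sgn_interval split: split_indicator)
qed

definition prim :: "(real \<Rightarrow> real) \<Rightarrow> real \<Rightarrow> real" where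
  "prim k s = (\<integral>\<sigma>. k \<sigma> * sgn_interval 0 s \<sigma> \<partial>lborel)"

lemma prim_0 [simp]: "prim k 0 = 0"
  by (simp add: prim_def sgn_interval_def)

lemma prim_diff:
  assumes "k \<in> borel_measurable borel" "\<And>s. \<bar>k s\<bar> \<le> C"
  shows "prim k b - prim k a = (\<integral>\<sigma>. k \<sigma> * sgn_interval a b \<sigma> \<partial>lborel)"
proof -
  have "prim k b = (\<integral>\<sigma>. k \<sigma> * sgn_interval 0 a \<sigma> + k \<sigma> * sgn_interval a b \<sigma> \<partial>lborel)"
    unfolding prim_def by (simp add: distrib_left[symmetric] sgn_interval_add)
  then show ?thesis
    using integrable_mult_sgn_interval[OF assms] by (simp add: prim_def)
qed

text \<open>Subtract the constant \<open>c\<close> from the integrand. Used with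
  \<open>c = 0\<close> for the Lipschitz bound, with \<open>c = k x\<close> for differentiability at
  a point of continuity, and with \<open>e = 0\<close> where \<open>k\<close> is constant.\<close>

lemma prim_diff_weighted_le:
  assumes k: "k \<in> borel_measurable borel" "\<And>s. \<bar>k s\<bar> \<le> C" and s: "\<And>s. s \<in> {min a b<..max a b} \<Longrightarrow> \<bar>k s - c\<bar> \<le> e"
  shows "\<bar>prim k b - prim k a - c * (b - a)\<bar> \<le> e * \<bar>b - a\<bar>"
proof -
  have one: "(\<integral>\<sigma>. sgn_interval a b \<sigma> \<partial>lborel) = b - a"
    unfolding sgn_interval_def by (cases "a \<le> b") auto
  have i1: "integrable lborel (\<lambda>s. sgn_interval a b s)"
    using integrable_mult_sgn_interval[of "\<lambda>_. 1" 1 a b] by simp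
  have "prim k b - prim k a - c * (b - a) = (\<integral>\<sigma>. k \<sigma> * sgn_interval a b \<sigma> \<partial>lborel) - (\<integral>\<sigma>. c * sgn_interval a b \<sigma> \<partial>lborel)"
    by (simp add: prim_diff[OF k] one)
  also have "\<dots> = (\<integral>\<sigma>. (k \<sigma> - c) * sgn_interval a b \<sigma> \<partial>lborel)"
    using integrable_mult_sgn_interval[OF k, of a b] i1
    by (simp add: left_diff_distrib)
  finally have eq: "prim k b - prim k a - c * (b - a) = (\<integral>\<sigma>. (k \<sigma> - c) * sgn_interval a b \<sigma> \<partial>lborel)" .
  have "\<bar>\<integral>\<sigma>. (k \<sigma> - c) * sgn_interval a b \<sigma> \<partial>lborel\<bar> \<le> (\<integral>\<sigma>. e * indicator {min a b<..max a b} \<sigma> \<partial>lborel)"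
    using s order_trans[OF abs_ge_zero s]
    by (intro order_trans[OF integral_abs_bound] integral_mono')
      (auto simp: abs_mult abs_sgn_interval min_def max_def split: split_indicator)
  also have "\<dots> = e * \<bar>b - a\<bar>"
    by (cases "a \<le> b") (auto simp: min_def max_def)
  finally show ?thesis unfolding eq .
qed

lemma prim_lipschitz:
  assumes "k \<in> borel_measurable borel" "\<And>s. \<bar>k s\<bar> \<le> C"
  shows "\<bar>prim k b - prim k a\<bar> \<le> C * \<bar>b - a\<bar>"
  using prim_diff_weighted_le[of k C a b 0 C] assms by simp

lemma abs_prim_le:
  assumes "k \<in> borel_measurable borel" "\<And>s. \<bar>k s\<bar> \<le> C"
  shows "\<bar>prim k b\<bar> \<le> C * \<bar>b\<bar>"
  using prim_lipschitz[OF assms, of b 0] by simp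

lemma prim_deriv:
  assumes k: "continuous_on UNIV k" "\<And>s. \<bar>k s\<bar> \<le> C"
  shows "(prim k has_real_derivative k x) (at x)"
  unfolding has_field_derivative_def has_derivative_def
proof (intro conjI)
  have kb: "k \<in> borel_measurable borel" using k(1) by (rule borel_measurable_continuous_onI)
  show "bounded_linear ((*) (k x))" by (rule bounded_linear_mult_right)
  show "((\<lambda>y. (prim k y - prim k (netlimit (at x)) - k x * (y - netlimit (at x))) /\<^sub>R norm (y - netlimit (at x))) \<longlongrightarrow> 0) (at x)"
    unfolding tendsto_iff
  proof (intro allI impI)
    fix e :: real assume e: "e > 0"
    have "isCont k x" using k(1) by (simp add: continuous_on_eq_continuous_at)
    then obtain d where d: "d > 0" "\<And>s. dist s x < d \<Longrightarrow> dist (k s) (k x) < e / 2"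
      unfolding continuous_at_eps_delta using e by (meson half_gt_zero)
    have "norm ((prim k y - prim k x - k x * (y - x)) /\<^sub>R norm (y - x)) < e" if "y \<noteq> x" "dist y x < d" for y
    proof -
      have "\<bar>prim k y - prim k x - k x * (y - x)\<bar> \<le> e / 2 * \<bar>y - x\<bar>"
      proof (rule prim_diff_weighted_le[OF kb k(2)])
        fix s assume "s \<in> {min x y<..max x y}"
        then have "dist s x < d" using that(2) by (auto simp: dist_real_def min_def max_def split: if_splits)
        then show "\<bar>k s - k x\<bar> \<le> e / 2" using d(2)[of s] by (simp add: dist_real_def)
      qed
      moreover have "e / 2 * \<bar>y - x\<bar> < e * \<bar>y - x\<bar>" using e that(1) by simp
      ultimately show ?thesis using that(1) by (simp add: divide_simps)
    qed
    then show "\<forall>\<^sub>F y in at x. dist ((prim k y - prim k (netlimit (at x)) - k x * (y - netlimit (at x))) /\<^sub>R norm (y - netlimit (at x))) 0 < e"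
      unfolding eventually_at using d(1) by (intro exI[of _ d]) (simp add: netlimit_at)
  qed
qed

text \<open>The sets whose indicators satisfy the equation form a Dynkin system, and indicators of open sets
  are increasing limits of bounded Lipschitz functions.\<close>

lemma signed_measure_eqI:
  fixes X1 :: "'a \<Rightarrow> 'c::{metric_space, second_countable_topology}" and X2 :: "'b \<Rightarrow> 'c"
  assumes X1 [measurable]: "X1 \<in> borel_measurable M1" and X2 [measurable]: "X2 \<in> borel_measurable M2"
    and w1: "integrable M1 w1" and w2: "integrable M2 w2"
    and lip: "\<And>H L. L-lipschitz_on UNIV H \<Longrightarrow> (\<And>x. \<bar>H x\<bar> \<le> (1::real)) \<Longrightarrow>
        (\<integral>x. H (X1 x) * w1 x \<partial>M1) = (\<integral>x. H (X2 x) * w2 x \<partial>M2)"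
    and H [measurable]: "H \<in> borel_measurable borel" and bd: "\<And>x. \<bar>H x\<bar> \<le> (C::real)"
  shows "(\<integral>x. H (X1 x) * w1 x \<partial>M1) = (\<integral>x. H (X2 x) * w2 x \<partial>M2 :: real)"
proof -
  have [measurable]: "w1 \<in> borel_measurable M1" "w2 \<in> borel_measurable M2" using w1 w2 by auto
  define E where "E H \<longleftrightarrow> (\<integral>x. H (X1 x) * w1 x \<partial>M1) = (\<integral>x. H (X2 x) * w2 x \<partial>M2)" for H :: "'c \<Rightarrow> real"
  have int1: "integrable M1 (\<lambda>x. h (X1 x) * w1 x)" and int2: "integrable M2 (\<lambda>x. h (X2 x) * w2 x)"
    if [measurable]: "h \<in> borel_measurable borel" and b: "\<And>x. \<bar>h x\<bar> \<le> c" for h :: "'c \<Rightarrow> real" and c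
  proof -
    have c: "0 \<le> c" using order_trans[OF abs_ge_zero b] .
    show "integrable M1 (\<lambda>x. h (X1 x) * w1 x)"
      by (rule Bochner_Integration.integrable_bound[of _ "\<lambda>x. c * w1 x"])
        (use w1 c b in \<open>auto simp: abs_mult intro!: mult_right_mono\<close>)
    show "integrable M2 (\<lambda>x. h (X2 x) * w2 x)"
      by (rule Bochner_Integration.integrable_bound[of _ "\<lambda>x. c * w2 x"])
        (use w2 c b in \<open>auto simp: abs_mult intro!: mult_right_mono\<close>)
  qed
  have lim: "E h" if m: "\<And>n. hn n \<in> borel_measurable borel" and b: "\<And>n x. \<bar>hn n x\<bar> \<le> c"
    and l: "\<And>x. (\<lambda>n. hn n x) \<longlonglongrightarrow> h x" and e: "\<And>n::nat. E (hn n)" for hn and h :: "'c \<Rightarrow> real" and c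
  proof -
    have [measurable]: "hn n \<in> borel_measurable borel" for n by (rule m)
    have [measurable]: "h \<in> borel_measurable borel" by (rule borel_measurable_LIMSEQ_real[OF l]) simp
    have "(\<lambda>n. \<integral>x. hn n (X1 x) * w1 x \<partial>M1) \<longlonglongrightarrow> (\<integral>x. h (X1 x) * w1 x \<partial>M1)"
      by (rule integral_dominated_convergence[where w="\<lambda>x. c * \<bar>w1 x\<bar>"])
        (use w1 b in \<open>auto intro!: tendsto_intros l always_eventually mult_right_mono simp: abs_mult\<close>)
    moreover have "(\<lambda>n. \<integral>x. hn n (X2 x) * w2 x \<partial>M2) \<longlonglongrightarrow> (\<integral>x. h (X2 x) * w2 x \<partial>M2)"
      by (rule integral_dominated_convergence[where w="\<lambda>x. c * \<bar>w2 x\<bar>"])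
        (use w2 b in \<open>auto intro!: tendsto_intros l always_eventually mult_right_mono simp: abs_mult\<close>)
    ultimately show ?thesis using e unfolding E_def by (auto intro: LIMSEQ_unique)
  qed
  have add: "E (\<lambda>x. h x + k x)" if "E h" "E k" "h \<in> borel_measurable borel" "k \<in> borel_measurable borel"
    "\<And>x. \<bar>h x\<bar> \<le> c" "\<And>x. \<bar>k x\<bar> \<le> d" for h k c d
    using int1[OF that(3,5)] int1[OF that(4,6)] int2[OF that(3,5)] int2[OF that(4,6)] that(1,2)
    by (simp add: E_def distrib_right)
  have cmult: "E (\<lambda>x. c * h x)" if "E h" for h c
    using that by (simp add: E_def mult.assoc)
  have openE: "E (indicator A)" if A: "open A" for A
  \<comment> \<open>The distance to the empty set is 0 by convention, so for \<open>A = UNIV\<close>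
    the functions \<open>hn\<close> below would vanish; the constant 1 is itself Lipschitz.\<close>
  proof (cases "A = UNIV")
    case True
    show ?thesis unfolding E_def by (rule lip[of 0]) (auto simp: True lipschitz_on_def)
  next
    case False
    define hn where "hn n x = min 1 (real n * infdist x (- A))" for n x
    show ?thesis
    proof (rule lim[of hn 1])
      show "hn n \<in> borel_measurable borel" for n unfolding hn_def
        by (intro borel_measurable_continuous_onI continuous_intros)
      show b: "\<bar>hn n x\<bar> \<le> 1" for n x by (simp add: hn_def infdist_nonneg)
      show "(\<lambda>n. hn n x) \<longlonglongrightarrow> indicator A x" for x
      proof (cases "x \<in> A")
        case True
        have "infdist x (- A) > 0"
          using True A False by (intro infdist_pos_not_in_closed) auto
        then obtain N where N: "1 \<le> real N * infdist x (- A)"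
          by (metis less_eq_real_def reals_Archimedean3)
        have "hn n x = 1" if "n \<ge> N" for n
        proof -
          have "real N * infdist x (- A) \<le> real n * infdist x (- A)" using that infdist_nonneg by (intro mult_right_mono) auto
          with N show ?thesis by (simp add: hn_def)
        qed
        then have "\<forall>\<^sub>F n in sequentially. hn n x = 1" by (rule eventually_sequentiallyI[of N])
        then show ?thesis using True by (simp add: tendsto_eventually)
      next
        case False
        then show ?thesis by (simp add: hn_def)
      qed
      show "E (hn n)" for n unfolding E_def
      proof (rule lip[OF _ b])
        have inf: "\<bar>infdist x S - infdist y S\<bar> \<le> dist x y" for x y :: 'c and S
          using infdist_triangle[of x S y] infdist_triangle[of y S x] by (auto simp: dist_commute)
        show "(real n)-lipschitz_on UNIV (hn n)"
        proof (rule lipschitz_onI)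
          fix x y :: 'c
          have "dist (hn n x) (hn n y) \<le> \<bar>real n * infdist x (- A) - real n * infdist y (- A)\<bar>"
            unfolding hn_def dist_real_def by (auto simp: min_def)
          also have "\<dots> = real n * \<bar>infdist x (- A) - infdist y (- A)\<bar>"
            by (simp add: right_diff_distrib[symmetric] abs_mult)
          also have "\<dots> \<le> real n * dist x y" using inf by (intro mult_left_mono) auto
          finally show "dist (hn n x) (hn n y) \<le> real n * dist x y" .
        qed simp
      qed
    qed
  qed
  have setE: "E (indicator A)" if A: "A \<in> sets borel" for A
  proof -
    have "A \<in> sigma_sets UNIV (Collect open)" using A by (simp add: borel_def)
    then have "A \<in> sets borel \<and> E (indicator A)"
    proof (rule sigma_sets_induct_disjoint[rotated 2])
      show "Int_stable (Collect open :: 'c set set)" by (auto simp: Int_stable_def)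
    next
      fix A :: "'c set" assume "A \<in> Collect open"
      then show "A \<in> sets borel \<and> E (indicator A)" using openE by auto
    next
      show "{} \<in> sets borel \<and> E (indicator {})" by (simp add: E_def)
    next
      fix A :: "'c set" assume A: "A \<in> sets borel \<and> E (indicator A)"
      have "E (\<lambda>x. indicator UNIV x + (- 1) * indicator A x)"
        using A openE[of UNIV] by (intro add[where c=1 and d=1] cmult) (auto split: split_indicator)
      then show "UNIV - A \<in> sets borel \<and> E (indicator (UNIV - A))"
        using A by (auto simp: indicator_diff elim!: back_subst[of E])
    next
      fix A :: "nat \<Rightarrow> 'c set" assume dis: "disjoint_family A" and A: "\<And>i. A i \<in> sets borel \<and> E (indicator (A i))"
      have fin: "E (indicator (\<Union>i<n. A i))" for n
      proof (induction n)
        case 0 then show ?case by (simp add: E_def)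
      next
        case (Suc n)
        have "E (\<lambda>x. indicator (\<Union>i<n. A i) x + indicator (A n) x)"
        proof (rule add[where c=1 and d=1])
          have "(\<Union>i<n. A i) \<in> sets borel" "A n \<in> sets borel" using A by auto
          then show "indicat_real (\<Union>i<n. A i) \<in> borel_measurable borel" "indicat_real (A n) \<in> borel_measurable borel"
            by (simp_all add: borel_measurable_indicator)
        qed (use A Suc in \<open>auto split: split_indicator\<close>)
        moreover have "(\<lambda>x. indicator (\<Union>i<n. A i) x + indicator (A n) x) = (indicator (\<Union>i<Suc n. A i) :: 'c \<Rightarrow> real)"
        proof
          fix x
          have "x \<notin> A i" if "x \<in> A n" "i < n" for i
            using dis that unfolding disjoint_family_on_def by (metis UNIV_I disjoint_iff less_irrefl)
          then show "indicator (\<Union>i<n. A i) x + indicator (A n) x = (indicator (\<Union>i<Suc n. A i) x :: real)"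
            by (auto simp: lessThan_Suc split: split_indicator)
        qed
        ultimately show ?case by simp
      qed
      have "E (indicator (\<Union>i. A i))"
      proof (rule lim[of "\<lambda>n. indicator (\<Union>i<n. A i)" 1])
        show "(\<lambda>n. indicator (\<Union>i<n. A i) x) \<longlonglongrightarrow> (indicator (\<Union>i. A i) x :: real)" for x
          by (rule LIMSEQ_indicator_UN)
        show "indicat_real (\<Union>i<n. A i) \<in> borel_measurable borel" for n
          by (rule borel_measurable_indicator) (use A in auto)
      qed (use fin in \<open>auto split: split_indicator\<close>)
      then show "(\<Union>i. A i) \<in> sets borel \<and> E (indicator (\<Union>i. A i))" using A by auto
    qed simp
    then show ?thesis by simp
  qed
  \<comment> \<open>Passage from indicators to \<open>H\<close>: the bound by 2 |H| \<le> 2 C is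
    uniform in the index, as dominated convergence in \<open>lim\<close> requires, and each simple
    function is a finite combination of indicators.\<close>
  obtain F where F: "\<And>i. simple_function borel (F i)" "\<And>x. (\<lambda>i. F i x) \<longlonglongrightarrow> H x"
    "\<And>i x. norm (F i x) \<le> 2 * norm (H x)"
    using borel_measurable_implies_sequence_metric[OF H, of 0] by auto
  have "E H"
  proof (rule lim[of F "2 * C"])
    show "F n \<in> borel_measurable borel" for n using F(1) by (rule borel_measurable_simple_function)
    show "\<bar>F n x\<bar> \<le> 2 * C" for n x using F(3)[of n x] bd[of x] by simp
    show "E (F n)" for n
    proof -
      have fin: "finite (range (F n))" using F(1)[of n] by (simp add: simple_function_def)
      have m: "F n -` {y} \<in> sets borel" for y
        using simple_functionD(2)[OF F(1)[of n], of "{y}"] by simp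
      have bi: "\<bar>y * indicator S x\<bar> \<le> \<bar>y\<bar>" for y :: real and S :: "'c set" and x by (auto split: split_indicator)
      have "E (\<lambda>x. \<Sum>y\<in>S. y * indicator (F n -` {y}) x) " if "finite S" for S
        using that
      proof (induction S)
        case empty then show ?case by (simp add: E_def)
      next
        case (insert y S)
        have "E (\<lambda>x. y * indicator (F n -` {y}) x + (\<Sum>y\<in>S. y * indicator (F n -` {y}) x))"
        proof (rule add[where c="\<bar>y\<bar>" and d="\<Sum>y\<in>S. \<bar>y\<bar>"])
          show "\<bar>\<Sum>y\<in>S. y * indicator (F n -` {y}) x\<bar> \<le> (\<Sum>y\<in>S. \<bar>y\<bar>)" for x
            by (rule order_trans[OF sum_abs]) (intro sum_mono bi)
          show "E (\<lambda>x. y * indicator (F n -` {y}) x)" by (intro cmult setE m)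
          show "E (\<lambda>x. \<Sum>y\<in>S. y * indicator (F n -` {y}) x)" by (rule insert.IH)
        qed (intro bi borel_measurable_sum borel_measurable_times borel_measurable_const borel_measurable_indicator m)+
        then show ?case by (simp only: sum.insert[OF insert.hyps])
      qed
      from this[OF fin] show ?thesis
        by (rule back_subst[of E]) (auto simp: fun_eq_iff indicator_def fin sum.If_cases vimage_def)
    qed
  qed (rule F(2))
  then show ?thesis by (simp add: E_def)
qed

section \<open>Weak differentiation along the dilations\<close>

text \<open>Here \<open>zun n\<close> is the classical derivative of \<open>un n\<close> along the
  dilations, and \<open>zu\<close> is its limit in L2(M), which takes the place of Zu. Nothing is
  assumed about pointwise differentiability of \<open>u\<close>.\<close>

locale dil_approx = dil_measure \<gamma> M \<tau>
  for \<gamma> :: real and M :: "((real^'m::finite) \<times> (real^'k::finite)) measure" and \<tau> :: real +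
  fixes u zu :: "(real^'m) \<times> (real^'k) \<Rightarrow> real" and un zun :: "nat \<Rightarrow> (real^'m) \<times> (real^'k) \<Rightarrow> real"
    and A :: "((real^'m) \<times> (real^'k)) set"
  assumes conv_u: "L2conv M un u" and conv_zu: "L2conv M zun zu"
    and un_deriv: "\<And>n p s. ((\<lambda>s. un n (dil \<gamma> s p)) has_real_derivative zun n (dil \<gamma> s p)) (at s)"
    and un_cont: "\<And>n. continuous_on UNIV (un n)" and zun_cont: "\<And>n. continuous_on UNIV (zun n)"
    and un_zero: "\<And>n p. p \<notin> A \<Longrightarrow> un n p = 0" and zun_zero: "\<And>n p. p \<notin> A \<Longrightarrow> zun n p = 0"
    and u_zero: "\<And>p. p \<notin> A \<Longrightarrow> u p = 0" and zu_zero: "\<And>p. p \<notin> A \<Longrightarrow> zu p = 0"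
    and A_compact: "compact A"
    and finite_thick: "emeasure M ((\<lambda>x. dil \<gamma> (fst x) (snd x)) ` ({-1..1} \<times> A)) < \<infinity>"
    and sigma_finite_M: "sigma_finite_measure M"
begin

text \<open>The points that a dilation with parameter in [-1, 1] carries into \<open>A\<close>. It
  supports \<open>U h (un n)\<close> for |h| \<le> 1 and has finite measure, so L2 functions are
  integrable on it.\<close>

definition thick :: "((real^'m) \<times> (real^'k)) set" where
  "thick = (\<lambda>x. dil \<gamma> (fst x) (snd x)) ` ({-1..1} \<times> A)"

lemma compact_thick: "compact thick"
  unfolding thick_def using A_compact
  by (intro compact_continuous_image continuous_on_subset[OF continuous_on_dil2] compact_Times) auto

lemma thick_measurable [measurable]: "thick \<in> sets borel"
  using compact_thick by (simp add: compact_imp_closed)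

lemma dil_in_A: "dil \<gamma> s p \<in> A \<Longrightarrow> \<bar>s\<bar> \<le> 1 \<Longrightarrow> p \<in> thick"
  unfolding thick_def by (rule image_eqI[of _ _ "(- s, dil \<gamma> s p)"]) auto

lemma A_subset_thick: "A \<subseteq> thick"
  using dil_in_A[of 0] by auto

lemma A_measurable [measurable]: "A \<in> sets borel"
  using A_compact by (simp add: compact_imp_closed)

lemma u_meas [measurable]: "u \<in> borel_measurable borel" "zu \<in> borel_measurable borel"
    "un n \<in> borel_measurable borel" "zun n \<in> borel_measurable borel"
  using L2convD(1,2)[OF conv_u] L2convD(1,2)[OF conv_zu] by (simp_all add: sqint_def)

lemma sqint_thick: "sqint M (indicator thick)"
proof -
  have "integrable M (indicator thick :: _ \<Rightarrow> real)"
    using finite_thick unfolding thick_def[symmetric] by (intro integrable_real_indicator) auto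
  then show ?thesis
    by (simp add: sqint_def power2_eq_square indicator_inter_arith[symmetric])
qed

lemma sqint_thick_integrable:
  assumes "sqint M f" shows "integrable M (\<lambda>p. indicator thick p * f p)"
  using sqint_mult_integrable[OF sqint_thick assms] .

lemma integrable_supported:
  assumes "sqint M f" "\<And>p. p \<notin> thick \<Longrightarrow> f p = 0" shows "integrable M f"
proof -
  have "f = (\<lambda>p. indicator thick p * f p)" using assms(2) by (auto simp: fun_eq_iff split: split_indicator)
  then show ?thesis using sqint_thick_integrable[OF assms(1)] by simp
qed

lemma un_bounded: "\<exists>C. \<forall>p. \<bar>un n p\<bar> \<le> C" "\<exists>C. \<forall>p. \<bar>zun n p\<bar> \<le> C"
proof -
  have *: "\<exists>C. \<forall>p. \<bar>f p\<bar> \<le> C" if "continuous_on UNIV f" "\<And>p. p \<notin> A \<Longrightarrow> f p = 0" for f :: "_ \<Rightarrow> real"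
  proof -
    have "bounded (f ` A)"
      using A_compact that(1) by (intro compact_imp_bounded compact_continuous_image) (auto intro: continuous_on_subset)
    then obtain C where "\<And>p. p \<in> A \<Longrightarrow> \<bar>f p\<bar> \<le> C" unfolding bounded_iff by auto
    with that(2) have "\<bar>f p\<bar> \<le> max C 0" for p by (cases "p \<in> A") (auto simp: max.coboundedI1)
    then show ?thesis by blast
  qed
  show "\<exists>C. \<forall>p. \<bar>un n p\<bar> \<le> C" "\<exists>C. \<forall>p. \<bar>zun n p\<bar> \<le> C"
    by (rule *; simp add: un_cont zun_cont un_zero zun_zero)+
qed

section \<open>The generator of the unitary group and derivatives of pairings\<close>

definition Du where "Du p = zu p - \<tau> * u p"
definition Dn where "Dn n p = zun n p - \<tau> * un n p"

lemma Du_meas [measurable]: "Du \<in> borel_measurable borel" "Dn n \<in> borel_measurable borel"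
  unfolding Du_def[abs_def] Dn_def[abs_def] by measurable

lemma conv_Du: "L2conv M Dn Du"
  unfolding Du_def[abs_def] Dn_def[abs_def] by (intro L2conv_diff L2conv_cmult conv_u conv_zu)

lemma U_un_deriv: "((\<lambda>s. U s (un n) p) has_real_derivative U s (Dn n) p) (at s)"
  unfolding U_def Dn_def
  by (auto intro!: derivative_eq_intros un_deriv simp: algebra_simps)

text \<open>Dominated convergence: for |h| \<le> 1 the difference quotients of
  \<open>U h (un n)\<close> are bounded by a constant on \<open>thick\<close> and vanish elsewhere,
  while \<open>Y\<close> is integrable on \<open>thick\<close>.\<close>

lemma deriv0_approx:
  assumes Y: "sqint M Y"
  shows "((\<lambda>h. \<integral>p. Y p * U h (un n) p \<partial>M) has_real_derivative (\<integral>p. Y p * Dn n p \<partial>M)) (at 0)"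
  unfolding DERIV_def tendsto_at_iff_sequentially comp_def
proof (intro allI impI)
  fix X :: "nat \<Rightarrow> real" assume X: "\<forall>i. X i \<in> UNIV - {0}" "X \<longlonglongrightarrow> 0"
  have [measurable]: "Y \<in> borel_measurable borel" using sqint_meas[OF Y] by simp
  obtain C1 C2 where C: "\<And>p. \<bar>un n p\<bar> \<le> C1" "\<And>p. \<bar>zun n p\<bar> \<le> C2" using un_bounded by metis
  define C where "C = exp \<bar>\<tau>\<bar> * (C2 + \<bar>\<tau>\<bar> * C1)"
  have "\<forall>\<^sub>F i in sequentially. norm (X i) < 1"
    using X(2) by (intro order_tendstoD(2)[OF tendsto_norm_zero]) auto
  then obtain N where N: "\<And>i. i \<ge> N \<Longrightarrow> \<bar>X i\<bar> \<le> 1" unfolding eventually_sequentially by force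
  have UD: "\<bar>U s (Dn n) p\<bar> \<le> C" if "\<bar>s\<bar> \<le> 1" for s p
  proof -
    have "exp (- \<tau> * s) \<le> exp \<bar>\<tau>\<bar>"
    proof -
      have "\<bar>\<tau> * s\<bar> \<le> \<bar>\<tau>\<bar> * 1" using that unfolding abs_mult by (intro mult_left_mono) auto
      then show ?thesis by simp
    qed
    moreover have "\<bar>Dn n q\<bar> \<le> C2 + \<bar>\<tau>\<bar> * C1" for q
      unfolding Dn_def using C(2)[of q] mult_left_mono[OF C(1)[of q], of "\<bar>\<tau>\<bar>"]
      by (intro order_trans[OF abs_triangle_ineq4]) (simp add: abs_mult)
    ultimately show ?thesis unfolding U_def abs_mult C_def by (intro mult_mono) auto
  qed
  have bd: "\<bar>U h (un n) p - un n p\<bar> \<le> C * \<bar>h\<bar> * indicator thick p" if h: "\<bar>h\<bar> \<le> 1" for h p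
  proof (cases "p \<in> thick")
    case True
    have "norm (U h (un n) p - U 0 (un n) p) \<le> C * norm (h - 0)"
    proof (rule field_differentiable_bound[of "{-1..1}" "\<lambda>s. U s (un n) p" "\<lambda>s. U s (Dn n) p" C h 0])
      show "((\<lambda>s. U s (un n) p) has_field_derivative U z (Dn n) p) (at z within {- 1..1})" for z
        using U_un_deriv by (rule has_field_derivative_at_within)
      show "norm (U z (Dn n) p) \<le> C" if "z \<in> {-1..1}" for z using that by (auto intro!: UD)
    qed (use h in auto)
    then show ?thesis using True by simp
  next
    case False
    then have "dil \<gamma> h p \<notin> A" "p \<notin> A" using dil_in_A[of h p] h A_subset_thick by auto
    then show ?thesis using False by (simp add: U_def un_zero)
  qed
  have iY: "integrable M (\<lambda>p. Y p * U h (un n) p)" for h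
    using sqint_mult_integrable[OF Y sqint_U[OF L2convD(1)[OF conv_u]]] .
  have "(\<lambda>i. \<integral>p. Y p * ((U (X (i + N)) (un n) p - un n p) / X (i + N)) \<partial>M) \<longlonglongrightarrow> (\<integral>p. Y p * Dn n p \<partial>M)"
  proof (rule integral_dominated_convergence[where w="\<lambda>p. C * \<bar>indicator thick p * Y p\<bar>"])
    show "integrable M (\<lambda>p. C * \<bar>indicator thick p * Y p\<bar>)"
      using sqint_thick_integrable[OF Y] by simp
    show "AE p in M. (\<lambda>i. Y p * ((U (X (i + N)) (un n) p - un n p) / X (i + N))) \<longlonglongrightarrow> Y p * Dn n p"
    proof (intro always_eventually allI tendsto_mult_left)
      fix p
      have "(\<lambda>i. (U (X i) (un n) p - un n p) / X i) \<longlonglongrightarrow> Dn n p"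
        using U_un_deriv[of n p 0] X unfolding DERIV_def tendsto_at_iff_sequentially comp_def by simp
      then show "(\<lambda>i. (U (X (i + N)) (un n) p - un n p) / X (i + N)) \<longlonglongrightarrow> Dn n p"
        by (rule LIMSEQ_ignore_initial_segment)
    qed
    show "AE p in M. norm (Y p * ((U (X (i + N)) (un n) p - un n p) / X (i + N))) \<le> C * \<bar>indicator thick p * Y p\<bar>" for i
    proof (intro always_eventually allI)
      fix p
      have "\<bar>(U (X (i + N)) (un n) p - un n p) / X (i + N)\<bar> \<le> C * indicator thick p"
        using bd[of "X (i + N)" p] N[of "i + N"] X(1)[rule_format, of "i + N"] by (simp add: abs_divide divide_le_eq mult_ac)
      from mult_left_mono[OF this, of "\<bar>Y p\<bar>"]
      show "norm (Y p * ((U (X (i + N)) (un n) p - un n p) / X (i + N))) \<le> C * \<bar>indicator thick p * Y p\<bar>"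
        by (simp add: abs_mult mult_ac)
    qed
  qed simp_all
  moreover have "(\<integral>p. Y p * ((U h (un n) p - un n p) / h) \<partial>M)
      = ((\<integral>p. Y p * U (0 + h) (un n) p \<partial>M) - (\<integral>p. Y p * U 0 (un n) p \<partial>M)) / h" for h
    using iY[of h] iY[of 0] by (simp add: right_diff_distrib diff_divide_distrib)
  ultimately have "(\<lambda>i. ((\<integral>p. Y p * U (0 + X (i + N)) (un n) p \<partial>M) - (\<integral>p. Y p * U 0 (un n) p \<partial>M)) / X (i + N)) \<longlonglongrightarrow> (\<integral>p. Y p * Dn n p \<partial>M)"
    by (simp only:)
  then show "(\<lambda>i. ((\<integral>p. Y p * U (0 + X i) (un n) p \<partial>M) - (\<integral>p. Y p * U 0 (un n) p \<partial>M)) / X i) \<longlonglongrightarrow> (\<integral>p. Y p * Dn n p \<partial>M)"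
    by (rule LIMSEQ_offset)
qed

text \<open>The group law moves the base point: with the adjoint of \<open>U s\<close> applied to
  \<open>Y\<close>, the derivative at \<open>s\<close> becomes a derivative at 0.\<close>

lemma deriv_approx:
  assumes Y: "sqint M Y"
  shows "((\<lambda>h. \<integral>p. Y p * U h (un n) p \<partial>M) has_real_derivative (\<integral>p. Y p * U s (Dn n) p \<partial>M)) (at s)"
proof -
  have [measurable]: "Y \<in> borel_measurable borel" using sqint_meas[OF Y] by simp
  have "((\<lambda>h. \<integral>p. U (- s) Y p * U h (un n) p \<partial>M) has_real_derivative (\<integral>p. U (- s) Y p * Dn n p \<partial>M)) (at 0)"
    by (rule deriv0_approx[OF sqint_U[OF Y]])
  moreover have "(\<integral>p. U (- s) Y p * U h (un n) p \<partial>M) = (\<integral>p. Y p * U (h + s) (un n) p \<partial>M)" for h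
    by (subst integral_U_mult[symmetric]) (simp_all add: U_U add.commute)
  moreover have "(\<integral>p. U (- s) Y p * Dn n p \<partial>M) = (\<integral>p. Y p * U s (Dn n) p \<partial>M)"
    by (rule integral_U_mult[symmetric]) simp_all
  ultimately have "((\<lambda>h. \<integral>p. Y p * U (h + s) (un n) p \<partial>M) has_real_derivative (\<integral>p. Y p * U s (Dn n) p \<partial>M)) (at 0)"
    by simp
  then show ?thesis by (simp add: DERIV_def add.commute)
qed

text \<open>Since \<open>U s\<close> preserves the norm, the derivatives for \<open>un n\<close>
  converge uniformly in \<open>s\<close>, at the rate of the L2 distance of \<open>Dn n\<close> and
  \<open>Du\<close>. Uniform convergence of derivatives makes the limit of the pairings
  differentiable.\<close>

lemma deriv_weak:
  assumes Y: "sqint M Y"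
  shows "((\<lambda>h. \<integral>p. Y p * U h u p \<partial>M) has_real_derivative (\<integral>p. Y p * Du p \<partial>M)) (at 0)"
proof -
  define f where "f n h = (\<integral>p. Y p * U h (un n) p \<partial>M)" for n h
  define f' where "f' n s h = (\<integral>p. Y p * U s (Dn n) p \<partial>M) * h" for n :: nat and s h :: real
  define g' where "g' s h = (\<integral>p. Y p * U s Du p \<partial>M) * h" for s h :: real
  have lim: "(\<lambda>n. f n h) \<longlonglongrightarrow> (\<integral>p. Y p * U h u p \<partial>M)" for h
    unfolding f_def by (rule L2conv_integral_mult[OF L2conv_U[OF conv_u] Y])
  have "\<exists>g. \<forall>x\<in>UNIV. (\<lambda>n. f n x) \<longlonglongrightarrow> g x \<and> (g has_derivative g' x) (at x within UNIV)"
  proof (rule has_derivative_sequence[of UNIV f _ g' 0])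
    show "(f n has_derivative f' n x) (at x within UNIV)" for n x
      using deriv_approx[OF Y, of n x] unfolding f_def f'_def has_field_derivative_def by (simp add: mult.commute)
    show "\<forall>\<^sub>F n in sequentially. \<forall>x\<in>UNIV. \<forall>h. norm (f' n x h - g' x h) \<le> e * norm h" if e: "e > 0" for e
    proof -
      have "(\<lambda>n. l2norm M Y * l2norm M (\<lambda>x. Dn n x - Du x)) \<longlonglongrightarrow> 0"
        using tendsto_mult_left[OF L2convD(4)[OF conv_Du], of "l2norm M Y"] by simp
      then have ev: "\<forall>\<^sub>F n in sequentially. l2norm M Y * l2norm M (\<lambda>x. Dn n x - Du x) < e"
        using e by (rule order_tendstoD)
      have le: "\<bar>(\<integral>p. Y p * U s (Dn n) p \<partial>M) - (\<integral>p. Y p * U s Du p \<partial>M)\<bar> \<le> l2norm M Y * l2norm M (\<lambda>x. Dn n x - Du x)" for n s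
      proof -
        note q = sqint_U[OF L2convD(1)[OF conv_Du]] sqint_U[OF L2convD(2)[OF conv_Du]]
        have eq: "(\<lambda>p. U s (Dn n) p - U s Du p) = U s (\<lambda>p. Dn n p - Du p)" by (simp add: fun_eq_iff U_diff)
        have eq2: "(\<integral>p. Y p * U s (Dn n) p \<partial>M) - (\<integral>p. Y p * U s Du p \<partial>M) = (\<integral>p. Y p * (U s (Dn n) p - U s Du p) \<partial>M)"
          using sqint_mult_integrable[OF Y q(1)] sqint_mult_integrable[OF Y q(2)] by (simp add: right_diff_distrib)
        have "\<bar>\<integral>p. Y p * (U s (Dn n) p - U s Du p) \<partial>M\<bar> \<le> l2norm M Y * l2norm M (\<lambda>p. U s (Dn n) p - U s Du p)"
          by (rule integral_mult_le_l2norm[OF Y sqint_diff[OF q]])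
        also have "l2norm M (\<lambda>p. U s (Dn n) p - U s Du p) = l2norm M (\<lambda>x. Dn n x - Du x)"
          unfolding eq by (rule l2norm_U) simp
        finally show ?thesis unfolding eq2 .
      qed
      show ?thesis using ev
      proof eventually_elim
        case (elim n)
        have "norm (f' n x h - g' x h) \<le> e * norm h" for x h
        proof -
          have "norm (f' n x h - g' x h) = \<bar>(\<integral>p. Y p * U x (Dn n) p \<partial>M) - (\<integral>p. Y p * U x Du p \<partial>M)\<bar> * \<bar>h\<bar>"
            unfolding f'_def g'_def by (simp add: left_diff_distrib[symmetric] abs_mult)
          also have "\<dots> \<le> e * \<bar>h\<bar>" using le[of x n] elim by (intro mult_right_mono) auto
          finally show ?thesis by simp
        qed
        then show ?case by blast
      qed
    qed
  qed (auto intro: lim)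
  then obtain g where g: "\<And>x. (\<lambda>n. f n x) \<longlonglongrightarrow> g x" "(g has_derivative g' 0) (at 0)" by auto
  have "g = (\<lambda>h. \<integral>p. Y p * U h u p \<partial>M)"
    using LIMSEQ_unique[OF g(1) lim] by auto
  moreover have "g' 0 = (*) (\<integral>p. Y p * Du p \<partial>M)" by (simp add: g'_def fun_eq_iff)
  ultimately show ?thesis using g(2) by (simp add: has_field_derivative_def)
qed

text \<open>The derivative of an even function vanishes at 0. This is how a symmetry of a form is
  turned into an identity for \<open>Du\<close> without inserting \<open>Du\<close> into the
  form.\<close>

lemma weak_even_zero:
  assumes Y: "sqint M Y" and d: "d > 0"
    and ev: "\<And>h. \<bar>h\<bar> < d \<Longrightarrow> (\<integral>p. Y p * U h u p \<partial>M) = (\<integral>p. Y p * U (- h) u p \<partial>M)"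
  shows "(\<integral>p. Y p * Du p \<partial>M) = 0"
proof -
  define G where "G h = (\<integral>p. Y p * U h u p \<partial>M)" for h
  have D: "(G has_real_derivative (\<integral>p. Y p * Du p \<partial>M)) (at 0)" unfolding G_def by (rule deriv_weak[OF Y])
  have "((\<lambda>h::real. - h) has_real_derivative - 1) (at 0)" by (auto intro!: derivative_eq_intros)
  from DERIV_chain2[OF _ this, of G] D
  have 1: "((\<lambda>h. G (- h)) has_real_derivative (\<integral>p. Y p * Du p \<partial>M) * (- 1)) (at 0)" by simp
  have ev': "\<forall>\<^sub>F h in nhds 0. G (- h) = G h"
    unfolding eventually_nhds_metric
  proof (intro exI[of _ d] conjI allI impI d)
    fix h :: real assume "dist h 0 < d"
    then have "\<bar>h\<bar> < d" by simp
    then show "G (- h) = G h" unfolding G_def by (rule ev[symmetric])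
  qed
  have "(G has_real_derivative (\<integral>p. Y p * Du p \<partial>M) * (- 1)) (at 0)"
    by (rule iffD1[OF DERIV_cong_ev[OF refl ev' refl] 1])
  from DERIV_unique[OF this D] show ?thesis by simp
qed

lemma u_Du_orthogonal: "(\<integral>p. u p * Du p \<partial>M) = 0"
proof (rule weak_even_zero[where d=1])
  show "(\<integral>p. u p * U h u p \<partial>M) = (\<integral>p. u p * U (- h) u p \<partial>M)" for h
    using integral_U_mult[of u u h] by (simp add: mult.commute)
qed (use L2convD(2)[OF conv_u] in auto)


text \<open>With \<open>Y = w u\<close> and G(h) = \<langle>Y, U h u\<rangle>, homogeneity of
  \<open>w\<close> gives G(h) = exp (- \<epsilon> h) G(-h). Differentiation at 0 yields 2 G'(0) = -
  \<epsilon> G(0).\<close>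

lemma hardy:
  assumes w [measurable]: "w \<in> borel_measurable borel" and bd: "\<And>p. p \<in> thick \<Longrightarrow> \<bar>w p\<bar> \<le> C"
    and hom: "\<And>s p. w (dil \<gamma> s p) = exp (\<epsilon> * s) * w p"
  shows "\<epsilon> * (\<integral>p. w p * (u p)\<^sup>2 \<partial>M) = - 2 * (\<integral>p. w p * (u p * Du p) \<partial>M)"
proof -
  \<comment> \<open>The indicator changes nothing, as \<open>u\<close> vanishes off
    \<open>A\<close>, but it exhibits \<open>Y\<close> as a bounded multiple of
    \<open>u\<close>.\<close>
  define Y where "Y p = indicator thick p * w p * u p" for p
  have Ymu: "Y p = w p * u p" for p using u_zero[of p] A_subset_thick by (auto simp: Y_def split: split_indicator)
  have Y: "sqint M Y"
    unfolding Y_def[abs_def]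
  proof (rule sqint_bounded_mult[where C="\<bar>C\<bar>"])
    show "sqint M u" by (rule L2convD(2)[OF conv_u])
    show "\<bar>indicator thick p * w p\<bar> \<le> \<bar>C\<bar>" for p
      using bd[of p] by (auto split: split_indicator)
  qed simp
  define G where "G h = (\<integral>p. Y p * U h u p \<partial>M)" for h
  have sym: "G h = exp (- \<epsilon> * h) * G (- h)" for h
  proof -
    have "G h = (\<integral>p. U (- h) Y p * u p \<partial>M)"
      unfolding G_def by (rule integral_U_mult) (simp_all add: Ymu[abs_def])
    also have "\<dots> = (\<integral>p. exp (- \<epsilon> * h) * (Y p * U (- h) u p) \<partial>M)"
      by (rule Bochner_Integration.integral_cong) (simp_all add: U_def Ymu hom)
    finally show ?thesis by (simp add: G_def)
  qed
  define d where "d = (\<integral>p. Y p * Du p \<partial>M)"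
  have D: "(G has_real_derivative d) (at 0)" unfolding G_def d_def by (rule deriv_weak[OF Y])
  have "((\<lambda>h::real. - h) has_real_derivative - 1) (at 0)" by (auto intro!: derivative_eq_intros)
  from DERIV_chain2[OF _ this, of G] D
  have D2: "((\<lambda>h. G (- h)) has_real_derivative d * (- 1)) (at 0)" by simp
  have "((\<lambda>h. exp (- \<epsilon> * h) * G (- h)) has_real_derivative - \<epsilon> * G 0 - d) (at 0)"
    by (rule derivative_eq_intros D2 refl | simp)+
  then have "(G has_real_derivative - \<epsilon> * G 0 - d) (at 0)"
    unfolding sym[symmetric] .
  from DERIV_unique[OF this D] have "\<epsilon> * G 0 = - 2 * d" by simp
  then show ?thesis by (simp add: G_def d_def Ymu power2_eq_square mult.assoc)
qed

section \<open>The chain rule integrated over the dilation parameter\<close>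

lemma notin_A: "p \<notin> thick \<Longrightarrow> p \<notin> A"
  using A_subset_thick by auto

text \<open>All functions live on a set of finite measure, so Cauchy-Schwarz against its indicator
  turns L2 convergence into L1 convergence.\<close>

lemma L1conv:
  assumes c: "L2conv M fn f" and z: "\<And>n p. p \<notin> A \<Longrightarrow> fn n p = 0" "\<And>p. p \<notin> A \<Longrightarrow> f p = 0"
  shows "(\<lambda>n. \<integral>p. \<bar>fn n p - f p\<bar> \<partial>M) \<longlonglongrightarrow> 0"
proof (rule Lim_null_comparison)
  show "(\<lambda>n. l2norm M (indicator thick) * l2norm M (\<lambda>p. fn n p - f p)) \<longlonglongrightarrow> 0"
    using tendsto_mult_left[OF L2convD(4)[OF c], of "l2norm M (indicator thick)"] by simp
  have "(\<integral>p. \<bar>fn n p - f p\<bar> \<partial>M) = (\<integral>p. \<bar>indicator thick p\<bar> * \<bar>fn n p - f p\<bar> \<partial>M)" for n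
    by (intro Bochner_Integration.integral_cong refl, subst indicator_def) (use z notin_A in \<open>auto simp del: split_paired_All\<close>)
  then show "\<forall>\<^sub>F n in sequentially. norm (\<integral>p. \<bar>fn n p - f p\<bar> \<partial>M) \<le> l2norm M (indicator thick) * l2norm M (\<lambda>p. fn n p - f p)"
    using integral_abs_mult_le_l2norm[OF sqint_thick L2convD(3)[OF c]] by simp
qed

lemma L1_integrable [simp]: "integrable M (un n)" "integrable M (zun n)" "integrable M u" "integrable M zu"
  by (rule integrable_supported, use L2convD(1,2)[OF conv_u] L2convD(1,2)[OF conv_zu] in \<open>simp\<close>,
      simp add: notin_A un_zero zun_zero u_zero zu_zero)+

lemma integrable_pair_bounded:
  fixes f :: "real \<times> (real^'m) \<times> (real^'k) \<Rightarrow> real"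
  assumes f [measurable]: "f \<in> borel_measurable (borel \<Otimes>\<^sub>M borel)" and g: "integrable M g"
    and le: "\<And>s p. \<bar>f (s, p)\<bar> \<le> indicator {0..y} s * \<bar>g p\<bar>"
  shows "integrable (lborel \<Otimes>\<^sub>M M) f"
proof -
  interpret sigma_finite_measure M by (rule sigma_finite_M)
  interpret LM: pair_sigma_finite lborel M ..
  have [measurable]: "g \<in> borel_measurable borel" using borel_measurable_integrable[OF g] by simp
  have mm: "measurable (lborel \<Otimes>\<^sub>M M) N = measurable (borel \<Otimes>\<^sub>M borel) N" for N :: "real measure"
    by (rule measurable_cong_sets) (simp_all cong: sets_pair_measure_cong)
  have "integrable (lborel \<Otimes>\<^sub>M M) (\<lambda>x. indicator {0..y} (fst x) * \<bar>g (snd x)\<bar> :: real)"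
  proof (rule LM.Fubini_integrable)
    show "(\<lambda>x. indicator {0..y} (fst x) * \<bar>g (snd x)\<bar> :: real) \<in> borel_measurable (lborel \<Otimes>\<^sub>M M)"
      unfolding mm by measurable
    show "integrable lborel (\<lambda>x. \<integral>p. norm (indicator {0..y} (fst (x, p)) * \<bar>g (snd (x, p))\<bar> :: real) \<partial>M)"
      using integrable_real_indicator[of "{0..y}" lborel] by (simp add: abs_mult emeasure_lborel_Icc_eq)
    show "AE x in lborel. integrable M (\<lambda>p. indicator {0..y} (fst (x, p)) * \<bar>g (snd (x, p))\<bar> :: real)"
      using g by simp
  qed
  then show ?thesis
    by (rule Bochner_Integration.integrable_bound) (use f le in \<open>auto simp: mm abs_mult\<close>)
qed

text \<open>Evaluates at \<open>H\<close> the first of the two signed measures behind the chain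
  rule: the image of exp (2 \<tau> s) w(p) ds dM(p), with s in [0, y], under (s, p) \<mapsto> (dil
  (-s) p, v p). The integrability claims make the iterated integral legitimate.\<close>

lemma transport_integral:
  fixes y :: real and v :: "(real^'m) \<times> (real^'k) \<Rightarrow> real"
  assumes H [measurable]: "H \<in> borel_measurable borel" and bd: "\<And>x. \<bar>H x\<bar> \<le> C"
    and v [measurable]: "v \<in> borel_measurable borel" and w: "integrable M w"
  defines "f \<equiv> (\<lambda>x. H (dil \<gamma> (- fst x) (snd x), v (snd x)) * (indicator {0..y} (fst x) * exp (2 * \<tau> * fst x) * w (snd x)) :: real)"
  shows "integrable (lborel \<Otimes>\<^sub>M M) f"
    and "(\<integral>x. f x \<partial>(lborel \<Otimes>\<^sub>M M))
      = (\<integral>s. indicator {0..y} s * (exp (2 * \<tau> * s) * (\<integral>p. H (dil \<gamma> (- s) p, v p) * w p \<partial>M)) \<partial>lborel)"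
    and "integrable lborel (\<lambda>s. indicator {0..y} s * (exp (2 * \<tau> * s) * (\<integral>p. H (dil \<gamma> (- s) p, v p) * w p \<partial>M)))"
proof -
  interpret sigma_finite_measure M by (rule sigma_finite_M)
  interpret LM: pair_sigma_finite lborel M ..
  have [measurable]: "w \<in> borel_measurable borel" using borel_measurable_integrable[OF w] by simp
  have Hm [measurable]: "H \<in> borel_measurable (borel \<Otimes>\<^sub>M borel)" using H by (simp add: borel_prod)
  have C: "0 \<le> C" using order_trans[OF abs_ge_zero bd] .
  have d: "(\<lambda>x. dil \<gamma> (- fst x) (snd x)) \<in> borel_measurable (borel \<Otimes>\<^sub>M borel)"
    using measurable_compose[OF _ dil_measurable2, of "\<lambda>x. (- fst x, snd x)" "borel \<Otimes>\<^sub>M borel"] by simp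
  note [measurable] = d
  show i: "integrable (lborel \<Otimes>\<^sub>M M) f"
  proof (rule integrable_pair_bounded)
    show "f \<in> borel_measurable (borel \<Otimes>\<^sub>M borel)" unfolding f_def by measurable
    show "integrable M (\<lambda>p. C * exp (2 * \<bar>\<tau>\<bar> * \<bar>y\<bar>) * w p)" using w by simp
    fix s p
    show "\<bar>f (s, p)\<bar> \<le> indicator {0..y} s * \<bar>C * exp (2 * \<bar>\<tau>\<bar> * \<bar>y\<bar>) * w p\<bar>"
    proof (cases "s \<in> {0..y}")
      case True
      have "exp (2 * \<tau> * s) \<le> exp (2 * \<bar>\<tau>\<bar> * \<bar>y\<bar>)"
        using True by (simp, intro mult_mono) auto
      then have "\<bar>H (dil \<gamma> (- s) p, v p)\<bar> * (exp (2 * \<tau> * s) * \<bar>w p\<bar>) \<le> C * (exp (2 * \<bar>\<tau>\<bar> * \<bar>y\<bar>) * \<bar>w p\<bar>)"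
        using bd C by (intro mult_mono) auto
      then show ?thesis using True C by (simp add: f_def abs_mult mult_ac)
    qed (simp add: f_def)
  qed
  have eq: "(\<integral>p. f (s, p) \<partial>M) = indicator {0..y} s * (exp (2 * \<tau> * s) * (\<integral>p. H (dil \<gamma> (- s) p, v p) * w p \<partial>M))" for s
    by (simp add: f_def mult.assoc mult.left_commute[of "H _"])
  show "(\<integral>x. f x \<partial>(lborel \<Otimes>\<^sub>M M))
      = (\<integral>s. indicator {0..y} s * (exp (2 * \<tau> * s) * (\<integral>p. H (dil \<gamma> (- s) p, v p) * w p \<partial>M)) \<partial>lborel)"
    using LM.integral_fst'[OF i] unfolding eq by simp
  show "integrable lborel (\<lambda>s. indicator {0..y} s * (exp (2 * \<tau> * s) * (\<integral>p. H (dil \<gamma> (- s) p, v p) * w p \<partial>M)))"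
    using LM.integrable_fst'[OF i] unfolding eq by simp
qed

text \<open>Evaluates at \<open>H\<close> the second signed measure: over each point
  \<open>p\<close> it is Lebesgue measure on the oriented interval from \<open>v p\<close> to
  \<open>v' p\<close>. Its fibre integrals are increments of primitives.\<close>

lemma section_integral:
  assumes H [measurable]: "H \<in> borel_measurable borel" and bd: "\<And>x. \<bar>H x\<bar> \<le> C"
    and v: "integrable M v" "integrable M v'"
  defines "f \<equiv> (\<lambda>x. H x * sgn_interval (v (fst x)) (v' (fst x)) (snd x) :: real)"
  shows "integrable (M \<Otimes>\<^sub>M lborel) f"
    and "(\<integral>x. f x \<partial>(M \<Otimes>\<^sub>M lborel)) = (\<integral>p. prim (\<lambda>s. H (p, s)) (v' p) - prim (\<lambda>s. H (p, s)) (v p) \<partial>M)"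
    and "integrable M (\<lambda>p. prim (\<lambda>s. H (p, s)) (v' p) - prim (\<lambda>s. H (p, s)) (v p))"
proof -
  interpret sigma_finite_measure M by (rule sigma_finite_M)
  interpret PM: pair_sigma_finite M lborel ..
  have [measurable]: "v \<in> borel_measurable borel" "v' \<in> borel_measurable borel"
    using borel_measurable_integrable[OF v(1)] borel_measurable_integrable[OF v(2)] by simp_all
  have Hm [measurable]: "H \<in> borel_measurable (borel \<Otimes>\<^sub>M borel)" using H by (simp add: borel_prod)
  have C: "0 \<le> C" using order_trans[OF abs_ge_zero bd] .
  have mm: "measurable (M \<Otimes>\<^sub>M lborel) N = measurable (borel \<Otimes>\<^sub>M borel) N" for N :: "real measure"
    by (rule measurable_cong_sets) (simp_all cong: sets_pair_measure_cong)
  have Hp: "(\<lambda>s. H (p, s)) \<in> borel_measurable borel" for p by measurable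
  have fm [measurable]: "f \<in> borel_measurable (M \<Otimes>\<^sub>M lborel)" unfolding f_def mm by measurable
  have le: "(\<integral>s. norm (f (p, s)) \<partial>lborel) \<le> C * \<bar>v' p - v p\<bar>" for p
  proof -
    have i1: "integrable lborel (\<lambda>s. \<bar>sgn_interval (v p) (v' p) s\<bar>)"
      using integrable_mult_sgn_interval[of "\<lambda>_. 1" 1 "v p" "v' p"] by simp
    have "(\<integral>s. norm (f (p, s)) \<partial>lborel) \<le> (\<integral>s. C * \<bar>sgn_interval (v p) (v' p) s\<bar> \<partial>lborel)"
      using i1 bd C by (intro integral_mono') (auto simp: f_def abs_mult intro!: mult_right_mono bd simp del: split_paired_All)
    also have "\<dots> = C * \<bar>v' p - v p\<bar>"
      unfolding abs_sgn_interval by (auto simp: min_def max_def)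
    finally show ?thesis .
  qed
  show i: "integrable (M \<Otimes>\<^sub>M lborel) f"
  proof (rule PM.Fubini_integrable)
    show "integrable M (\<lambda>p. \<integral>s. norm (f (p, s)) \<partial>lborel)"
    proof (rule Bochner_Integration.integrable_bound)
      show "integrable M (\<lambda>p. C * \<bar>v' p - v p\<bar>)" using v by simp
      show "(\<lambda>p. \<integral>s. norm (f (p, s)) \<partial>lborel) \<in> borel_measurable M"
        by (rule lborel.borel_measurable_lebesgue_integral) simp
      show "AE p in M. norm (\<integral>s. norm (f (p, s)) \<partial>lborel) \<le> norm (C * \<bar>v' p - v p\<bar>)"
        using le C by (auto intro!: always_eventually order_trans[OF le])
    qed
    show "AE p in M. integrable lborel (\<lambda>s. f (p, s))"
      using integrable_mult_sgn_interval[OF Hp bd] by (simp add: f_def)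
  qed simp
  have eq: "(\<integral>s. f (p, s) \<partial>lborel) = prim (\<lambda>s. H (p, s)) (v' p) - prim (\<lambda>s. H (p, s)) (v p)" for p
    by (simp add: prim_diff[OF Hp bd] f_def)
  show "(\<integral>x. f x \<partial>(M \<Otimes>\<^sub>M lborel)) = (\<integral>p. prim (\<lambda>s. H (p, s)) (v' p) - prim (\<lambda>s. H (p, s)) (v p) \<partial>M)"
    using PM.integral_fst'[OF i] unfolding eq by simp
  show "integrable M (\<lambda>p. prim (\<lambda>s. H (p, s)) (v' p) - prim (\<lambda>s. H (p, s)) (v p))"
    using PM.integrable_fst'[OF i] unfolding eq by simp
qed

text \<open>For continuous \<open>H\<close> the fundamental theorem applies along each orbit to the
  primitive evaluated at \<open>un n (dil \<gamma> s p)\<close>. Fubini and the substitution p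
  \<mapsto> dil (-s) p, which costs exp (2 \<tau> s), give the stated form, where the derivative
  \<open>zun n\<close> is no longer dilated.\<close>

lemma smooth_chain_rule:
  fixes H :: "((real^'m) \<times> (real^'k)) \<times> real \<Rightarrow> real"
  assumes Hc: "continuous_on UNIV H" and bd: "\<And>x. \<bar>H x\<bar> \<le> C" and y: "0 \<le> y" "y \<le> 1"
  shows "(\<integral>s. indicator {0..y} s * (exp (2 * \<tau> * s) * (\<integral>p. H (dil \<gamma> (- s) p, un n p) * zun n p \<partial>M)) \<partial>lborel)
    = (\<integral>p. prim (\<lambda>s. H (p, s)) (un n (dil \<gamma> y p)) - prim (\<lambda>s. H (p, s)) (un n p) \<partial>M)"
proof -
  interpret sigma_finite_measure M by (rule sigma_finite_M)
  interpret LM: pair_sigma_finite lborel M ..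
  have [measurable]: "H \<in> borel_measurable borel" using Hc by (rule borel_measurable_continuous_onI)
  have Hm [measurable]: "H \<in> borel_measurable (borel \<Otimes>\<^sub>M borel)" by (simp add: borel_prod)
  have C: "0 \<le> C" using order_trans[OF abs_ge_zero bd] .
  have Hpc: "continuous_on UNIV (\<lambda>s. H (p, s))" for p
    by (intro continuous_on_compose2[OF Hc] continuous_intros) auto
  obtain Z where Z: "\<And>p. \<bar>zun n p\<bar> \<le> Z" using un_bounded(2)[of n] by blast
  define q where "q s p = H (p, un n (dil \<gamma> s p)) * zun n (dil \<gamma> s p)" for s p
  have qm [measurable]: "(\<lambda>x. q (fst x) (snd x)) \<in> borel_measurable (borel \<Otimes>\<^sub>M borel)"
    unfolding q_def by measurable
  have ftc: "prim (\<lambda>s. H (p, s)) (un n (dil \<gamma> y p)) - prim (\<lambda>s. H (p, s)) (un n p) = (\<integral>s. indicator {0..y} s * q s p \<partial>lborel)" for p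
  proof -
    have "(\<integral>s. q s p * indicator {0..y} s \<partial>lborel) = prim (\<lambda>s. H (p, s)) (un n (dil \<gamma> y p)) - prim (\<lambda>s. H (p, s)) (un n (dil \<gamma> 0 p))"
    proof (rule integral_FTC_Icc_real[OF y(1)])
      fix s assume "0 \<le> s" "s \<le> y"
      show "((\<lambda>s. prim (\<lambda>s. H (p, s)) (un n (dil \<gamma> s p))) has_real_derivative q s p) (at s)"
        unfolding q_def by (rule DERIV_chain2[OF prim_deriv[OF Hpc bd] un_deriv])
      have cd: "isCont (\<lambda>s. dil \<gamma> s p) s" unfolding dil_def by (intro continuous_intros)
      have cu: "isCont (un n) q" "isCont (zun n) q" "isCont (\<lambda>s. H (p, s)) t" for q t
        using un_cont[of n] zun_cont[of n] Hpc[of p] unfolding continuous_on_eq_continuous_at[OF open_UNIV] by blast+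
      show "isCont (\<lambda>s. q s p) s" unfolding q_def
        by (rule isCont_mult[OF isCont_o2[OF isCont_o2[OF cd cu(1)] cu(3)] isCont_o2[OF cd cu(2)]])
    qed
    then show ?thesis by (simp add: mult.commute)
  qed
  have qint: "integrable (lborel \<Otimes>\<^sub>M M) (\<lambda>(s, p). indicator {0..y} s * q s p)"
  proof (rule integrable_pair_bounded)
    show "(\<lambda>(s, p). indicator {0..y} s * q s p) \<in> borel_measurable (borel \<Otimes>\<^sub>M borel)"
      unfolding case_prod_beta by measurable
    show "integrable M (\<lambda>p. C * Z * indicator thick p)"
      using integrable_supported[OF sqint_thick] by simp
    show "\<bar>case (s, p) of (s, p) \<Rightarrow> indicator {0..y} s * q s p\<bar> \<le> indicator {0..y} s * \<bar>C * Z * indicator thick p\<bar>" for s p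
    proof (cases "s \<in> {0..y} \<and> p \<in> thick")
      case True
      then show ?thesis using mult_mono[OF bd[of "(p, un n (dil \<gamma> s p))"] Z[of "dil \<gamma> s p"] C] C order_trans[OF abs_ge_zero Z[of p]] by (simp add: q_def abs_mult)
    next
      case False
      then have "s \<notin> {0..y} \<or> dil \<gamma> s p \<notin> A" using dil_in_A[of s p] y by auto
      then show ?thesis by (auto simp: q_def zun_zero)
    qed
  qed
  have "(\<integral>p. q s p \<partial>M) = exp (2 * \<tau> * s) * (\<integral>p. H (dil \<gamma> (- s) p, un n p) * zun n p \<partial>M)" for s
    using integral_dil[of "\<lambda>p. H (dil \<gamma> (- s) p, un n p) * zun n p" s] by (simp add: q_def)
  then have "(\<integral>s. indicator {0..y} s * (exp (2 * \<tau> * s) * (\<integral>p. H (dil \<gamma> (- s) p, un n p) * zun n p \<partial>M)) \<partial>lborel)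
     = (\<integral>s. (\<integral>p. indicator {0..y} s * q s p \<partial>M) \<partial>lborel)"
    by simp
  also have "\<dots> = (\<integral>p. (\<integral>s. indicator {0..y} s * q s p \<partial>lborel) \<partial>M)"
    by (rule LM.Fubini_integral[OF qint, symmetric])
  finally show ?thesis unfolding ftc .
qed

text \<open>\<open>H (p, s)\<close> is merely Borel in \<open>s\<close>, so there is no pointwise chain rule for its primitive. Integrated
  over the dilation parameter, the chain rule is an equality of two signed measures evaluated at \<open>H\<close>.\<close>

lemma chain_rule:
  fixes H :: "((real^'m) \<times> (real^'k)) \<times> real \<Rightarrow> real"
  assumes Hm [measurable]: "H \<in> borel_measurable borel" and bd: "\<And>x. \<bar>H x\<bar> \<le> C" and y: "0 \<le> y" "y \<le> 1"
  shows "(\<integral>s. indicator {0..y} s * (exp (2 * \<tau> * s) * (\<integral>p. H (dil \<gamma> (- s) p, u p) * zu p \<partial>M)) \<partial>lborel)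
    = (\<integral>p. prim (\<lambda>s. H (p, s)) (u (dil \<gamma> y p)) - prim (\<lambda>s. H (p, s)) (u p) \<partial>M)"
proof -
  interpret sigma_finite_measure M by (rule sigma_finite_M)
  interpret LM: pair_sigma_finite lborel M ..
  have udil: "integrable M (\<lambda>p. v (dil \<gamma> y p))" if "integrable M v" for v :: "_ \<Rightarrow> real"
    using integrable_dil[OF that] .
  have lip: "(\<integral>s. indicator {0..y} s * (exp (2 * \<tau> * s) * (\<integral>p. H (dil \<gamma> (- s) p, u p) * zu p \<partial>M)) \<partial>lborel)
    = (\<integral>p. prim (\<lambda>s. H (p, s)) (u (dil \<gamma> y p)) - prim (\<lambda>s. H (p, s)) (u p) \<partial>M)"
    if lip: "L-lipschitz_on UNIV H" and bd: "\<And>x. \<bar>H x\<bar> \<le> 1" for H :: "((real^'m) \<times> (real^'k)) \<times> real \<Rightarrow> real" and L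
  proof -
    have Hc: "continuous_on UNIV H" using lip by (rule lipschitz_on_continuous_on)
    have Hm [measurable]: "H \<in> borel_measurable borel" using Hc by (rule borel_measurable_continuous_onI)
    have Hm' [measurable]: "H \<in> borel_measurable (borel \<Otimes>\<^sub>M borel)" by (simp add: borel_prod)
    have Hpm: "(\<lambda>s. H (p, s)) \<in> borel_measurable borel" for p by measurable
    have L: "0 \<le> L" using lip by (rule lipschitz_on_nonneg)
    have Hl: "\<bar>H (p, a) - H (p, b)\<bar> \<le> L * \<bar>a - b\<bar>" for p a b
      using lipschitz_onD[OF lip, of "(p, a)" "(p, b)"] by (simp add: dist_real_def dist_Pair_Pair)
    \<comment> \<open>An error bound that does not depend on the dilation parameter: |H| \<le> 1
      controls the change of \<open>zun\<close>, and the Lipschitz constant controls the change of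
      the argument \<open>un\<close>.\<close>
    define E where "E n = (\<integral>p. \<bar>zun n p - zu p\<bar> \<partial>M) + L * (l2norm M zu * l2norm M (\<lambda>p. un n p - u p))" for n
    have E0: "E \<longlonglongrightarrow> 0"
      unfolding E_def
      using tendsto_add[OF L1conv[OF conv_zu zun_zero zu_zero]
          tendsto_mult_left[OF tendsto_mult_left[OF L2convD(4)[OF conv_u], of "l2norm M zu"], of L]] by simp
    have iH: "integrable M (\<lambda>p. H (dil \<gamma> (- s) p, v p) * w p)" if "integrable M w" "v \<in> borel_measurable borel" for s v w
    proof (rule Bochner_Integration.integrable_bound[OF that(1)])
      have [measurable]: "w \<in> borel_measurable borel" "v \<in> borel_measurable borel"
        using that borel_measurable_integrable by auto
      show "(\<lambda>p. H (dil \<gamma> (- s) p, v p) * w p) \<in> borel_measurable M" by simp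
      show "AE p in M. norm (H (dil \<gamma> (- s) p, v p) * w p) \<le> norm (w p)"
        using mult_right_mono[OF bd abs_ge_zero] by (auto simp: abs_mult)
    qed
    have inner: "\<bar>(\<integral>p. H (dil \<gamma> (- s) p, un n p) * zun n p \<partial>M) - (\<integral>p. H (dil \<gamma> (- s) p, u p) * zu p \<partial>M)\<bar> \<le> E n" for s n
    proof -
      have i: "integrable M (\<lambda>p. \<bar>zun n p - zu p\<bar>)" "integrable M (\<lambda>p. \<bar>zu p\<bar> * \<bar>un n p - u p\<bar>)"
        using sqint_mult_integrable[OF L2convD(2)[OF conv_zu] L2convD(3)[OF conv_u], THEN integrable_abs]
        by (simp_all add: abs_mult)
      have "\<bar>(\<integral>p. H (dil \<gamma> (- s) p, un n p) * zun n p \<partial>M) - (\<integral>p. H (dil \<gamma> (- s) p, u p) * zu p \<partial>M)\<bar>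
        = \<bar>\<integral>p. H (dil \<gamma> (- s) p, un n p) * zun n p - H (dil \<gamma> (- s) p, u p) * zu p \<partial>M\<bar>"
        by (simp add: iH)
      also have "\<dots> \<le> (\<integral>p. \<bar>zun n p - zu p\<bar> + L * (\<bar>zu p\<bar> * \<bar>un n p - u p\<bar>) \<partial>M)"
      proof (rule order_trans[OF integral_abs_bound integral_mono'])
        show "integrable M (\<lambda>p. \<bar>zun n p - zu p\<bar> + L * (\<bar>zu p\<bar> * \<bar>un n p - u p\<bar>))"
          using i by simp
        fix p
        define a b where "a = H (dil \<gamma> (- s) p, un n p)" "b = H (dil \<gamma> (- s) p, u p)"
        have "a * zun n p - b * zu p = a * (zun n p - zu p) + (a - b) * zu p" by (simp add: algebra_simps)
        then have "\<bar>a * zun n p - b * zu p\<bar> \<le> \<bar>a\<bar> * \<bar>zun n p - zu p\<bar> + \<bar>a - b\<bar> * \<bar>zu p\<bar>"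
          by (metis abs_mult abs_triangle_ineq)
        also have "\<dots> \<le> 1 * \<bar>zun n p - zu p\<bar> + (L * \<bar>un n p - u p\<bar>) * \<bar>zu p\<bar>"
          unfolding a_b_def using bd Hl by (intro add_mono mult_right_mono) auto
        finally show "\<bar>H (dil \<gamma> (- s) p, un n p) * zun n p - H (dil \<gamma> (- s) p, u p) * zu p\<bar>
          \<le> \<bar>zun n p - zu p\<bar> + L * (\<bar>zu p\<bar> * \<bar>un n p - u p\<bar>)"
          by (simp add: a_b_def mult_ac)
      qed (use L in auto)
      also have "\<dots> = (\<integral>p. \<bar>zun n p - zu p\<bar> \<partial>M) + L * (\<integral>p. \<bar>zu p\<bar> * \<bar>un n p - u p\<bar> \<partial>M)"
        using i by simp
      also have "\<dots> \<le> E n" unfolding E_def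
        using integral_abs_mult_le_l2norm[OF L2convD(2)[OF conv_zu] L2convD(3)[OF conv_u]] L
        by (intro add_mono mult_left_mono) auto
      finally show ?thesis .
    qed
    define I where "I v w s = indicator {0..y} s * (exp (2 * \<tau> * s) * (\<integral>p. H (dil \<gamma> (- s) p, v p) * w p \<partial>M))" for v w s
    have Iint: "integrable lborel (I (un n) (zun n))" "integrable lborel (I u zu)" for n
      unfolding I_def by (rule transport_integral(3)[OF Hm bd]; simp)+
    have lim1: "(\<lambda>n. \<integral>s. I (un n) (zun n) s \<partial>lborel) \<longlonglongrightarrow> (\<integral>s. I u zu s \<partial>lborel)"
    proof (rule LIM_zero_cancel, rule Lim_null_comparison)
      show "(\<lambda>n. y * exp (2 * \<bar>\<tau>\<bar>) * E n) \<longlonglongrightarrow> 0"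
        using tendsto_mult_left[OF E0, of "y * exp (2 * \<bar>\<tau>\<bar>)"] by simp
      have "\<bar>(\<integral>s. I (un n) (zun n) s \<partial>lborel) - (\<integral>s. I u zu s \<partial>lborel)\<bar> \<le> y * exp (2 * \<bar>\<tau>\<bar>) * E n" for n
      proof -
        have "\<bar>(\<integral>s. I (un n) (zun n) s \<partial>lborel) - (\<integral>s. I u zu s \<partial>lborel)\<bar> = \<bar>\<integral>s. I (un n) (zun n) s - I u zu s \<partial>lborel\<bar>"
          using Iint by simp
        also have "\<dots> \<le> (\<integral>s. (exp (2 * \<bar>\<tau>\<bar>) * E n) * indicator {0..y} s \<partial>lborel)"
        proof (rule order_trans[OF integral_abs_bound integral_mono'])
          show "integrable lborel (\<lambda>s. exp (2 * \<bar>\<tau>\<bar>) * E n * indicator {0..y} s)"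
            by (intro integrable_mult_right integrable_real_indicator) (auto simp: emeasure_lborel_Icc_eq)
          have E: "0 \<le> E n" using order_trans[OF abs_ge_zero inner] .
          then show "0 \<le> exp (2 * \<bar>\<tau>\<bar>) * E n * indicator {0..y} s" for s by simp
          show "\<bar>I (un n) (zun n) s - I u zu s\<bar> \<le> exp (2 * \<bar>\<tau>\<bar>) * E n * indicator {0..y} s" for s
          proof (cases "s \<in> {0..y}")
            case True
            have "\<tau> * s \<le> \<bar>\<tau>\<bar> * 1" using True y by (intro mult_mono) auto
            then have "exp (2 * \<tau> * s) \<le> exp (2 * \<bar>\<tau>\<bar>)" by simp
            then have "exp (2 * \<tau> * s) * \<bar>(\<integral>p. H (dil \<gamma> (- s) p, un n p) * zun n p \<partial>M) - (\<integral>p. H (dil \<gamma> (- s) p, u p) * zu p \<partial>M)\<bar>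
               \<le> exp (2 * \<bar>\<tau>\<bar>) * E n"
              using inner by (intro mult_mono) auto
            then show ?thesis using True by (simp add: I_def right_diff_distrib[symmetric] abs_mult)
          qed (simp add: I_def)
        qed
        also have "\<dots> = y * exp (2 * \<bar>\<tau>\<bar>) * E n" using y by simp
        finally show ?thesis .
      qed
      then show "\<forall>\<^sub>F n in sequentially. norm ((\<integral>s. I (un n) (zun n) s \<partial>lborel) - (\<integral>s. I u zu s \<partial>lborel)) \<le> y * exp (2 * \<bar>\<tau>\<bar>) * E n"
        by simp
    qed
    define P where "P v p = prim (\<lambda>s. H (p, s)) (v (dil \<gamma> y p)) - prim (\<lambda>s. H (p, s)) (v p)" for v p
    have Pint: "integrable M (P v)" if "integrable M v" for v
      unfolding P_def by (rule section_integral(3)[OF Hm bd that udil[OF that]])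
    have lim2: "(\<lambda>n. \<integral>p. P (un n) p \<partial>M) \<longlonglongrightarrow> (\<integral>p. P u p \<partial>M)"
    proof (rule LIM_zero_cancel, rule Lim_null_comparison)
      show "(\<lambda>n. (exp (2 * \<tau> * y) + 1) * (\<integral>p. \<bar>un n p - u p\<bar> \<partial>M)) \<longlonglongrightarrow> 0"
        using tendsto_mult_left[OF L1conv[OF conv_u un_zero u_zero], of "exp (2 * \<tau> * y) + 1"] by simp
      have "\<bar>(\<integral>p. P (un n) p \<partial>M) - (\<integral>p. P u p \<partial>M)\<bar> \<le> (exp (2 * \<tau> * y) + 1) * (\<integral>p. \<bar>un n p - u p\<bar> \<partial>M)" for n
      proof -
        have i: "integrable M (\<lambda>p. \<bar>un n p - u p\<bar>)" by simp
        have "\<bar>(\<integral>p. P (un n) p \<partial>M) - (\<integral>p. P u p \<partial>M)\<bar> = \<bar>\<integral>p. P (un n) p - P u p \<partial>M\<bar>"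
          using Pint by simp
        also have "\<dots> \<le> (\<integral>p. \<bar>un n (dil \<gamma> y p) - u (dil \<gamma> y p)\<bar> + \<bar>un n p - u p\<bar> \<partial>M)"
        proof (rule order_trans[OF integral_abs_bound integral_mono'])
          show "integrable M (\<lambda>p. \<bar>un n (dil \<gamma> y p) - u (dil \<gamma> y p)\<bar> + \<bar>un n p - u p\<bar>)"
            using i udil[OF i] by simp
          show "\<bar>P (un n) p - P u p\<bar> \<le> \<bar>un n (dil \<gamma> y p) - u (dil \<gamma> y p)\<bar> + \<bar>un n p - u p\<bar>" for p
          proof -
            have tri: "\<bar>a - b - (c - d)\<bar> \<le> \<bar>a - c\<bar> + \<bar>b - d\<bar>" for a b c d :: real by linarith
            show ?thesis unfolding P_def
              using prim_lipschitz[OF Hpm bd, of p "un n (dil \<gamma> y p)" "u (dil \<gamma> y p)"] prim_lipschitz[OF Hpm bd, of p "un n p" "u p"]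
              by (intro order_trans[OF tri] add_mono) simp_all
          qed
        qed simp
        also have "\<dots> = (exp (2 * \<tau> * y) + 1) * (\<integral>p. \<bar>un n p - u p\<bar> \<partial>M)"
          using i udil[OF i] integral_dil[of "\<lambda>p. \<bar>un n p - u p\<bar>" y] by (simp add: algebra_simps)
        finally show ?thesis .
      qed
      then show "\<forall>\<^sub>F n in sequentially. norm ((\<integral>p. P (un n) p \<partial>M) - (\<integral>p. P u p \<partial>M)) \<le> (exp (2 * \<tau> * y) + 1) * (\<integral>p. \<bar>un n p - u p\<bar> \<partial>M)"
        by simp
    qed
    have "(\<integral>s. I (un n) (zun n) s \<partial>lborel) = (\<integral>p. P (un n) p \<partial>M)" for n
      unfolding I_def P_def by (rule smooth_chain_rule[OF Hc bd y])
    with lim1 lim2 have "(\<integral>s. I u zu s \<partial>lborel) = (\<integral>p. P u p \<partial>M)" by (auto intro: LIMSEQ_unique)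
    then show ?thesis by (simp add: I_def P_def)
  qed
  \<comment> \<open>The two sides of the chain rule as integrals of \<open>H\<close> against signed
    measures, with densities \<open>w1\<close> pushed forward by \<open>X1\<close> and
    \<open>w2\<close> pushed forward by the identity. They agree on bounded Lipschitz functions by
    \<open>lip\<close>.\<close>
  define X1 where "X1 x = (dil \<gamma> (- fst x) (snd x), u (snd x))" for x
  define w1 where "w1 x = indicator {0..y} (fst x) * exp (2 * \<tau> * fst x) * zu (snd x)" for x
  define w2 where "w2 x = sgn_interval (u (fst x)) (u (dil \<gamma> y (fst x))) (snd x)" for x
  have one: "(\<lambda>_. 1 :: real) \<in> borel_measurable borel" by simp
  note ui = L1_integrable(3)
  have mm: "measurable (lborel \<Otimes>\<^sub>M M) N = measurable (borel \<Otimes>\<^sub>M borel) N" for N :: "'x measure"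
    by (rule measurable_cong_sets) (simp_all cong: sets_pair_measure_cong)
  have "(\<integral>x. H (X1 x) * w1 x \<partial>(lborel \<Otimes>\<^sub>M M)) = (\<integral>x. H (id x) * w2 x \<partial>(M \<Otimes>\<^sub>M lborel))"
  proof (rule signed_measure_eqI[OF _ _ _ _ _ Hm bd])
    have [measurable]: "(\<lambda>x. dil \<gamma> (- fst x) (snd x)) \<in> borel_measurable (borel \<Otimes>\<^sub>M borel)"
      using measurable_compose[OF _ dil_measurable2, of "\<lambda>x. (- fst x, snd x)" "borel \<Otimes>\<^sub>M borel"] by simp
    have "X1 \<in> borel \<Otimes>\<^sub>M borel \<rightarrow>\<^sub>M borel \<Otimes>\<^sub>M borel" unfolding X1_def by measurable
    then show "X1 \<in> borel_measurable (lborel \<Otimes>\<^sub>M M)" by (simp add: mm borel_prod)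
    show "id \<in> borel_measurable (M \<Otimes>\<^sub>M lborel)"
      by (subst measurable_cong_sets[OF _ refl, of _ borel]) (simp_all add: borel_prod[symmetric] cong: sets_pair_measure_cong)
    show "integrable (lborel \<Otimes>\<^sub>M M) w1"
      using transport_integral(1)[of "\<lambda>_. 1" 1 u zu y] by (simp add: w1_def[abs_def])
    show "integrable (M \<Otimes>\<^sub>M lborel) w2"
      using section_integral(1)[of "\<lambda>_. 1" 1 u "\<lambda>p. u (dil \<gamma> y p)"] udil[OF ui] by (simp add: w2_def[abs_def])
    fix H :: "((real^'m) \<times> (real^'k)) \<times> real \<Rightarrow> real" and L
    assume H: "L-lipschitz_on UNIV H" "\<And>x. \<bar>H x\<bar> \<le> 1"
    have Hm [measurable]: "H \<in> borel_measurable borel"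
      using lipschitz_on_continuous_on[OF H(1)] by (rule borel_measurable_continuous_onI)
    show "(\<integral>x. H (X1 x) * w1 x \<partial>(lborel \<Otimes>\<^sub>M M)) = (\<integral>x. H (id x) * w2 x \<partial>(M \<Otimes>\<^sub>M lborel))"
      using transport_integral(2)[OF Hm H(2) u_meas(1) L1_integrable(4), of y] section_integral(2)[OF Hm H(2) ui udil[OF ui]] lip[OF H]
      by (simp add: X1_def w1_def w2_def)
  qed
  then show ?thesis
    using transport_integral(2)[OF Hm bd u_meas(1) L1_integrable(4), of y] section_integral(2)[OF Hm bd ui udil[OF ui]]
    by (simp add: X1_def w1_def w2_def)
qed


text \<open>Divide the chain rule by y and let y tend to 0 from above. The left side tends to the
  integral of \<open>H (p, u p) * zu p\<close>; after a dilation of the integration variable the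
  hypothesis \<open>low\<close> bounds the right side below by (exp ((2 \<tau> - c) y) - 1)/y times
  the integral of the primitive.\<close>

lemma nonlinear_lower_bound:
  fixes H :: "((real^'m) \<times> (real^'k)) \<times> real \<Rightarrow> real"
  assumes Hm [measurable]: "H \<in> borel_measurable borel" and bd: "\<And>x. \<bar>H x\<bar> \<le> C"
    and low: "\<And>p y s. 0 \<le> y \<Longrightarrow> y \<le> 1 \<Longrightarrow>
      exp (- c * y) * prim (\<lambda>s. H (p, s)) s \<le> prim (\<lambda>s. H (dil \<gamma> (- y) p, s)) s"
    and lim: "\<And>p s. p \<in> A \<Longrightarrow> ((\<lambda>y. H (dil \<gamma> (- y) p, s)) \<longlongrightarrow> H (p, s)) (at_right 0)"
  shows "(2 * \<tau> - c) * (\<integral>p. prim (\<lambda>s. H (p, s)) (u p) \<partial>M) \<le> (\<integral>p. H (p, u p) * zu p \<partial>M)"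
proof -
  have Hm' [measurable]: "H \<in> borel_measurable (borel \<Otimes>\<^sub>M borel)" by (simp add: borel_prod)
  have Hpm: "(\<lambda>s. H (p, s)) \<in> borel_measurable borel" for p by measurable
  have C: "0 \<le> C" using order_trans[OF abs_ge_zero bd] .
  have prim_meas: "(\<lambda>p. prim (\<lambda>s. H (b p, s)) (v p)) \<in> borel_measurable borel"
    if [measurable]: "v \<in> borel_measurable borel" "b \<in> borel_measurable borel" for v b
    unfolding prim_def by (rule lborel.borel_measurable_lebesgue_integral) (simp add: case_prod_beta)
  have prim_int: "integrable M (\<lambda>p. prim (\<lambda>s. H (b p, s)) (v p))"
    if v: "integrable M v" and b: "b \<in> borel_measurable borel" for v b
  proof (rule Bochner_Integration.integrable_bound)
    show "integrable M (\<lambda>p. C * \<bar>v p\<bar>)" using v by simp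
    show "(\<lambda>p. prim (\<lambda>s. H (b p, s)) (v p)) \<in> borel_measurable M"
      using prim_meas[OF _ b] borel_measurable_integrable[OF v] by simp
    show "AE p in M. norm (prim (\<lambda>s. H (b p, s)) (v p)) \<le> norm (C * \<bar>v p\<bar>)"
      using abs_prim_le[OF Hpm bd] C by (simp add: abs_mult)
  qed
  define I where "I = (\<integral>p. prim (\<lambda>s. H (p, s)) (u p) \<partial>M)"
  define g where "g s = exp (2 * \<tau> * s) * (\<integral>p. H (dil \<gamma> (- s) p, u p) * zu p \<partial>M)" for s
  define k where "k = 2 * \<tau> - c"
  have lower: "(exp (k * y) - 1) * I \<le> (\<integral>s. indicator {0..y} s * g s \<partial>lborel)" if y: "0 < y" "y \<le> 1" for y
  proof -
    have i: "integrable M (\<lambda>p. prim (\<lambda>s. H (p, s)) (u (dil \<gamma> y p)))" "integrable M (\<lambda>p. prim (\<lambda>s. H (p, s)) (u p))"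
      using integrable_dil[OF L1_integrable(3), of y] L1_integrable(3) by (intro prim_int; simp)+
    have "(\<integral>s. indicator {0..y} s * g s \<partial>lborel) = (\<integral>p. prim (\<lambda>s. H (p, s)) (u (dil \<gamma> y p)) \<partial>M) - I"
      unfolding g_def using chain_rule[OF Hm bd, of y] y i by (simp add: I_def)
    moreover have "(\<integral>p. prim (\<lambda>s. H (p, s)) (u (dil \<gamma> y p)) \<partial>M) = exp (2 * \<tau> * y) * (\<integral>p. prim (\<lambda>s. H (dil \<gamma> (- y) p, s)) (u p) \<partial>M)"
      using integral_dil[OF prim_meas[of u "dil \<gamma> (- y)"], of y] by simp
    moreover have "(\<integral>p. exp (- c * y) * prim (\<lambda>s. H (p, s)) (u p) \<partial>M) \<le> (\<integral>p. prim (\<lambda>s. H (dil \<gamma> (- y) p, s)) (u p) \<partial>M)"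
      using i(2) prim_int[OF L1_integrable(3), of "dil \<gamma> (- y)"] low y by (intro integral_mono) simp_all
    then have "exp (2 * \<tau> * y) * (exp (- c * y) * I) \<le> exp (2 * \<tau> * y) * (\<integral>p. prim (\<lambda>s. H (dil \<gamma> (- y) p, s)) (u p) \<partial>M)"
      by (simp add: I_def)
    moreover have "exp (2 * \<tau> * y) * (exp (- c * y) * I) = exp (k * y) * I"
      by (simp add: k_def left_diff_distrib exp_diff exp_minus field_simps)
    ultimately show ?thesis unfolding left_diff_distrib mult_1_left by linarith
  qed
  have g_lim: "(g \<longlongrightarrow> (\<integral>p. H (p, u p) * zu p \<partial>M)) (at_right 0)"
  proof -
    have "((\<lambda>s. \<integral>p. H (dil \<gamma> (- s) p, u p) * zu p \<partial>M) \<longlongrightarrow> (\<integral>p. H (p, u p) * zu p \<partial>M)) (at_right 0)"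
    proof (rule tendsto_at_right_sequentially[of 0 1])
      fix S :: "nat \<Rightarrow> real" assume S: "\<And>n. 0 < S n" "\<And>n. S n < 1" "decseq S" "S \<longlonglongrightarrow> 0"
      show "(\<lambda>n. \<integral>p. H (dil \<gamma> (- S n) p, u p) * zu p \<partial>M) \<longlonglongrightarrow> (\<integral>p. H (p, u p) * zu p \<partial>M)"
      proof (rule integral_dominated_convergence[where w="\<lambda>p. C * \<bar>zu p\<bar>"])
        show "AE p in M. (\<lambda>n. H (dil \<gamma> (- S n) p, u p) * zu p) \<longlonglongrightarrow> H (p, u p) * zu p"
        proof (intro always_eventually allI)
          fix p
          have fl: "filterlim S (at_right 0) sequentially"
            using S(4) S(1) by (auto simp: filterlim_at less_imp_neq[OF S(1), symmetric])
          show "(\<lambda>n. H (dil \<gamma> (- S n) p, u p) * zu p) \<longlonglongrightarrow> H (p, u p) * zu p"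
          proof (cases "p \<in> A")
            case True
            show ?thesis by (rule tendsto_mult_right, rule filterlim_compose[OF lim[OF True] fl])
          qed (simp add: zu_zero)
        qed
        show "AE p in M. norm (H (dil \<gamma> (- S n) p, u p) * zu p) \<le> C * \<bar>zu p\<bar>" for n
          using bd by (intro always_eventually allI) (simp add: abs_mult mult_right_mono)
      qed simp_all
    qed simp
    moreover have "((\<lambda>s. exp (2 * \<tau> * s)) \<longlongrightarrow> exp (2 * \<tau> * 0)) (at_right 0)"
      by (intro tendsto_intros)
    ultimately have "(g \<longlongrightarrow> exp (2 * \<tau> * 0) * (\<integral>p. H (p, u p) * zu p \<partial>M)) (at_right 0)"
      unfolding g_def by (intro tendsto_mult)
    then show ?thesis by simp
  qed
  have g_int: "integrable lborel (\<lambda>s. indicator {0..y} s * g s)" for y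
    unfolding g_def by (rule transport_integral(3)[OF Hm bd]) simp_all
  have "k * I \<le> (\<integral>p. H (p, u p) * zu p \<partial>M) + e" if e: "e > 0" for e
  proof -
    define G where "G = (\<integral>p. H (p, u p) * zu p \<partial>M) + e"
    have "\<forall>\<^sub>F s in at_right 0. g s < G"
      using g_lim by (rule order_tendstoD) (simp add: G_def e)
    then obtain d where d: "d > 0" "\<And>s. 0 < s \<Longrightarrow> s < d \<Longrightarrow> g s < G"
      unfolding eventually_at_right_field by auto
    have "(exp (k * y) - 1) / y * I \<le> G" if y: "0 < y" "y < min d 1" for y
    proof -
      \<comment> \<open>The bound on \<open>g\<close> is available for positive \<open>s\<close>
        only; the endpoint 0 is a null set.\<close>
      have "(\<integral>s. indicator {0..y} s * g s \<partial>lborel) \<le> (\<integral>s. G * indicator {0..y} s \<partial>lborel)"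
      proof (rule integral_mono_AE[OF g_int])
        show "integrable lborel (\<lambda>s. G * indicator {0..y} s)"
          by (intro integrable_mult_right integrable_real_indicator) (auto simp: emeasure_lborel_Icc_eq)
        show "AE s in lborel. indicator {0..y} s * g s \<le> G * indicator {0..y} s"
          using AE_lborel_singleton[of 0]
          by eventually_elim (use d y in \<open>auto split: split_indicator intro!: less_imp_le\<close>)
      qed
      also have "\<dots> = G * y" using y by simp
      finally have "(exp (k * y) - 1) * I \<le> G * y" using lower[of y] y by simp
      then show ?thesis using y by (simp add: field_simps)
    qed
    then have ev: "\<forall>\<^sub>F y in at_right 0. (exp (k * y) - 1) / y * I \<le> G"
      unfolding eventually_at_right_field using d(1) by (intro exI[of _ "min d 1"]) auto
    have "((\<lambda>y. exp (k * y)) has_real_derivative k) (at 0)"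
      by (auto intro!: derivative_eq_intros)
    then have "((\<lambda>y. (exp (k * y) - 1) / y) \<longlongrightarrow> k) (at 0)"
      by (simp add: DERIV_def)
    then have "((\<lambda>y. (exp (k * y) - 1) / y * I) \<longlongrightarrow> k * I) (at_right 0)"
      by (intro tendsto_mult_right) (rule tendsto_mono[OF at_le], auto)
    from tendsto_upperbound[OF this ev] show ?thesis by (simp add: G_def)
  qed
  then have "k * I \<le> (\<integral>p. H (p, u p) * zu p \<partial>M)" by (rule field_le_epsilon)
  then show ?thesis by (simp add: k_def I_def)
qed

end

section \<open>The gauge and directional derivatives\<close>

text \<open>The power \<rho>^(2(\<gamma>+1)) of the gauge. Unlike \<rho> it is differentiable
  everywhere, including the origin, and \<open>gauge_S'\<close> is its derivative applied to
  \<open>v\<close>.\<close>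

definition gauge_S :: "real \<Rightarrow> (real^'m::finite) \<times> (real^'k::finite) \<Rightarrow> real" where
  "gauge_S \<gamma> p = norm (fst p) powr (2 * (\<gamma> + 1)) + (\<gamma> + 1)\<^sup>2 * (norm (snd p))\<^sup>2"

definition gauge_S' :: "real \<Rightarrow> (real^'m::finite) \<times> (real^'k::finite) \<Rightarrow> (real^'m) \<times> (real^'k) \<Rightarrow> real" where
  "gauge_S' \<gamma> p v = 2 * (\<gamma> + 1) * (norm (fst p) powr (2 * \<gamma>) * (fst p \<bullet> fst v) + (\<gamma> + 1) * (snd p \<bullet> snd v))"

definition xdir :: "'m + 'k \<Rightarrow> (real^'m::finite) \<times> (real^'k::finite)" where
  "xdir i = (case i of Inl a \<Rightarrow> (axis a 1, 0) | Inr b \<Rightarrow> (0, axis b 1))"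

definition xcoef :: "real \<Rightarrow> 'm + 'k \<Rightarrow> (real^'m::finite) \<times> (real^'k::finite) \<Rightarrow> real" where
  "xcoef \<gamma> i p = (case i of Inl a \<Rightarrow> 1 | Inr b \<Rightarrow> norm (fst p) powr \<gamma>)"

text \<open>The coefficients in Z = \<Sum> zcoef_i X_i. For the t-directions they are singular at z
  = 0, where the X_i do not span; \<open>zvec\<close> is the same field without this
  singularity.\<close>

definition zcoef :: "real \<Rightarrow> 'm + 'k \<Rightarrow> (real^'m::finite) \<times> (real^'k::finite) \<Rightarrow> real" where
  "zcoef \<gamma> i p = (case i of Inl a \<Rightarrow> fst p $ a | Inr b \<Rightarrow> (\<gamma> + 1) * snd p $ b / norm (fst p) powr \<gamma>)"

definition zvec :: "real \<Rightarrow> (real^'m::finite) \<times> (real^'k::finite) \<Rightarrow> (real^'m) \<times> (real^'k)" where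
  "zvec \<gamma> p = (fst p, (\<gamma> + 1) *\<^sub>R snd p)"

lemma Xv_eq: "Xv \<gamma> i u p = xcoef \<gamma> i p * partial (xdir i) u p"
  by (simp add: Xv_def xcoef_def xdir_def split: sum.split)

lemma xdir_Basis: "xdir i \<in> Basis"
  by (auto simp: xdir_def Basis_prod_def axis_in_Basis_iff split: sum.split)

text \<open>The coefficient of X_i does not vary in the direction that X_i differentiates. Hence X_i
  X_i is a coefficient squared times a pure second derivative, and X_i is formally
  skew-adjoint.\<close>

lemma xcoef_shift [simp]: "xcoef \<gamma> i (p + h *\<^sub>R xdir i) = xcoef \<gamma> i p"
  by (auto simp: xcoef_def xdir_def split: sum.split)

lemma continuous_on_xcoef: "\<gamma> > 0 \<Longrightarrow> continuous_on S (xcoef \<gamma> i)"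
  unfolding xcoef_def by (cases i) (auto intro!: continuous_intros continuous_on_powr')

lemma norm_fst_measurable [measurable]:
  "(\<lambda>p::(real^'m::finite) \<times> (real^'k::finite). norm (fst p)) \<in> borel_measurable borel"
  "(\<lambda>p::(real^'m::finite) \<times> (real^'k::finite). norm (snd p)) \<in> borel_measurable borel"
  by (auto intro!: borel_measurable_continuous_onI continuous_intros)

lemma xcoef_meas [measurable]: "xcoef \<gamma> i \<in> borel_measurable borel"
  unfolding xcoef_def by (cases i) simp_all

lemma zcoef_meas [measurable]:
  "zcoef \<gamma> i \<in> borel_measurable (borel :: ((real^'a::finite) \<times> (real^'b::finite)) measure)"
proof -
  have "(\<lambda>p::(real^'a) \<times> (real^'b). fst p $ a) \<in> borel_measurable borel"
    "(\<lambda>p::(real^'a) \<times> (real^'b). snd p $ b) \<in> borel_measurable borel" for a b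
    by (auto intro!: borel_measurable_continuous_onI continuous_intros)
  then show ?thesis unfolding zcoef_def by (cases i) simp_all
qed

lemma sum_xdir: "(\<Sum>i\<in>UNIV. f i) = (\<Sum>a\<in>UNIV. f (Inl a)) + (\<Sum>b\<in>UNIV. f (Inr b))"
  for f :: "'m::finite + 'k::finite \<Rightarrow> 'a::comm_monoid_add"
  unfolding UNIV_sum by (subst sum.union_disjoint) (auto simp: sum.reindex)

text \<open>At z = 0 the difference quotient is bounded by a power of the norm with exponent c - 1 >
  0, so the derivative is 0, in agreement with the formula.\<close>

lemma has_derivative_norm_powr:
  fixes z :: "'a::euclidean_space"
  assumes c: "c > 1"
  shows "((\<lambda>z. norm z powr c) has_derivative (\<lambda>v. c * norm z powr (c - 2) * (z \<bullet> v))) (at z)"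
proof (cases "z = 0")
  case True
  have "((\<lambda>h::'a. norm h powr (c - 1)) \<longlongrightarrow> 0) (at 0)"
    by (rule tendsto_zero_powrI[where b="c - 1"]) (use c in \<open>auto intro!: tendsto_norm_zero\<close>)
  moreover have "norm h powr (c - 1) = norm h powr c / norm h" for h :: 'a
    by (cases "h = 0") (simp_all add: powr_diff)
  ultimately have "((\<lambda>h::'a. norm h powr c / norm h) \<longlongrightarrow> 0) (at 0)" by simp
  then show ?thesis unfolding True has_derivative_at by simp
next
  case False
  have "((\<lambda>z. norm z powr c) has_derivative (\<lambda>v. (norm z powr c) * (0 * ln (norm z) + (v \<bullet> sgn z) * c / norm z))) (at z)"
    using False by (intro has_derivative_powr has_derivative_norm has_derivative_const) auto
  moreover have "(norm z powr c) * (0 * ln (norm z) + (v \<bullet> sgn z) * c / norm z) = c * norm z powr (c - 2) * (z \<bullet> v)" for v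
    using False by (simp add: powr_diff sgn_div_norm inner_commute power2_eq_square field_simps)
  ultimately show ?thesis by (simp only:)
qed

lemma gauge_S_has_derivative:
  assumes "\<gamma> > 0"
  shows "(gauge_S \<gamma> has_derivative gauge_S' \<gamma> p) (at p)"
proof -
  have 1: "((\<lambda>p. norm (fst p) powr (2 * (\<gamma> + 1))) has_derivative
      (\<lambda>v. 2 * (\<gamma> + 1) * norm (fst p) powr (2 * (\<gamma> + 1) - 2) * (fst p \<bullet> fst v))) (at p)"
    using assms
    by (intro has_derivative_compose[OF has_derivative_fst[OF has_derivative_ident] has_derivative_norm_powr, simplified]) auto
  have 2: "((\<lambda>p. (\<gamma> + 1)\<^sup>2 * (snd p \<bullet> snd p)) has_derivative (\<lambda>v. (\<gamma> + 1)\<^sup>2 * (snd p \<bullet> snd v + snd v \<bullet> snd p))) (at p)"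
    by (auto intro!: derivative_eq_intros)
  show ?thesis
    unfolding gauge_S_def[abs_def] gauge_S'_def[abs_def] power2_norm_eq_inner
    by (rule has_derivative_eq_rhs[OF has_derivative_add[OF 1 2]])
      (simp add: fun_eq_iff inner_commute power2_eq_square algebra_simps)
qed

lemma continuous_on_gauge_S: "\<gamma> > 0 \<Longrightarrow> continuous_on A (gauge_S \<gamma>)"
  by (intro continuous_at_imp_continuous_on ballI has_derivative_continuous[OF gauge_S_has_derivative])

lemma continuous_on_gauge_S': "\<gamma> > 0 \<Longrightarrow> continuous_on A (\<lambda>p. gauge_S' \<gamma> p v)"
  unfolding gauge_S'_def by (intro continuous_intros continuous_on_powr') auto

lemma gauge_S_nonneg: "gauge_S \<gamma> p \<ge> 0"
  by (simp add: gauge_S_def)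

lemma gauge_S_pos: assumes "\<gamma> > 0" "p \<noteq> 0" shows "gauge_S \<gamma> p > 0"
proof (cases "fst p = 0")
  case True
  with assms(2) have "snd p \<noteq> 0" by (auto simp: prod_eq_iff)
  with assms(1) have "0 < (\<gamma> + 1)\<^sup>2 * (norm (snd p))\<^sup>2" by simp
  then show ?thesis unfolding gauge_S_def by (smt (verit) powr_ge_zero)
next
  case False
  then have "norm (fst p) powr (2 * (\<gamma> + 1)) > 0" by simp
  then show ?thesis unfolding gauge_S_def by (smt (verit) mult_nonneg_nonneg zero_le_power2)
qed

lemma gauge_S_zero [simp]: "gauge_S \<gamma> 0 = 0"
  by (simp add: gauge_S_def)

lemma gauge_rho_S: "gauge_rho \<gamma> p = gauge_S \<gamma> p powr (1 / (2 * (\<gamma> + 1)))"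
  by (simp add: gauge_rho_def gauge_S_def)

lemma gauge_rho_nonneg [simp]: "gauge_rho \<gamma> p \<ge> 0"
  by (simp add: gauge_rho_S)

lemma gauge_rho_pos: "\<gamma> > 0 \<Longrightarrow> p \<noteq> 0 \<Longrightarrow> gauge_rho \<gamma> p > 0"
  using gauge_S_pos[of \<gamma> p] by (simp add: gauge_rho_S)

lemma gauge_rho_zero [simp]: "gauge_rho \<gamma> 0 = 0"
  by (simp add: gauge_rho_S)

lemma gauge_S_rho: "\<gamma> > 0 \<Longrightarrow> gauge_S \<gamma> p = gauge_rho \<gamma> p powr (2 * (\<gamma> + 1))"
  using gauge_S_nonneg[of \<gamma> p] by (cases "gauge_S \<gamma> p = 0") (simp_all add: gauge_rho_S powr_powr)

lemma continuous_on_gauge_rho: "\<gamma> > 0 \<Longrightarrow> continuous_on A (gauge_rho \<gamma>)"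
  unfolding gauge_rho_S[abs_def]
  by (intro continuous_on_powr' continuous_on_gauge_S continuous_intros) (auto simp: gauge_S_nonneg)

lemma gauge_S_measurable [measurable]: "gauge_S \<gamma> \<in> borel_measurable borel"
  unfolding gauge_S_def[abs_def] by measurable

lemma gauge_rho_measurable [measurable]: "gauge_rho \<gamma> \<in> borel_measurable borel"
  unfolding gauge_rho_S[abs_def] by simp

lemma angle_fun_measurable [measurable]: "angle_fun \<gamma> \<in> borel_measurable borel"
  unfolding angle_fun_def[abs_def] by measurable

lemma gauge_S_dil: "gauge_S \<gamma> (dil \<gamma> y p) = exp (2 * (\<gamma> + 1) * y) * gauge_S \<gamma> p"
proof -
  have "exp y powr (2 * (\<gamma> + 1)) = exp (2 * (\<gamma> + 1) * y)" by (simp add: powr_def)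
  moreover have "(exp ((\<gamma> + 1) * y))\<^sup>2 = exp (2 * (\<gamma> + 1) * y)" by (simp add: exp_double[symmetric] algebra_simps)
  ultimately show ?thesis
    by (simp add: gauge_S_def dil_def powr_mult power_mult_distrib distrib_left mult_ac)
qed

lemma gauge_rho_dil: "\<gamma> > 0 \<Longrightarrow> gauge_rho \<gamma> (dil \<gamma> y p) = exp y * gauge_rho \<gamma> p"
  by (simp add: gauge_rho_S gauge_S_dil powr_mult gauge_S_nonneg powr_def[of "exp _"])

lemma angle_fun_dil: "\<gamma> > 0 \<Longrightarrow> angle_fun \<gamma> (dil \<gamma> y p) = angle_fun \<gamma> p"
  by (simp add: angle_fun_def gauge_rho_dil powr_mult) (simp add: dil_def powr_mult)

lemma angle_fun_nonneg [simp]: "0 \<le> angle_fun \<gamma> p"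
  by (simp add: angle_fun_def)

lemma norm_fst_le_rho: assumes "\<gamma> > 0" shows "norm (fst p) \<le> gauge_rho \<gamma> p"
proof -
  have "norm (fst p) = (norm (fst p) powr (2 * (\<gamma> + 1))) powr (1 / (2 * (\<gamma> + 1)))"
    using assms by (simp add: powr_powr)
  also have "\<dots> \<le> gauge_S \<gamma> p powr (1 / (2 * (\<gamma> + 1)))"
    unfolding gauge_S_def using assms by (intro powr_mono2) simp_all
  finally show ?thesis by (simp add: gauge_rho_S)
qed

lemma angle_fun_le_1: assumes "\<gamma> > 0" shows "angle_fun \<gamma> p \<le> 1"
proof -
  have "norm (fst p) powr (2 * \<gamma>) \<le> gauge_rho \<gamma> p powr (2 * \<gamma>)"
    using assms by (intro powr_mono2[OF _ _ norm_fst_le_rho]) simp_all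
  then show ?thesis by (simp add: angle_fun_def divide_le_eq_1)
qed

lemma norm_snd_le_rho: assumes "\<gamma> > 0" shows "norm (snd p) \<le> gauge_rho \<gamma> p powr (\<gamma> + 1)"
proof (rule power2_le_imp_le)
  have "(norm (snd p))\<^sup>2 \<le> (\<gamma> + 1)\<^sup>2 * (norm (snd p))\<^sup>2"
    using assms mult_right_mono[of 1 "(\<gamma> + 1)\<^sup>2" "(norm (snd p))\<^sup>2"] by (simp add: one_le_power)
  also have "\<dots> \<le> gauge_S \<gamma> p" by (simp add: gauge_S_def)
  also have "\<dots> = (gauge_rho \<gamma> p powr (\<gamma> + 1))\<^sup>2"
    by (simp add: gauge_S_rho[OF assms] powr_powr power2_eq_square powr_add[symmetric])
  finally show "(norm (snd p))\<^sup>2 \<le> (gauge_rho \<gamma> p powr (\<gamma> + 1))\<^sup>2" .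
qed simp

lemma norm_le_rho:
  assumes "\<gamma> > 0" "gauge_rho \<gamma> p \<le> r" shows "norm p \<le> r + r powr (\<gamma> + 1)"
proof -
  have r: "0 \<le> r" using order_trans[OF gauge_rho_nonneg assms(2)] .
  have "norm p \<le> norm (fst p) + norm (snd p)"
    using norm_Pair_le[of "fst p" "snd p"] by simp
  also have "\<dots> \<le> r + r powr (\<gamma> + 1)"
    using norm_fst_le_rho[OF assms(1), of p] norm_snd_le_rho[OF assms(1), of p] assms
      powr_mono2[of "\<gamma> + 1" "gauge_rho \<gamma> p" r] by (intro add_mono) auto
  finally show ?thesis .
qed

section \<open>Directional derivatives and integration by parts\<close>

lemma partial_eq:
  assumes "(w has_derivative D) (at p)" shows "partial v w p = D v"
    and "((\<lambda>h. w (p + h *\<^sub>R v)) has_real_derivative D v) (at 0)"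
proof -
  have "((\<lambda>h. p + h *\<^sub>R v) has_derivative (\<lambda>h. h *\<^sub>R v)) (at 0)"
    by (auto intro!: derivative_eq_intros)
  from has_derivative_compose[OF this, of w D] assms
  have "((\<lambda>h. w (p + h *\<^sub>R v)) has_derivative (\<lambda>h. D (h *\<^sub>R v))) (at 0)" by simp
  moreover have "linear D" using assms by (rule has_derivative_linear)
  ultimately show "((\<lambda>h. w (p + h *\<^sub>R v)) has_real_derivative D v) (at 0)"
    by (simp add: has_field_derivative_def linear_cmul mult.commute[of _ "D v"] ext)
  then show "partial v w p = D v" unfolding partial_def by (rule DERIV_imp_deriv)
qed

text \<open>Differentiability along the single direction \<open>v\<close>, at every point. For
  \<open>v = xdir i\<close> this class is stable under multiplication by
  \<open>xcoef \<gamma> i\<close>, which for small \<gamma> is not differentiable in all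
  directions.\<close>

definition has_dd :: "'a::euclidean_space \<Rightarrow> ('a \<Rightarrow> real) \<Rightarrow> ('a \<Rightarrow> real) \<Rightarrow> bool" where
  "has_dd v w w' \<longleftrightarrow> (\<forall>p. ((\<lambda>h. w (p + h *\<^sub>R v)) has_real_derivative w' p) (at 0))"

lemma has_dd_partial: "has_dd v w w' \<Longrightarrow> partial v w p = w' p"
  unfolding has_dd_def partial_def by (blast intro: DERIV_imp_deriv)

lemma has_dd_derivative: "(\<And>p. (w has_derivative D p) (at p)) \<Longrightarrow> has_dd v w (\<lambda>p. D p v)"
  unfolding has_dd_def using partial_eq(2) by blast

lemma has_dd_mult: "has_dd v w w' \<Longrightarrow> has_dd v x x' \<Longrightarrow> has_dd v (\<lambda>p. w p * x p) (\<lambda>p. w' p * x p + w p * x' p)"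
  unfolding has_dd_def by (auto intro!: derivative_eq_intros)

lemma has_dd_const_mult: "(\<And>p h. c (p + h *\<^sub>R v) = c p) \<Longrightarrow> has_dd v w w' \<Longrightarrow> has_dd v (\<lambda>p. c p * w p) (\<lambda>p. c p * w' p)"
  unfolding has_dd_def by (auto intro!: derivative_eq_intros)

lemma has_dd_at:
  assumes "has_dd v w w'"
  shows "((\<lambda>h. w (p + h *\<^sub>R v)) has_real_derivative w' (p + s *\<^sub>R v)) (at s)"
proof -
  have "((\<lambda>h. w (p + s *\<^sub>R v + h *\<^sub>R v)) has_real_derivative w' (p + s *\<^sub>R v)) (at 0)"
    using assms by (simp add: has_dd_def)
  then show ?thesis by (simp add: DERIV_def algebra_simps)
qed

lemma integrable_indicator_compact:
  fixes K :: "'a::euclidean_space set"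
  assumes "compact K" shows "integrable lborel (indicat_real K)"
  using emeasure_bounded_finite[OF compact_imp_bounded[OF assms]] assms
  by (intro integrable_real_indicator) (simp_all add: compact_imp_closed)

text \<open>By translation invariance the difference quotients along \<open>v\<close> have integral
  0. They are bounded by \<open>C\<close> and live in the compact set \<open>K'\<close> swept out by
  \<open>K\<close> along segments of length at most one step of \<open>v\<close>, so dominated
  convergence applies.\<close>

lemma integral_dd_zero:
  fixes w :: "'a::euclidean_space \<Rightarrow> real"
  assumes dd: "has_dd v w w'" and w [measurable]: "w \<in> borel_measurable borel" "w' \<in> borel_measurable borel"
    and bd: "\<And>p. \<bar>w p\<bar> \<le> C" "\<And>p. \<bar>w' p\<bar> \<le> C"
    and K: "compact K" "\<And>p. p \<notin> K \<Longrightarrow> w p = 0"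
  shows "(\<integral>p. w' p \<partial>lborel) = 0"
proof -
  define K' where "K' = (\<lambda>x. fst x - snd x *\<^sub>R v) ` (K \<times> {0..1})"
  have K': "compact K'" unfolding K'_def
    by (intro compact_continuous_image continuous_intros compact_Times K) auto
  have in_K': "p \<in> K'" if "p + s *\<^sub>R v \<in> K" "0 \<le> s" "s \<le> 1" for p s
    unfolding K'_def using that by (intro image_eqI[of _ _ "(p + s *\<^sub>R v, s)"]) auto
  have C: "0 \<le> C" using order_trans[OF abs_ge_zero bd(1)] .
  define D where "D n p = (w (p + (1 / real (Suc n)) *\<^sub>R v) - w p) / (1 / real (Suc n))" for n p
  have iw: "integrable lborel w"
  proof (rule Bochner_Integration.integrable_bound)
    show "integrable lborel (\<lambda>p. C * indicator K p)"
      by (intro integrable_mult_right integrable_indicator_compact K)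
    show "AE p in lborel. norm (w p) \<le> norm (C * indicator K p)"
      using bd(1) K(2) C by (auto intro!: always_eventually split: split_indicator)
  qed simp
  have tr: "(\<integral>p. w (p + c) \<partial>lborel) = (\<integral>p. w p \<partial>lborel)" "integrable lborel (\<lambda>p. w (p + c))" for c
  proof -
    have "(\<integral>p. w p \<partial>lborel) = (\<integral>p. w p \<partial>distr lborel borel ((+) c))" by (simp add: lborel_distr_plus)
    also have "\<dots> = (\<integral>p. w (c + p) \<partial>lborel)" by (rule integral_distr) simp_all
    finally show "(\<integral>p. w (p + c) \<partial>lborel) = (\<integral>p. w p \<partial>lborel)" by (simp add: add.commute)
    have "integrable (distr lborel borel ((+) c)) w" using iw by (simp add: lborel_distr_plus)
    then show "integrable lborel (\<lambda>p. w (p + c))" by (subst (asm) integrable_distr_eq) (simp_all add: add.commute)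
  qed
  have D0: "(\<integral>p. D n p \<partial>lborel) = 0" for n
    unfolding D_def using tr iw by simp
  have "(\<lambda>n. \<integral>p. D n p \<partial>lborel) \<longlonglongrightarrow> (\<integral>p. w' p \<partial>lborel)"
  proof (rule integral_dominated_convergence[where w="\<lambda>p. C * indicator K' p"])
    show "integrable lborel (\<lambda>p. C * indicator K' p)"
      by (intro integrable_mult_right integrable_indicator_compact K')
    show "D n \<in> borel_measurable lborel" for n unfolding D_def by simp
    show "AE p in lborel. (\<lambda>n. D n p) \<longlonglongrightarrow> w' p"
    proof (intro always_eventually allI)
      fix p
      have "(\<lambda>h. (w (p + h *\<^sub>R v) - w p) / h) \<midarrow>0\<rightarrow> w' p"
        using dd unfolding has_dd_def DERIV_def by simp
      moreover have "filterlim (\<lambda>n. 1 / real (Suc n)) (at 0) sequentially"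
        unfolding filterlim_at using LIMSEQ_inverse_real_of_nat by (simp add: inverse_eq_divide)
      ultimately show "(\<lambda>n. D n p) \<longlonglongrightarrow> w' p"
        unfolding D_def by (rule filterlim_compose)
    qed
    show "AE p in lborel. norm (D n p) \<le> C * indicator K' p" for n
    proof (intro always_eventually allI)
      fix p
      define h where "h = 1 / real (Suc n)"
      have h: "0 < h" "h \<le> 1" by (simp_all add: h_def)
      show "norm (D n p) \<le> C * indicator K' p"
      proof (cases "p \<in> K'")
        case True
        have "norm (w (p + h *\<^sub>R v) - w (p + 0 *\<^sub>R v)) \<le> C * norm (h - 0)"
          by (rule field_differentiable_bound[of UNIV "\<lambda>s. w (p + s *\<^sub>R v)" "\<lambda>s. w' (p + s *\<^sub>R v)"])
            (use has_dd_at[OF dd] bd in auto)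
        then show ?thesis using True h unfolding D_def h_def[symmetric] by (simp add: abs_divide divide_le_eq)
      next
        case False
        then have "p + h *\<^sub>R v \<notin> K" "p + 0 *\<^sub>R v \<notin> K" using in_K'[of p h] in_K'[of p 0] h by auto
        then show ?thesis using K(2) False unfolding D_def h_def[symmetric] by simp
      qed
    qed
  qed simp
  then show ?thesis unfolding D0 by (simp add: LIMSEQ_const_iff)
qed

section \<open>Weak limits\<close>

lemma continuous_bounded_compact:
  fixes f :: "'a::topological_space \<Rightarrow> real"
  assumes "compact K" "continuous_on K f" obtains C where "0 \<le> C" "\<And>p. p \<in> K \<Longrightarrow> \<bar>f p\<bar> \<le> C"
proof -
  have "bounded (f ` K)" using assms by (intro compact_imp_bounded compact_continuous_image)
  then obtain C where "\<And>p. p \<in> K \<Longrightarrow> \<bar>f p\<bar> \<le> C" unfolding bounded_iff by auto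
  then show ?thesis by (intro that[of "max C 0"]) (auto simp: max.coboundedI1)
qed

lemma sqint_bounded_compact:
  fixes w :: "'a::euclidean_space \<Rightarrow> real"
  assumes w: "w \<in> borel_measurable borel" "\<And>p. \<bar>w p\<bar> \<le> C" and K: "compact K" "\<And>p. p \<notin> K \<Longrightarrow> w p = 0"
  shows "sqint lborel w"
proof -
  have "sqint lborel (indicat_real K)"
    using integrable_indicator_compact[OF K(1)] K(1)
    by (simp add: sqint_def power2_eq_square indicator_inter_arith[symmetric] compact_imp_closed)
  then have "sqint lborel (\<lambda>p. w p * indicat_real K p)"
    by (rule sqint_bounded_mult) (use w in auto)
  also have "(\<lambda>p. w p * indicat_real K p) = w"
    using K(2) by (auto simp: fun_eq_iff split: split_indicator)
  finally show ?thesis .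
qed

lemma sqint_continuous_compact:
  fixes w :: "'a::euclidean_space \<Rightarrow> real"
  assumes w: "continuous_on UNIV w" and K: "compact K" "\<And>p. p \<notin> K \<Longrightarrow> w p = 0"
  shows "sqint lborel w"
proof -
  obtain C where "0 \<le> C" "\<And>p. p \<in> K \<Longrightarrow> \<bar>w p\<bar> \<le> C"
    using continuous_bounded_compact[OF K(1) continuous_on_subset[OF w]] by auto
  then have "\<bar>w p\<bar> \<le> C" for p using K(2)[of p] by (cases "p \<in> K") auto
  then show ?thesis using w K by (intro sqint_bounded_compact) (auto intro: borel_measurable_continuous_onI)
qed

text \<open>The derivative of the product of c \<phi> and w has integral 0, and \<open>c\<close>
  behaves like a constant because it does not vary along \<open>v\<close>.\<close>

lemma dd_ibp:
  fixes \<phi> :: "'a::euclidean_space \<Rightarrow> real"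
  assumes c: "continuous_on UNIV c" "\<And>p h. c (p + h *\<^sub>R v) = c p"
    and \<phi>: "has_dd v \<phi> \<phi>'" "continuous_on UNIV \<phi>" "continuous_on UNIV \<phi>'"
    and K: "compact K" "\<And>p. p \<notin> K \<Longrightarrow> \<phi> p = 0" "\<And>p. p \<notin> K \<Longrightarrow> \<phi>' p = 0"
    and w: "has_dd v w w'" "w \<in> borel_measurable borel" "w' \<in> borel_measurable borel"
      "\<And>p. \<bar>w p\<bar> \<le> B" "\<And>p. \<bar>w' p\<bar> \<le> B"
  shows "(\<integral>p. (c p * \<phi>' p) * w p \<partial>lborel) = - (\<integral>p. \<phi> p * (c p * w' p) \<partial>lborel)"
proof -
  have B: "0 \<le> B" using order_trans[OF abs_ge_zero w(4)] .
  have *: "\<exists>C\<ge>0. \<forall>p. \<bar>c p * \<psi> p\<bar> \<le> C" if "continuous_on UNIV \<psi>" "\<And>p. p \<notin> K \<Longrightarrow> \<psi> p = 0" for \<psi>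
  proof -
    have "continuous_on K (\<lambda>p. c p * \<psi> p)" using c(1) that(1) by (intro continuous_on_mult) (auto intro: continuous_on_subset)
    from continuous_bounded_compact[OF K(1) this] obtain C where "0 \<le> C" "\<And>p. p \<in> K \<Longrightarrow> \<bar>c p * \<psi> p\<bar> \<le> C" by blast
    then show ?thesis using that(2) by (intro exI[of _ C]) (metis abs_zero mult_zero_right)
  qed
  obtain C1 C2 where C: "0 \<le> C1" "\<And>p. \<bar>c p * \<phi> p\<bar> \<le> C1" "0 \<le> C2" "\<And>p. \<bar>c p * \<phi>' p\<bar> \<le> C2"
    using *[OF \<phi>(2) K(2)] *[OF \<phi>(3) K(3)] by metis
  have [measurable]: "c \<in> borel_measurable borel" "\<phi> \<in> borel_measurable borel" "\<phi>' \<in> borel_measurable borel"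
      "w \<in> borel_measurable borel" "w' \<in> borel_measurable borel"
    using c \<phi> w by (auto intro: borel_measurable_continuous_onI)
  define f1 f2 where "f1 p = (c p * \<phi>' p) * w p" and "f2 p = (c p * \<phi> p) * w' p" for p
  have b1: "\<bar>f1 p\<bar> \<le> C2 * B" and b2: "\<bar>f2 p\<bar> \<le> C1 * B" and b3: "\<bar>(c p * \<phi> p) * w p\<bar> \<le> C1 * B" for p
    unfolding f1_def f2_def using C w(4,5) B by (auto simp only: abs_mult[of "_ * _"] intro!: mult_mono)
  have [measurable]: "f1 \<in> borel_measurable borel" "f2 \<in> borel_measurable borel" unfolding f1_def[abs_def] f2_def[abs_def] by measurable
  have ii: "integrable lborel f" if f: "f \<in> borel_measurable borel" "\<And>p. \<bar>f p\<bar> \<le> D" "\<And>p. p \<notin> K \<Longrightarrow> f p = 0" for f :: "'a \<Rightarrow> real" and D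
  proof (rule Bochner_Integration.integrable_bound)
    show "integrable lborel (\<lambda>p. D * indicat_real K p)" by (intro integrable_mult_right integrable_indicator_compact K)
    show "AE p in lborel. norm (f p) \<le> norm (D * indicat_real K p)"
      using f(2,3) order_trans[OF abs_ge_zero f(2)] by (intro always_eventually allI) (auto split: split_indicator)
  qed (use f in simp)
  have i: "integrable lborel f1" "integrable lborel f2"
    by (rule ii[where D="C2 * B"], simp, rule b1, simp add: f1_def K) (rule ii[where D="C1 * B"], simp, rule b2, simp add: f2_def K)
  have "has_dd v (\<lambda>p. (c p * \<phi> p) * w p) (\<lambda>p. (c p * \<phi>' p) * w p + (c p * \<phi> p) * w' p)"
    by (intro has_dd_mult has_dd_const_mult c \<phi> w)
  then have "has_dd v (\<lambda>p. (c p * \<phi> p) * w p) (\<lambda>p. f1 p + f2 p)" by (simp add: f1_def f2_def)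
  then have "(\<integral>p. f1 p + f2 p \<partial>lborel) = 0"
  proof (rule integral_dd_zero[where C="C1 * B + C2 * B" and K=K])
    have "0 \<le> C1 * B" "0 \<le> C2 * B" using C B by auto
    then show "\<bar>(c p * \<phi> p) * w p\<bar> \<le> C1 * B + C2 * B" "\<bar>f1 p + f2 p\<bar> \<le> C1 * B + C2 * B" for p
      using b1[of p] b2[of p] b3[of p] by linarith+
  qed (use K in auto)
  then have "(\<integral>p. f1 p \<partial>lborel) + (\<integral>p. f2 p \<partial>lborel) = 0" using i by simp
  then show ?thesis unfolding f1_def f2_def by (simp add: mult_ac add_eq_0_iff2)
qed

text \<open>Integration by parts for the smooth members of the sequence, then passage to the limit:
  both test factors \<open>w\<close> and \<open>c w'\<close> are fixed elements of L2, so weak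
  convergence is enough. The compact sets \<open>K n\<close> may grow with \<open>n\<close>.\<close>

lemma weak_limit:
  fixes f g :: "'a::euclidean_space \<Rightarrow> real"
  assumes L: "L2conv lborel \<phi> f" "L2conv lborel (\<lambda>n p. c p * \<phi>' n p) g"
    and c: "continuous_on UNIV c" "\<And>p h. c (p + h *\<^sub>R v) = c p"
    and \<phi>: "\<And>n. has_dd v (\<phi> n) (\<phi>' n)" "\<And>n. continuous_on UNIV (\<phi> n)" "\<And>n. continuous_on UNIV (\<phi>' n)"
    and K: "\<And>n. compact (K n)" "\<And>n p. p \<notin> K n \<Longrightarrow> \<phi> n p = 0" "\<And>n p. p \<notin> K n \<Longrightarrow> \<phi>' n p = 0"
    and w: "has_dd v w w'" "w \<in> borel_measurable borel" "w' \<in> borel_measurable borel"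
      "\<And>p. \<bar>w p\<bar> \<le> B" "\<And>p. \<bar>w' p\<bar> \<le> B" "compact K'" "\<And>p. p \<notin> K' \<Longrightarrow> w p = 0" "\<And>p. p \<notin> K' \<Longrightarrow> w' p = 0"
  shows "(\<integral>p. g p * w p \<partial>lborel) = - (\<integral>p. f p * (c p * w' p) \<partial>lborel)"
proof (rule LIMSEQ_unique)
  have sw: "sqint lborel w" using w by (intro sqint_bounded_compact[where K=K']) auto
  have scw: "sqint lborel (\<lambda>p. c p * w' p)"
  proof -
    obtain C where C: "0 \<le> C" "\<And>p. p \<in> K' \<Longrightarrow> \<bar>c p\<bar> \<le> C"
      using continuous_bounded_compact[OF w(6) continuous_on_subset[OF c(1)]] by auto
    show ?thesis
    proof (rule sqint_bounded_compact[OF _ _ w(6)])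
      show "(\<lambda>p. c p * w' p) \<in> borel_measurable borel"
        by (intro borel_measurable_times borel_measurable_continuous_onI[OF c(1)] w(3))
      show "\<bar>c p * w' p\<bar> \<le> C * B" for p
        using w(8)[of p] mult_mono[OF C(2) w(5) C(1)] order_trans[OF abs_ge_zero w(5)] C(1)
        by (cases "p \<in> K'") (auto simp: abs_mult)
    qed (simp add: w)
  qed
  show "(\<lambda>n. \<integral>p. w p * (c p * \<phi>' n p) \<partial>lborel) \<longlonglongrightarrow> (\<integral>p. g p * w p \<partial>lborel)"
    using L2conv_integral_mult[OF L(2) sw] by (simp add: mult.commute)
  have "(\<integral>p. w p * (c p * \<phi>' n p) \<partial>lborel) = - (\<integral>p. (c p * w' p) * \<phi> n p \<partial>lborel)" for n
    using dd_ibp[OF c \<phi> K w(1-5), of n] by (simp add: mult_ac)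
  then show "(\<lambda>n. \<integral>p. w p * (c p * \<phi>' n p) \<partial>lborel) \<longlonglongrightarrow> - (\<integral>p. f p * (c p * w' p) \<partial>lborel)"
    using tendsto_minus[OF L2conv_integral_mult[OF L(1) scw]] by (simp add: mult.commute)
qed

section \<open>Test functions, representatives, supports and cutoffs\<close>

lemma foldr_partial_zero:
  assumes p: "p \<notin> closure {p. u p \<noteq> 0}" shows "foldr partial es u p = 0"
  using p
proof (induction es arbitrary: p)
  case Nil
  then show ?case using closure_subset[of "{p. u p \<noteq> 0}"] by auto
next
  case (Cons e es)
  let ?O = "- closure {p. u p \<noteq> 0}"
  have o: "open ?O" by auto
  have "isCont (\<lambda>h. p + h *\<^sub>R e) 0" by (intro continuous_intros)
  then have "((\<lambda>h. p + h *\<^sub>R e) \<longlongrightarrow> p) (nhds 0)"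
    by (simp add: continuous_within tendsto_nhds_iff)
  then have "\<forall>\<^sub>F h in nhds 0. p + h *\<^sub>R e \<in> ?O"
    using o Cons.prems by (auto dest: topological_tendstoD)
  then have ev: "\<forall>\<^sub>F h in nhds 0. foldr partial es u (p + h *\<^sub>R e) = 0"
    by eventually_elim (use Cons.IH in auto)
  have "((\<lambda>h. foldr partial es u (p + h *\<^sub>R e)) has_real_derivative 0) (at 0)"
    by (rule iffD2[OF DERIV_cong_ev[OF refl ev refl]]) simp
  then have "partial e (foldr partial es u) p = 0"
    unfolding partial_def[of e "foldr partial es u"] by (rule DERIV_imp_deriv)
  then show ?case by simp
qed

lemma test_fun_partial:
  fixes u :: "'a::euclidean_space \<Rightarrow> real"
  assumes t: "test_fun \<Omega> u" and es: "set es \<subseteq> Basis" and v: "v \<in> Basis"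
  shows "continuous_on UNIV (foldr partial es u)" "has_dd v (foldr partial es u) (partial v (foldr partial es u))"
    "continuous_on UNIV (partial v (foldr partial es u))"
    "(foldr partial es u has_derivative frechet_derivative (foldr partial es u) (at p)) (at p)"
proof -
  have d: "foldr partial es u differentiable at p" if "set es \<subseteq> Basis" for p es
    using t that unfolding test_fun_def smooth_def differentiable_on_def by auto
  show "continuous_on UNIV (foldr partial es u)"
    using d[OF es] by (intro differentiable_imp_continuous_on) (simp add: differentiable_on_def)
  show *: "(foldr partial es u has_derivative frechet_derivative (foldr partial es u) (at p)) (at p)" for p
    using d[OF es] frechet_derivative_works by blast
  show "has_dd v (foldr partial es u) (partial v (foldr partial es u))"
  proof -
    have "partial v (foldr partial es u) = (\<lambda>p. frechet_derivative (foldr partial es u) (at p) v)"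
      by (rule ext) (rule partial_eq(1)[OF *])
    then show ?thesis using has_dd_derivative[OF *, of v] by simp
  qed
  have "continuous_on UNIV (foldr partial (v # es) u)"
    using d[of "v # es"] es v by (intro differentiable_imp_continuous_on) (simp add: differentiable_on_def)
  then show "continuous_on UNIV (partial v (foldr partial es u))" by simp
qed

lemma frechet_partial_basis:
  fixes w :: "'a::euclidean_space \<Rightarrow> real"
  assumes "(w has_derivative D) (at p)"
  shows "D v = (\<Sum>e\<in>Basis. (v \<bullet> e) * partial e w p)"
proof -
  have l: "linear D" using assms by (rule has_derivative_linear)
  have "D v = D (\<Sum>e\<in>Basis. (v \<bullet> e) *\<^sub>R e)" by (simp add: euclidean_representation)
  also have "\<dots> = (\<Sum>e\<in>Basis. (v \<bullet> e) * D e)" using l by (simp add: linear_sum linear_cmul)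
  finally show ?thesis using partial_eq(1)[OF assms] by simp
qed

text \<open>Replaces the Lebesgue measurable limit on \<Omega> by a Borel function on the whole
  space that is 0 off \<Omega>. Square integrability of the limit is deduced from that of one member
  \<open>fn N\<close> whose distance to it is finite.\<close>

lemma L2_representative:
  fixes f :: "'a::euclidean_space \<Rightarrow> real"
  assumes \<Omega>: "\<Omega> \<in> sets borel" and L: "L2_tendsto \<Omega> fn f"
    and fn: "\<And>n. fn n \<in> borel_measurable borel" "\<And>n p. p \<notin> \<Omega> \<Longrightarrow> fn n p = 0"
    and fin: "\<And>n. (\<integral>\<^sup>+p\<in>\<Omega>. ennreal ((fn n p)\<^sup>2) \<partial>lebesgue) < \<infinity>"
  shows "\<exists>f'. L2conv lborel fn f' \<and> (\<forall>p. p \<notin> \<Omega> \<longrightarrow> f' p = 0) \<and> (AE p in lebesgue. p \<in> \<Omega> \<longrightarrow> f' p = f p)"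
proof -
  have \<Omega>': "\<Omega> \<in> sets lebesgue" using \<Omega> by simp
  have fm: "f \<in> borel_measurable (lebesgue_on \<Omega>)" using L by (simp add: L2_tendsto_def)
  have "(\<lambda>p. indicator \<Omega> p *\<^sub>R f p) \<in> borel_measurable lebesgue"
    using fm \<Omega>' by (subst (asm) borel_measurable_restrict_space_iff) simp_all
  from completion_ex_borel_measurable_real[OF this] obtain f1 where f1: "f1 \<in> borel_measurable lborel"
    "AE p in lborel. indicator \<Omega> p *\<^sub>R f p = f1 p" by blast
  define f' where "f' p = indicator \<Omega> p * f1 p" for p
  have [measurable]: "f' \<in> borel_measurable borel" "\<And>n. fn n \<in> borel_measurable borel"
    unfolding f'_def using f1(1) \<Omega> fn by auto
  have AE': "AE p in lborel. p \<in> \<Omega> \<longrightarrow> f' p = f p"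
    using f1(2) by eventually_elim (auto simp: f'_def)
  then have ae: "AE p in lebesgue. p \<in> \<Omega> \<longrightarrow> f' p = f p" by (rule AE_completion)
  have eq: "(\<integral>\<^sup>+p\<in>\<Omega>. ennreal ((fn n p - f p)\<^sup>2) \<partial>lebesgue) = (\<integral>\<^sup>+p. ennreal ((fn n p - f' p)\<^sup>2) \<partial>lborel)" for n
  proof -
    have "(\<integral>\<^sup>+p\<in>\<Omega>. ennreal ((fn n p - f p)\<^sup>2) \<partial>lebesgue) = (\<integral>\<^sup>+p. ennreal ((fn n p - f' p)\<^sup>2) \<partial>lebesgue)"
      by (rule nn_integral_cong_AE) (use ae in \<open>eventually_elim, simp add: f'_def fn indicator_def\<close>)
    also have "\<dots> = (\<integral>\<^sup>+p. ennreal ((fn n p - f' p)\<^sup>2) \<partial>lborel)"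
      by (rule nn_integral_completion)
    finally show ?thesis .
  qed
  have eqn: "(\<integral>\<^sup>+p\<in>\<Omega>. ennreal ((fn n p)\<^sup>2) \<partial>lebesgue) = (\<integral>\<^sup>+p. ennreal ((fn n p)\<^sup>2) \<partial>lborel)" for n
  proof -
    have "(\<integral>\<^sup>+p\<in>\<Omega>. ennreal ((fn n p)\<^sup>2) \<partial>lebesgue) = (\<integral>\<^sup>+p. ennreal ((fn n p)\<^sup>2) \<partial>lebesgue)"
      by (rule nn_integral_cong) (auto simp: fn split: split_indicator)
    also have "\<dots> = (\<integral>\<^sup>+p. ennreal ((fn n p)\<^sup>2) \<partial>lborel)"
      by (rule nn_integral_completion)
    finally show ?thesis .
  qed
  have sfn: "sqint lborel (fn n)" for n
    unfolding sqint_def integrable_iff_bounded using fin[of n, unfolded eqn] by simp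
  have lim: "(\<lambda>n. \<integral>\<^sup>+p. ennreal ((fn n p - f' p)\<^sup>2) \<partial>lborel) \<longlonglongrightarrow> 0"
    using L unfolding L2_tendsto_def eq by simp
  then have "\<forall>\<^sub>F n in sequentially. (\<integral>\<^sup>+p. ennreal ((fn n p - f' p)\<^sup>2) \<partial>lborel) < \<infinity>"
    by (rule order_tendstoD) simp
  then obtain N where "(\<integral>\<^sup>+p. ennreal ((fn N p - f' p)\<^sup>2) \<partial>lborel) < \<infinity>"
    unfolding eventually_sequentially by blast
  then have "sqint lborel (\<lambda>p. fn N p - f' p)"
    unfolding sqint_def integrable_iff_bounded by simp
  from sqint_diff[OF sfn[of N] this] have sf: "sqint lborel f'" by simp
  have "(\<lambda>n. l2norm lborel (\<lambda>p. fn n p - f' p)) \<longlonglongrightarrow> 0"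
  proof -
    have "ennreal (\<integral>p. (fn n p - f' p)\<^sup>2 \<partial>lborel) = (\<integral>\<^sup>+p. ennreal ((fn n p - f' p)\<^sup>2) \<partial>lborel)" for n
      using sqint_diff[OF sfn[of n] sf] by (subst nn_integral_eq_integral) (auto simp: sqint_def)
    with lim have "(\<lambda>n. ennreal (\<integral>p. (fn n p - f' p)\<^sup>2 \<partial>lborel)) \<longlonglongrightarrow> ennreal 0" by simp
    then have "(\<lambda>n. \<integral>p. (fn n p - f' p)\<^sup>2 \<partial>lborel) \<longlonglongrightarrow> 0"
      by (rule tendsto_ennrealD) (auto intro!: always_eventually)
    from tendsto_real_sqrt[OF this] show ?thesis by (simp add: l2norm_def)
  qed
  with sfn sf have "L2conv lborel fn f'" by (simp add: L2conv_def)
  with ae show ?thesis by (intro exI[of _ f']) (auto simp: f'_def)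
qed

text \<open>The complement of the support is the union of all open sets on which \<open>u\<close>
  vanishes almost everywhere; by Lindelof countably many of them suffice, so the exceptional sets
  add up to a null set.\<close>

lemma ess_support_closed: "closed (ess_support \<Omega> u)"
  and AE_zero_off_ess_support: "AE y in lebesgue. y \<in> \<Omega> - ess_support \<Omega> u \<longrightarrow> u y = 0"
proof -
  define F where "F = {U. open U \<and> (AE y in lebesgue. y \<in> U \<inter> \<Omega> \<longrightarrow> u y = 0)}"
  have eq: "- ess_support \<Omega> u = \<Union>F" by (auto simp: ess_support_def F_def)
  have "open (\<Union>F)" by (auto simp: F_def)
  then show "closed (ess_support \<Omega> u)" by (simp add: closed_def eq)
  obtain F' where F': "F' \<subseteq> F" "countable F'" "\<Union>F' = \<Union>F"
    using Lindelof[of F] by (auto simp: F_def)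
  have "AE y in lebesgue. \<forall>U\<in>F'. y \<in> U \<inter> \<Omega> \<longrightarrow> u y = 0"
    using F' by (subst AE_ball_countable) (auto simp: F_def)
  then show "AE y in lebesgue. y \<in> \<Omega> - ess_support \<Omega> u \<longrightarrow> u y = 0"
  proof eventually_elim
    case (elim y)
    show ?case
    proof
      assume y: "y \<in> \<Omega> - ess_support \<Omega> u"
      then have "y \<in> \<Union>F'" unfolding F'(3) eq[symmetric] by simp
      then obtain U where "U \<in> F'" "y \<in> U" by (rule UnionE)
      with elim y show "u y = 0" by blast
    qed
  qed
qed

text \<open>The squared positive part, a C^1 function with C^1 vanishing on the negative half-line.
  Cutoffs of this regularity suffice, since only first derivatives fall on them.\<close>

definition pos2 :: "real \<Rightarrow> real" where "pos2 x = (max 0 x)\<^sup>2"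

lemma pos2_deriv: "(pos2 has_real_derivative 2 * max 0 x) (at x)"
proof -
  have "\<bar>pos2 y - pos2 x - 2 * max 0 x * (y - x)\<bar> \<le> (y - x)\<^sup>2" for y
  proof -
    consider "x \<le> 0" "y \<le> 0" | "x \<le> 0" "y > 0" | "x > 0" "y \<le> 0" | "x > 0" "y > 0" by linarith
    then show ?thesis
    proof cases
      case 2
      then have "y\<^sup>2 \<le> (y - x)\<^sup>2" by (intro power_mono) auto
      with 2 show ?thesis by (simp add: pos2_def)
    next
      case 3
      have "\<bar>- x\<^sup>2 - 2 * x * (y - x)\<bar> = x * \<bar>x - 2 * y\<bar>" using 3
        by (simp add: power2_eq_square algebra_simps abs_mult flip: abs_mult)
      moreover have "x * \<bar>x - 2 * y\<bar> \<le> (y - x)\<^sup>2" using 3 by (simp add: power2_eq_square algebra_simps)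
      ultimately show ?thesis using 3 by (simp add: pos2_def)
    next
      case 4
      have "y\<^sup>2 - x\<^sup>2 - 2 * x * (y - x) = (y - x)\<^sup>2" by (simp add: power2_eq_square algebra_simps)
      with 4 show ?thesis by (simp add: pos2_def)
    qed (simp add: pos2_def)
  qed
  note sq = this
  have le: "\<bar>(pos2 (x + h) - pos2 x) / h - 2 * max 0 x\<bar> \<le> \<bar>h\<bar>" if "h \<noteq> 0" for h
  proof -
    have "(pos2 (x + h) - pos2 x) / h - 2 * max 0 x = (pos2 (x + h) - pos2 x - 2 * max 0 x * h) / h"
      using that by (simp add: field_simps)
    then show ?thesis
      using sq[of "x + h"] that by (simp add: abs_divide divide_le_eq power2_eq_square abs_mult[symmetric])
  qed
  show ?thesis unfolding DERIV_def
  proof (rule LIM_zero_cancel, rule Lim_null_comparison[where g="\<lambda>h. \<bar>h\<bar>"])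
    show "((\<lambda>h::real. \<bar>h\<bar>) \<longlongrightarrow> 0) (at 0)" by (intro tendsto_rabs_zero tendsto_ident_at)
    show "\<forall>\<^sub>F h in at 0. norm ((pos2 (x + h) - pos2 x) / h - 2 * max 0 x) \<le> \<bar>h\<bar>"
      unfolding eventually_at_filter using le by (intro always_eventually) simp
  qed
qed

lemma pos2_simps: "pos2 x \<ge> 0" "x \<le> 0 \<Longrightarrow> pos2 x = 0" "x > 0 \<Longrightarrow> pos2 x > 0" "pos2 x = 0 \<longleftrightarrow> x \<le> 0"
  by (auto simp: pos2_def max_def)

section \<open>Approximation of elements of the Sobolev space\<close>

locale S22_approx =
  fixes \<gamma> R :: real and u :: "(real^'m::finite) \<times> (real^'k::finite) \<Rightarrow> real"
    and g hh :: "'m + 'k \<Rightarrow> (real^'m) \<times> (real^'k) \<Rightarrow> real"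
    and A :: "((real^'m) \<times> (real^'k)) set"
    and un :: "nat \<Rightarrow> (real^'m) \<times> (real^'k) \<Rightarrow> real"
    and Dun :: "nat \<Rightarrow> (real^'m) \<times> (real^'k) \<Rightarrow> (real^'m) \<times> (real^'k) \<Rightarrow> real"
  assumes \<gamma>: "\<gamma> > 0"
    and A_compact: "compact A" and A_nonzero: "0 \<notin> A" and A_ball: "A \<subseteq> gauge_ball \<gamma> R"
    and conv_un: "L2conv lborel un u"
    and conv_g: "\<And>i. L2conv lborel (\<lambda>n p. xcoef \<gamma> i p * Dun n p (xdir i)) (g i)"
    and deriv: "\<And>n p. (un n has_derivative Dun n p) (at p)"
    and cont: "\<And>n v. continuous_on UNIV (\<lambda>p. Dun n p v)"
    and u_zero: "\<And>p. p \<notin> A \<Longrightarrow> u p = 0" and g_zero: "\<And>i p. p \<notin> A \<Longrightarrow> g i p = 0"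
    and un_zero: "\<And>n p. p \<notin> A \<Longrightarrow> un n p = 0" and Dun_zero: "\<And>n p v. p \<notin> A \<Longrightarrow> Dun n p v = 0"
    and hh: "\<And>i. sqint lborel (hh i)"
    and weak: "\<And>i w w' B K. has_dd (xdir i) w w' \<Longrightarrow> w \<in> borel_measurable borel \<Longrightarrow> w' \<in> borel_measurable borel \<Longrightarrow>
      (\<And>p. \<bar>w p\<bar> \<le> B) \<Longrightarrow> (\<And>p. \<bar>w' p\<bar> \<le> B) \<Longrightarrow> compact K \<Longrightarrow> (\<And>p. p \<notin> K \<Longrightarrow> w p = 0) \<Longrightarrow> (\<And>p. p \<notin> K \<Longrightarrow> w' p = 0) \<Longrightarrow>
      (\<integral>p. hh i p * w p \<partial>lborel) = - (\<integral>p. g i p * (xcoef \<gamma> i p * w' p) \<partial>lborel)"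

lemma open_gauge_ball: "\<gamma> > 0 \<Longrightarrow> open (gauge_ball \<gamma> R)"
  unfolding gauge_ball_def by (intro open_Collect_less continuous_on_gauge_rho continuous_on_const)

lemma compact_gauge_sublevel:
  assumes "\<gamma> > 0" shows "compact {p. gauge_rho \<gamma> p \<le> r}"
  unfolding compact_eq_bounded_closed
proof
  show "bounded {p. gauge_rho \<gamma> p \<le> r}"
    unfolding bounded_iff using norm_le_rho[OF assms, of _ r] by blast
  show "closed {p. gauge_rho \<gamma> p \<le> r}"
    by (intro closed_Collect_le continuous_on_gauge_rho assms continuous_on_const)
qed

lemma gauge_S_less_iff:
  assumes "\<gamma> > 0" "r \<ge> 0" shows "gauge_S \<gamma> p < r powr (2 * (\<gamma> + 1)) \<longleftrightarrow> gauge_rho \<gamma> p < r"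
proof
  assume "gauge_rho \<gamma> p < r"
  then show "gauge_S \<gamma> p < r powr (2 * (\<gamma> + 1))"
    unfolding gauge_S_rho[OF assms(1)] using assms by (intro powr_less_mono2) auto
next
  assume *: "gauge_S \<gamma> p < r powr (2 * (\<gamma> + 1))"
  show "gauge_rho \<gamma> p < r"
  proof (rule ccontr)
    assume "\<not> gauge_rho \<gamma> p < r"
    then have "r powr (2 * (\<gamma> + 1)) \<le> gauge_S \<gamma> p"
      unfolding gauge_S_rho[OF assms(1)] using assms by (intro powr_mono2) auto
    with * show False by simp
  qed
qed

text \<open>The components \<open>g\<close> vanish a.e. where \<open>u\<close> vanishes on an open set: test the weak derivative
  against \<open>e X\<^sub>i\<phi>\<^sub>n\<close> with a function \<open>e\<close> vanishing exactly off this set, and let \<open>n\<close> tend to infinity.\<close>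

lemma S22_approximation:
  fixes u0 :: "(real^'m::finite) \<times> (real^'k::finite) \<Rightarrow> real"
  defines "\<Omega> \<equiv> \<lambda>\<gamma> R. gauge_ball \<gamma> R - {0} :: ((real^'m) \<times> (real^'k)) set"
  assumes \<gamma>: "\<gamma> > 0" and R: "R > 0" and el: "S22_element \<gamma> (\<Omega> \<gamma> R) u0 g0 h0"
    and supp: "ess_support (\<Omega> \<gamma> R) u0 \<subseteq> \<Omega> \<gamma> R"
  shows "\<exists>u g hh A un Dun. S22_approx \<gamma> R u g hh A un Dun \<and> (AE p in lebesgue. p \<in> \<Omega> \<gamma> R \<longrightarrow> u p = u0 p)
    \<and> (\<forall>i. AE p in lebesgue. p \<in> \<Omega> \<gamma> R \<longrightarrow> hh i p = h0 i i p)"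
proof -
  define W where "W = \<Omega> \<gamma> R"
  have W_open: "open W" unfolding W_def \<Omega>_def using open_gauge_ball[OF \<gamma>] by (intro open_Diff) auto
  have Wm [measurable]: "W \<in> sets borel" using W_open by simp
  obtain \<phi> where \<phi>: "\<And>n. test_fun W (\<phi> n)" "\<And>n. S22_norm_sq \<gamma> W (\<phi> n) < \<infinity>" "L2_tendsto W \<phi> u0"
    "\<And>i. L2_tendsto W (\<lambda>n. Xv \<gamma> i (\<phi> n)) (g0 i)" "\<And>i j. L2_tendsto W (\<lambda>n. Xv \<gamma> i (Xv \<gamma> j (\<phi> n))) (h0 i j)"
    using el unfolding S22_element_def W_def[symmetric] by blast
  define K where "K n = closure {p. \<phi> n p \<noteq> 0}" for n
  have K: "compact (K n)" "K n \<subseteq> W" for n using \<phi>(1)[of n] by (auto simp: test_fun_def K_def)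
  define P1 where "P1 i n = partial (xdir i) (\<phi> n)" for i and n
  define P2 where "P2 i n = partial (xdir i) (P1 i n)" for i and n
  define X1 where "X1 i n p = xcoef \<gamma> i p * P1 i n p" for i and n and p
  define X2 where "X2 i n p = xcoef \<gamma> i p * (xcoef \<gamma> i p * P2 i n p)" for i and n and p
  have f0: "continuous_on UNIV (\<phi> n)" "has_dd v (\<phi> n) (partial v (\<phi> n))" "continuous_on UNIV (partial v (\<phi> n))"
    "(\<phi> n has_derivative frechet_derivative (\<phi> n) (at p)) (at p)" if "v \<in> Basis" for v n p
    using test_fun_partial(1-3)[OF \<phi>(1)[of n], of "[]" v] test_fun_partial(4)[OF \<phi>(1)[of n], where es="[]" and v=v and p=p] that by simp_all
  have f1: "continuous_on UNIV (partial v (\<phi> n))" "has_dd v (partial v (\<phi> n)) (partial v (partial v (\<phi> n)))"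
    "continuous_on UNIV (partial v (partial v (\<phi> n)))" if "v \<in> Basis" for v n
    using test_fun_partial(1-3)[OF \<phi>(1)[of n], of "[v]" v] that by simp_all
  have zero: "\<phi> n p = 0" "P1 i n p = 0" "P2 i n p = 0" "X1 i n p = 0" "X2 i n p = 0" if "p \<notin> K n" for i n p
    using foldr_partial_zero[of p "\<phi> n" "[]"] foldr_partial_zero[of p "\<phi> n" "[xdir i]"] foldr_partial_zero[of p "\<phi> n" "[xdir i, xdir i]"] that
    by (simp_all add: P1_def P2_def X1_def X2_def K_def)
  have xc: "continuous_on UNIV (xcoef \<gamma> i :: (real^'m) \<times> (real^'k) \<Rightarrow> real)" for i by (rule continuous_on_xcoef[OF \<gamma>])
  have cont: "continuous_on UNIV (\<phi> n)" "continuous_on UNIV (P1 i n)" "continuous_on UNIV (P2 i n)"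
    "continuous_on UNIV (X1 i n)" "continuous_on UNIV (X2 i n)" for i n
    using f0(1)[OF xdir_Basis[of i], of n] f0(3)[OF xdir_Basis[of i], of n] f1(3)[OF xdir_Basis[of i], of n] xc[of i]
    unfolding P1_def P2_def X1_def X2_def by (auto intro!: continuous_intros)
  have dd: "has_dd (xdir i) (\<phi> n) (P1 i n)" "has_dd (xdir i) (P1 i n) (P2 i n)" for i n
    using f0(2)[OF xdir_Basis[of i], of n] f1(2)[OF xdir_Basis[of i], of n] by (simp_all add: P1_def P2_def)
  have dd1: "has_dd (xdir i) (X1 i n) (\<lambda>p. xcoef \<gamma> i p * P2 i n p)" for i n
    unfolding X1_def[abs_def] by (rule has_dd_const_mult[OF xcoef_shift dd(2)])
  have X1: "Xv \<gamma> i (\<phi> n) = X1 i n" for i n by (simp add: fun_eq_iff Xv_eq X1_def P1_def)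
  have X2: "Xv \<gamma> i (Xv \<gamma> i (\<phi> n)) = X2 i n" for i n
    by (simp add: fun_eq_iff X1 Xv_eq[of _ _ "X1 i n"] X2_def has_dd_partial[OF dd1])
  have meas: "\<phi> n \<in> borel_measurable borel" "X1 i n \<in> borel_measurable borel" "X2 i n \<in> borel_measurable borel" for i n
    using cont by (auto intro: borel_measurable_continuous_onI)
  have fin: "(\<integral>\<^sup>+p\<in>W. ennreal (f p) \<partial>lebesgue) < \<infinity>"
    if "\<And>p. f p \<le> (\<phi> n p)\<^sup>2 + (\<Sum>i\<in>UNIV. (Xv \<gamma> i (\<phi> n) p)\<^sup>2) + (\<Sum>i\<in>UNIV. \<Sum>j\<in>UNIV. (Xv \<gamma> i (Xv \<gamma> j (\<phi> n)) p)\<^sup>2)" for n f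
  proof -
    have "(\<integral>\<^sup>+p\<in>W. ennreal (f p) \<partial>lebesgue) \<le> S22_norm_sq \<gamma> W (\<phi> n)"
      unfolding S22_norm_sq_def by (intro nn_integral_mono mult_right_mono ennreal_leI that) auto
    then show ?thesis using \<phi>(2)[of n] by (rule le_less_trans)
  qed
  have s1: "(Xv \<gamma> i (\<phi> n) p)\<^sup>2 \<le> (\<Sum>i\<in>UNIV. (Xv \<gamma> i (\<phi> n) p)\<^sup>2)" for i n p
    by (rule member_le_sum) auto
  have s2: "(Xv \<gamma> i (Xv \<gamma> i (\<phi> n)) p)\<^sup>2 \<le> (\<Sum>i\<in>UNIV. \<Sum>j\<in>UNIV. (Xv \<gamma> i (Xv \<gamma> j (\<phi> n)) p)\<^sup>2)" for i n p
    by (rule order_trans[OF member_le_sum[of i UNIV "\<lambda>j. (Xv \<gamma> i (Xv \<gamma> j (\<phi> n)) p)\<^sup>2"] member_le_sum[of i UNIV "\<lambda>i. \<Sum>j\<in>UNIV. (Xv \<gamma> i (Xv \<gamma> j (\<phi> n)) p)\<^sup>2"]])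
      (auto intro: sum_nonneg)
  have nn: "0 \<le> (\<Sum>i\<in>UNIV. (Xv \<gamma> i (\<phi> n) p)\<^sup>2)" "0 \<le> (\<Sum>i\<in>UNIV. \<Sum>j\<in>UNIV. (Xv \<gamma> i (Xv \<gamma> j (\<phi> n)) p)\<^sup>2)" "0 \<le> (\<phi> n p)\<^sup>2" for n p
    by (auto intro!: sum_nonneg)
  have offW: "\<phi> n p = 0" "X1 i n p = 0" "X2 i n p = 0" if "p \<notin> W" for i n p
  proof -
    have "p \<notin> K n" using that K(2)[of n] by blast
    then show "\<phi> n p = 0" "X1 i n p = 0" "X2 i n p = 0" by (rule zero)+
  qed
  have "\<exists>u'. L2conv lborel \<phi> u' \<and> (\<forall>p. p \<notin> W \<longrightarrow> u' p = 0) \<and> (AE p in lebesgue. p \<in> W \<longrightarrow> u' p = u0 p)"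
  proof (rule L2_representative[OF Wm \<phi>(3) meas(1) offW(1)])
    show "(\<integral>\<^sup>+p\<in>W. ennreal ((\<phi> n p)\<^sup>2) \<partial>lebesgue) < \<infinity>" for n
    proof (rule fin)
      show "(\<phi> n p)\<^sup>2 \<le> (\<phi> n p)\<^sup>2 + (\<Sum>i\<in>UNIV. (Xv \<gamma> i (\<phi> n) p)\<^sup>2) + (\<Sum>i\<in>UNIV. \<Sum>j\<in>UNIV. (Xv \<gamma> i (Xv \<gamma> j (\<phi> n)) p)\<^sup>2)" for p
        using nn[of n p] by linarith
    qed
  qed
  then obtain u1 where u1: "L2conv lborel \<phi> u1" "\<And>p. p \<notin> W \<Longrightarrow> u1 p = 0" "AE p in lebesgue. p \<in> W \<longrightarrow> u1 p = u0 p"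
    by blast
  have "\<exists>g'. L2conv lborel (X1 i) g' \<and> (\<forall>p. p \<notin> W \<longrightarrow> g' p = 0) \<and> (AE p in lebesgue. p \<in> W \<longrightarrow> g' p = g0 i p)" for i
  proof (rule L2_representative[OF Wm _ meas(2) offW(2)])
    show "L2_tendsto W (X1 i) (g0 i)" using \<phi>(4)[of i] by (simp add: X1)
    show "(\<integral>\<^sup>+p\<in>W. ennreal ((X1 i n p)\<^sup>2) \<partial>lebesgue) < \<infinity>" for n
    proof (rule fin)
      show "(X1 i n p)\<^sup>2 \<le> (\<phi> n p)\<^sup>2 + (\<Sum>i\<in>UNIV. (Xv \<gamma> i (\<phi> n) p)\<^sup>2) + (\<Sum>i\<in>UNIV. \<Sum>j\<in>UNIV. (Xv \<gamma> i (Xv \<gamma> j (\<phi> n)) p)\<^sup>2)" for p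
        using s1[of i n p] nn[of n p] unfolding X1 by linarith
    qed
  qed
  then obtain g1 where g1': "\<forall>i. L2conv lborel (X1 i) (g1 i) \<and> (\<forall>p. p \<notin> W \<longrightarrow> g1 i p = 0)"
    using choice[of "\<lambda>i g'. L2conv lborel (X1 i) g' \<and> (\<forall>p. p \<notin> W \<longrightarrow> g' p = 0)"] by blast
  have g1: "\<And>i. L2conv lborel (X1 i) (g1 i)" "\<And>i p. p \<notin> W \<Longrightarrow> g1 i p = 0"
    using g1' by blast+
  have "\<exists>h'. L2conv lborel (X2 i) h' \<and> (\<forall>p. p \<notin> W \<longrightarrow> h' p = 0) \<and> (AE p in lebesgue. p \<in> W \<longrightarrow> h' p = h0 i i p)" for i
  proof (rule L2_representative[OF Wm _ meas(3) offW(3)])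
    show "L2_tendsto W (X2 i) (h0 i i)" using \<phi>(5)[of i i] by (simp add: X2)
    show "(\<integral>\<^sup>+p\<in>W. ennreal ((X2 i n p)\<^sup>2) \<partial>lebesgue) < \<infinity>" for n
    proof (rule fin)
      show "(X2 i n p)\<^sup>2 \<le> (\<phi> n p)\<^sup>2 + (\<Sum>i\<in>UNIV. (Xv \<gamma> i (\<phi> n) p)\<^sup>2) + (\<Sum>i\<in>UNIV. \<Sum>j\<in>UNIV. (Xv \<gamma> i (Xv \<gamma> j (\<phi> n)) p)\<^sup>2)" for p
        using s2[of i n p] nn[of n p] unfolding X2 by linarith
    qed
  qed
  then obtain h1 where h1': "\<forall>i. L2conv lborel (X2 i) (h1 i) \<and> (\<forall>p. p \<notin> W \<longrightarrow> h1 i p = 0) \<and> (AE p in lebesgue. p \<in> W \<longrightarrow> h1 i p = h0 i i p)"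
    using choice[of "\<lambda>i h'. L2conv lborel (X2 i) h' \<and> (\<forall>p. p \<notin> W \<longrightarrow> h' p = 0) \<and> (AE p in lebesgue. p \<in> W \<longrightarrow> h' p = h0 i i p)"] by blast
  have h1: "\<And>i. L2conv lborel (X2 i) (h1 i)" "\<And>i. AE p in lebesgue. p \<in> W \<longrightarrow> h1 i p = h0 i i p"
    using h1' by blast+
  have [measurable]: "u1 \<in> borel_measurable borel" "g1 i \<in> borel_measurable borel" for i
    using L2convD(2)[OF u1(1)] L2convD(2)[OF g1(1)] by (simp_all add: sqint_def)

  define R' where "R' = R powr (2 * (\<gamma> + 1))"
  have R': "0 < R'" using R by (simp add: R'_def)
  have inW: "p \<in> W \<longleftrightarrow> 0 < gauge_S \<gamma> p \<and> gauge_S \<gamma> p < R'" for p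
  proof -
    have "p \<noteq> 0 \<longleftrightarrow> 0 < gauge_S \<gamma> p" using gauge_S_pos[OF \<gamma>, of p] by force
    moreover have "gauge_rho \<gamma> p < R \<longleftrightarrow> gauge_S \<gamma> p < R'"
      unfolding R'_def by (rule gauge_S_less_iff[OF \<gamma>, symmetric]) (use R in simp)
    ultimately show ?thesis unfolding W_def \<Omega>_def gauge_ball_def by blast
  qed
  define K0 where "K0 = ess_support W u0"
  have "\<exists>s0 s1. 0 < s0 \<and> s0 \<le> s1 \<and> s1 < R' \<and> (\<forall>p\<in>K0. s0 \<le> gauge_S \<gamma> p \<and> gauge_S \<gamma> p \<le> s1)"
  proof (cases "K0 = {}")
    case True
    then show ?thesis using R' by (intro exI[of _ "R' / 2"]) auto
  next
    case False
    have sub: "K0 \<subseteq> W" using supp by (simp add: K0_def W_def)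
    have "bounded K0"
      using compact_imp_bounded[OF compact_gauge_sublevel[OF \<gamma>, of R]]
      by (rule bounded_subset) (use sub in \<open>auto simp: W_def \<Omega>_def gauge_ball_def\<close>)
    then have cK: "compact K0" using ess_support_closed by (simp add: compact_eq_bounded_closed K0_def)
    obtain a where a: "a \<in> K0" "\<And>p. p \<in> K0 \<Longrightarrow> gauge_S \<gamma> a \<le> gauge_S \<gamma> p"
      using continuous_attains_inf[OF cK False continuous_on_gauge_S[OF \<gamma>]] by blast
    obtain b where b: "b \<in> K0" "\<And>p. p \<in> K0 \<Longrightarrow> gauge_S \<gamma> p \<le> gauge_S \<gamma> b"
      using continuous_attains_sup[OF cK False continuous_on_gauge_S[OF \<gamma>]] by blast
    have "0 < gauge_S \<gamma> a" "gauge_S \<gamma> b < R'" using a(1) b(1) sub inW by blast+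
    then show ?thesis using a b by blast
  qed
  then obtain s0 s1 where s: "0 < s0" "s0 \<le> s1" "s1 < R'" "\<And>p. p \<in> K0 \<Longrightarrow> s0 \<le> gauge_S \<gamma> p \<and> gauge_S \<gamma> p \<le> s1" by blast
  \<comment> \<open>The gauge values of the support fill at most the interval [s0, s1].
    \<open>E\<close> vanishes exactly on the corresponding shell, is C^1, and its derivative
    vanishes there too.\<close>
  define E where "E p = pos2 (gauge_S \<gamma> p - s1) + pos2 (s0 - gauge_S \<gamma> p)" for p :: "(real^'m) \<times> (real^'k)"
  define E' where "E' p v = (2 * max 0 (gauge_S \<gamma> p - s1) - 2 * max 0 (s0 - gauge_S \<gamma> p)) * gauge_S' \<gamma> p v" for p v :: "(real^'m) \<times> (real^'k)"
  have E_deriv: "(E has_derivative E' p) (at p)" for p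
  proof -
    have d1: "((\<lambda>p. gauge_S \<gamma> p - s1) has_derivative gauge_S' \<gamma> p) (at p)" and d2: "((\<lambda>p. s0 - gauge_S \<gamma> p) has_derivative (\<lambda>v. - gauge_S' \<gamma> p v)) (at p)"
      using gauge_S_has_derivative[OF \<gamma>, of p] by (auto intro!: derivative_eq_intros)
    have c: "(pos2 has_derivative (\<lambda>h. 2 * max 0 x * h)) (at x)" for x
      using pos2_deriv[of x] by (simp add: has_field_derivative_def)
    show ?thesis unfolding E_def[abs_def]
      by (rule has_derivative_eq_rhs[OF has_derivative_add[OF has_derivative_compose[OF d1 c] has_derivative_compose[OF d2 c]]])
        (simp add: fun_eq_iff E'_def algebra_simps)
  qed
  have E_cont: "continuous_on UNIV E"
    by (intro continuous_at_imp_continuous_on ballI has_derivative_continuous[OF E_deriv])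
  have E'_cont: "continuous_on UNIV (\<lambda>p. E' p v)" for v
    unfolding E'_def by (intro continuous_intros continuous_on_gauge_S continuous_on_gauge_S' \<gamma>)
  have [measurable]: "E \<in> borel_measurable borel" using E_cont by (rule borel_measurable_continuous_onI)
  have E_nonneg: "0 \<le> E p" for p by (simp add: E_def pos2_simps)
  have E0: "E p = 0 \<longleftrightarrow> s0 \<le> gauge_S \<gamma> p \<and> gauge_S \<gamma> p \<le> s1" for p
    using pos2_simps(1)[of "gauge_S \<gamma> p - s1"] pos2_simps(1)[of "s0 - gauge_S \<gamma> p"] pos2_simps(4)
    by (auto simp: E_def add_nonneg_eq_0_iff)
  have E'0: "E' p v = 0" if "E p = 0" for p v using that unfolding E0 by (simp add: E'_def)
  have aeu: "AE p in lborel. E p \<noteq> 0 \<longrightarrow> u1 p = 0"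
  proof -
    have "AE p in lebesgue. E p \<noteq> 0 \<longrightarrow> u1 p = 0"
      using u1(3) AE_zero_off_ess_support[of W u0]
    proof eventually_elim
      case (elim p)
      show ?case
      proof
        assume "E p \<noteq> 0"
        then have "p \<notin> K0" using s(4)[of p] E0[of p] by blast
        then show "u1 p = 0" using elim u1(2)[of p] by (cases "p \<in> W") (auto simp: K0_def)
      qed
    qed
    then show ?thesis by (simp add: AE_completion_iff)
  qed
  have aeg: "AE p in lborel. E p \<noteq> 0 \<longrightarrow> g1 i p = 0" for i
  proof -
    obtain CE where CE: "0 \<le> CE" "\<And>p. p \<in> {p. gauge_rho \<gamma> p \<le> R} \<Longrightarrow> \<bar>E p\<bar> \<le> CE"
      using continuous_bounded_compact[OF compact_gauge_sublevel[OF \<gamma>] continuous_on_subset[OF E_cont]] by blast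
    \<comment> \<open>On \<open>W\<close> the product of \<open>Y\<close> and \<open>g1 i\<close> is
      E (g1 i)^2 \<ge> 0, so showing that its integral is 0 forces \<open>g1 i\<close> to vanish
      where \<open>E\<close> does not.\<close>
    define Y where "Y p = (indicator W p * E p) * g1 i p" for p
    have Y: "sqint lborel Y" unfolding Y_def
    proof (rule sqint_bounded_mult[OF L2convD(2)[OF g1(1)]])
      show "\<bar>indicator W p * E p\<bar> \<le> CE" for p
        using CE(2)[of p] CE(1) by (auto simp: W_def \<Omega>_def gauge_ball_def split: split_indicator)
    qed simp
    have "(\<integral>p. Y p * X1 i m p \<partial>lborel) = 0" for m
    proof -
      define w where "w p = X1 i m p * E p" for p
      define w' where "w' p = (xcoef \<gamma> i p * P2 i m p) * E p + X1 i m p * E' p (xdir i)" for p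
      have wc: "continuous_on UNIV w" "continuous_on UNIV w'"
        unfolding w_def w'_def by (intro continuous_intros cont xc E_cont E'_cont)+
      have wz: "w p = 0" "w' p = 0" if "p \<notin> K m" for p using zero[OF that] by (simp_all add: w_def w'_def)
      obtain B1 where B1: "0 \<le> B1" "\<And>p. p \<in> K m \<Longrightarrow> \<bar>w p\<bar> \<le> B1"
        using continuous_bounded_compact[OF K(1) continuous_on_subset[OF wc(1)]] by auto
      obtain B2 where B2: "0 \<le> B2" "\<And>p. p \<in> K m \<Longrightarrow> \<bar>w' p\<bar> \<le> B2"
        using continuous_bounded_compact[OF K(1) continuous_on_subset[OF wc(2)]] by auto
      have "(\<integral>p. g1 i p * w p \<partial>lborel) = - (\<integral>p. u1 p * (xcoef \<gamma> i p * w' p) \<partial>lborel)"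
      proof (rule weak_limit[where \<phi>=\<phi> and \<phi>'="P1 i" and c="xcoef \<gamma> i" and v="xdir i" and K=K and K'="K m" and B="max B1 B2"])
        show "L2conv lborel (\<lambda>n p. xcoef \<gamma> i p * P1 i n p) (g1 i)" using g1(1)[of i] by (simp add: X1_def[abs_def])
        show "has_dd (xdir i) w w'" unfolding w_def[abs_def] w'_def[abs_def]
          by (rule has_dd_mult[OF dd1 has_dd_derivative[OF E_deriv]])
        show "w \<in> borel_measurable borel" "w' \<in> borel_measurable borel" using wc by (auto intro: borel_measurable_continuous_onI)
        have "\<bar>w p\<bar> \<le> B1" "\<bar>w' p\<bar> \<le> B2" for p
          using B1(1) B2(1) B1(2)[of p] B2(2)[of p] wz[of p] by (cases "p \<in> K m"; simp)+
        then show "\<bar>w p\<bar> \<le> max B1 B2" "\<bar>w' p\<bar> \<le> max B1 B2" for p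
          by (simp_all add: max.coboundedI1 max.coboundedI2)
      qed (simp_all add: u1(1) xc dd cont K zero wz)
      \<comment> \<open>Where E = 0, both terms of \<open>w'\<close> vanish, because each contains
        \<open>E\<close> or its derivative; where E is nonzero, \<open>u1\<close> vanishes almost
        everywhere.\<close>
      also have "(\<integral>p. u1 p * (xcoef \<gamma> i p * w' p) \<partial>lborel) = 0"
      proof (rule integral_eq_zero_AE)
        show "AE p in lborel. u1 p * (xcoef \<gamma> i p * w' p) = 0"
          using aeu
        proof eventually_elim
          case (elim p)
          then show ?case using E'0[of p "xdir i"] by (cases "E p = 0") (auto simp: w'_def)
        qed
      qed
      finally have "(\<integral>p. g1 i p * w p \<partial>lborel) = 0" by simp
      moreover have "Y p * X1 i m p = g1 i p * w p" for p using g1(2)[of p i] by (auto simp: Y_def w_def split: split_indicator)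
      ultimately show ?thesis by simp
    qed
    with L2conv_integral_mult[OF g1(1)[of i] Y] have "(\<integral>p. Y p * g1 i p \<partial>lborel) = 0"
      by (simp add: LIMSEQ_const_iff)
    moreover have "integrable lborel (\<lambda>p. Y p * g1 i p)" by (rule sqint_mult_integrable[OF Y L2convD(2)[OF g1(1)]])
    moreover have nonneg: "0 \<le> Y p * g1 i p" for p
      using E_nonneg[of p] by (auto simp: Y_def mult.assoc split: split_indicator)
    ultimately have "AE p in lborel. Y p * g1 i p = 0"
      by (subst (asm) integral_nonneg_eq_0_iff_AE) auto
    then show ?thesis
    proof eventually_elim
      case (elim p)
      then show ?case using g1(2)[of p i] by (auto simp: Y_def split: split_indicator_asm)
    qed
  qed
  \<comment> \<open>Half the gap to either end of (0, R'): the enlarged shell \<open>A\<close>,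
    given by E \<le> \<delta>^2, then still avoids the origin and the boundary of the ball.\<close>
  define \<delta> where "\<delta> = min s0 (R' - s1) / 2"
  have \<delta>: "0 < \<delta>" "\<delta> < s0" "s1 + \<delta> < R'" using s by (auto simp: \<delta>_def min_def field_simps)
  define A where "A = {p :: (real^'m) \<times> (real^'k). E p \<le> \<delta>\<^sup>2}"
  have A_S: "0 < gauge_S \<gamma> p \<and> gauge_S \<gamma> p \<le> s1 + \<delta>" if "p \<in> A" for p
  proof -
    have p2: "x \<le> \<delta>" if "pos2 x \<le> \<delta>\<^sup>2" for x
    proof (rule ccontr)
      assume "\<not> x \<le> \<delta>"
      then have "\<delta>\<^sup>2 < x\<^sup>2" "0 < x" using \<delta> by (auto intro!: power_strict_mono)
      with that show False by (simp add: pos2_def)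
    qed
    have "pos2 (gauge_S \<gamma> p - s1) \<le> \<delta>\<^sup>2" "pos2 (s0 - gauge_S \<gamma> p) \<le> \<delta>\<^sup>2"
      using that pos2_simps(1)[of "gauge_S \<gamma> p - s1"] pos2_simps(1)[of "s0 - gauge_S \<gamma> p"] unfolding A_def E_def mem_Collect_eq by linarith+
    from this[THEN p2] show ?thesis using \<delta> by simp
  qed
  have A_W: "A \<subseteq> W" using A_S \<delta> unfolding inW by (meson inW le_less_trans subsetI)
  have A_closed: "closed A" unfolding A_def by (intro closed_Collect_le E_cont continuous_on_const)
  have A_compact: "compact A"
  proof -
    have "bounded A" by (rule bounded_subset[OF compact_imp_bounded[OF compact_gauge_sublevel[OF \<gamma>, of R]]])
      (use A_W in \<open>auto simp: W_def \<Omega>_def gauge_ball_def\<close>)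
    with A_closed show ?thesis by (simp add: compact_eq_bounded_closed)
  qed
  \<comment> \<open>A C^1 cutoff equal to 1, with derivative 0, on the shell E = 0, and vanishing
    with its derivative off \<open>A\<close>.\<close>
  define \<eta> where "\<eta> p = pos2 (1 - E p / \<delta>\<^sup>2)" for p
  define \<eta>' where "\<eta>' p v = 2 * max 0 (1 - E p / \<delta>\<^sup>2) * (- (E' p v / \<delta>\<^sup>2))" for p v
  have \<eta>_deriv: "(\<eta> has_derivative \<eta>' p) (at p)" for p
  proof -
    have d1: "((\<lambda>p. 1 - E p / \<delta>\<^sup>2) has_derivative (\<lambda>v. - (E' p v / \<delta>\<^sup>2))) (at p)"
      using E_deriv[of p] \<delta> by (auto intro!: derivative_eq_intros simp: divide_inverse)
    have c: "(pos2 has_derivative (\<lambda>h. 2 * max 0 x * h)) (at x)" for x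
      using pos2_deriv[of x] by (simp add: has_field_derivative_def)
    show ?thesis unfolding \<eta>_def[abs_def] \<eta>'_def[abs_def]
      by (rule has_derivative_compose[OF d1 c])
  qed
  have \<eta>_cont: "continuous_on UNIV \<eta>" by (intro continuous_at_imp_continuous_on ballI has_derivative_continuous[OF \<eta>_deriv])
  have \<eta>'_cont: "continuous_on UNIV (\<lambda>p. \<eta>' p v)" for v
    unfolding \<eta>'_def using \<delta> by (intro continuous_intros E_cont E'_cont) auto
  have \<eta>0: "\<eta> p = 0" "\<eta>' p v = 0" if "p \<notin> A" for p v
    using that \<delta> by (auto simp: A_def \<eta>_def \<eta>'_def pos2_def max_def field_simps)
  have \<eta>1: "\<eta> p = 1" "\<eta>' p v = 0" if "E p = 0" for p v
    using that E'0[OF that, of v] by (simp_all add: \<eta>_def \<eta>'_def pos2_def)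
  have bounded: "\<exists>C. \<forall>p. \<bar>f p\<bar> \<le> C" if "continuous_on UNIV f" "\<And>p. p \<notin> A \<Longrightarrow> f p = 0" for f :: "(real^'m) \<times> (real^'k) \<Rightarrow> real"
    using continuous_bounded_compact[OF A_compact continuous_on_subset[OF that(1)]] that(2) by (metis abs_zero subset_UNIV)
  \<comment> \<open>A change on a null set only. It makes \<open>u\<close> and \<open>g\<close>
    vanish at every point off \<open>A\<close>, which pointwise arguments along orbits rely
    on.\<close>
  define u where "u p = (if E p = 0 then u1 p else 0)" for p
  define g where "g i p = (if E p = 0 then g1 i p else 0)" for i p
  have [measurable]: "u \<in> borel_measurable borel" "g i \<in> borel_measurable borel" for i
    unfolding u_def[abs_def] g_def[abs_def] by measurable
  define D where "D n p = frechet_derivative (\<phi> n) (at p)" for n p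
  have D: "(\<phi> n has_derivative D n p) (at p)" for n p using f0(4)[OF xdir_Basis] unfolding D_def .
  have D_partial: "D n p (xdir i) = P1 i n p" for n p i unfolding P1_def by (rule partial_eq(1)[OF D, symmetric])
  have D_cont: "continuous_on UNIV (\<lambda>p. D n p v)" for n v
    unfolding frechet_partial_basis[OF D] using f0(3) by (intro continuous_intros)
  define un where "un n p = \<eta> p * \<phi> n p" for n p
  define Dun where "Dun n p v = \<eta> p * D n p v + \<eta>' p v * \<phi> n p" for n p v
  have "S22_approx \<gamma> R u g h1 A un Dun"
  proof
    show "\<gamma> > 0" "compact A" by (rule \<gamma>, rule A_compact)
    show "0 \<notin> A" "A \<subseteq> gauge_ball \<gamma> R" using A_W by (auto simp: W_def \<Omega>_def)
    obtain C where "\<And>p. \<bar>\<eta> p\<bar> \<le> C" using bounded[OF \<eta>_cont \<eta>0(1)] by blast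
    note b = L2conv_bounded_mult[OF _ _ this]
    have cm: "\<eta> \<in> borel_measurable lborel" using borel_measurable_continuous_onI[OF \<eta>_cont] by simp
    show "L2conv lborel un u"
      unfolding un_def[abs_def]
    proof (rule L2conv_AE_cong[OF b[OF u1(1) cm]])
      show "AE p in lborel. \<eta> p * u1 p = u p" using aeu by eventually_elim (auto simp: u_def \<eta>1)
    qed simp
    show "L2conv lborel (\<lambda>n p. xcoef \<gamma> i p * Dun n p (xdir i)) (g i)" for i
    proof -
      have "continuous_on UNIV (\<lambda>p. xcoef \<gamma> i p * \<eta>' p (xdir i))" by (intro continuous_on_mult xc \<eta>'_cont)
      moreover from bounded[OF this] obtain C' where "\<And>p. \<bar>xcoef \<gamma> i p * \<eta>' p (xdir i)\<bar> \<le> C'" using \<eta>0(2) by auto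
      ultimately have "L2conv lborel (\<lambda>n p. \<eta> p * X1 i n p + (xcoef \<gamma> i p * \<eta>' p (xdir i)) * \<phi> n p)
          (\<lambda>p. \<eta> p * g1 i p + (xcoef \<gamma> i p * \<eta>' p (xdir i)) * u1 p)"
        by (intro L2conv_add b g1(1) cm L2conv_bounded_mult[OF u1(1)]) (auto intro: borel_measurable_continuous_onI)
      moreover have "\<eta> p * X1 i n p + (xcoef \<gamma> i p * \<eta>' p (xdir i)) * \<phi> n p = xcoef \<gamma> i p * Dun n p (xdir i)" for n p
        by (simp add: Dun_def D_partial X1_def algebra_simps)
      ultimately have "L2conv lborel (\<lambda>n p. xcoef \<gamma> i p * Dun n p (xdir i)) (\<lambda>p. \<eta> p * g1 i p + (xcoef \<gamma> i p * \<eta>' p (xdir i)) * u1 p)"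
        by simp
      then show ?thesis
      proof (rule L2conv_AE_cong)
        show "AE p in lborel. \<eta> p * g1 i p + (xcoef \<gamma> i p * \<eta>' p (xdir i)) * u1 p = g i p"
          using aeu aeg[of i] by eventually_elim (auto simp: g_def \<eta>1)
      qed simp
    qed
    show "(un n has_derivative Dun n p) (at p)" for n p
      unfolding un_def[abs_def] Dun_def[abs_def]
      by (rule has_derivative_eq_rhs[OF has_derivative_mult[OF \<eta>_deriv D]]) (simp add: fun_eq_iff)
    show "continuous_on UNIV (\<lambda>p. Dun n p v)" for n v
      unfolding Dun_def by (intro continuous_intros \<eta>_cont D_cont \<eta>'_cont cont)
    show "u p = 0" if "p \<notin> A" for p using that \<delta> by (auto simp: u_def A_def)
    show "g i p = 0" if "p \<notin> A" for i p using that \<delta> by (auto simp: g_def A_def)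
    show "un n p = 0" "Dun n p v = 0" if "p \<notin> A" for n p v using \<eta>0[OF that] by (auto simp: un_def Dun_def)
    show "sqint lborel (h1 i)" for i by (rule L2convD(2)[OF h1(1)])
    fix i :: "'m + 'k" and w w' :: "(real^'m) \<times> (real^'k) \<Rightarrow> real" and B K'
    assume w: "has_dd (xdir i) w w'" "w \<in> borel_measurable borel" "w' \<in> borel_measurable borel"
      "\<And>p. \<bar>w p\<bar> \<le> B" "\<And>p. \<bar>w' p\<bar> \<le> B" "compact K'" "\<And>p. p \<notin> K' \<Longrightarrow> w p = 0" "\<And>p. p \<notin> K' \<Longrightarrow> w' p = 0"
    have "(\<integral>p. h1 i p * w p \<partial>lborel) = - (\<integral>p. g1 i p * (xcoef \<gamma> i p * w' p) \<partial>lborel)"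
    proof (rule weak_limit[where \<phi>="X1 i" and \<phi>'="\<lambda>n p. xcoef \<gamma> i p * P2 i n p" and c="xcoef \<gamma> i" and v="xdir i" and K=K and K'=K' and B=B])
      show "L2conv lborel (\<lambda>n p. xcoef \<gamma> i p * (xcoef \<gamma> i p * P2 i n p)) (h1 i)" using h1(1)[of i] by (simp add: X2_def[abs_def])
      show "continuous_on UNIV (\<lambda>p. xcoef \<gamma> i p * P2 i n p)" for n by (intro continuous_on_mult xc cont)
    qed (simp_all add: g1(1) xc dd1 cont K zero w)
    also have "(\<integral>p. g1 i p * (xcoef \<gamma> i p * w' p) \<partial>lborel) = (\<integral>p. g i p * (xcoef \<gamma> i p * w' p) \<partial>lborel)"
    proof (rule integral_cong_AE)
      show "AE p in lborel. g1 i p * (xcoef \<gamma> i p * w' p) = g i p * (xcoef \<gamma> i p * w' p)"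
        using aeg[of i] by eventually_elim (auto simp: g_def)
    qed (use w(3) in simp_all)
    finally show "(\<integral>p. h1 i p * w p \<partial>lborel) = - (\<integral>p. g i p * (xcoef \<gamma> i p * w' p) \<partial>lborel)" .
  qed
  moreover have "AE p in lebesgue. p \<in> W \<longrightarrow> u p = u0 p"
    using u1(3) AE_completion[OF aeu] by eventually_elim (auto simp: u_def)
  ultimately show ?thesis unfolding W_def[symmetric] using h1(2) by blast
qed

section \<open>The energy identity\<close>

lemma L2conv_AE_cong_seq:
  assumes c: "L2conv M fn f" and g: "\<And>n. gn n \<in> borel_measurable M" "\<And>n. AE x in M. fn n x = gn n x"
  shows "L2conv M gn f"
proof -
  have [measurable]: "f \<in> borel_measurable M" "fn n \<in> borel_measurable M" "gn n \<in> borel_measurable M" for n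
    using g L2convD(1,2)[OF c] by (auto simp: sqint_def)
  have "sqint M (gn n)" for n
  proof -
    have "AE x in M. (fn n x)\<^sup>2 = (gn n x)\<^sup>2" using g(2)[of n] by auto
    then show ?thesis
      using L2convD(1)[OF c, of n] integrable_cong_AE[of "\<lambda>x. (fn n x)\<^sup>2" M "\<lambda>x. (gn n x)\<^sup>2"] by (auto simp: sqint_def)
  qed
  moreover have "l2norm M (\<lambda>x. gn n x - f x) = l2norm M (\<lambda>x. fn n x - f x)" for n
    unfolding l2norm_def using g(2)[of n]
    by (intro arg_cong[where f=sqrt] integral_cong_AE) auto
  ultimately show ?thesis using c by (auto simp: L2conv_def)
qed

text \<open>Multiplication by \<open>c\<close> is bounded from L2(N) into the weighted space on
  functions supported in \<open>A\<close>, with norm at most the square root of \<open>C\<close>. It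
  is the product m c^2 that must be bounded there; \<open>c\<close> itself may be singular.\<close>

lemma L2conv_density:
  fixes fn :: "nat \<Rightarrow> 'a \<Rightarrow> real"
  assumes L: "L2conv N fn f" and m: "m \<in> borel_measurable N" "\<And>x. 0 \<le> m x" and c: "c \<in> borel_measurable N"
    and bd: "\<And>x. x \<in> A \<Longrightarrow> m x * (c x)\<^sup>2 \<le> C" and z: "\<And>n x. x \<notin> A \<Longrightarrow> fn n x = 0" "\<And>x. x \<notin> A \<Longrightarrow> f x = 0"
  shows "L2conv (density N (\<lambda>x. ennreal (m x))) (\<lambda>n x. c x * fn n x) (\<lambda>x. c x * f x)"
proof -
  have C: "\<bar>m x * (c x)\<^sup>2 * indicator A x\<bar> \<le> \<bar>C\<bar>" for x
    using bd[of x] m(2)[of x] by (auto split: split_indicator)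
  have le: "m x * (c x * v x)\<^sup>2 \<le> \<bar>C\<bar> * (v x)\<^sup>2" if "\<And>x. x \<notin> A \<Longrightarrow> v x = 0" for v :: "'a \<Rightarrow> real" and x
  proof (cases "x \<in> A")
    case True
    then have "m x * (c x)\<^sup>2 \<le> \<bar>C\<bar>" using bd[of x] by simp
    from mult_right_mono[OF this, of "(v x)\<^sup>2"] show ?thesis by (simp add: power_mult_distrib mult_ac)
  qed (simp add: that)
  have key: "sqint (density N (\<lambda>x. ennreal (m x))) (\<lambda>x. c x * v x) \<and>
      l2norm (density N (\<lambda>x. ennreal (m x))) (\<lambda>x. c x * v x) \<le> sqrt \<bar>C\<bar> * l2norm N v"
    if v: "sqint N v" "\<And>x. x \<notin> A \<Longrightarrow> v x = 0" for v
  proof -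
    have [measurable]: "v \<in> borel_measurable N" "c \<in> borel_measurable N" "m \<in> borel_measurable N" using v m c by (auto simp: sqint_def)
    have lev: "m x * (c x * v x)\<^sup>2 \<le> \<bar>C\<bar> * (v x)\<^sup>2" for x by (rule le) (rule v(2))
    have i: "integrable N (\<lambda>x. m x * (c x * v x)\<^sup>2)"
    proof (rule Bochner_Integration.integrable_bound)
      show "integrable N (\<lambda>x. \<bar>C\<bar> * (v x)\<^sup>2)" using v(1) by (simp add: sqint_def)
      show "AE x in N. norm (m x * (c x * v x)\<^sup>2) \<le> norm (\<bar>C\<bar> * (v x)\<^sup>2)"
        using lev m(2) by (simp add: abs_mult)
    qed simp
    have "(\<integral>x. (c x * v x)\<^sup>2 \<partial>density N (\<lambda>x. ennreal (m x))) = (\<integral>x. m x * (c x * v x)\<^sup>2 \<partial>N)"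
      using m(2) by (subst integral_density) simp_all
    also have "\<dots> \<le> (\<integral>x. \<bar>C\<bar> * (v x)\<^sup>2 \<partial>N)"
      using i v(1) lev by (intro integral_mono) (auto simp: sqint_def)
    finally have "(\<integral>x. (c x * v x)\<^sup>2 \<partial>density N (\<lambda>x. ennreal (m x))) \<le> \<bar>C\<bar> * (\<integral>x. (v x)\<^sup>2 \<partial>N)" by simp
    then have "l2norm (density N (\<lambda>x. ennreal (m x))) (\<lambda>x. c x * v x) \<le> sqrt \<bar>C\<bar> * l2norm N v"
      unfolding l2norm_def real_sqrt_mult[symmetric] by (rule real_sqrt_le_mono)
    moreover have "sqint (density N (\<lambda>x. ennreal (m x))) (\<lambda>x. c x * v x)"
      unfolding sqint_def using i m(2) by (subst integrable_density) simp_all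
    ultimately show ?thesis by blast
  qed
  have "(\<lambda>n. l2norm (density N (\<lambda>x. ennreal (m x))) (\<lambda>x. c x * (fn n x - f x))) \<longlonglongrightarrow> 0"
  proof (rule Lim_null_comparison)
    show "(\<lambda>n. sqrt \<bar>C\<bar> * l2norm N (\<lambda>x. fn n x - f x)) \<longlonglongrightarrow> 0"
      using tendsto_mult_left[OF L2convD(4)[OF L], of "sqrt \<bar>C\<bar>"] by simp
    show "\<forall>\<^sub>F n in sequentially. norm (l2norm (density N (\<lambda>x. ennreal (m x))) (\<lambda>x. c x * (fn n x - f x))) \<le> sqrt \<bar>C\<bar> * l2norm N (\<lambda>x. fn n x - f x)"
      using key[OF L2convD(3)[OF L]] z by (intro always_eventually allI) simp
  qed
  then show ?thesis
    unfolding L2conv_def using key[OF L2convD(1)[OF L]] key[OF L2convD(2)[OF L]] z by (simp add: right_diff_distrib)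
qed

section \<open>The weighted measure and its dilation structure\<close>

lemma null_fst_zero: "AE p in lborel. norm (fst (p :: (real^'m::finite) \<times> (real^'k::finite))) \<noteq> 0"
proof -
  obtain a :: 'm where True by blast
  have "negligible {p :: (real^'m) \<times> (real^'k). (axis a 1, 0) \<bullet> p = 0}"
    by (rule negligible_hyperplane) (auto simp: zero_prod_def)
  moreover have "closed {p :: (real^'m) \<times> (real^'k). (axis a 1, 0) \<bullet> p = 0}" by (rule closed_hyperplane)
  ultimately have "{p :: (real^'m) \<times> (real^'k). (axis a 1, 0) \<bullet> p = 0} \<in> null_sets lborel"
    by (simp add: negligible_iff_null_sets null_sets_completion_iff)
  from AE_not_in[OF this] show ?thesis
    by eventually_elim (auto simp: inner_prod_def)
qed

definition weight :: "real \<Rightarrow> real \<Rightarrow> (real^'m::finite) \<times> (real^'k::finite) \<Rightarrow> real" where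
  "weight \<gamma> \<alpha> p = gauge_rho \<gamma> p powr (- 2 * \<alpha> - 4) * angle_fun \<gamma> p"

definition mu :: "real \<Rightarrow> real \<Rightarrow> ((real^'m::finite) \<times> (real^'k::finite)) measure" where
  "mu \<gamma> \<alpha> = density lborel (\<lambda>p. ennreal (weight \<gamma> \<alpha> p))"

lemma weight_measurable [measurable]: "weight \<gamma> \<alpha> \<in> borel_measurable borel"
  unfolding weight_def[abs_def] by simp

lemma weight_nonneg [simp]: "0 \<le> weight \<gamma> \<alpha> p"
  by (simp add: weight_def)

lemma weight_dil: "\<gamma> > 0 \<Longrightarrow> weight \<gamma> \<alpha> (dil \<gamma> y p) = exp ((- 2 * \<alpha> - 4) * y) * weight \<gamma> \<alpha> p"
  by (simp add: weight_def gauge_rho_dil angle_fun_dil powr_mult powr_def[of "exp _"])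

lemma continuous_on_weight:
  assumes "\<gamma> > 0" "0 \<notin> A" shows "continuous_on A (weight \<gamma> \<alpha>)"
proof -
  have *: "gauge_rho \<gamma> p \<noteq> 0" "gauge_rho \<gamma> p powr x \<noteq> 0" if "p \<in> A" for p x
    using that assms gauge_rho_pos[of \<gamma> p] by (metis less_irrefl, metis less_irrefl powr_eq_0_iff)
  show ?thesis unfolding weight_def[abs_def] angle_fun_def[abs_def]
    using assms * by (intro continuous_intros continuous_on_gauge_rho continuous_on_powr') auto
qed

locale S22_weighted = S22_approx \<gamma> R u g hh A un Dun
  for \<gamma> R :: real and u :: "(real^'m::finite) \<times> (real^'k::finite) \<Rightarrow> real"
    and g hh :: "'m + 'k \<Rightarrow> (real^'m) \<times> (real^'k) \<Rightarrow> real"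
    and A :: "((real^'m) \<times> (real^'k)) set"
    and un :: "nat \<Rightarrow> (real^'m) \<times> (real^'k) \<Rightarrow> real"
    and Dun :: "nat \<Rightarrow> (real^'m) \<times> (real^'k) \<Rightarrow> (real^'m) \<times> (real^'k) \<Rightarrow> real" +
  fixes \<alpha> \<tau> :: real and M :: "((real^'m) \<times> (real^'k)) measure"
  assumes \<tau>_def: "\<tau> = \<alpha> + 2 - hom_dim \<gamma> TYPE('m) TYPE('k) / 2" and M_def: "M = mu \<gamma> \<alpha>"
begin

definition zu :: "(real^'m) \<times> (real^'k) \<Rightarrow> real" where "zu p = (\<Sum>i\<in>UNIV. zcoef \<gamma> i p * g i p)"

definition zun :: "nat \<Rightarrow> (real^'m) \<times> (real^'k) \<Rightarrow> real" where "zun n p = Dun n p (zvec \<gamma> p)"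

lemma g_measurable [measurable]: "g i \<in> borel_measurable borel"
  using L2convD(2)[OF conv_g] by (simp add: sqint_def)

lemma hh_measurable [measurable]: "hh i \<in> borel_measurable borel"
  using hh by (simp add: sqint_def)

lemma Dun_linear: "linear (Dun n p)"
  using deriv by (rule has_derivative_linear)

lemma zun_cont: "continuous_on UNIV (zun n)"
proof -
  have "Dun n p v = (\<Sum>e\<in>Basis. (v \<bullet> e) * Dun n p e)" for p v
  proof -
    have "Dun n p v = Dun n p (\<Sum>e\<in>Basis. (v \<bullet> e) *\<^sub>R e)" by (simp add: euclidean_representation)
    also have "\<dots> = (\<Sum>e\<in>Basis. (v \<bullet> e) * Dun n p e)" using Dun_linear by (simp add: linear_sum linear_cmul)
    finally show ?thesis .
  qed
  then have eq: "zun n = (\<lambda>p. \<Sum>e\<in>Basis. (zvec \<gamma> p \<bullet> e) * Dun n p e)" unfolding zun_def by (rule ext)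
  have "continuous_on UNIV (zvec \<gamma> :: (real^'m) \<times> (real^'k) \<Rightarrow> _)" unfolding zvec_def[abs_def] by (intro continuous_intros)
  then show ?thesis unfolding eq by (intro continuous_intros cont)
qed

text \<open>Off z = 0 the factor |z|^\<gamma> in \<open>xcoef\<close> cancels the denominator of
  \<open>zcoef\<close>, and the right-hand side is the expansion of \<open>zvec\<close> in the
  directions \<open>xdir i\<close>.\<close>

lemma zun_eq:
  assumes "norm (fst p) \<noteq> 0"
  shows "zun n p = (\<Sum>i\<in>UNIV. zcoef \<gamma> i p * (xcoef \<gamma> i p * Dun n p (xdir i)))"
proof -
  have z: "fst p = (\<Sum>a\<in>UNIV. (fst p $ a) *\<^sub>R axis a 1)" and t: "snd p = (\<Sum>b\<in>UNIV. (snd p $ b) *\<^sub>R axis b 1)"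
    using basis_expansion[of "fst p"] basis_expansion[of "snd p"] by (simp_all add: scalar_mult_eq_scaleR)
  define e1 :: "'m \<Rightarrow> (real^'m) \<times> (real^'k)" where "e1 a = (axis a 1, 0)" for a
  define e2 :: "'k \<Rightarrow> (real^'m) \<times> (real^'k)" where "e2 b = (0, axis b 1)" for b
  have "zvec \<gamma> p = (\<Sum>a\<in>UNIV. (fst p $ a) *\<^sub>R e1 a) + (\<Sum>b\<in>UNIV. ((\<gamma> + 1) * snd p $ b) *\<^sub>R e2 b)"
  proof (rule prod_eqI)
    show "fst (zvec \<gamma> p) = fst ((\<Sum>a\<in>UNIV. (fst p $ a) *\<^sub>R e1 a) + (\<Sum>b\<in>UNIV. ((\<gamma> + 1) * snd p $ b) *\<^sub>R e2 b))"
      using z by (simp add: fst_sum zvec_def e1_def e2_def)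
    have "(\<gamma> + 1) *\<^sub>R (\<Sum>b\<in>UNIV. (snd p $ b) *\<^sub>R axis b 1) = (\<Sum>b\<in>UNIV. ((\<gamma> + 1) * snd p $ b) *\<^sub>R axis b (1::real))"
      by (simp add: scaleR_sum_right)
    then show "snd (zvec \<gamma> p) = snd ((\<Sum>a\<in>UNIV. (fst p $ a) *\<^sub>R e1 a) + (\<Sum>b\<in>UNIV. ((\<gamma> + 1) * snd p $ b) *\<^sub>R e2 b))"
      unfolding t[symmetric] by (simp add: snd_sum zvec_def e1_def e2_def)
  qed
  then have "zun n p = (\<Sum>a\<in>UNIV. fst p $ a * Dun n p (e1 a)) + (\<Sum>b\<in>UNIV. ((\<gamma> + 1) * snd p $ b) * Dun n p (e2 b))"
    unfolding zun_def using Dun_linear[of n p] by (simp add: linear_add linear_sum linear_cmul)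
  then show ?thesis
    using assms by (simp add: sum_xdir zcoef_def xcoef_def xdir_def e1_def e2_def mult.assoc)
qed

lemma weight_bounded:
  assumes "compact K" "0 \<notin> K" obtains C where "0 \<le> C" "\<And>p. p \<in> K \<Longrightarrow> weight \<gamma> \<alpha> p \<le> C"
proof -
  obtain C where "0 \<le> C" "\<And>p. p \<in> K \<Longrightarrow> \<bar>weight \<gamma> \<alpha> p\<bar> \<le> C"
    using continuous_bounded_compact[OF assms(1) continuous_on_weight[OF \<gamma> assms(2)]] by blast
  then show ?thesis using that[of C] by auto
qed

text \<open>The angle function in the weight contributes |z|^(2 \<gamma>), which exactly cancels the
  square of the singular factor 1/|z|^\<gamma> in \<open>zcoef\<close>. This is why Zu is square
  integrable for the weighted measure although only the X_i u are controlled.\<close>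

lemma weight_zcoef_le:
  assumes "p \<noteq> 0"
  shows "weight \<gamma> \<alpha> p * (zcoef \<gamma> i p)\<^sup>2 \<le> gauge_rho \<gamma> p powr (- 2 * \<alpha> - 4) * ((norm p)\<^sup>2 + (\<gamma> + 1)\<^sup>2 * (norm p)\<^sup>2 / gauge_rho \<gamma> p powr (2 * \<gamma>))"
proof -
  have r: "gauge_rho \<gamma> p > 0" using assms \<gamma> by (rule gauge_rho_pos[rotated])
  have comp: "(x $ a)\<^sup>2 \<le> (norm x)\<^sup>2" for x :: "real^'n::finite" and a
    using component_le_norm_cart[of x a] by (metis abs_ge_zero power2_abs power_mono)
  have fs: "(norm (fst p))\<^sup>2 \<le> (norm p)\<^sup>2" "(norm (snd p))\<^sup>2 \<le> (norm p)\<^sup>2"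
    by (simp_all add: norm_prod_def)
  have "angle_fun \<gamma> p * (zcoef \<gamma> i p)\<^sup>2 \<le> (norm p)\<^sup>2 + (\<gamma> + 1)\<^sup>2 * (norm p)\<^sup>2 / gauge_rho \<gamma> p powr (2 * \<gamma>)"
  proof (cases i)
    case (Inl a)
    have "angle_fun \<gamma> p * (zcoef \<gamma> i p)\<^sup>2 \<le> 1 * (norm p)\<^sup>2"
      using Inl order_trans[OF comp fs(1), of a] angle_fun_le_1[OF \<gamma>] by (intro mult_mono) (simp_all add: zcoef_def)
    moreover have "0 \<le> (\<gamma> + 1)\<^sup>2 * (norm p)\<^sup>2 / gauge_rho \<gamma> p powr (2 * \<gamma>)" by simp
    ultimately show ?thesis by linarith
  next
    case (Inr b)
    have "angle_fun \<gamma> p * (zcoef \<gamma> i p)\<^sup>2 \<le> (\<gamma> + 1)\<^sup>2 * (snd p $ b)\<^sup>2 / gauge_rho \<gamma> p powr (2 * \<gamma>)"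
    proof (cases "norm (fst p) = 0")
      case False
      have "(norm (fst p) powr \<gamma>)\<^sup>2 = norm (fst p) powr (2 * \<gamma>)" by (simp add: power2_eq_square powr_add[symmetric])
      then show ?thesis using False Inr by (simp add: zcoef_def angle_fun_def power_divide power_mult_distrib)
    qed (simp add: angle_fun_def)
    also have "\<dots> \<le> (\<gamma> + 1)\<^sup>2 * (norm p)\<^sup>2 / gauge_rho \<gamma> p powr (2 * \<gamma>)"
      using order_trans[OF comp fs(2), of b] by (intro divide_right_mono mult_left_mono) simp_all
    finally show ?thesis by (simp add: add_increasing)
  qed
  from mult_left_mono[OF this, of "gauge_rho \<gamma> p powr (- 2 * \<alpha> - 4)"]
  show ?thesis by (simp add: weight_def mult_ac)
qed

lemma weight_zcoef_bounded: obtains C where "0 \<le> C" "\<And>p. p \<in> A \<Longrightarrow> weight \<gamma> \<alpha> p * (zcoef \<gamma> i p)\<^sup>2 \<le> C"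
proof -
  let ?f = "\<lambda>p. gauge_rho \<gamma> p powr (- 2 * \<alpha> - 4) * ((norm p)\<^sup>2 + (\<gamma> + 1)\<^sup>2 * (norm p)\<^sup>2 / gauge_rho \<gamma> p powr (2 * \<gamma>))"
  have *: "gauge_rho \<gamma> p \<noteq> 0" "gauge_rho \<gamma> p powr x \<noteq> 0" if "p \<in> A" for p x
    using that A_nonzero \<gamma> gauge_rho_pos[of \<gamma> p] by (metis less_irrefl, metis less_irrefl powr_eq_0_iff)
  have "continuous_on A ?f"
    using * \<gamma> by (intro continuous_intros continuous_on_gauge_rho continuous_on_powr') auto
  from continuous_bounded_compact[OF A_compact this] obtain C where C: "0 \<le> C" "\<And>p. p \<in> A \<Longrightarrow> \<bar>?f p\<bar> \<le> C" by blast
  show ?thesis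
  proof (rule that[OF C(1)])
    fix p assume p: "p \<in> A"
    then have "p \<noteq> 0" using A_nonzero by auto
    from order_trans[OF weight_zcoef_le[OF this] order_trans[OF abs_ge_self C(2)[OF p]]]
    show "weight \<gamma> \<alpha> p * (zcoef \<gamma> i p)\<^sup>2 \<le> C" .
  qed
qed

lemma A_sets [measurable]: "A \<in> sets borel"
  using A_compact by (simp add: compact_imp_closed)

lemma AE_M: "(AE p in M. P p) \<longleftrightarrow> (AE p in lborel. 0 < weight \<gamma> \<alpha> p \<longrightarrow> P p)"
  unfolding M_def mu_def by (subst AE_density) simp_all

text \<open>The value of \<tau> balances two scalings: pulling back under
  \<open>dil \<gamma> y\<close>, the density contributes exp ((2 \<alpha> + 4) y) and Lebesgue
  measure exp (- Q y), in total exp (2 \<tau> y). Finite measure of the thickened support holds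
  because it is compact and does not contain 0.\<close>

sublocale dil_approx \<gamma> M \<tau> u zu un zun A
proof
  show sM: "sets M = sets borel" by (simp add: M_def mu_def)
  show "(\<integral>\<^sup>+p. w (dil \<gamma> y p) \<partial>M) = ennreal (exp (2 * \<tau> * y)) * (\<integral>\<^sup>+p. w p \<partial>M)"
    if [measurable]: "w \<in> borel_measurable borel" for w :: "(real^'m) \<times> (real^'k) \<Rightarrow> ennreal" and y
  proof -
    have "(\<integral>\<^sup>+p. w (dil \<gamma> y p) \<partial>M) = (\<integral>\<^sup>+p. ennreal (weight \<gamma> \<alpha> p) * w (dil \<gamma> y p) \<partial>lborel)"
      unfolding M_def mu_def by (simp add: nn_integral_density)
    also have "\<dots> = (\<integral>\<^sup>+p. ennreal (exp ((2 * \<alpha> + 4) * y)) * (ennreal (weight \<gamma> \<alpha> (dil \<gamma> y p)) * w (dil \<gamma> y p)) \<partial>lborel)"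
    proof (rule nn_integral_cong)
      fix p :: "(real^'m) \<times> (real^'k)"
      have "exp ((2 * \<alpha> + 4) * y) * weight \<gamma> \<alpha> (dil \<gamma> y p) = weight \<gamma> \<alpha> p"
        by (simp add: weight_dil[OF \<gamma>] exp_add[symmetric] algebra_simps flip: mult.assoc)
      then have "ennreal (exp ((2 * \<alpha> + 4) * y)) * ennreal (weight \<gamma> \<alpha> (dil \<gamma> y p)) = ennreal (weight \<gamma> \<alpha> p)"
        by (simp add: ennreal_mult[symmetric])
      then show "ennreal (weight \<gamma> \<alpha> p) * w (dil \<gamma> y p) = ennreal (exp ((2 * \<alpha> + 4) * y)) * (ennreal (weight \<gamma> \<alpha> (dil \<gamma> y p)) * w (dil \<gamma> y p))"
        by (simp add: mult.assoc[symmetric])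
    qed
    also have "\<dots> = ennreal (exp ((2 * \<alpha> + 4) * y)) * (\<integral>\<^sup>+p. ennreal (weight \<gamma> \<alpha> (dil \<gamma> y p)) * w (dil \<gamma> y p) \<partial>lborel)"
      by (rule nn_integral_cmult) simp
    also have "\<dots> = ennreal (exp ((2 * \<alpha> + 4) * y)) * (ennreal (exp (- hom_dim \<gamma> TYPE('m) TYPE('k) * y)) * (\<integral>\<^sup>+p. ennreal (weight \<gamma> \<alpha> p) * w p \<partial>lborel))"
      using nn_integral_dil_lborel[of "\<lambda>p. ennreal (weight \<gamma> \<alpha> p) * w p" \<gamma> y] by simp
    also have "\<dots> = (ennreal (exp ((2 * \<alpha> + 4) * y)) * ennreal (exp (- hom_dim \<gamma> TYPE('m) TYPE('k) * y))) * (\<integral>\<^sup>+p. w p \<partial>M)"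
      unfolding M_def mu_def by (simp add: nn_integral_density mult.assoc)
    also have "ennreal (exp ((2 * \<alpha> + 4) * y)) * ennreal (exp (- hom_dim \<gamma> TYPE('m) TYPE('k) * y)) = ennreal (exp (2 * \<tau> * y))"
      by (simp add: ennreal_mult[symmetric] exp_add[symmetric] \<tau>_def algebra_simps)
    finally show ?thesis .
  qed
  obtain C where C: "0 \<le> C" "\<And>p. p \<in> A \<Longrightarrow> weight \<gamma> \<alpha> p \<le> C" using weight_bounded[OF A_compact A_nonzero] by blast
  show "L2conv M un u"
    unfolding M_def mu_def using L2conv_density[OF conv_un, of "weight \<gamma> \<alpha>" "\<lambda>_. 1" A C] C un_zero u_zero by simp
  have "L2conv M (\<lambda>n p. \<Sum>i\<in>UNIV. zcoef \<gamma> i p * (xcoef \<gamma> i p * Dun n p (xdir i))) zu"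
    unfolding zu_def[abs_def]
  proof (rule L2conv_sum)
    fix i
    obtain C where "0 \<le> C" "\<And>p. p \<in> A \<Longrightarrow> weight \<gamma> \<alpha> p * (zcoef \<gamma> i p)\<^sup>2 \<le> C" using weight_zcoef_bounded by blast
    then show "L2conv M (\<lambda>n p. zcoef \<gamma> i p * (xcoef \<gamma> i p * Dun n p (xdir i))) (\<lambda>p. zcoef \<gamma> i p * g i p)"
      unfolding M_def mu_def by (intro L2conv_density[OF conv_g, where A=A and C=C]) (simp_all add: Dun_zero g_zero)
  qed simp
  then show "L2conv M zun zu"
  proof (rule L2conv_AE_cong_seq)
    show "zun n \<in> borel_measurable M" for n
      using borel_measurable_continuous_onI[OF zun_cont, of n] measurable_cong_sets[OF sM refl] by blast
    show "AE p in M. (\<Sum>i\<in>UNIV. zcoef \<gamma> i p * (xcoef \<gamma> i p * Dun n p (xdir i))) = zun n p" for n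
      unfolding AE_M using null_fst_zero by eventually_elim (simp add: zun_eq)
  qed
  show "((\<lambda>s. un n (dil \<gamma> s p)) has_real_derivative zun n (dil \<gamma> s p)) (at s)" for n p s
  proof -
    have "((\<lambda>s. dil \<gamma> s p) has_derivative (\<lambda>h. h *\<^sub>R zvec \<gamma> (dil \<gamma> s p))) (at s)"
      unfolding dil_def[abs_def] zvec_def
      by (auto intro!: derivative_eq_intros simp: fun_eq_iff algebra_simps)
    from has_derivative_compose[OF this deriv, of n]
    have "((\<lambda>s. un n (dil \<gamma> s p)) has_derivative (\<lambda>h. Dun n (dil \<gamma> s p) (h *\<^sub>R zvec \<gamma> (dil \<gamma> s p)))) (at s)" .
    then show ?thesis
      using Dun_linear[of n "dil \<gamma> s p"]
      by (simp add: has_field_derivative_def zun_def linear_cmul mult.commute[of _ "Dun _ _ _"] ext)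
  qed
  show "continuous_on UNIV (un n)" for n
    by (intro continuous_at_imp_continuous_on ballI has_derivative_continuous[OF deriv])
  show "continuous_on UNIV (zun n)" for n by (rule zun_cont)
  show "un n p = 0" "zun n p = 0" if "p \<notin> A" for n p using that by (simp_all add: un_zero zun_def Dun_zero)
  show "u p = 0" "zu p = 0" if "p \<notin> A" for p using that by (simp_all add: u_zero zu_def g_zero)
  show "compact A" by (rule A_compact)
  let ?T = "(\<lambda>x. dil \<gamma> (fst x) (snd x)) ` ({-1..1} \<times> A)"
  have cT: "compact ?T"
    using A_compact by (intro compact_continuous_image continuous_on_subset[OF continuous_on_dil2] compact_Times) auto
  have zT: "0 \<notin> ?T"
  proof
    assume "0 \<in> ?T"
    then obtain s p where p: "p \<in> A" "dil \<gamma> s p = 0" by auto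
    then have "p = dil \<gamma> (- s) 0" using dil_dil_inverse(1)[of \<gamma> s p] by simp
    then have "p = 0" by (simp add: dil_def zero_prod_def)
    with p A_nonzero show False by simp
  qed
  obtain C' where C': "0 \<le> C'" "\<And>p. p \<in> ?T \<Longrightarrow> weight \<gamma> \<alpha> p \<le> C'" using weight_bounded[OF cT zT] by blast
  have T: "?T \<in> sets borel" using cT by (simp add: compact_imp_closed)
  have "emeasure M ?T = (\<integral>\<^sup>+p. ennreal (weight \<gamma> \<alpha> p) * indicator ?T p \<partial>lborel)"
    unfolding M_def mu_def using T by (subst emeasure_density) simp_all
  also have "\<dots> \<le> (\<integral>\<^sup>+p. ennreal C' * indicator ?T p \<partial>lborel)"
    using C'(2) by (intro nn_integral_mono) (simp add: indicator_def ennreal_leI)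
  also have "\<dots> = ennreal C' * emeasure lborel ?T" using T by (simp add: nn_integral_cmult_indicator)
  also have "\<dots> < \<infinity>" using emeasure_bounded_finite[OF compact_imp_bounded[OF cT]] by (simp add: ennreal_mult_less_top)
  finally show "emeasure M ?T < \<infinity>" .
  have sf: "sigma_finite_measure M"
    unfolding M_def mu_def by (subst sigma_finite_measure.sigma_finite_iff_density_finite[OF lborel.sigma_finite_measure_axioms]) simp_all
  show "\<exists>A. countable A \<and> A \<subseteq> sets M \<and> \<Union>A = space M \<and> (\<forall>a\<in>A. emeasure M a \<noteq> \<infinity>)"
    by (rule sigma_finite_measure.sigma_finite_countable[OF sf])
qed

lemma thick_nonzero: "0 \<notin> thick"
proof
  assume "0 \<in> thick"
  then obtain s p where p: "p \<in> A" "dil \<gamma> s p = 0" unfolding thick_def by auto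
  then have "p = dil \<gamma> (- s) 0" using dil_dil_inverse(1)[of \<gamma> s p] by simp
  then have "p = 0" by (simp add: dil_def zero_prod_def)
  with p A_nonzero show False by simp
qed

end

section \<open>The form with weight \<rho>^(-b) and its symmetry\<close>

lemma dil_xdir: "dil \<gamma> h (xdir i) = exp (case i of Inl _ \<Rightarrow> h | Inr _ \<Rightarrow> (\<gamma> + 1) * h) *\<^sub>R xdir i"
  by (simp add: dil_def xdir_def split: sum.split)

text \<open>Homogeneity of degree one of X_i: applied to a function composed with the dilation by h,
  it gives exp h times the dilated X_i-derivative, in the t-directions as well as in the
  z-directions.\<close>

lemma xcoef_dil:
  "xcoef \<gamma> i p * exp (case i of Inl _ \<Rightarrow> h | Inr _ \<Rightarrow> (\<gamma> + 1) * h) = exp h * xcoef \<gamma> i (dil \<gamma> h p)"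
proof (cases i)
  case (Inr b)
  have "exp h powr \<gamma> = exp (\<gamma> * h)" by (simp add: powr_def)
  then have "exp ((\<gamma> + 1) * h) = exp h * exp h powr \<gamma>" by (simp add: exp_add[symmetric] algebra_simps)
  with Inr show ?thesis by (simp add: xcoef_def dil_def powr_mult)
qed (simp add: xcoef_def)

lemma has_derivative_dil: "(dil \<gamma> h has_derivative dil \<gamma> h) (at p)"
  unfolding dil_def[abs_def] by (auto intro!: derivative_eq_intros)

context S22_weighted begin

abbreviation "b \<equiv> 2 * \<alpha> + 2"

text \<open>The weight \<rho>^(-b) of the form, written as a power of \<open>gauge_S\<close> so that
  its derivative \<open>W'\<close> exists wherever p is nonzero, even at z = 0.\<close>

definition W where "W p = gauge_S \<gamma> p powr (- b / (2 * (\<gamma> + 1)))" for p :: "(real^'m) \<times> (real^'k)"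

definition W' where "W' p v = (- b / (2 * (\<gamma> + 1))) * gauge_S \<gamma> p powr (- b / (2 * (\<gamma> + 1)) - 1) * gauge_S' \<gamma> p v"
  for p v :: "(real^'m) \<times> (real^'k)"

lemma W_deriv: assumes "p \<noteq> 0" shows "(W has_derivative W' p) (at p)"
proof -
  define \<beta> where "\<beta> = - b / (2 * (\<gamma> + 1))"
  have S: "gauge_S \<gamma> p > 0" using assms by (rule gauge_S_pos[OF \<gamma>])
  have "((\<lambda>p. gauge_S \<gamma> p powr \<beta>) has_derivative (\<lambda>v. (gauge_S \<gamma> p powr \<beta>) * (0 * ln (gauge_S \<gamma> p) + gauge_S' \<gamma> p v * \<beta> / gauge_S \<gamma> p))) (at p)"
    using S by (intro has_derivative_powr gauge_S_has_derivative[OF \<gamma>] has_derivative_const) auto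
  moreover have "(gauge_S \<gamma> p powr \<beta>) * (0 * ln (gauge_S \<gamma> p) + gauge_S' \<gamma> p v * \<beta> / gauge_S \<gamma> p) = W' p v" for v
    using S unfolding W'_def \<beta>_def[symmetric] by (simp add: powr_diff)
  ultimately show ?thesis unfolding W_def[abs_def] \<beta>_def by (simp only:)
qed

lemma W_rho: "W p = gauge_rho \<gamma> p powr (- b)"
  using \<gamma> by (simp add: W_def gauge_S_rho powr_powr)

lemma W_measurable [measurable]: "W \<in> borel_measurable borel"
  unfolding W_def[abs_def] by simp

lemma W_dil: "W (dil \<gamma> y p) = exp (- b * y) * W p"
  using \<gamma> by (simp add: W_rho gauge_rho_dil powr_mult powr_def[of "exp _"])

text \<open>Translates between the form, taken with Lebesgue measure and \<open>W\<close>, and the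
  inner product of L2(M), where \<rho>^2/\<psi> multiplies the operator.\<close>

lemma W_weight:
  assumes "angle_fun \<gamma> p \<noteq> 0" shows "W p = weight \<gamma> \<alpha> p * ((gauge_rho \<gamma> p)\<^sup>2 / angle_fun \<gamma> p)"
proof -
  have "p \<noteq> 0" using assms \<gamma> by (auto simp: angle_fun_def)
  then have r: "gauge_rho \<gamma> p > 0" by (rule gauge_rho_pos[OF \<gamma>])
  then have "gauge_rho \<gamma> p powr (- b) = gauge_rho \<gamma> p powr (- 2 * \<alpha> - 4) * (gauge_rho \<gamma> p)\<^sup>2"
    by (simp add: powr_add[symmetric] algebra_simps flip: powr_numeral)
  then show ?thesis using assms by (simp add: W_rho weight_def)
qed

lemma xcoef_gauge_S': "xcoef \<gamma> i p * gauge_S' \<gamma> p (xdir i) = 2 * (\<gamma> + 1) * norm (fst p) powr (2 * \<gamma>) * zcoef \<gamma> i p"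
proof (cases i)
  case (Inl a)
  then show ?thesis by (simp add: xcoef_def gauge_S'_def xdir_def zcoef_def inner_axis)
next
  case (Inr b)
  have "norm (fst p) powr (2 * \<gamma>) / norm (fst p) powr \<gamma> = norm (fst p) powr \<gamma>"
    by (cases "norm (fst p) = 0") (simp_all add: powr_diff[symmetric])
  then have "norm (fst p) powr (2 * \<gamma>) * ((\<gamma> + 1) * snd p $ b / norm (fst p) powr \<gamma>) = norm (fst p) powr \<gamma> * ((\<gamma> + 1) * snd p $ b)"
    by (metis (no_types, opaque_lifting) mult.commute times_divide_eq_left)
  then show ?thesis using Inr by (simp add: xcoef_def gauge_S'_def xdir_def zcoef_def inner_axis mult_ac)
qed

text \<open>The product rule term of the form: X\<rho> \<cdot> Xu = (\<psi>/\<rho>) Zu, so summing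
  X_i(\<rho>^(-b)) X_i u gives -b times the weight times Zu. This is the origin of the first-order
  term b Zu.\<close>

lemma xcoef_W': assumes "p \<noteq> 0" shows "xcoef \<gamma> i p * W' p (xdir i) = - b * (weight \<gamma> \<alpha> p * zcoef \<gamma> i p)"
proof -
  define \<beta> where "\<beta> = - b / (2 * (\<gamma> + 1))"
  have r: "gauge_rho \<gamma> p > 0" using assms by (rule gauge_rho_pos[OF \<gamma>])
  have "xcoef \<gamma> i p * W' p (xdir i) = \<beta> * gauge_S \<gamma> p powr (\<beta> - 1) * (xcoef \<gamma> i p * gauge_S' \<gamma> p (xdir i))"
    unfolding W'_def \<beta>_def by simp
  also have "\<dots> = (\<beta> * (2 * (\<gamma> + 1))) * (gauge_S \<gamma> p powr (\<beta> - 1) * norm (fst p) powr (2 * \<gamma>)) * zcoef \<gamma> i p"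
    unfolding xcoef_gauge_S' by simp
  also have "\<beta> * (2 * (\<gamma> + 1)) = - b" using \<gamma> by (simp add: \<beta>_def)
  also have "gauge_S \<gamma> p powr (\<beta> - 1) = gauge_rho \<gamma> p powr (- 2 * \<alpha> - 4 - 2 * \<gamma>)"
  proof -
    have "2 * (\<gamma> + 1) * (\<beta> - 1) = - 2 * \<alpha> - 4 - 2 * \<gamma>" using \<gamma> by (simp add: \<beta>_def field_simps)
    then show ?thesis by (simp only: gauge_S_rho[OF \<gamma>] powr_powr)
  qed
  also have "gauge_rho \<gamma> p powr (- 2 * \<alpha> - 4 - 2 * \<gamma>) * norm (fst p) powr (2 * \<gamma>) = weight \<gamma> \<alpha> p"
    using r by (simp add: weight_def angle_fun_def powr_diff)
  finally show ?thesis by simp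
qed

lemma W_cont: "0 \<notin> B \<Longrightarrow> continuous_on B W"
  by (intro continuous_at_imp_continuous_on ballI has_derivative_continuous[OF W_deriv]) auto

lemma W'_cont: assumes "0 \<notin> B" shows "continuous_on B (\<lambda>p. W' p v)"
proof -
  have "gauge_S \<gamma> p > 0" if "p \<in> B" for p using that assms by (intro gauge_S_pos[OF \<gamma>]) auto
  then show ?thesis unfolding W'_def using \<gamma>
    by (intro continuous_intros continuous_on_gauge_S continuous_on_gauge_S' continuous_on_powr') fastforce+
qed

definition G where "G i n p = xcoef \<gamma> i p * Dun n p (xdir i)"

lemma conv_G: "L2conv lborel (G i) (g i)"
  using conv_g[of i] by (simp add: G_def[abs_def])

lemma G_measurable [measurable]: "G i n \<in> borel_measurable borel"
  using L2convD(1)[OF conv_G] by (simp add: sqint_def)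

text \<open>A second instance of the scaling law, with -Q/2 in the role of \<tau>: the terms of the
  form are integrals against Lebesgue measure.\<close>

lemma dil_measure_lborel: "dil_measure \<gamma> (lborel :: ((real^'m) \<times> (real^'k)) measure) (- hom_dim \<gamma> TYPE('m) TYPE('k) / 2)"
  by unfold_locales (simp_all add: nn_integral_dil_lborel)

lemma L2conv_dil:
  fixes f :: "(real^'m) \<times> (real^'k) \<Rightarrow> real"
  assumes "L2conv lborel fn f"
  shows "L2conv lborel (\<lambda>n p. c * fn n (dil \<gamma> h p)) (\<lambda>p. c * f (dil \<gamma> h p))"
proof -
  interpret L: dil_measure \<gamma> "lborel :: ((real^'m) \<times> (real^'k)) measure" "- hom_dim \<gamma> TYPE('m) TYPE('k) / 2"
    by (rule dil_measure_lborel)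
  define e where "e = exp (hom_dim \<gamma> TYPE('m) TYPE('k) / 2 * h)"
  have "L2conv lborel (\<lambda>n p. (c / e) * L.U h (fn n) p) (\<lambda>p. (c / e) * L.U h f p)"
    by (rule L2conv_cmult[OF L.L2conv_U[OF assms]])
  moreover have "(c / e) * L.U h k p = c * k (dil \<gamma> h p)" for k p
    unfolding L.U_def e_def by simp
  ultimately show ?thesis by simp
qed

lemma sqint_mult_A:
  assumes "0 \<notin> B \<Longrightarrow> continuous_on B c" "compact B" "0 \<notin> B" "c \<in> borel_measurable borel" "sqint lborel f"
  shows "sqint lborel (\<lambda>p. (indicator B p * c p) * f p)"
proof -
  obtain C where "0 \<le> C" "\<And>p. p \<in> B \<Longrightarrow> \<bar>c p\<bar> \<le> C" using continuous_bounded_compact assms by metis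
  then show ?thesis using assms
    by (intro sqint_bounded_mult[where C=C]) (auto simp: compact_imp_closed split: split_indicator)
qed

lemma W'_measurable [measurable]: "(\<lambda>p. W' p v) \<in> borel_measurable borel"
proof -
  have "(\<lambda>p::(real^'m) \<times> (real^'k). gauge_S' \<gamma> p v) \<in> borel_measurable borel"
    by (intro borel_measurable_continuous_onI continuous_on_gauge_S' \<gamma>)
  then show ?thesis unfolding W'_def by simp
qed

lemma sqint_mult_g:
  assumes "continuous_on A c" "c \<in> borel_measurable borel"
  shows "sqint lborel (\<lambda>p. c p * g i p)"
proof -
  have "sqint lborel (\<lambda>p. (indicator A p * c p) * g i p)"
    by (rule sqint_mult_A[OF assms(1) A_compact A_nonzero assms(2) L2convD(2)[OF conv_G]])
  also have "(\<lambda>p. (indicator A p * c p) * g i p) = (\<lambda>p. c p * g i p)"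
    using g_zero by (auto simp: fun_eq_iff indicator_def simp del: split_paired_All)
  finally show ?thesis .
qed

lemma sqint_W'_g: "sqint lborel (\<lambda>p. xcoef \<gamma> i p * W' p (xdir i) * g i p)"
  using A_nonzero by (intro sqint_mult_g continuous_intros continuous_on_xcoef \<gamma> W'_cont) simp_all

lemma sqint_W_g: "sqint lborel (\<lambda>p. W p * g i p)"
  using A_nonzero by (intro sqint_mult_g W_cont) simp_all

text \<open>The weak relation between \<open>hh i\<close> and \<open>g i\<close>, tested with
  \<rho>^(-b) times the odd part of the orbit of \<open>un n\<close>. Only this test function is
  smooth; the other factor is already the limit \<open>g i\<close>. The last integral contains the
  dilated derivatives by homogeneity of X_i.\<close>

lemma energy_approx:
  assumes h: "\<bar>h\<bar> \<le> 1"
  defines "w \<equiv> \<lambda>n p. U h (un n) p - U (- h) (un n) p"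
  shows "(\<integral>p. hh i p * (W p * w n p) \<partial>lborel)
    = - (\<integral>p. (xcoef \<gamma> i p * W' p (xdir i) * g i p) * w n p \<partial>lborel)
      - (\<integral>p. (W p * g i p) * (exp ((1 - \<tau>) * h) * G i n (dil \<gamma> h p) - exp (- (1 - \<tau>) * h) * G i n (dil \<gamma> (- h) p)) \<partial>lborel)"
proof -
  define Dw where "Dw s p v = exp (- \<tau> * s) * Dun n (dil \<gamma> s p) (dil \<gamma> s v)" for s p v
  have Dw: "(U s (un n) has_derivative Dw s p) (at p)" for s p
    unfolding U_def[abs_def] Dw_def[abs_def]
    by (intro has_derivative_mult_right has_derivative_compose[OF has_derivative_dil deriv])
  have Dw_x: "xcoef \<gamma> i p * Dw s p (xdir i) = exp ((1 - \<tau>) * s) * G i n (dil \<gamma> s p)" for s p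
  proof -
    define e where "e = exp (case i of Inl _ \<Rightarrow> s | Inr _ \<Rightarrow> (\<gamma> + 1) * s)"
    have "xcoef \<gamma> i p * Dw s p (xdir i) = exp (- \<tau> * s) * ((xcoef \<gamma> i p * e) * Dun n (dil \<gamma> s p) (xdir i))"
      unfolding Dw_def dil_xdir e_def[symmetric] using Dun_linear[of n "dil \<gamma> s p"] by (simp add: linear_cmul mult_ac)
    also have "xcoef \<gamma> i p * e = exp s * xcoef \<gamma> i (dil \<gamma> s p)" unfolding e_def by (rule xcoef_dil)
    also have "exp (- \<tau> * s) * (exp s * xcoef \<gamma> i (dil \<gamma> s p) * Dun n (dil \<gamma> s p) (xdir i)) = (exp (- \<tau> * s) * exp s) * G i n (dil \<gamma> s p)"
      by (simp add: G_def mult_ac)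
    also have "exp (- \<tau> * s) * exp s = exp ((1 - \<tau>) * s)" by (simp add: exp_add[symmetric] algebra_simps)
    finally show ?thesis .
  qed
  define w' where "w' p = Dw h p (xdir i) - Dw (- h) p (xdir i)" for p
  define F where "F p = W p * w n p" for p
  define F' where "F' p = W' p (xdir i) * w n p + W p * w' p" for p
  have wd: "(w n has_derivative (\<lambda>v. Dw h p v - Dw (- h) p v)) (at p)" for p
    unfolding w_def by (rule has_derivative_diff[OF Dw Dw])
  have w_zero: "w n p = 0" "w' p = 0" if "p \<notin> thick" for p
  proof -
    have "dil \<gamma> h p \<notin> A" "dil \<gamma> (- h) p \<notin> A" using dil_in_A[of h p] dil_in_A[of "- h" p] h that by auto
    then show "w n p = 0" "w' p = 0" by (simp_all add: w_def U_def un_zero w'_def Dw_def Dun_zero)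
  qed
  have w_cont: "continuous_on UNIV (w n)"
    by (intro continuous_at_imp_continuous_on ballI has_derivative_continuous[OF wd])
  have Dw_cont: "continuous_on UNIV (\<lambda>p. Dw s p v)" for s v
    unfolding Dw_def by (intro continuous_intros continuous_on_compose2[OF cont continuous_on_dil]) auto
  then have w'_cont: "continuous_on UNIV w'" unfolding w'_def by (intro continuous_intros)
  have dd: "has_dd (xdir i) F F'"
    unfolding has_dd_def
  proof
    fix p
    show "((\<lambda>h. F (p + h *\<^sub>R xdir i)) has_real_derivative F' p) (at 0)"
    proof (cases "p = 0")
      case False
      from has_derivative_mult[OF W_deriv[OF False] wd[of p]]
      have "(F has_derivative (\<lambda>v. W p * (Dw h p v - Dw (- h) p v) + W' p v * w n p)) (at p)" by (simp add: F_def[abs_def])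
      from partial_eq(2)[OF this, of "xdir i"] show ?thesis by (simp add: F'_def w'_def add.commute)
    next
      \<comment> \<open>The weight is singular at the origin, but \<open>thick\<close> is closed and
        does not contain it, so \<open>F\<close> vanishes in a neighbourhood.\<close>
      case True
      have "isCont (\<lambda>h. p + h *\<^sub>R xdir i) (0::real)" by (intro continuous_intros)
      then have "((\<lambda>h. p + h *\<^sub>R xdir i) \<longlongrightarrow> p) (nhds (0::real))" by (simp add: continuous_within tendsto_nhds_iff)
      moreover have "open (- thick)" "p \<in> - thick" using compact_thick thick_nonzero True by (auto simp: open_Compl compact_imp_closed)
      ultimately have "\<forall>\<^sub>F h in nhds (0::real). p + h *\<^sub>R xdir i \<in> - thick" by (rule topological_tendstoD)
      then have ev: "\<forall>\<^sub>F h in nhds (0::real). F (p + h *\<^sub>R xdir i) = 0"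
        by eventually_elim (simp add: F_def w_zero)
      have "F' p = 0" using w_zero[of p] thick_nonzero True by (simp add: F'_def)
      moreover have "((\<lambda>h. F (p + h *\<^sub>R xdir i)) has_real_derivative 0) (at 0)"
        by (rule iffD2[OF DERIV_cong_ev[OF refl ev refl]]) simp
      ultimately show ?thesis by simp
    qed
  qed
  have Wc: "continuous_on thick W" "continuous_on thick (\<lambda>p. W' p (xdir i))"
    using thick_nonzero by (intro W_cont W'_cont; simp)+
  have c: "continuous_on thick F" "continuous_on thick F'"
    unfolding F_def[abs_def] F'_def[abs_def]
    by (intro continuous_intros Wc continuous_on_subset[OF w_cont] continuous_on_subset[OF w'_cont] subset_UNIV)+
  obtain B1 where B1: "0 \<le> B1" "\<And>p. p \<in> thick \<Longrightarrow> \<bar>F p\<bar> \<le> B1" using continuous_bounded_compact[OF compact_thick c(1)] by blast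
  obtain B2 where B2: "0 \<le> B2" "\<And>p. p \<in> thick \<Longrightarrow> \<bar>F' p\<bar> \<le> B2" using continuous_bounded_compact[OF compact_thick c(2)] by blast
  have Fz: "F p = 0" "F' p = 0" if "p \<notin> thick" for p using w_zero[OF that] by (simp_all add: F_def F'_def)
  have [measurable]: "w n \<in> borel_measurable borel" "w' \<in> borel_measurable borel"
    using w_cont w'_cont by (auto intro: borel_measurable_continuous_onI)
  have F_bd: "\<bar>F p\<bar> \<le> B1" "\<bar>F' p\<bar> \<le> B2" for p using B1 B2 Fz[of p] by (cases "p \<in> thick"; simp)+
  have "(\<integral>p. hh i p * F p \<partial>lborel) = - (\<integral>p. g i p * (xcoef \<gamma> i p * F' p) \<partial>lborel)"
  proof (rule weak[OF dd, where B="max B1 B2" and K=thick])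
    show "F \<in> borel_measurable borel" "F' \<in> borel_measurable borel" unfolding F_def[abs_def] F'_def[abs_def] by measurable
    show "\<bar>F p\<bar> \<le> max B1 B2" "\<bar>F' p\<bar> \<le> max B1 B2" for p using F_bd[of p] by (simp_all add: max.coboundedI1 max.coboundedI2)
  qed (simp_all add: compact_thick Fz)
  also have "(\<integral>p. g i p * (xcoef \<gamma> i p * F' p) \<partial>lborel) = (\<integral>p. (xcoef \<gamma> i p * W' p (xdir i) * g i p) * w n p
      + (W p * g i p) * (exp ((1 - \<tau>) * h) * G i n (dil \<gamma> h p) - exp (- (1 - \<tau>) * h) * G i n (dil \<gamma> (- h) p)) \<partial>lborel)"
  proof (rule Bochner_Integration.integral_cong[OF refl])
    fix p
    have "xcoef \<gamma> i p * w' p = exp ((1 - \<tau>) * h) * G i n (dil \<gamma> h p) - exp (- (1 - \<tau>) * h) * G i n (dil \<gamma> (- h) p)"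
      unfolding w'_def right_diff_distrib Dw_x by (simp add: algebra_simps)
    note eq = this
    show "g i p * (xcoef \<gamma> i p * F' p) = (xcoef \<gamma> i p * W' p (xdir i) * g i p) * w n p
      + (W p * g i p) * (exp ((1 - \<tau>) * h) * G i n (dil \<gamma> h p) - exp (- (1 - \<tau>) * h) * G i n (dil \<gamma> (- h) p))"
      unfolding eq[symmetric] F'_def by (simp only: distrib_left mult_ac)
  qed
  also have "\<dots> = (\<integral>p. (xcoef \<gamma> i p * W' p (xdir i) * g i p) * w n p \<partial>lborel)
      + (\<integral>p. (W p * g i p) * (exp ((1 - \<tau>) * h) * G i n (dil \<gamma> h p) - exp (- (1 - \<tau>) * h) * G i n (dil \<gamma> (- h) p)) \<partial>lborel)"
  proof (rule Bochner_Integration.integral_add)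
    have sw: "sqint lborel (w n)" using w_zero by (intro sqint_continuous_compact[OF w_cont compact_thick]) auto
    show "integrable lborel (\<lambda>p. xcoef \<gamma> i p * W' p (xdir i) * g i p * w n p)"
      by (rule sqint_mult_integrable[OF sqint_W'_g sw])
    show "integrable lborel (\<lambda>p. (W p * g i p) * (exp ((1 - \<tau>) * h) * G i n (dil \<gamma> h p) - exp (- (1 - \<tau>) * h) * G i n (dil \<gamma> (- h) p)))"
      by (rule sqint_mult_integrable[OF sqint_W_g]) (intro sqint_diff L2convD(1)[OF L2conv_dil[OF conv_G]])
  qed
  finally show ?thesis by (simp add: F_def)
qed

text \<open>After n tends to infinity the principal part pairs \<open>g i\<close> with the odd part
  of its own orbit, and this vanishes by symmetry. What survives is the derivative of the weight,
  which is b times the pairing with \<open>zu\<close>.\<close>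

lemma energy_weak:
  assumes h: "\<bar>h\<bar> \<le> 1"
  defines "w \<equiv> \<lambda>p. U h u p - U (- h) u p"
  shows "(\<integral>p. (indicator thick p * W p * (\<Sum>i\<in>UNIV. hh i p)) * w p \<partial>lborel) = b * (\<integral>p. zu p * w p \<partial>M)"
proof -
  define wn where "wn n p = U h (un n) p - U (- h) (un n) p" for n p
  have wn: "L2conv lborel wn w"
    unfolding wn_def[abs_def] w_def U_def by (intro L2conv_diff L2conv_dil conv_un)
  have wn_zero: "wn n p = 0" "w p = 0" if "p \<notin> thick" for n p
  proof -
    have "dil \<gamma> h p \<notin> A" "dil \<gamma> (- h) p \<notin> A" using dil_in_A[of h p] dil_in_A[of "- h" p] h that by auto
    then show "wn n p = 0" "w p = 0" by (simp_all add: wn_def w_def U_def un_zero u_zero)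
  qed
  have sh: "sqint lborel (\<lambda>p. (indicator thick p * W p) * hh i p)" for i
    by (rule sqint_mult_A[OF W_cont compact_thick thick_nonzero _ hh]) simp_all
  \<comment> \<open>This fixes the exponent b: the substitution gives exp (- Q s) from Lebesgue
    measure and exp (b s) from the weight, and (1 - \<tau>) - Q + b = -(1 - \<tau>) holds exactly
    for b = 2 \<alpha> + 2.\<close>
  have sym: "exp ((1 - \<tau>) * s) * (\<integral>p. (W p * g i p) * g i (dil \<gamma> s p) \<partial>lborel)
      = exp (- (1 - \<tau>) * s) * (\<integral>p. (W p * g i p) * g i (dil \<gamma> (- s) p) \<partial>lborel)" for s i
  proof -
    interpret L: dil_measure \<gamma> "lborel :: ((real^'m) \<times> (real^'k)) measure" "- hom_dim \<gamma> TYPE('m) TYPE('k) / 2"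
      by (rule dil_measure_lborel)
    let ?Q = "hom_dim \<gamma> TYPE('m) TYPE('k)"
    have "(\<integral>p. (W p * g i p) * g i (dil \<gamma> s p) \<partial>lborel)
      = (\<integral>p. (\<lambda>p. (W (dil \<gamma> (- s) p) * g i (dil \<gamma> (- s) p)) * g i p) (dil \<gamma> s p) \<partial>lborel)" by simp
    also have "\<dots> = exp (2 * (- ?Q / 2) * s) * (\<integral>p. (W (dil \<gamma> (- s) p) * g i (dil \<gamma> (- s) p)) * g i p \<partial>lborel)"
      by (rule L.integral_dil) simp
    also have "(\<integral>p. (W (dil \<gamma> (- s) p) * g i (dil \<gamma> (- s) p)) * g i p \<partial>lborel) = (\<integral>p. exp (b * s) * ((W p * g i p) * g i (dil \<gamma> (- s) p)) \<partial>lborel)"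
      by (rule Bochner_Integration.integral_cong) (simp_all add: W_dil algebra_simps)
    also have "\<dots> = exp (b * s) * (\<integral>p. (W p * g i p) * g i (dil \<gamma> (- s) p) \<partial>lborel)" by simp
    finally have "exp ((1 - \<tau>) * s) * (\<integral>p. (W p * g i p) * g i (dil \<gamma> s p) \<partial>lborel)
      = (exp ((1 - \<tau>) * s) * exp (2 * (- ?Q / 2) * s) * exp (b * s)) * (\<integral>p. (W p * g i p) * g i (dil \<gamma> (- s) p) \<partial>lborel)"
      by (simp only: mult.assoc)
    also have "exp ((1 - \<tau>) * s) * exp (2 * (- ?Q / 2) * s) * exp (b * s) = exp (- (1 - \<tau>) * s)"
      by (simp add: exp_add[symmetric] \<tau>_def algebra_simps)
    finally show ?thesis .
  qed
  have each: "(\<integral>p. ((indicator thick p * W p) * hh i p) * w p \<partial>lborel) = - (\<integral>p. (xcoef \<gamma> i p * W' p (xdir i) * g i p) * w p \<partial>lborel)" for i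
  proof -
    define kn where "kn n p = exp ((1 - \<tau>) * h) * G i n (dil \<gamma> h p) - exp (- (1 - \<tau>) * h) * G i n (dil \<gamma> (- h) p)" for n p
    define k where "k p = exp ((1 - \<tau>) * h) * g i (dil \<gamma> h p) - exp (- (1 - \<tau>) * h) * g i (dil \<gamma> (- h) p)" for p
    have kn: "L2conv lborel kn k" unfolding kn_def[abs_def] k_def[abs_def]
      by (intro L2conv_diff L2conv_dil conv_G)
    have ig: "integrable lborel (\<lambda>p. (W p * g i p) * (c * g i (dil \<gamma> s p)))" for c s
      by (intro sqint_mult_integrable[OF sqint_W_g] L2convD(2)[OF L2conv_dil[OF conv_G]])
    have "(\<integral>p. (W p * g i p) * k p \<partial>lborel)
      = (\<integral>p. (W p * g i p) * (exp ((1 - \<tau>) * h) * g i (dil \<gamma> h p)) \<partial>lborel) - (\<integral>p. (W p * g i p) * (exp (- (1 - \<tau>) * h) * g i (dil \<gamma> (- h) p)) \<partial>lborel)"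
      unfolding k_def right_diff_distrib by (rule Bochner_Integration.integral_diff[OF ig ig])
    also have "\<dots> = exp ((1 - \<tau>) * h) * (\<integral>p. (W p * g i p) * g i (dil \<gamma> h p) \<partial>lborel) - exp (- (1 - \<tau>) * h) * (\<integral>p. (W p * g i p) * g i (dil \<gamma> (- h) p) \<partial>lborel)"
      by (simp only: mult.left_commute[of _ "exp _"] integral_mult_right_zero)
    also have "\<dots> = 0" using sym[of h i] by simp
    finally have k0: "(\<integral>p. (W p * g i p) * k p \<partial>lborel) = 0" .
    have "(\<integral>p. ((indicator thick p * W p) * hh i p) * wn n p \<partial>lborel) = - (\<integral>p. (xcoef \<gamma> i p * W' p (xdir i) * g i p) * wn n p \<partial>lborel) - (\<integral>p. (W p * g i p) * kn n p \<partial>lborel)" for n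
    proof -
      have "(\<integral>p. ((indicator thick p * W p) * hh i p) * wn n p \<partial>lborel) = (\<integral>p. hh i p * (W p * wn n p) \<partial>lborel)"
      proof (rule Bochner_Integration.integral_cong[OF refl])
        show "((indicator thick p * W p) * hh i p) * wn n p = hh i p * (W p * wn n p)" for p
          by (cases "p \<in> thick") (simp_all add: wn_zero)
      qed
      then show ?thesis using energy_approx[OF h, of i n] by (simp add: wn_def kn_def)
    qed
    moreover have "(\<lambda>n. \<integral>p. ((indicator thick p * W p) * hh i p) * wn n p \<partial>lborel) \<longlonglongrightarrow> (\<integral>p. ((indicator thick p * W p) * hh i p) * w p \<partial>lborel)"
      by (rule L2conv_integral_mult[OF wn sh])
    moreover have "(\<lambda>n. - (\<integral>p. (xcoef \<gamma> i p * W' p (xdir i) * g i p) * wn n p \<partial>lborel) - (\<integral>p. (W p * g i p) * kn n p \<partial>lborel))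
       \<longlonglongrightarrow> - (\<integral>p. (xcoef \<gamma> i p * W' p (xdir i) * g i p) * w p \<partial>lborel) - 0"
      unfolding k0[symmetric] by (intro tendsto_diff tendsto_minus L2conv_integral_mult[OF wn sqint_W'_g] L2conv_integral_mult[OF kn sqint_W_g])
    ultimately show ?thesis by (simp add: LIMSEQ_unique)
  qed
  have sw: "sqint lborel w" by (rule L2convD(2)[OF wn])
  have "(\<integral>p. (indicator thick p * W p * (\<Sum>i\<in>UNIV. hh i p)) * w p \<partial>lborel) = (\<integral>p. (\<Sum>i\<in>UNIV. ((indicator thick p * W p) * hh i p) * w p) \<partial>lborel)"
    by (simp only: sum_distrib_left sum_distrib_right)
  also have "\<dots> = (\<Sum>i\<in>UNIV. (\<integral>p. ((indicator thick p * W p) * hh i p) * w p \<partial>lborel))"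
    by (rule Bochner_Integration.integral_sum) (rule sqint_mult_integrable[OF sh sw])
  also have "\<dots> = (\<Sum>i\<in>UNIV. - (\<integral>p. (xcoef \<gamma> i p * W' p (xdir i) * g i p) * w p \<partial>lborel))"
    by (simp only: each)
  also have "\<dots> = - (\<integral>p. (\<Sum>i\<in>UNIV. (xcoef \<gamma> i p * W' p (xdir i) * g i p) * w p) \<partial>lborel)"
    by (subst Bochner_Integration.integral_sum) (auto intro: sqint_mult_integrable[OF sqint_W'_g sw] simp: sum_negf)
  also have "\<dots> = - (\<integral>p. - b * (weight \<gamma> \<alpha> p * (zu p * w p)) \<partial>lborel)"
  proof (rule arg_cong[where f=uminus], rule Bochner_Integration.integral_cong[OF refl])
    fix p
    show "(\<Sum>i\<in>UNIV. (xcoef \<gamma> i p * W' p (xdir i) * g i p) * w p) = - b * (weight \<gamma> \<alpha> p * (zu p * w p))"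
    proof (cases "p = 0")
      case True
      then show ?thesis using wn_zero(2)[of p] thick_nonzero by simp
    next
      case False
      show ?thesis unfolding xcoef_W'[OF False] zu_def by (simp add: sum_distrib_left sum_distrib_right mult_ac)
    qed
  qed
  also have "\<dots> = b * (\<integral>p. weight \<gamma> \<alpha> p * (zu p * w p) \<partial>lborel)"
    by (simp only: integral_mult_right_zero mult_minus_left minus_minus Bochner_Integration.integral_minus)
  also have "(\<integral>p. weight \<gamma> \<alpha> p * (zu p * w p) \<partial>lborel) = (\<integral>p. zu p * w p \<partial>M)"
    unfolding M_def mu_def using sqint_meas[OF sw] by (subst integral_density) simp_all
  finally show ?thesis .
qed


text \<open>Where \<open>z = 0\<close> the angle function vanishes and the quotient is \<open>0\<close>; this is a null set.\<close>

definition T1 where "T1 p = indicator (gauge_ball \<gamma> R) p * ((gauge_rho \<gamma> p)\<^sup>2 * (\<Sum>i\<in>UNIV. hh i p) / angle_fun \<gamma> p)"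

lemma rho_A: "p \<in> A \<Longrightarrow> 0 < gauge_rho \<gamma> p \<and> gauge_rho \<gamma> p < R"
  using A_ball A_nonzero gauge_rho_pos[OF \<gamma>, of p] by (auto simp: gauge_ball_def)

text \<open>\<open>T1\<close> is cut off outside the gauge ball. Since \<open>A\<close> stays at
  gauge distance at most r < R, a dilation by less than ln (R/r) keeps the supports inside the ball,
  and the cutoff is invisible to small \<open>h\<close>.\<close>

lemma dil_in_ball: "\<exists>d>0. d \<le> 1 \<and> (\<forall>h p. \<bar>h\<bar> < d \<longrightarrow> dil \<gamma> h p \<in> A \<longrightarrow> p \<in> gauge_ball \<gamma> R)"
proof (cases "A = {}")
  case True
  then show ?thesis by (intro exI[of _ 1]) auto
next
  case False
  obtain a where a: "a \<in> A" "\<And>p. p \<in> A \<Longrightarrow> gauge_rho \<gamma> p \<le> gauge_rho \<gamma> a"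
    using continuous_attains_sup[OF A_compact False continuous_on_gauge_rho[OF \<gamma>]] by blast
  define r where "r = gauge_rho \<gamma> a"
  have r: "0 < r" "r < R" using rho_A[OF a(1)] by (simp_all add: r_def)
  define d where "d = min 1 (ln (R / r))"
  have d: "d > 0" "d \<le> 1" using r by (simp_all add: d_def)
  have "p \<in> gauge_ball \<gamma> R" if "\<bar>h\<bar> < d" "dil \<gamma> h p \<in> A" for h p
  proof -
    have "exp h * gauge_rho \<gamma> p \<le> r" using a(2)[OF that(2)] by (simp add: r_def gauge_rho_dil[OF \<gamma>])
    then have "gauge_rho \<gamma> p \<le> exp (- h) * r" by (simp add: exp_minus field_simps)
    also have "\<dots> < exp (ln (R / r)) * r"
    proof (rule mult_strict_right_mono)
      have "\<bar>h\<bar> < ln (R / r)" using that(1) by (simp add: d_def)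
      then have "- h < ln (R / r)" by linarith
      then show "exp (- h) < exp (ln (R / r))" by (simp only: exp_less_cancel_iff)
    qed (rule r)
    also have "\<dots> = R" using r by simp
    finally show ?thesis by (simp add: gauge_ball_def)
  qed
  with d show ?thesis by blast
qed

text \<open>The pairing of \<open>T1 - b * zu\<close> with the orbit of \<open>u\<close> is even
  near 0, so its derivative \<langle>T1 - b Zu, Du\<rangle> vanishes. Finally Zu = Du + \<tau> u,
  and u is orthogonal to Du.\<close>

lemma energy_identity:
  assumes T1: "sqint M T1"
  shows "(\<integral>p. T1 p * Du p \<partial>M) = b * (\<integral>p. (Du p)\<^sup>2 \<partial>M)"
proof -
  have sz: "sqint M zu" by (rule L2convD(2)[OF conv_zu])
  have su: "sqint M u" by (rule L2convD(2)[OF conv_u])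
  have sD: "sqint M Du" by (rule L2convD(2)[OF conv_Du])
  define Y where "Y p = T1 p - b * zu p" for p
  have Y: "sqint M Y" unfolding Y_def[abs_def] by (intro sqint_diff T1 sqint_cmult sz)
  have T1m [measurable]: "T1 \<in> borel_measurable borel" using sqint_meas[OF T1] by simp
  obtain d where d: "d > 0" "d \<le> 1" "\<And>h p. \<bar>h\<bar> < d \<Longrightarrow> dil \<gamma> h p \<in> A \<Longrightarrow> p \<in> gauge_ball \<gamma> R"
    using dil_in_ball by blast
  have "(\<integral>p. Y p * Du p \<partial>M) = 0"
  proof (rule weak_even_zero[OF Y d(1)])
    fix h :: real assume h: "\<bar>h\<bar> < d"
    define w where "w p = U h u p - U (- h) u p" for p
    have sw: "sqint M w" unfolding w_def[abs_def] by (intro sqint_diff sqint_U su)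
    have wm [measurable]: "w \<in> borel_measurable borel" using sqint_meas[OF sw] by simp
    have w0: "w p = 0" if "p \<notin> thick \<or> p \<notin> gauge_ball \<gamma> R" for p
    proof -
      have "dil \<gamma> h p \<notin> A" "dil \<gamma> (- h) p \<notin> A"
        using that d(2) d(3)[of h p] d(3)[of "- h" p] dil_in_A[of h p] dil_in_A[of "- h" p] h by auto
      then show ?thesis by (simp add: w_def U_def u_zero)
    qed
    have "(\<integral>p. T1 p * w p \<partial>M) = (\<integral>p. weight \<gamma> \<alpha> p * (T1 p * w p) \<partial>lborel)"
      unfolding M_def mu_def by (subst integral_density) simp_all
    also have "\<dots> = (\<integral>p. (indicator thick p * W p * (\<Sum>i\<in>UNIV. hh i p)) * w p \<partial>lborel)"
    proof (rule integral_cong_AE)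
      show "AE p in lborel. weight \<gamma> \<alpha> p * (T1 p * w p) = (indicator thick p * W p * (\<Sum>i\<in>UNIV. hh i p)) * w p"
        using null_fst_zero
      proof eventually_elim
        case (elim p)
        show ?case
        proof (cases "w p = 0")
          case False
          then have p: "p \<in> thick" "p \<in> gauge_ball \<gamma> R" using w0[of p] by blast+
          then have "p \<noteq> 0" using thick_nonzero by auto
          then have "angle_fun \<gamma> p \<noteq> 0" using elim gauge_rho_pos[OF \<gamma>, of p] by (simp add: angle_fun_def)
          from W_weight[OF this] p show ?thesis by (simp add: T1_def)
        qed simp
      qed
    qed simp_all
    also have "\<dots> = b * (\<integral>p. zu p * w p \<partial>M)"
      unfolding w_def by (rule energy_weak) (use h d(2) in simp)
    finally have "(\<integral>p. Y p * w p \<partial>M) = 0"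
      using sqint_mult_integrable[OF T1 sw] sqint_mult_integrable[OF sz sw] by (simp add: Y_def left_diff_distrib mult.assoc)
    moreover have "(\<integral>p. Y p * w p \<partial>M) = (\<integral>p. Y p * U h u p \<partial>M) - (\<integral>p. Y p * U (- h) u p \<partial>M)"
      unfolding w_def right_diff_distrib
      by (intro Bochner_Integration.integral_diff sqint_mult_integrable Y sqint_U su)
    ultimately show "(\<integral>p. Y p * U h u p \<partial>M) = (\<integral>p. Y p * U (- h) u p \<partial>M)" by simp
  qed
  then have "(\<integral>p. T1 p * Du p \<partial>M) = b * (\<integral>p. zu p * Du p \<partial>M)"
    using sqint_mult_integrable[OF T1 sD] sqint_mult_integrable[OF sz sD] by (simp add: Y_def left_diff_distrib mult.assoc)
  also have "(\<integral>p. zu p * Du p \<partial>M) = (\<integral>p. (Du p)\<^sup>2 + \<tau> * (u p * Du p) \<partial>M)"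
    by (rule Bochner_Integration.integral_cong) (simp_all add: Du_def power2_eq_square algebra_simps)
  also have "\<dots> = (\<integral>p. (Du p)\<^sup>2 \<partial>M)"
    using sD sqint_mult_integrable[OF su sD] u_Du_orthogonal by (simp add: sqint_def)
  finally show ?thesis .
qed

section \<open>The Hardy inequality and the core estimate\<close>

lemma sqint_rho_u:
  assumes "s \<ge> 0" shows "sqint M (\<lambda>p. gauge_rho \<gamma> p powr s * u p)"
proof -
  have "sqint M (\<lambda>p. (indicator A p * gauge_rho \<gamma> p powr s) * u p)"
  proof (rule sqint_bounded_mult[OF L2convD(2)[OF conv_u]])
    show "\<bar>indicator A p * gauge_rho \<gamma> p powr s\<bar> \<le> R powr s" for p
      using rho_A[of p] assms powr_mono2[of s "gauge_rho \<gamma> p" R] by (auto split: split_indicator)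
  qed simp
  also have "(\<lambda>p. (indicator A p * gauge_rho \<gamma> p powr s) * u p) = (\<lambda>p. gauge_rho \<gamma> p powr s * u p)"
    using u_zero by (auto simp: fun_eq_iff indicator_def simp del: split_paired_All)
  finally show ?thesis .
qed

lemma Du_zero: "p \<notin> A \<Longrightarrow> Du p = 0"
  by (simp add: Du_def zu_zero u_zero)

text \<open>The identity \<open>hardy\<close> for w = \<rho>^s, with the power split evenly: one
  half stays with \<open>u\<close>, the other is bounded by R^(s/2) on \<open>A\<close>.
  Cauchy-Schwarz then allows one factor of the norm to be cancelled.\<close>

lemma hardy_bound:
  assumes s: "s > 0" and R: "R > 0"
  shows "s * l2norm M (\<lambda>p. gauge_rho \<gamma> p powr (s / 2) * u p) \<le> 2 * R powr (s / 2) * l2norm M Du"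
proof -
  define v where "v p = gauge_rho \<gamma> p powr (s / 2) * u p" for p
  have sv: "sqint M v" unfolding v_def using sqint_rho_u[of "s / 2"] s by simp
  have sD: "sqint M Du" by (rule L2convD(2)[OF conv_Du])
  have pp: "gauge_rho \<gamma> p powr s = gauge_rho \<gamma> p powr (s / 2) * gauge_rho \<gamma> p powr (s / 2)" for p
    by (simp add: powr_add[symmetric])
  have "continuous_on thick (\<lambda>p. gauge_rho \<gamma> p powr s)"
    using s by (intro continuous_on_powr' continuous_on_gauge_rho \<gamma> continuous_intros) auto
  from continuous_bounded_compact[OF compact_thick this] obtain C where C: "\<And>p. p \<in> thick \<Longrightarrow> \<bar>gauge_rho \<gamma> p powr s\<bar> \<le> C" by blast
  have "s * (\<integral>p. gauge_rho \<gamma> p powr s * (u p)\<^sup>2 \<partial>M) = - 2 * (\<integral>p. gauge_rho \<gamma> p powr s * (u p * Du p) \<partial>M)"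
  proof (rule hardy[OF _ C])
    show "gauge_rho \<gamma> (dil \<gamma> y p) powr s = exp (s * y) * gauge_rho \<gamma> p powr s" for y p
      by (simp add: gauge_rho_dil[OF \<gamma>] powr_mult powr_def[of "exp _"])
  qed simp_all
  also have "(\<integral>p. gauge_rho \<gamma> p powr s * (u p)\<^sup>2 \<partial>M) = (l2norm M v)\<^sup>2"
    unfolding l2norm_sq v_def by (simp add: power2_eq_square pp mult_ac)
  also have "(\<integral>p. gauge_rho \<gamma> p powr s * (u p * Du p) \<partial>M) = (\<integral>p. v p * (gauge_rho \<gamma> p powr (s / 2) * Du p) \<partial>M)"
    unfolding v_def by (simp add: pp mult_ac)
  finally have "s * (l2norm M v)\<^sup>2 = - 2 * (\<integral>p. v p * (gauge_rho \<gamma> p powr (s / 2) * Du p) \<partial>M)" .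
  also have "\<dots> \<le> 2 * (R powr (s / 2) * (l2norm M v * l2norm M Du))"
  proof -
    have "\<bar>\<integral>p. v p * (gauge_rho \<gamma> p powr (s / 2) * Du p) \<partial>M\<bar> \<le> (\<integral>p. R powr (s / 2) * (\<bar>v p\<bar> * \<bar>Du p\<bar>) \<partial>M)"
    proof (rule order_trans[OF integral_abs_bound integral_mono'])
      show "integrable M (\<lambda>p. R powr (s / 2) * (\<bar>v p\<bar> * \<bar>Du p\<bar>))"
        using sqint_mult_integrable[OF sv sD, THEN integrable_abs] by (simp add: abs_mult)
      show "\<bar>v p * (gauge_rho \<gamma> p powr (s / 2) * Du p)\<bar> \<le> R powr (s / 2) * (\<bar>v p\<bar> * \<bar>Du p\<bar>)" for p
      proof (cases "p \<in> A")
        case True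
        then have "gauge_rho \<gamma> p powr (s / 2) \<le> R powr (s / 2)" using rho_A[of p] s by (intro powr_mono2) auto
        from mult_right_mono[OF this, of "\<bar>v p\<bar> * \<bar>Du p\<bar>"] show ?thesis by (simp add: abs_mult mult_ac)
      qed (simp add: Du_zero)
    qed simp
    also have "\<dots> \<le> R powr (s / 2) * (l2norm M v * l2norm M Du)"
      using integral_abs_mult_le_l2norm[OF sv sD] by (simp add: mult_left_mono)
    finally show ?thesis by linarith
  qed
  finally have *: "s * (l2norm M v)\<^sup>2 \<le> 2 * (R powr (s / 2) * (l2norm M v * l2norm M Du))" .
  show ?thesis
  proof (cases "l2norm M v = 0")
    case True
    then show ?thesis unfolding v_def[abs_def] by simp
  next
    case False
    then have "l2norm M v > 0" using l2norm_nonneg[of M v] by linarith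
    with * have "l2norm M v * (s * l2norm M v) \<le> l2norm M v * (2 * R powr (s / 2) * l2norm M Du)"
      by (simp add: power2_eq_square mult_ac)
    then have "s * l2norm M v \<le> 2 * R powr (s / 2) * l2norm M Du" using \<open>l2norm M v > 0\<close> by simp
    then show ?thesis unfolding v_def[abs_def] .
  qed
qed

text \<open>Here \<open>H\<close> is the bounded model of \<rho>^2 f and \<open>N\<close> is
  \<rho>^2 f(u) itself. The model is handled by the chain rule, giving (2 \<tau> - c) - q \<tau>
  times the integral of its primitive; the remainder is at most linear in |u| and is charged to
  |Du|^2.\<close>

lemma carleman_core:
  fixes H :: "((real^'m) \<times> (real^'k)) \<times> real \<Rightarrow> real"
  assumes R: "R > 0" and b0: "\<alpha> \<ge> 0" and \<tau>0: "\<tau> \<ge> 0"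
    and Hm [measurable]: "H \<in> borel_measurable borel" and bd: "\<And>x. \<bar>H x\<bar> \<le> C"
    and low: "\<And>p y s. 0 \<le> y \<Longrightarrow> y \<le> 1 \<Longrightarrow>
      exp (- c * y) * prim (\<lambda>s. H (p, s)) s \<le> prim (\<lambda>s. H (dil \<gamma> (- y) p, s)) s"
    and lim: "\<And>p s. p \<in> A \<Longrightarrow> ((\<lambda>y. H (dil \<gamma> (- y) p, s)) \<longlongrightarrow> H (p, s)) (at_right 0)"
    and hom: "\<And>p s. s * H (p, s) \<le> q * prim (\<lambda>s. H (p, s)) s"
    and N [measurable]: "N \<in> borel_measurable borel" and N0: "\<And>p. p \<notin> A \<Longrightarrow> N p = 0"
    and N2: "\<And>p. p \<in> A \<Longrightarrow> \<bar>N p - H (p, u p)\<bar> \<le> C2 * (gauge_rho \<gamma> p)\<^sup>2 * \<bar>u p\<bar>" and C2: "C2 \<ge> 0"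
    and T: "sqint M (\<lambda>p. T1 p + N p)"
  shows "b\<^sup>2 * (l2norm M Du)\<^sup>2 + 2 * b * ((2 - q) * \<tau> - c) * (\<integral>p. prim (\<lambda>s. H (p, s)) (u p) \<partial>M)
     \<le> (l2norm M (\<lambda>p. T1 p + N p))\<^sup>2 + b * C2 * R\<^sup>2 * (l2norm M Du)\<^sup>2"
    and "integrable M (\<lambda>p. prim (\<lambda>s. H (p, s)) (u p))"
proof -
  have Hm' [measurable]: "H \<in> borel_measurable (borel \<Otimes>\<^sub>M borel)" by (simp add: borel_prod)
  have sD: "sqint M Du" by (rule L2convD(2)[OF conv_Du])
  have su: "sqint M u" by (rule L2convD(2)[OF conv_u])
  have sz: "sqint M zu" by (rule L2convD(2)[OF conv_zu])
  have Hpm: "(\<lambda>s. H (p, s)) \<in> borel_measurable borel" for p by measurable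
  have C: "0 \<le> C" using order_trans[OF abs_ge_zero bd] .
  define I where "I = (\<integral>p. prim (\<lambda>s. H (p, s)) (u p) \<partial>M)"
  show pint: "integrable M (\<lambda>p. prim (\<lambda>s. H (p, s)) (u p))"
  proof (rule Bochner_Integration.integrable_bound)
    show "integrable M (\<lambda>p. C * \<bar>u p\<bar>)" by simp
    have "(\<lambda>p. prim (\<lambda>s. H (p, s)) (u p)) \<in> borel_measurable borel"
      unfolding prim_def by (rule lborel.borel_measurable_lebesgue_integral) (simp add: case_prod_beta)
    then show "(\<lambda>p. prim (\<lambda>s. H (p, s)) (u p)) \<in> borel_measurable M" by simp
    show "AE p in M. norm (prim (\<lambda>s. H (p, s)) (u p)) \<le> norm (C * \<bar>u p\<bar>)"
      using abs_prim_le[OF Hpm bd] C by (simp add: abs_mult)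
  qed
  \<comment> \<open>The split into model and remainder. The indicator makes \<open>N1\<close> square
    integrable, being bounded on a set of finite measure; it is harmless in products with
    \<open>u\<close> and \<open>zu\<close>.\<close>
  define N1 where "N1 p = H (p, u p) * indicator A p" for p
  define N2' where "N2' p = N p - N1 p" for p
  have sN1: "sqint M N1" unfolding N1_def
  proof (rule sqint_bounded_mult)
    have "sqint M (\<lambda>p. indicator A p * indicator thick p)" by (rule sqint_bounded_mult[OF sqint_thick, of _ 1]) (auto split: split_indicator)
    also have "(\<lambda>p. indicator A p * indicator thick p) = (indicator A :: _ \<Rightarrow> real)"
      using A_subset_thick by (auto simp: fun_eq_iff split: split_indicator)
    finally show "sqint M (indicator A)" .
  qed (use bd in simp_all)
  have N2'_le: "\<bar>N2' p\<bar> \<le> \<bar>C2 * (gauge_rho \<gamma> p powr 2 * u p)\<bar>" for p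
  proof (cases "p \<in> A")
    case True
    then have "gauge_rho \<gamma> p powr 2 = (gauge_rho \<gamma> p)\<^sup>2" using rho_A[of p] by (simp add: powr_numeral)
    with True N2[of p] C2 show ?thesis by (simp add: N2'_def N1_def abs_mult mult_ac)
  qed (simp add: N2'_def N1_def N0)
  have sr: "sqint M (\<lambda>p. C2 * (gauge_rho \<gamma> p powr 2 * u p))" by (intro sqint_cmult sqint_rho_u) simp
  have N2'm [measurable]: "N2' \<in> borel_measurable borel" unfolding N2'_def[abs_def] N1_def by measurable
  have sN2: "sqint M N2'" unfolding sqint_def
  proof
    show "integrable M (\<lambda>p. (N2' p)\<^sup>2)"
    proof (rule Bochner_Integration.integrable_bound)
      show "integrable M (\<lambda>p. (C2 * (gauge_rho \<gamma> p powr 2 * u p))\<^sup>2)" using sr by (simp add: sqint_def)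
      show "AE p in M. norm ((N2' p)\<^sup>2) \<le> norm ((C2 * (gauge_rho \<gamma> p powr 2 * u p))\<^sup>2)"
        using N2'_le by (auto simp: abs_le_square_iff)
    qed simp
  qed simp
  define S where "S p = T1 p + N p" for p
  have sS: "sqint M S" using T by (simp add: S_def[abs_def])
  have sT1: "sqint M T1"
  proof -
    have "sqint M (\<lambda>p. S p - (N1 p + N2' p))" by (intro sqint_diff sqint_add sS sN1 sN2)
    then show ?thesis by (simp add: S_def N2'_def)
  qed
  define D where "D = (l2norm M Du)\<^sup>2"
  have "(\<integral>p. S p * Du p \<partial>M) = (\<integral>p. T1 p * Du p + (N1 p * Du p + N2' p * Du p) \<partial>M)"
    by (rule Bochner_Integration.integral_cong) (simp_all add: S_def N2'_def algebra_simps)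
  also have "\<dots> = b * D + ((\<integral>p. N1 p * Du p \<partial>M) + (\<integral>p. N2' p * Du p \<partial>M))"
    using sqint_mult_integrable[OF sT1 sD] sqint_mult_integrable[OF sN1 sD] sqint_mult_integrable[OF sN2 sD] energy_identity[OF sT1]
    by (simp add: D_def l2norm_sq)
  finally have SD: "(\<integral>p. S p * Du p \<partial>M) = b * D + ((\<integral>p. N1 p * Du p \<partial>M) + (\<integral>p. N2' p * Du p \<partial>M))" .
  have N1D: "((2 - q) * \<tau> - c) * I \<le> (\<integral>p. N1 p * Du p \<partial>M)"
  proof -
    have e1: "N1 p * zu p = H (p, u p) * zu p" "N1 p * u p = H (p, u p) * u p" for p
      by (auto simp: N1_def zu_zero u_zero split: split_indicator)
    have "(\<integral>p. N1 p * Du p \<partial>M) = (\<integral>p. N1 p * zu p - \<tau> * (N1 p * u p) \<partial>M)"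
      by (rule Bochner_Integration.integral_cong) (simp_all add: Du_def algebra_simps)
    also have "\<dots> = (\<integral>p. H (p, u p) * zu p \<partial>M) - \<tau> * (\<integral>p. H (p, u p) * u p \<partial>M)"
      using sqint_mult_integrable[OF sN1 sz] sqint_mult_integrable[OF sN1 su] unfolding e1 by simp
    finally have "(\<integral>p. N1 p * Du p \<partial>M) = (\<integral>p. H (p, u p) * zu p \<partial>M) - \<tau> * (\<integral>p. H (p, u p) * u p \<partial>M)" .
    moreover have "(2 * \<tau> - c) * I \<le> (\<integral>p. H (p, u p) * zu p \<partial>M)"
      unfolding I_def by (rule nonlinear_lower_bound[OF Hm bd low lim])
    moreover have "(\<integral>p. H (p, u p) * u p \<partial>M) \<le> (\<integral>p. q * prim (\<lambda>s. H (p, s)) (u p) \<partial>M)"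
      using sqint_mult_integrable[OF sN1 su] pint hom unfolding e1 by (intro integral_mono) (simp_all add: mult.commute)
    then have "\<tau> * (\<integral>p. H (p, u p) * u p \<partial>M) \<le> \<tau> * (q * I)" using \<tau>0 by (intro mult_left_mono) (simp_all add: I_def)
    ultimately show ?thesis by (simp add: algebra_simps)
  qed
  have N2D: "- (C2 * R\<^sup>2 / 2 * D) \<le> (\<integral>p. N2' p * Du p \<partial>M)"
  proof -
    have l: "l2norm M N2' \<le> C2 * l2norm M (\<lambda>p. gauge_rho \<gamma> p powr 2 * u p)"
    proof -
      have "l2norm M N2' \<le> l2norm M (\<lambda>p. C2 * (gauge_rho \<gamma> p powr 2 * u p))"
        using N2'_le by (intro l2norm_mono sr) simp_all
      then show ?thesis using C2 by (simp add: l2norm_cmult)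
    qed
    \<comment> \<open>The remainder carries \<rho>^2 u, whose square has weight \<rho>^4; the Hardy
      inequality with s = 4 has constant 2 R^2/4.\<close>
    have R4: "R powr (4 / 2) = R\<^sup>2" using R by (simp add: powr_numeral)
    have "l2norm M (\<lambda>p. gauge_rho \<gamma> p powr 2 * u p) \<le> R\<^sup>2 / 2 * l2norm M Du"
      using hardy_bound[of 4, OF _ R] unfolding R4 by simp
    then have "l2norm M N2' \<le> C2 * (R\<^sup>2 / 2 * l2norm M Du)"
      using l C2 by (meson mult_left_mono order_trans)
    then have "l2norm M N2' * l2norm M Du \<le> C2 * (R\<^sup>2 / 2 * l2norm M Du) * l2norm M Du"
      by (intro mult_right_mono) simp_all
    then have "l2norm M N2' * l2norm M Du \<le> C2 * R\<^sup>2 / 2 * D" by (simp add: D_def power2_eq_square)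
    with integral_mult_le_l2norm[OF sN2 sD] show ?thesis by linarith
  qed
  \<comment> \<open>The square S - b Du is nonnegative: |S|^2 + b^2 |Du|^2 dominates 2 b \<langle>S,
    Du\<rangle>, in which the principal term is already 2 b^2 |Du|^2.\<close>
  have "0 \<le> (\<integral>p. (S p - b * Du p)\<^sup>2 \<partial>M)" by simp
  also have "\<dots> = (\<integral>p. (S p)\<^sup>2 - 2 * b * (S p * Du p) + b\<^sup>2 * (Du p)\<^sup>2 \<partial>M)"
    by (rule Bochner_Integration.integral_cong) (simp_all add: power2_eq_square algebra_simps)
  also have "\<dots> = (l2norm M S)\<^sup>2 - 2 * b * (\<integral>p. S p * Du p \<partial>M) + b\<^sup>2 * D"
    using sS sD sqint_mult_integrable[OF sS sD] by (simp add: l2norm_sq D_def sqint_def)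
  finally have fin: "2 * b * (\<integral>p. S p * Du p \<partial>M) \<le> (l2norm M S)\<^sup>2 + b\<^sup>2 * D" by linarith
  have "b * D + (((2 - q) * \<tau> - c) * I - C2 * R\<^sup>2 / 2 * D) \<le> (\<integral>p. S p * Du p \<partial>M)"
    unfolding SD using N1D N2D by linarith
  then have "2 * b * (b * D + (((2 - q) * \<tau> - c) * I - C2 * R\<^sup>2 / 2 * D)) \<le> 2 * b * (\<integral>p. S p * Du p \<partial>M)"
    using b0 by (intro mult_left_mono) simp_all
  then have "2 * b * (b * D + (((2 - q) * \<tau> - c) * I - C2 * R\<^sup>2 / 2 * D)) \<le> (l2norm M S)\<^sup>2 + b\<^sup>2 * D"
    using fin by linarith
  moreover have "2 * b * (b * D + (((2 - q) * \<tau> - c) * I - C2 * R\<^sup>2 / 2 * D)) = 2 * (b\<^sup>2 * D) + 2 * b * ((2 - q) * \<tau> - c) * I - b * C2 * R\<^sup>2 * D"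
    by (simp add: power2_eq_square algebra_simps)
  ultimately show "b\<^sup>2 * (l2norm M Du)\<^sup>2 + 2 * b * ((2 - q) * \<tau> - c) * (\<integral>p. prim (\<lambda>s. H (p, s)) (u p) \<partial>M)
     \<le> (l2norm M (\<lambda>p. T1 p + N p))\<^sup>2 + b * C2 * R\<^sup>2 * (l2norm M Du)\<^sup>2"
    unfolding D_def[symmetric] I_def[symmetric] S_def[abs_def, symmetric] by linarith
qed

end

section \<open>Scalar inequalities for the nonlinearity\<close>

text \<open>Reduces negative arguments to positive ones: s \<mapsto> -g(-s) has the reflected
  primitive. The two indicators differ at the endpoints only.\<close>

lemma prim_reflect:
  assumes [measurable]: "g \<in> borel_measurable borel"
  shows "prim (\<lambda>s. - g (- s)) s = prim g (- s)"
proof -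
  have "prim g (- s) = \<bar>- 1\<bar> *\<^sub>R (\<integral>\<sigma>. g (0 + (- 1) * \<sigma>) * sgn_interval 0 (- s) (0 + (- 1) * \<sigma>) \<partial>lborel)"
    unfolding prim_def by (rule lborel_integral_real_affine) simp
  also have "\<dots> = (\<integral>\<sigma>. g (- \<sigma>) * sgn_interval 0 (- s) (- \<sigma>) \<partial>lborel)" by simp
  also have "\<dots> = prim (\<lambda>s. - g (- s)) s"
    unfolding prim_def
  proof (rule integral_cong_AE)
    show "AE \<sigma> in lborel. g (- \<sigma>) * sgn_interval 0 (- s) (- \<sigma>) = - g (- \<sigma>) * sgn_interval 0 s \<sigma>"
      using AE_lborel_singleton[of 0] AE_lborel_singleton[of s]
      by eventually_elim (auto simp: sgn_interval_def indicator_def)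
  qed simp_all
  finally show ?thesis ..
qed

text \<open>Formally s F' \<le> q F makes F(s) s^(-q) nonincreasing, whence F(s) \<ge> F(1/2) (2
  s)^q. As \<open>g\<close> is only measurable, F need not have derivative \<open>g\<close> at every
  point, so monotonicity is proved for a C^1 majorant of F that touches it at
  \<open>s\<close>.\<close>

lemma lower_1D:
  assumes g: "g \<in> borel_measurable borel" "\<And>s. \<bar>g s\<bar> \<le> C" and q: "q > 0"
    and pos: "\<And>s. 0 < s \<Longrightarrow> s < 1 \<Longrightarrow> 0 < s * g s" and le: "\<And>s. 0 < s \<Longrightarrow> s < 1 \<Longrightarrow> s * g s \<le> q * prim g s"
    and s: "0 < s" "s < 1"
  shows "0 < prim g (1 / 2)" "prim g (1 / 2) * s powr q \<le> prim g s"
proof -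
  define F where "F = prim g"
  have pos': "0 < F s" if "0 < s" "s < 1" for s
    using pos[OF that] le[OF that] q by (smt (verit) F_def zero_less_mult_pos)
  show "0 < prim g (1 / 2)" using pos'[of "1 / 2"] by (simp add: F_def)
  have mono: "F x \<le> F y" if "0 < x" "x \<le> y" "y < 1" for x y
  proof -
    have "0 \<le> (\<integral>\<sigma>. g \<sigma> * sgn_interval x y \<sigma> \<partial>lborel)"
    proof (rule integral_nonneg_AE, rule always_eventually, rule allI)
      fix \<sigma>
      show "0 \<le> g \<sigma> * sgn_interval x y \<sigma>"
      proof (cases "\<sigma> \<in> {x<..y}")
        case True
        then have "0 < g \<sigma>" using pos[of \<sigma>] that by (simp add: zero_less_mult_iff)
        then show ?thesis using True that by (simp add: sgn_interval_def)
      qed (use that in \<open>simp add: sgn_interval_def\<close>)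
    qed
    then show ?thesis unfolding F_def using prim_diff[OF g, of y x] by simp
  qed
  have Fcont: "continuous_on UNIV F"
  proof (rule lipschitz_on_continuous_on[of "C"])
    show "C-lipschitz_on UNIV F"
      by (rule lipschitz_onI) (use prim_lipschitz[OF g] order_trans[OF abs_ge_zero g(2)] in \<open>auto simp: F_def dist_real_def\<close>)
  qed
  show "prim g (1 / 2) * s powr q \<le> prim g s"
  proof (cases "s \<le> 1 / 2")
    case False
    have "F (1 / 2) * s powr q \<le> F (1 / 2) * 1"
      using s q pos'[of "1 / 2"] powr_mono2[of q s 1] by (intro mult_left_mono) auto
    also have "\<dots> \<le> F s" using mono[of "1 / 2" s] False s by simp
    finally show ?thesis by (simp add: F_def)
  next
    case True
    \<comment> \<open>Clamping to [s, 1/2] makes q F(\<sigma>)/\<sigma> continuous and bounded on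
      the whole line, as the differentiation of its primitive requires.\<close>
    define m where "m \<sigma> = max s (min (1 / 2) \<sigma>)" for \<sigma> :: real
    have m: "s \<le> m \<sigma>" "m \<sigma> \<le> 1 / 2" for \<sigma> using True by (auto simp: m_def)
    define k where "k \<sigma> = q * F (m \<sigma>) / m \<sigma>" for \<sigma>
    have mc: "continuous_on UNIV m" unfolding m_def by (intro continuous_intros)
    have m0: "m \<sigma> \<noteq> 0" for \<sigma> using m(1)[of \<sigma>] s(1) by linarith
    have kc: "continuous_on UNIV k" unfolding k_def using m0
      by (intro continuous_intros mc continuous_on_compose2[OF Fcont mc]) auto
    obtain B where B: "\<And>\<sigma>. \<bar>k \<sigma>\<bar> \<le> B"
    proof
      fix \<sigma>
      have "F (m \<sigma>) \<le> F (1 / 2)" "0 < F (m \<sigma>)" using mono[of "m \<sigma>" "1 / 2"] pos'[of "m \<sigma>"] m[of \<sigma>] s by auto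
      then show "\<bar>k \<sigma>\<bar> \<le> q * F (1 / 2) / s"
        unfolding k_def using m[of \<sigma>] s q by (simp add: abs_mult abs_divide) (intro frac_le mult_left_mono, auto)
    qed
    \<comment> \<open>The majorant: N(s) = F(s), N' = q F/x on [s, 1/2], and F \<le> N there by
      integrating g \<le> k. Then N' \<le> q N/x, so N x^(-q) is nonincreasing.\<close>
    define N where "N x = F s + prim k x - prim k s" for x
    have N': "(N has_real_derivative k x) (at x)" for x
      unfolding N_def by (auto intro!: derivative_eq_intros prim_deriv[OF kc B])
    have FN: "F x \<le> N x" if x: "s \<le> x" "x \<le> 1 / 2" for x
    proof -
      have km: "k \<in> borel_measurable borel" using kc by (rule borel_measurable_continuous_onI)
      have "(\<integral>\<sigma>. g \<sigma> * sgn_interval s x \<sigma> \<partial>lborel) \<le> (\<integral>\<sigma>. k \<sigma> * sgn_interval s x \<sigma> \<partial>lborel)"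
      proof (rule integral_mono[OF integrable_mult_sgn_interval[OF g] integrable_mult_sgn_interval[OF km B]])
        fix \<sigma>
        show "g \<sigma> * sgn_interval s x \<sigma> \<le> k \<sigma> * sgn_interval s x \<sigma>"
        proof (cases "\<sigma> \<in> {s<..x}")
          case True
          then have ms: "m \<sigma> = \<sigma>" using x by (auto simp: m_def)
          have "g \<sigma> \<le> k \<sigma>" unfolding k_def ms using le[of \<sigma>] True s x by (simp add: F_def field_simps)
          then show ?thesis using True x by (simp add: sgn_interval_def)
        qed (use x in \<open>simp add: sgn_interval_def\<close>)
      qed
      then show ?thesis unfolding N_def F_def using prim_diff[OF g, of x s] prim_diff[OF km B, of x s] by linarith
    qed
    have "N (1 / 2) * (1 / 2) powr (- q) \<le> N s * s powr (- q)"
    proof (rule DERIV_nonpos_imp_nonincreasing[OF True])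
      fix x assume x: "s \<le> x" "x \<le> 1 / 2"
      have x0: "0 < x" using s x by simp
      have kx: "k x = q * F x / x" using x by (simp add: k_def m_def)
      have "((\<lambda>x. N x * x powr (- q)) has_real_derivative k x * x powr (- q) + N x * (- q * x powr (- q - 1))) (at x)"
        using x0 N'[of x] by (auto intro!: derivative_eq_intros)
      moreover have "k x * x powr (- q) + N x * (- q * x powr (- q - 1)) = q * x powr (- q - 1) * (F x - N x)"
        unfolding kx using x0 by (simp add: powr_diff field_simps)
      moreover have "q * x powr (- q - 1) * (F x - N x) \<le> 0"
        using FN[OF x] q by (intro mult_nonneg_nonpos) auto
      ultimately show "\<exists>y. ((\<lambda>x. N x * x powr (- q)) has_real_derivative y) (at x) \<and> y \<le> 0" by auto
    qed
    note leN = this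
    have le1: "F (1 / 2) * (1 / 2) powr (- q) \<le> N (1 / 2) * (1 / 2) powr (- q)"
      using FN[of "1 / 2"] True by (intro mult_right_mono) auto
    have "N s = F s" by (simp add: N_def)
    with order_trans[OF le1 leN] have "F (1 / 2) * (1 / 2) powr (- q) \<le> F s * s powr (- q)" by (simp only:)
    moreover have "F (1 / 2) \<le> F (1 / 2) * (1 / 2) powr (- q)"
    proof -
      have "1 \<le> (1 / 2) powr (- q)" using powr_mono2'[of "- q" "1 / 2" 1] q by simp
      then show ?thesis using pos'[of "1 / 2"] by simp
    qed
    ultimately have "F (1 / 2) \<le> F s * s powr (- q)" by linarith
    then have "F (1 / 2) * s powr q \<le> (F s * s powr (- q)) * s powr q" by (intro mult_right_mono) auto
    also have "\<dots> = F s" using s by (simp add: mult.assoc powr_add[symmetric])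
    finally show ?thesis by (simp add: F_def)
  qed
qed

section \<open>The truncated power that replaces the nonlinearity for large values\<close>

definition cut :: "real \<Rightarrow> real \<Rightarrow> real \<Rightarrow> real \<Rightarrow> real" where
  "cut c q L s = q * c * sgn s * min \<bar>s\<bar> L powr (q - 1)"

lemma cut_measurable [measurable]: "cut c q L \<in> borel_measurable borel"
  unfolding cut_def[abs_def] by measurable

lemma cut_odd: "- cut c q L (- s) = cut c q L s"
  by (simp add: cut_def sgn_minus)

lemma cut_bound: "\<lbrakk>c > 0; q > 1; L > 0\<rbrakk> \<Longrightarrow> \<bar>cut c q L s\<bar> \<le> q * c * L powr (q - 1)"
  unfolding cut_def abs_mult by (cases "s = 0") (auto simp: abs_sgn_eq intro!: mult_left_mono powr_mono2)

text \<open>Up to \<open>L\<close> the function is the derivative of c s^q; beyond \<open>L\<close>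
  it is constant, so the primitive continues along its tangent line.\<close>

lemma prim_cut:
  assumes c: "c > 0" "q > 1" "L > 0" and s: "0 \<le> s"
  shows "prim (cut c q L) s = (if s \<le> L then c * s powr q else c * L powr q + q * c * L powr (q - 1) * (s - L))"
proof -
  define k where "k \<sigma> = q * c * (min (max \<sigma> 0) L) powr (q - 1)" for \<sigma>
  have kc: "continuous_on UNIV k"
    unfolding k_def using c by (intro continuous_intros continuous_on_powr') auto
  have km: "k \<in> borel_measurable borel" using kc by (rule borel_measurable_continuous_onI)
  have kb: "\<bar>k \<sigma>\<bar> \<le> q * c * L powr (q - 1)" for \<sigma>
    unfolding k_def using c by (simp add: abs_mult) (intro powr_mono2, auto)
  have eq: "prim (cut c q L) x = prim k x" if "0 \<le> x" for x
    unfolding prim_def using that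
    by (intro Bochner_Integration.integral_cong refl) (auto simp: sgn_interval_def cut_def k_def indicator_def)
  have small: "prim k x = c * x powr q" if x: "0 \<le> x" "x \<le> L" for x
  proof (cases "x = 0")
    case False
    with x have x0: "0 < x" by simp
    have "(\<lambda>t. prim k t - c * t powr q) x = (\<lambda>t. prim k t - c * t powr q) 0"
    proof (rule DERIV_isconst_end[OF x0])
      have "continuous_on {0..x} (prim k)"
        by (intro continuous_at_imp_continuous_on ballI DERIV_isCont[OF prim_deriv[OF kc kb]])
      then show "continuous_on {0..x} (\<lambda>t. prim k t - c * t powr q)"
        using c by (intro continuous_intros continuous_on_powr') auto
      fix t assume t: "0 < t" "t < x"
      have "k t = q * c * t powr (q - 1)" using t x by (simp add: k_def)
      moreover have "((\<lambda>t. prim k t - c * t powr q) has_real_derivative k t - c * (q * t powr (q - 1))) (at t)"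
        using t by (auto intro!: derivative_eq_intros prim_deriv[OF kc kb])
      ultimately show "((\<lambda>t. prim k t - c * t powr q) has_real_derivative 0) (at t)" by simp
    qed
    then show ?thesis using c by simp
  qed simp
  show ?thesis
  proof (cases "s \<le> L")
    case True
    then show ?thesis using eq[OF s] small[OF s] by simp
  next
    case False
    have "\<bar>prim k s - prim k L - q * c * L powr (q - 1) * (s - L)\<bar> \<le> 0 * \<bar>s - L\<bar>"
      using False c by (intro prim_diff_weighted_le[OF km kb]) (auto simp: k_def)
    then show ?thesis using False eq[OF s] small[of L] c by simp
  qed
qed

text \<open>Up to \<open>L\<close> there is equality by homogeneity. Beyond it the truncation helps:
  the surplus is q c L^(q-1) (q-1) (s-L), nonnegative because q > 1.\<close>

lemma prim_cut_props:
  assumes c: "c > 0" "q > 1" "L > 0" and s: "0 \<le> s"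
  shows "s * cut c q L s \<le> q * prim (cut c q L) s" "c * min s L powr q \<le> prim (cut c q L) s"
proof -
  have pw: "x * x powr (q - 1) = x powr q" if "0 \<le> x" for x :: real
    using that by (cases "x = 0") (simp_all add: powr_mult_base)
  show "c * min s L powr q \<le> prim (cut c q L) s"
    using c unfolding prim_cut[OF assms] by simp
  show "s * cut c q L s \<le> q * prim (cut c q L) s"
  proof (cases "s \<le> L")
    case True
    then show ?thesis using s unfolding prim_cut[OF assms] by (cases "s = 0") (simp_all add: cut_def pw[symmetric] mult_ac)
  next
    case False
    have "q * prim (cut c q L) s - s * cut c q L s = q * c * L powr (q - 1) * ((q - 1) * (s - L))"
      using False c unfolding prim_cut[OF assms] by (simp add: cut_def pw[symmetric, of L] algebra_simps)
    moreover have "0 \<le> q * c * L powr (q - 1) * ((q - 1) * (s - L))" using False c by (intro mult_nonneg_nonneg) auto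
    ultimately show ?thesis by linarith
  qed
qed

text \<open>The nonlinearity is modified outside \<open>[-1/2, 1/2]\<close>, where the structural assumptions do not
  control it; the modification is bounded and changes it by at most a multiple of \<open>|s|\<close>.\<close>

lemma cut_1D:
  assumes c: "c > 0" "q > 1" "L > 1 / 2" and g: "g \<in> borel_measurable borel" "\<And>s. \<bar>g s\<bar> \<le> C"
    and small: "\<And>s. 0 < s \<Longrightarrow> s \<le> 1 / 2 \<Longrightarrow> s * g s \<le> q * prim g s" "\<And>s. 0 < s \<Longrightarrow> s \<le> 1 / 2 \<Longrightarrow> c * s powr q \<le> prim g s"
    and large: "\<And>s. s > 1 / 2 \<Longrightarrow> g s = cut c q L s" and s: "0 \<le> s"
  shows "s * g s \<le> q * prim g s" "c * min s L powr q \<le> prim g s"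
    "s > 1 / 2 \<Longrightarrow> prim g s = prim g (1 / 2) + (prim (cut c q L) s - prim (cut c q L) (1 / 2))"
    "s > 1 / 2 \<Longrightarrow> prim (cut c q L) (1 / 2) \<le> prim (cut c q L) s"
proof -
  have L0: "L > 0" using c by simp
  note cb = cut_bound[OF c(1,2) L0]
  show eq: "prim g s = prim g (1 / 2) + (prim (cut c q L) s - prim (cut c q L) (1 / 2))" if s: "s > 1 / 2" for s
  proof -
    have "prim g s - prim g (1 / 2) = prim (cut c q L) s - prim (cut c q L) (1 / 2)"
      unfolding prim_diff[OF g] prim_diff[OF cut_measurable cb] using s large
      by (intro Bochner_Integration.integral_cong refl) (auto simp: sgn_interval_def indicator_def)
    then show ?thesis by simp
  qed
  \<comment> \<open>At the junction the true primitive dominates c (1/2)^q, the primitive of the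
    model. Beyond it both grow alike, so the inequalities for the model pass to
    \<open>g\<close>.\<close>
  have half: "prim (cut c q L) (1 / 2) \<le> prim g (1 / 2)"
    using small(2)[of "1 / 2"] c unfolding prim_cut[OF c(1,2) L0, of "1 / 2", simplified] by simp
  show "prim (cut c q L) (1 / 2) \<le> prim (cut c q L) s" if "s > 1 / 2" for s
  proof -
    have "0 \<le> (\<integral>\<sigma>. cut c q L \<sigma> * sgn_interval (1 / 2) s \<sigma> \<partial>lborel)"
      using that c by (intro integral_nonneg_AE always_eventually allI) (auto simp: sgn_interval_def indicator_def cut_def)
    then show ?thesis using prim_diff[OF cut_measurable cb, of s "1 / 2"] by simp
  qed
  show "s * g s \<le> q * prim g s"
  proof (cases "s > 1 / 2")
    case True
    have "s * cut c q L s \<le> q * prim (cut c q L) s" by (rule prim_cut_props[OF c(1,2) L0 s])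
    also have "\<dots> \<le> q * prim g s" using eq[OF True] half c by (intro mult_left_mono) auto
    finally show ?thesis using large[OF True] by simp
  qed (use small(1)[of s] s in \<open>cases "s = 0"; simp\<close>)
  show "c * min s L powr q \<le> prim g s"
  proof (cases "s > 1 / 2")
    case True
    have "c * min s L powr q \<le> prim (cut c q L) s" by (rule prim_cut_props[OF c(1,2) L0 s])
    then show ?thesis using eq[OF True] half by linarith
  next
    case False
    then have "min s L = s" using c by simp
    then show ?thesis using small(2)[of s] s False by (cases "s = 0") simp_all
  qed
qed

text \<open>The function exp (c t) \<phi>(t) is nondecreasing.\<close>

lemma gronwall_curve:
  assumes d: "\<And>t. 0 \<le> t \<Longrightarrow> t \<le> 1 \<Longrightarrow> (\<phi> has_real_derivative \<phi>' t) (at t)"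
    and le: "\<And>t. 0 \<le> t \<Longrightarrow> t \<le> 1 \<Longrightarrow> - c * \<phi> t \<le> \<phi>' t"
  shows "exp (- c) * \<phi> 0 \<le> \<phi> 1"
proof -
  have "exp (c * 0) * \<phi> 0 \<le> exp (c * 1) * \<phi> 1"
  proof (rule DERIV_nonneg_imp_nondecreasing[of 0 1 "\<lambda>t. exp (c * t) * \<phi> t"])
    fix t :: real assume t: "0 \<le> t" "t \<le> 1"
    have "((\<lambda>t. exp (c * t) * \<phi> t) has_real_derivative exp (c * t) * (c * \<phi> t + \<phi>' t)) (at t)"
      by (rule derivative_eq_intros d[OF t] refl | simp add: algebra_simps)+
    moreover have "0 \<le> exp (c * t) * (c * \<phi> t + \<phi>' t)" using le[OF t] by (intro mult_nonneg_nonneg) auto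
    ultimately show "\<exists>y. ((\<lambda>t. exp (c * t) * \<phi> t) has_real_derivative y) (at t) \<and> 0 \<le> y" by blast
  qed simp
  then have "\<phi> 0 \<le> exp c * \<phi> 1" by simp
  then have "exp (- c) * \<phi> 0 \<le> exp (- c) * (exp c * \<phi> 1)" by (intro mult_left_mono) auto
  also have "exp (- c) * (exp c * \<phi> 1) = \<phi> 1" by (simp add: mult.assoc[symmetric] exp_add[symmetric])
  finally show ?thesis .
qed

text \<open>Continuity in \<open>p\<close> and measurability in \<open>s\<close> give joint
  measurability: approximate \<open>p\<close> by simple functions, for which only countably many
  sections of \<open>f\<close> occur.\<close>

lemma caratheodory_measurable:
  fixes f :: "'a::{metric_space, second_countable_topology} \<Rightarrow> real \<Rightarrow> real"
  assumes B: "open B" and c: "\<And>p s. p \<in> B \<Longrightarrow> isCont (\<lambda>p. f p s) p" and m: "\<And>p. p \<in> B \<Longrightarrow> f p \<in> borel_measurable borel"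
  shows "(\<lambda>x. indicator B (fst x) * f (fst x) (snd x)) \<in> borel_measurable (borel \<Otimes>\<^sub>M borel)"
proof -
  have Bm [measurable]: "B \<in> sets borel" using B by simp
  fix z :: 'a
  have "(\<lambda>x::'a. x) \<in> borel_measurable borel" by simp
  from borel_measurable_implies_sequence_metric[OF this, of z, unfolded space_borel]
  obtain F :: "nat \<Rightarrow> 'a \<Rightarrow> 'a" where F': "\<forall>i. simple_function borel (F i)" "\<forall>x. (\<lambda>i. F i x) \<longlonglongrightarrow> x" by blast
  then have F: "\<And>i. simple_function borel (F i)" "\<And>x. (\<lambda>i. F i x) \<longlonglongrightarrow> x" by blast+
  \<comment> \<open>The inner indicator discards approximants outside \<open>B\<close>, where
    nothing is known of \<open>f\<close>; since \<open>B\<close> is open, eventually none is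
    discarded.\<close>
  define fi where "fi i x = indicator B (fst x) * (indicator B (F i (fst x)) * f (F i (fst x)) (snd x))" for i x
  show ?thesis
  proof (rule borel_measurable_LIMSEQ_real)
    show "fi i \<in> borel_measurable (borel \<Otimes>\<^sub>M borel)" for i
    proof -
      have fin: "finite (range (F i))" using F(1)[of i] by (simp add: simple_function_def)
      have "(\<lambda>x. (\<lambda>y x. indicator B y * f y (snd x)) (F i (fst x)) x) \<in> borel_measurable (borel \<Otimes>\<^sub>M borel)"
      proof (rule measurable_compose_countable'[where I="range (F i)"])
        show "countable (range (F i))" using fin by (rule countable_finite)
        show "(\<lambda>x. F i (fst x)) \<in> borel \<Otimes>\<^sub>M borel \<rightarrow>\<^sub>M count_space (range (F i))"
        proof (rule measurable_compose[OF measurable_fst])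
          show "F i \<in> borel \<rightarrow>\<^sub>M count_space (range (F i))"
            using simple_functionD(2)[OF F(1)[of i]] unfolding measurable_count_space_eq2[OF fin] by auto
        qed
        show "(\<lambda>x. indicator B y * f y (snd x)) \<in> borel_measurable (borel \<Otimes>\<^sub>M borel)" for y
        proof (cases "y \<in> B")
          case True
          have "(\<lambda>x. f y (snd x)) \<in> borel_measurable (borel \<Otimes>\<^sub>M borel)"
            by (rule measurable_compose[OF measurable_snd m[OF True]])
          then show ?thesis using True by simp
        qed simp
      qed
      then show ?thesis unfolding fi_def by measurable
    qed
    fix x :: "'a \<times> real"
    show "(\<lambda>i. fi i x) \<longlonglongrightarrow> indicator B (fst x) * f (fst x) (snd x)"
    proof (cases "fst x \<in> B")
      case True
      have "(\<lambda>i. f (F i (fst x)) (snd x)) \<longlonglongrightarrow> f (fst x) (snd x)"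
        by (rule isCont_tendsto_compose[OF c[OF True] F(2)])
      moreover have "\<forall>\<^sub>F i in sequentially. F i (fst x) \<in> B" using F(2)[of "fst x"] B True by (rule topological_tendstoD)
      then have "\<forall>\<^sub>F i in sequentially. f (F i (fst x)) (snd x) = fi i x"
        by eventually_elim (simp add: fi_def True)
      ultimately show ?thesis using True by (simp add: tendsto_cong)
    qed (simp add: fi_def)
  qed
qed

section \<open>Consequences of the structural assumptions\<close>

text \<open>The gauge ball is star-shaped about the origin for ordinary scaling, so the segment from
  0 to a point stays in the ball and the primitive can be compared along it.\<close>

lemma gauge_rho_scale_le:
  assumes "\<gamma> > 0" "0 \<le> t" "t \<le> 1" shows "gauge_rho \<gamma> (t *\<^sub>R p) \<le> gauge_rho \<gamma> p"
proof -
  have "norm (fst (t *\<^sub>R p)) powr (2 * (\<gamma> + 1)) \<le> norm (fst p) powr (2 * (\<gamma> + 1))"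
    using assms by (intro powr_mono2) (auto simp: mult_left_le_one_le)
  moreover have "(norm (snd (t *\<^sub>R p)))\<^sup>2 \<le> (norm (snd p))\<^sup>2"
    using assms by (intro power_mono) (auto simp: mult_left_le_one_le)
  then have "(\<gamma> + 1)\<^sup>2 * (norm (snd (t *\<^sub>R p)))\<^sup>2 \<le> (\<gamma> + 1)\<^sup>2 * (norm (snd p))\<^sup>2"
    by (rule mult_left_mono) simp
  ultimately have "gauge_S \<gamma> (t *\<^sub>R p) \<le> gauge_S \<gamma> p" unfolding gauge_S_def by linarith
  then show ?thesis unfolding gauge_rho_S using assms by (intro powr_mono2) (auto simp: gauge_S_nonneg)
qed

text \<open>The interval integral uses an open interval and \<open>prim\<close> a half-open one;
  they differ by a null set, with the sign reversed for negative \<open>s\<close>.\<close>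

lemma primitive_eq_prim:
  assumes [measurable]: "f p \<in> borel_measurable borel" shows "primitive f p s = prim (f p) s"
proof (cases "0 \<le> s")
  case True
  have "primitive f p s = (\<integral>\<sigma>. indicator {0<..<s} \<sigma> * f p \<sigma> \<partial>lborel)"
    using True by (simp add: primitive_def interval_lebesgue_integral_def set_lebesgue_integral_def flip: zero_ereal_def)
      (simp add: zero_ereal_def)
  also have "\<dots> = prim (f p) s" unfolding prim_def
  proof (rule integral_cong_AE)
    show "AE \<sigma> in lborel. indicator {0<..<s} \<sigma> * f p \<sigma> = f p \<sigma> * sgn_interval 0 s \<sigma>"
      using AE_lborel_singleton[of s] by eventually_elim (use True in \<open>auto simp: sgn_interval_def indicator_def\<close>)
  qed simp_all
  finally show ?thesis .
next
  case False
  have "primitive f p s = - (\<integral>\<sigma>. indicator {s<..<0} \<sigma> * f p \<sigma> \<partial>lborel)"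
    using False by (simp add: primitive_def interval_lebesgue_integral_def set_lebesgue_integral_def flip: zero_ereal_def)
      (simp add: zero_ereal_def)
  also have "\<dots> = (\<integral>\<sigma>. - (indicator {s<..<0} \<sigma> * f p \<sigma>) \<partial>lborel)" by simp
  also have "\<dots> = prim (f p) s" unfolding prim_def
  proof (rule integral_cong_AE)
    show "AE \<sigma> in lborel. - (indicator {s<..<0} \<sigma> * f p \<sigma>) = f p \<sigma> * sgn_interval 0 s \<sigma>"
      using AE_lborel_singleton[of 0] by eventually_elim (use False in \<open>auto simp: sgn_interval_def indicator_def\<close>)
  qed simp_all
  finally show ?thesis .
qed

text \<open>Integrability up to each finite endpoint contains measurability on that interval. Gluing
  the intervals of radius n, with the point 0 added separately, gives a sequence eventually equal to
  \<open>k\<close> at each point.\<close>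

lemma borel_measurable_of_interval_integrable:
  fixes k :: "real \<Rightarrow> real"
  assumes "\<And>s. interval_lebesgue_integrable lborel 0 (ereal s) k"
  shows "k \<in> borel_measurable borel"
proof (rule borel_measurable_LIMSEQ_real)
  define kn where "kn n s = indicator {0<..<real n} s * k s + indicator {- real n<..<0} s * k s + indicator {0} s * k 0" for n s
  show "kn n \<in> borel_measurable borel" for n
  proof -
    have "(\<lambda>s. indicator {0<..<real n} s * k s) \<in> borel_measurable borel"
      using assms[of "real n"] borel_measurable_integrable
      by (fastforce simp: interval_lebesgue_integrable_def set_integrable_def zero_ereal_def split: if_splits)
    moreover have "(\<lambda>s. indicator {- real n<..<0} s * k s) \<in> borel_measurable borel"
      using assms[of "- real n"] borel_measurable_integrable
      by (cases "n = 0") (fastforce simp: interval_lebesgue_integrable_def set_integrable_def zero_ereal_def split: if_splits)+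
    ultimately show ?thesis unfolding kn_def by simp
  qed
  show "(\<lambda>n. kn n s) \<longlonglongrightarrow> k s" for s
  proof -
    obtain N :: nat where N: "\<bar>s\<bar> < real N" using reals_Archimedean2 by blast
    have "kn n s = k s" if "n \<ge> N" for n
    proof -
      have "\<bar>s\<bar> < real n" using N that by linarith
      then show ?thesis unfolding kn_def by (cases s "0::real" rule: linorder_cases) auto
    qed
    then have "\<forall>\<^sub>F n in sequentially. kn n s = k s" by (rule eventually_sequentiallyI[of N])
    then show ?thesis by (rule tendsto_eventually)
  qed
qed

locale structural =
  fixes \<gamma> R q K \<kappa> :: real and f :: "(real^'m::finite) \<times> (real^'k::finite) \<Rightarrow> real \<Rightarrow> real"
  assumes \<gamma>: "\<gamma> > 0" and R: "R > 0" and q: "1 < q" "q < 2"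
    and str: "structural_assumptions (gauge_ball \<gamma> R) q K \<kappa> f"
begin

abbreviation "B \<equiv> gauge_ball \<gamma> R :: ((real^'m) \<times> (real^'k)) set"

lemma B_open: "open B" by (rule open_gauge_ball[OF \<gamma>])

lemma zero_B: "0 \<in> B" using R by (simp add: gauge_ball_def)

lemma f_measurable: "p \<in> B \<Longrightarrow> f p \<in> borel_measurable borel"
  using str unfolding structural_assumptions_def by (intro borel_measurable_of_interval_integrable) blast

lemma f_zero: "p \<in> B \<Longrightarrow> f p 0 = 0"
  using str unfolding structural_assumptions_def by blast

lemma f_prim: "p \<in> B \<Longrightarrow> primitive f p s = prim (f p) s"
  by (rule primitive_eq_prim[OF f_measurable])

lemma f_pos: assumes "p \<in> B" "- 1 < s" "s < 1" "s \<noteq> 0" shows "0 < s * f p s" "s * f p s \<le> q * prim (f p) s"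
proof -
  have "\<forall>p\<in>B. \<forall>s\<in>{-1<..<1} - {0}. 0 < s * f p s \<and> s * f p s \<le> q * primitive f p s"
    by (rule str[unfolded structural_assumptions_def, THEN conjunct2, THEN conjunct2, THEN conjunct1])
  from bspec[OF bspec[OF this assms(1)], of s] assms(2-4)
  show "0 < s * f p s" "s * f p s \<le> q * prim (f p) s" by (simp_all add: f_prim[OF assms(1)])
qed

lemma f_growth: obtains r where "1 < r" "r < 2" "\<And>p s. p \<in> B \<Longrightarrow> \<bar>f p s\<bar> \<le> \<kappa> * \<bar>s\<bar> powr (r - 1)"
  using str unfolding structural_assumptions_def by force

lemma \<kappa>_nonneg: "\<kappa> \<ge> 0"
proof (rule f_growth)
  fix r assume "\<And>p s. p \<in> B \<Longrightarrow> \<bar>f p s\<bar> \<le> \<kappa> * \<bar>s\<bar> powr (r - 1)"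
  from this[OF zero_B, of 1] show ?thesis by simp
qed

lemma f_bound_small: "p \<in> B \<Longrightarrow> \<bar>s\<bar> \<le> 1 \<Longrightarrow> \<bar>f p s\<bar> \<le> \<kappa>"
  and f_bound_large: "p \<in> B \<Longrightarrow> \<bar>s\<bar> \<ge> 1 / 2 \<Longrightarrow> \<bar>f p s\<bar> \<le> 2 * \<kappa> * \<bar>s\<bar>"
proof -
  obtain r where r: "1 < r" "r < 2" "\<And>p s. p \<in> B \<Longrightarrow> \<bar>f p s\<bar> \<le> \<kappa> * \<bar>s\<bar> powr (r - 1)" using f_growth by blast
  have one: "\<bar>s\<bar> powr (r - 1) \<le> 1" if "\<bar>s\<bar> \<le> 1" for s :: real
    using that r powr_mono2[of "r - 1" "\<bar>s\<bar>" 1] by simp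
  have big: "\<bar>s\<bar> powr (r - 1) \<le> \<bar>s\<bar>" if "\<bar>s\<bar> \<ge> 1" for s :: real
    using that r powr_mono[of "r - 1" 1 "\<bar>s\<bar>"] by simp
  have two: "\<bar>s\<bar> powr (r - 1) \<le> 2 * \<bar>s\<bar>" if "\<bar>s\<bar> \<ge> 1 / 2" for s :: real
    using that one[of s] big[of s] by (cases "\<bar>s\<bar> \<ge> 1") linarith+
  show "\<bar>f p s\<bar> \<le> \<kappa>" if "p \<in> B" "\<bar>s\<bar> \<le> 1"
    using r(3)[OF that(1), of s] mult_left_mono[OF one[OF that(2)] \<kappa>_nonneg] by simp
  show "\<bar>f p s\<bar> \<le> 2 * \<kappa> * \<bar>s\<bar>" if "p \<in> B" "\<bar>s\<bar> \<ge> 1 / 2"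
    using r(3)[OF that(1), of s] mult_left_mono[OF two[OF that(2)] \<kappa>_nonneg] by (simp add: mult_ac)
qed

lemma f_continuous: assumes "p \<in> B" shows "isCont (\<lambda>p. f p s) p"
proof -
  have "\<forall>p\<in>B. \<forall>s. \<exists>D. GDERIV (\<lambda>x. f x s) p :> D \<and> norm D \<le> K * \<bar>f p s\<bar>"
    using str unfolding structural_assumptions_def by blast
  then obtain D where "GDERIV (\<lambda>x. f x s) p :> D" using assms by blast
  then show ?thesis unfolding gderiv_def by (rule has_derivative_continuous)
qed

text \<open>The gradient bound |\<nabla>F| \<le> K F says that log F is Lipschitz in
  \<open>p\<close>; Gronwall along the curve uses this without dividing by F. It is applied to
  straight segments and to dilation orbits.\<close>

lemma primitive_curve:
  assumes x: "\<And>t. 0 \<le> t \<Longrightarrow> t \<le> 1 \<Longrightarrow> (x has_vector_derivative x' t) (at t)"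
    and xB: "\<And>t. 0 \<le> t \<Longrightarrow> t \<le> 1 \<Longrightarrow> x t \<in> B" and x': "\<And>t. 0 \<le> t \<Longrightarrow> t \<le> 1 \<Longrightarrow> norm (x' t) \<le> L" and s: "- 1 < s" "s < 1"
  shows "exp (- (\<bar>K\<bar> * L)) * prim (f (x 0)) s \<le> prim (f (x 1)) s"
proof -
  have "\<forall>p\<in>B. \<forall>s. \<exists>D. GDERIV (\<lambda>x. primitive f x s) p :> D \<and> norm D \<le> K * primitive f p s"
    using str unfolding structural_assumptions_def by blast
  then have "\<forall>p\<in>B. \<exists>D. GDERIV (\<lambda>x. primitive f x s) p :> D \<and> norm D \<le> K * primitive f p s" by blast
  from bchoice[OF this] obtain D where D': "\<forall>p\<in>B. GDERIV (\<lambda>x. primitive f x s) p :> D p \<and> norm (D p) \<le> K * primitive f p s" ..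
  have D: "\<And>p. p \<in> B \<Longrightarrow> GDERIV (\<lambda>x. primitive f x s) p :> D p" "\<And>p. p \<in> B \<Longrightarrow> norm (D p) \<le> K * primitive f p s"
    using D' by blast+
  have nonneg: "0 \<le> primitive f p s" if "p \<in> B" for p
  proof (cases "s = 0")
    case False
    have "0 < q * prim (f p) s" using f_pos[OF that s False] by linarith
    then have "0 < prim (f p) s" using q(1) by (simp add: zero_less_mult_iff)
    then show ?thesis by (simp add: f_prim[OF that])
  qed (simp add: f_prim[OF that])
  have "exp (- (\<bar>K\<bar> * L)) * primitive f (x 0) s \<le> primitive f (x 1) s"
  proof (rule gronwall_curve[where \<phi>'="\<lambda>t. x' t \<bullet> D (x t)"])
    fix t :: real assume t: "0 \<le> t" "t \<le> 1"
    have "((\<lambda>t. primitive f (x t) s) has_derivative (\<lambda>h. (h *\<^sub>R x' t) \<bullet> D (x t))) (at t)"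
      using has_derivative_compose[OF x[OF t, unfolded has_vector_derivative_def] D(1)[OF xB[OF t], unfolded gderiv_def]]
      by simp
    then show "((\<lambda>t. primitive f (x t) s) has_real_derivative x' t \<bullet> D (x t)) (at t)"
      unfolding has_field_derivative_def by (rule has_derivative_eq_rhs) (simp add: fun_eq_iff mult.commute)
    have "\<bar>x' t \<bullet> D (x t)\<bar> \<le> norm (x' t) * norm (D (x t))" by (rule Cauchy_Schwarz_ineq2)
    also have "\<dots> \<le> L * (\<bar>K\<bar> * primitive f (x t) s)"
    proof (rule mult_mono)
      show "norm (D (x t)) \<le> \<bar>K\<bar> * primitive f (x t) s"
        using D(2)[OF xB[OF t]] mult_right_mono[OF abs_ge_self nonneg[OF xB[OF t]], of K] by linarith
      show "0 \<le> L" using x'[OF t] norm_ge_zero order_trans by blast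
    qed (use x'[OF t] in simp_all)
    finally show "- (\<bar>K\<bar> * L) * primitive f (x t) s \<le> x' t \<bullet> D (x t)" by (simp add: mult_ac abs_le_iff)
  qed
  then show ?thesis using f_prim xB[of 0] xB[of 1] by simp
qed

text \<open>A globally bounded version of \<open>f\<close>, as \<open>lower_1D\<close> demands, with
  the same primitive on [-1, 1].\<close>

definition fc :: "(real^'m) \<times> (real^'k) \<Rightarrow> real \<Rightarrow> real" where
  "fc p s = (if \<bar>s\<bar> \<le> 1 then f p s else 0)"

lemma fc_measurable: "p \<in> B \<Longrightarrow> fc p \<in> borel_measurable borel"
  using f_measurable[of p] unfolding fc_def[abs_def] by simp

lemma fc_bound: "p \<in> B \<Longrightarrow> \<bar>fc p s\<bar> \<le> \<kappa>"
  using f_bound_small[of p s] \<kappa>_nonneg by (simp add: fc_def)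

lemma prim_fc: "\<bar>s\<bar> \<le> 1 \<Longrightarrow> prim (fc p) s = prim (f p) s"
  unfolding prim_def fc_def by (intro Bochner_Integration.integral_cong refl) (auto simp: sgn_interval_def indicator_def)

text \<open>The sign \<open>e\<close> treats both half-lines at once: for e = -1 the one-dimensional
  bound is applied to the reflected function.\<close>

lemma prim_lower:
  assumes p: "p \<in> B" and e: "e = 1 \<or> e = - 1"
  shows "0 < prim (f p) (e / 2)" "0 < s \<Longrightarrow> s < 1 \<Longrightarrow> prim (f p) (e / 2) * s powr q \<le> prim (f p) (e * s)"
proof -
  define g where "g \<sigma> = e * fc p (e * \<sigma>)" for \<sigma>
  note fm [measurable] = fc_measurable[OF p]
  have gm: "g \<in> borel_measurable borel" unfolding g_def by measurable
  have gb: "\<bar>g \<sigma>\<bar> \<le> \<kappa>" for \<sigma> using fc_bound[OF p, of "e * \<sigma>"] e by (auto simp: g_def)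
  have pg: "prim g \<sigma> = prim (fc p) (e * \<sigma>)" for \<sigma>
    using e prim_reflect[OF fm, of \<sigma>] by (auto simp: g_def[abs_def])
  have *: "0 < \<sigma> * g \<sigma>" "\<sigma> * g \<sigma> \<le> q * prim g \<sigma>" if "0 < \<sigma>" "\<sigma> < 1" for \<sigma>
    using f_pos[OF p, of "e * \<sigma>"] e that unfolding pg g_def by (auto simp: prim_fc fc_def)
  show "0 < prim (f p) (e / 2)"
    using lower_1D(1)[OF gm gb _ *, of "1 / 2"] q e unfolding pg by (auto simp: prim_fc)
  show "prim (f p) (e / 2) * s powr q \<le> prim (f p) (e * s)" if "0 < s" "s < 1"
    using lower_1D(2)[OF gm gb _ * that] q e that unfolding pg by (auto simp: prim_fc)
qed

text \<open>The one-dimensional bound alone has a constant F(p, 1/2) or F(p, -1/2) depending on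
  \<open>p\<close>. Comparison along the segment from the origin bounds both below by a fixed
  multiple of their values at 0, where \<open>L\<close> bounds the length of the segment.\<close>

lemma lower_bound_exists: "\<exists>c>0. primitive_lower_bound B q f c"
proof -
  define L where "L = R + R powr (\<gamma> + 1)"
  have low: "exp (- (\<bar>K\<bar> * L)) * prim (f 0) s \<le> prim (f p) s" if "p \<in> B" "- 1 < s" "s < 1" for p s
  proof -
    have "exp (- (\<bar>K\<bar> * L)) * prim (f (0 *\<^sub>R p)) s \<le> prim (f (1 *\<^sub>R p)) s"
    proof (rule primitive_curve[of "\<lambda>t. t *\<^sub>R p" "\<lambda>_. p" L s])
      show "((\<lambda>t. t *\<^sub>R p) has_vector_derivative p) (at t)" for t
        by (auto intro!: derivative_eq_intros)
      show "t *\<^sub>R p \<in> B" if "0 \<le> t" "t \<le> 1" for t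
        using gauge_rho_scale_le[OF \<gamma> that, of p] \<open>p \<in> B\<close> by (simp add: gauge_ball_def)
      show "norm p \<le> L" unfolding L_def using \<open>p \<in> B\<close> by (intro norm_le_rho[OF \<gamma>]) (simp add: gauge_ball_def)
    qed (use that in simp_all)
    then show ?thesis by simp
  qed
  define c where "c = exp (- (\<bar>K\<bar> * L)) * min (prim (f 0) (1 / 2)) (prim (f 0) (- 1 / 2))"
  have c: "c > 0" using prim_lower(1)[OF zero_B, of 1] prim_lower(1)[OF zero_B, of "- 1"] by (simp add: c_def)
  have "c * \<bar>s\<bar> powr q \<le> primitive f p s" if p: "p \<in> B" and s: "- 1 < s" "s < 1" for p s
  proof (cases "s = 0")
    case True
    then show ?thesis using q by (simp add: f_prim[OF p])
  next
    case False
    define e where "e = sgn s"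
    have e: "e = 1 \<or> e = - 1" "e * \<bar>s\<bar> = s" using False by (auto simp: e_def sgn_if)
    have "c \<le> exp (- (\<bar>K\<bar> * L)) * prim (f 0) (e / 2)" unfolding c_def using e(1) by (intro mult_left_mono) auto
    also have "\<dots> \<le> prim (f p) (e / 2)" using e(1) by (intro low p) auto
    finally have "c * \<bar>s\<bar> powr q \<le> prim (f p) (e / 2) * \<bar>s\<bar> powr q" by (intro mult_right_mono) auto
    also have "\<dots> \<le> prim (f p) (e * \<bar>s\<bar>)" using prim_lower(2)[OF p e(1), of "\<bar>s\<bar>"] False s by auto
    finally show ?thesis by (simp add: e(2) f_prim[OF p])
  qed
  with c show ?thesis unfolding primitive_lower_bound_def by (intro exI[of _ c]) auto
qed

end

lemma prim_cmult: "prim (\<lambda>s. c * k s) x = c * prim k x"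
  by (simp add: prim_def mult.assoc)

section \<open>The modified nonlinearity and its behaviour along dilations\<close>

locale structural_lower = structural \<gamma> R q K \<kappa> f
  for \<gamma> R q K \<kappa> :: real and f :: "(real^'m::finite) \<times> (real^'k::finite) \<Rightarrow> real \<Rightarrow> real" +
  fixes c0 :: real
  assumes c0: "c0 > 0" and lower: "primitive_lower_bound (gauge_ball \<gamma> R) q f c0"
begin

definition f1 :: "real \<Rightarrow> (real^'m) \<times> (real^'k) \<Rightarrow> real \<Rightarrow> real" where
  "f1 L p s = (if \<bar>s\<bar> \<le> 1 / 2 then f p s else cut c0 q L s)"

lemma f1_measurable: "p \<in> B \<Longrightarrow> f1 L p \<in> borel_measurable borel"
  using f_measurable[of p] unfolding f1_def[abs_def] by simp

lemma f1_bound: "p \<in> B \<Longrightarrow> L > 0 \<Longrightarrow> \<bar>f1 L p s\<bar> \<le> \<kappa> + q * c0 * L powr (q - 1)"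
proof -
  assume "p \<in> B" "L > 0"
  moreover have "0 \<le> q * c0 * L powr (q - 1)" using q c0 by simp
  ultimately show ?thesis
    using f_bound_small[of p s] cut_bound[OF c0 q(1), of L s] \<kappa>_nonneg by (auto simp: f1_def)
qed

lemma prim_f1: "\<bar>s\<bar> \<le> 1 / 2 \<Longrightarrow> prim (f1 L p) s = prim (f p) s"
  unfolding prim_def f1_def by (intro Bochner_Integration.integral_cong refl) (auto simp: sgn_interval_def indicator_def)

text \<open>All four claims are reduced to s \<ge> 0 by the sign \<open>e\<close> and read off from
  \<open>cut_1D\<close>. The increment beyond |s| = 1/2 does not depend on \<open>p\<close>, which
  is what keeps comparisons between different points simple.\<close>

lemma
  assumes p: "p \<in> B" and L: "L > 1 / 2"
  shows f1_hom: "s * f1 L p s \<le> q * prim (f1 L p) s"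
    and f1_lower: "c0 * min \<bar>s\<bar> L powr q \<le> prim (f1 L p) s"
    and f1_large: "\<bar>s\<bar> > 1 / 2 \<Longrightarrow> prim (f1 L p) s = prim (f p) (sgn s / 2) + (prim (cut c0 q L) \<bar>s\<bar> - prim (cut c0 q L) (1 / 2))"
    and cut_mono: "\<bar>s\<bar> > 1 / 2 \<Longrightarrow> prim (cut c0 q L) (1 / 2) \<le> prim (cut c0 q L) \<bar>s\<bar>"
proof -
  define e where "e = (if s < 0 then - 1 else 1 :: real)"
  have e: "e = 1 \<or> e = - 1" "e * \<bar>s\<bar> = s" by (auto simp: e_def)
  define g where "g \<sigma> = e * f1 L p (e * \<sigma>)" for \<sigma>
  note fm [measurable] = f1_measurable[OF p, of L]
  have gm: "g \<in> borel_measurable borel" unfolding g_def by measurable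
  have gb: "\<bar>g \<sigma>\<bar> \<le> \<kappa> + q * c0 * L powr (q - 1)" for \<sigma>
    using f1_bound[OF p, of L "e * \<sigma>"] L e(1) by (auto simp: g_def)
  have pg: "prim g \<sigma> = prim (f1 L p) (e * \<sigma>)" for \<sigma>
    using e(1) prim_reflect[OF fm, of \<sigma>] by (auto simp: g_def[abs_def])
  have small: "\<sigma> * g \<sigma> \<le> q * prim g \<sigma>" "c0 * \<sigma> powr q \<le> prim g \<sigma>" if \<sigma>: "0 < \<sigma>" "\<sigma> \<le> 1 / 2" for \<sigma>
  proof -
    have s1: "\<bar>e * \<sigma>\<bar> \<le> 1 / 2" "- 1 < e * \<sigma>" "e * \<sigma> < 1" "e * \<sigma> \<noteq> 0" using e(1) \<sigma> by auto
    have "e * \<sigma> * f p (e * \<sigma>) \<le> q * prim (f p) (e * \<sigma>)" using f_pos(2)[OF p s1(2-4)] .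
    then show "\<sigma> * g \<sigma> \<le> q * prim g \<sigma>" unfolding pg g_def prim_f1[OF s1(1)] using s1(1) by (simp add: f1_def mult_ac)
    have "c0 * \<bar>e * \<sigma>\<bar> powr q \<le> primitive f p (e * \<sigma>)"
      using lower p s1(2,3) unfolding primitive_lower_bound_def by auto
    then show "c0 * \<sigma> powr q \<le> prim g \<sigma>" unfolding pg prim_f1[OF s1(1)] f_prim[OF p] using e(1) \<sigma> by auto
  qed
  have large: "g \<sigma> = cut c0 q L \<sigma>" if "\<sigma> > 1 / 2" for \<sigma>
    using e(1) that cut_odd[of c0 q L \<sigma>] by (auto simp: g_def f1_def)
  note c = cut_1D[OF c0 q(1) L gm gb small large, of "\<bar>s\<bar>", simplified]
  have "\<bar>s\<bar> * g \<bar>s\<bar> \<le> q * prim g \<bar>s\<bar>" by (rule c(1))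
  moreover have "\<bar>s\<bar> * g \<bar>s\<bar> = (e * \<bar>s\<bar>) * f1 L p (e * \<bar>s\<bar>)" unfolding g_def by simp
  ultimately show "s * f1 L p s \<le> q * prim (f1 L p) s" unfolding pg e(2) by simp
  show "c0 * min \<bar>s\<bar> L powr q \<le> prim (f1 L p) s" using c(2) unfolding pg e(2) .
  show "prim (f1 L p) s = prim (f p) (sgn s / 2) + (prim (cut c0 q L) \<bar>s\<bar> - prim (cut c0 q L) (1 / 2))" if s: "\<bar>s\<bar> > 1 / 2"
  proof -
    have "e / 2 = sgn s / 2" using s by (auto simp: e_def sgn_if)
    moreover have "prim (f1 L p) (e / 2) = prim (f p) (e / 2)" using e(1) by (intro prim_f1) auto
    ultimately show ?thesis using c(3) s unfolding pg e(2) by simp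
  qed
  show "prim (cut c0 q L) (1 / 2) \<le> prim (cut c0 q L) \<bar>s\<bar>" if "\<bar>s\<bar> > 1 / 2" using c(4) that by simp
qed

lemma f1_prim_nonneg: "p \<in> B \<Longrightarrow> L > 1 / 2 \<Longrightarrow> 0 \<le> prim (f1 L p) s"
  using f1_lower[of p L s] c0 by (smt (verit) mult_nonneg_nonneg powr_ge_zero)

lemma dil_B: "p \<in> B \<Longrightarrow> 0 \<le> y \<Longrightarrow> dil \<gamma> (- y) p \<in> B"
proof -
  assume "p \<in> B" "0 \<le> y"
  then have "exp (- y) * gauge_rho \<gamma> p < R"
    using mult_right_mono[of "exp (- y)" 1 "gauge_rho \<gamma> p"] by (auto simp: gauge_ball_def)
  then show ?thesis by (simp add: gauge_ball_def gauge_rho_dil[OF \<gamma>])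
qed

text \<open>A bound for the logarithmic derivative of the primitive along a dilation orbit inside
  the ball: the gradient constant times the largest speed |zvec|.\<close>

definition rate :: real where "rate = \<bar>K\<bar> * ((\<gamma> + 1) * (R + R powr (\<gamma> + 1)))"

lemma rate_nonneg: "0 \<le> rate"
  using \<gamma> R by (simp add: rate_def)

lemma norm_zvec: assumes "p \<in> B" shows "norm (zvec \<gamma> p) \<le> (\<gamma> + 1) * (R + R powr (\<gamma> + 1))"
proof -
  have "norm (zvec \<gamma> p) \<le> (\<gamma> + 1) * norm p"
  proof (rule power2_le_imp_le)
    have "(norm (zvec \<gamma> p))\<^sup>2 = (norm (fst p))\<^sup>2 + (\<gamma> + 1)\<^sup>2 * (norm (snd p))\<^sup>2"
      by (simp add: zvec_def norm_prod_def power_mult_distrib)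
    also have "\<dots> \<le> (\<gamma> + 1)\<^sup>2 * (norm (fst p))\<^sup>2 + (\<gamma> + 1)\<^sup>2 * (norm (snd p))\<^sup>2"
      using \<gamma> mult_right_mono[of 1 "(\<gamma> + 1)\<^sup>2" "(norm (fst p))\<^sup>2"] by (simp add: one_le_power)
    also have "\<dots> = ((\<gamma> + 1) * norm p)\<^sup>2" by (simp add: norm_prod_def power_mult_distrib distrib_left)
    finally show "(norm (zvec \<gamma> p))\<^sup>2 \<le> ((\<gamma> + 1) * norm p)\<^sup>2" .
  qed (use \<gamma> in simp)
  also have "\<dots> \<le> (\<gamma> + 1) * (R + R powr (\<gamma> + 1))"
    using norm_le_rho[OF \<gamma>, of p R] assms \<gamma> by (intro mult_left_mono) (auto simp: gauge_ball_def)
  finally show ?thesis .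
qed

lemma prim_f_dil:
  assumes p: "p \<in> B" and y: "0 \<le> y" and s: "- 1 < s" "s < 1"
  shows "exp (- (rate * y)) * prim (f p) s \<le> prim (f (dil \<gamma> (- y) p)) s"
proof -
  define x where "x t = dil \<gamma> (- (t * y)) p" for t
  have "exp (- (\<bar>K\<bar> * (y * ((\<gamma> + 1) * (R + R powr (\<gamma> + 1)))))) * prim (f (x 0)) s \<le> prim (f (x 1)) s"
  proof (rule primitive_curve[of x "\<lambda>t. - y *\<^sub>R zvec \<gamma> (x t)"])
    show xB: "x t \<in> B" if "0 \<le> t" "t \<le> 1" for t unfolding x_def using p y that by (intro dil_B) auto
    show "(x has_vector_derivative - y *\<^sub>R zvec \<gamma> (x t)) (at t)" for t
      unfolding x_def dil_def[abs_def] zvec_def has_vector_derivative_def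
      by (auto intro!: derivative_eq_intros simp: fun_eq_iff algebra_simps)
    show "norm (- y *\<^sub>R zvec \<gamma> (x t)) \<le> y * ((\<gamma> + 1) * (R + R powr (\<gamma> + 1)))" if "0 \<le> t" "t \<le> 1" for t
      using norm_zvec[OF xB[OF that]] y by (simp add: mult_left_mono)
  qed (use s in simp_all)
  then show ?thesis by (simp add: x_def rate_def mult_ac)
qed

text \<open>For |s| > 1/2 the primitive is its value for \<open>f\<close> at \<plusminus>1/2 plus an
  increment \<Delta> \<ge> 0 that does not depend on the point. The first part is covered by the
  gradient bound, and exp (- rate y) \<Delta> \<le> \<Delta>.\<close>

lemma prim_f1_dil:
  assumes p: "p \<in> B" and y: "0 \<le> y" and L: "L > 1 / 2"
  shows "exp (- (rate * y)) * prim (f1 L p) s \<le> prim (f1 L (dil \<gamma> (- y) p)) s"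
proof (cases "\<bar>s\<bar> \<le> 1 / 2")
  case True
  then show ?thesis using prim_f_dil[OF p y, of s] by (simp add: prim_f1)
next
  case False
  define \<Delta> where "\<Delta> = prim (cut c0 q L) \<bar>s\<bar> - prim (cut c0 q L) (1 / 2)"
  have \<Delta>: "0 \<le> \<Delta>" using cut_mono[OF p L, of s] False by (simp add: \<Delta>_def)
  have "exp (- (rate * y)) * (prim (f p) (sgn s / 2) + \<Delta>) \<le> prim (f (dil \<gamma> (- y) p)) (sgn s / 2) + \<Delta>"
    unfolding distrib_left
  proof (rule add_mono)
    show "exp (- (rate * y)) * prim (f p) (sgn s / 2) \<le> prim (f (dil \<gamma> (- y) p)) (sgn s / 2)"
      by (rule prim_f_dil[OF p y]) (auto simp: sgn_if)
    show "exp (- (rate * y)) * \<Delta> \<le> \<Delta>"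
      using \<Delta> rate_nonneg y by (intro mult_left_le_one_le) auto
  qed
  then show ?thesis using f1_large[OF p L, of s] f1_large[OF dil_B[OF p y] L, of s] False by (simp add: \<Delta>_def)
qed

lemma f_joint_measurable: "(\<lambda>x. indicator B (fst x) * f (fst x) (snd x)) \<in> borel_measurable (borel \<Otimes>\<^sub>M borel)"
  by (rule caratheodory_measurable[OF B_open f_continuous f_measurable])

text \<open>The bounded model of \<rho>^2 f, extended by 0 outside the ball so that it is defined
  and Borel on the whole space.\<close>

definition H :: "real \<Rightarrow> ((real^'m) \<times> (real^'k)) \<times> real \<Rightarrow> real" where
  "H L x = indicator B (fst x) * (gauge_rho \<gamma> (fst x))\<^sup>2 * f1 L (fst x) (snd x)"

lemma H_measurable: "H L \<in> borel_measurable borel"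
proof -
  note [measurable] = f_joint_measurable
  have [measurable]: "B \<in> sets borel" using B_open by simp
  have eq: "H L = (\<lambda>x. (gauge_rho \<gamma> (fst x))\<^sup>2 * (if \<bar>snd x\<bar> \<le> 1 / 2 then indicator B (fst x) * f (fst x) (snd x)
      else indicator B (fst x) * cut c0 q L (snd x)))"
    by (auto simp: H_def f1_def fun_eq_iff)
  have "H L \<in> borel_measurable (borel \<Otimes>\<^sub>M borel)" unfolding eq by measurable
  then show ?thesis by (simp add: borel_prod)
qed

lemma H_bound: assumes "L > 0" shows "\<bar>H L x\<bar> \<le> R\<^sup>2 * (\<kappa> + q * c0 * L powr (q - 1))"
proof (cases "fst x \<in> B")
  case True
  then have "(gauge_rho \<gamma> (fst x))\<^sup>2 \<le> R\<^sup>2" by (intro power_mono) (auto simp: gauge_ball_def)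
  then show ?thesis using True f1_bound[OF True assms, of "snd x"] by (auto simp: H_def abs_mult intro!: mult_mono)
next
  case False
  have "0 \<le> \<kappa> + q * c0 * L powr (q - 1)" using \<kappa>_nonneg q c0 by simp
  then show ?thesis using False by (simp add: H_def)
qed

lemma prim_H: "prim (\<lambda>s. H L (p, s)) s = indicator B p * (gauge_rho \<gamma> p)\<^sup>2 * prim (f1 L p) s"
  unfolding H_def by (simp add: prim_cmult)

lemma prim_H_nonneg: "L > 1 / 2 \<Longrightarrow> 0 \<le> prim (\<lambda>s. H L (p, s)) s"
  using f1_prim_nonneg[of p L s] by (cases "p \<in> B") (simp_all add: prim_H)

text \<open>The summand 2 in the exponent comes from the homogeneity of \<rho>^2,
  \<open>rate\<close> from the nonlinearity. Dilations by -y shrink, so they may bring a point into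
  the ball but never out of it; in the first case the left side is 0 and the right side
  nonnegative.\<close>

lemma H_dil:
  assumes y: "0 \<le> y" and L: "L > 1 / 2"
  shows "exp (- (rate + 2) * y) * prim (\<lambda>s. H L (p, s)) s \<le> prim (\<lambda>s. H L (dil \<gamma> (- y) p, s)) s"
proof (cases "p \<in> B")
  case True
  have "exp (- (rate + 2) * y) * prim (\<lambda>s. H L (p, s)) s = (exp (- y))\<^sup>2 * (gauge_rho \<gamma> p)\<^sup>2 * (exp (- (rate * y)) * prim (f1 L p) s)"
  proof -
    have "exp (- (rate + 2) * y) = exp (- y) * exp (- y) * exp (- (rate * y))"
      by (simp only: exp_add[symmetric]) (simp add: algebra_simps)
    then show ?thesis using True unfolding prim_H by (simp add: power2_eq_square mult_ac)
  qed
  also have "\<dots> \<le> (exp (- y))\<^sup>2 * (gauge_rho \<gamma> p)\<^sup>2 * prim (f1 L (dil \<gamma> (- y) p)) s"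
    by (intro mult_left_mono prim_f1_dil True y L) simp
  also have "\<dots> = prim (\<lambda>s. H L (dil \<gamma> (- y) p, s)) s"
    using dil_B[OF True y] by (simp add: prim_H gauge_rho_dil[OF \<gamma>] power_mult_distrib)
  finally show ?thesis .
next
  case False
  then show ?thesis using prim_H_nonneg[OF L, of "dil \<gamma> (- y) p" s] by (simp add: prim_H[of L p])
qed

lemma H_lim:
  assumes p: "p \<in> B" shows "((\<lambda>y. H L (dil \<gamma> (- y) p, s)) \<longlongrightarrow> H L (p, s)) (at_right 0)"
proof -
  have "isCont (\<lambda>p. (gauge_rho \<gamma> p)\<^sup>2 * f1 L p s) p"
  proof -
    have "isCont (gauge_rho \<gamma>) p" using continuous_on_gauge_rho[OF \<gamma>, of UNIV] unfolding continuous_on_eq_continuous_at[OF open_UNIV] by blast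
    moreover have "isCont (\<lambda>p. f1 L p s) p" using f_continuous[OF p, of s] by (cases "\<bar>s\<bar> \<le> 1 / 2") (simp_all add: f1_def)
    ultimately show ?thesis by (intro continuous_intros)
  qed
  moreover have "((\<lambda>y. dil \<gamma> (- y) p) \<longlongrightarrow> dil \<gamma> (- 0) p) (at_right 0)"
    unfolding dil_def by (intro tendsto_intros)
  ultimately have "((\<lambda>y. (gauge_rho \<gamma> (dil \<gamma> (- y) p))\<^sup>2 * f1 L (dil \<gamma> (- y) p) s) \<longlongrightarrow> (gauge_rho \<gamma> p)\<^sup>2 * f1 L p s) (at_right 0)"
    by (intro isCont_tendsto_compose[where g="\<lambda>p. (gauge_rho \<gamma> p)\<^sup>2 * f1 L p s" and l=p]) simp_all
  moreover have "\<forall>\<^sub>F y in at_right 0. (gauge_rho \<gamma> (dil \<gamma> (- y) p))\<^sup>2 * f1 L (dil \<gamma> (- y) p) s = H L (dil \<gamma> (- y) p, s)"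
    using dil_B[OF p] by (auto simp: eventually_at_right_field H_def intro!: exI[of _ 1])
  ultimately show ?thesis using p by (simp add: H_def tendsto_cong)
qed

lemma H_hom: assumes "L > 1 / 2" shows "s * H L (p, s) \<le> q * prim (\<lambda>s. H L (p, s)) s"
proof (cases "p \<in> B")
  case True
  from mult_left_mono[OF f1_hom[OF True assms, of s], of "(gauge_rho \<gamma> p)\<^sup>2"] True
  show ?thesis unfolding prim_H by (simp add: H_def mult_ac)
qed (simp add: prim_H, simp add: H_def)

text \<open>For |s| > 1/2 the original nonlinearity contributes 2 \<kappa> |s| and its replacement 2
  q c0 |s|, since |s|^(q-1) \<le> 2 |s| there.\<close>

definition C2 :: real where "C2 = 2 * \<kappa> + 2 * q * c0"

lemma C2_nonneg: "0 \<le> C2"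
  using \<kappa>_nonneg q c0 by (simp add: C2_def)

lemma f_f1: assumes p: "p \<in> B" and L: "L > 1 / 2" shows "\<bar>f p s - f1 L p s\<bar> \<le> C2 * \<bar>s\<bar>"
proof (cases "\<bar>s\<bar> \<le> 1 / 2")
  case True
  then show ?thesis using C2_nonneg by (simp add: f1_def)
next
  case False
  have "min \<bar>s\<bar> L powr (q - 1) \<le> \<bar>s\<bar> powr (q - 1)" using q L by (intro powr_mono2) auto
  also have "\<dots> \<le> 2 * \<bar>s\<bar>"
  proof (cases "\<bar>s\<bar> \<le> 1")
    case True
    have "\<bar>s\<bar> powr (q - 1) \<le> 1" using True q powr_mono2[of "q - 1" "\<bar>s\<bar>" 1] by simp
    then show ?thesis using False by simp
  next
    case False
    then show ?thesis using q powr_mono[of "q - 1" 1 "\<bar>s\<bar>"] by simp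
  qed
  finally have "q * c0 * min \<bar>s\<bar> L powr (q - 1) \<le> q * c0 * (2 * \<bar>s\<bar>)" using q c0 by (intro mult_left_mono) auto
  moreover have "\<bar>cut c0 q L s\<bar> = q * c0 * min \<bar>s\<bar> L powr (q - 1)"
  proof -
    have "s \<noteq> 0" using False by auto
    then show ?thesis using q c0 by (simp add: cut_def abs_mult abs_sgn_eq)
  qed
  ultimately have "\<bar>cut c0 q L s\<bar> \<le> 2 * q * c0 * \<bar>s\<bar>" by simp
  moreover have "\<bar>f p s\<bar> \<le> 2 * \<kappa> * \<bar>s\<bar>" using f_bound_large[OF p, of s] False by simp
  ultimately show ?thesis using False by (simp add: f1_def C2_def distrib_right)
qed

end

section \<open>The Carleman estimate\<close>

context structural_lower begin

text \<open>The summands serve separate ends: \<alpha> \<ge> 1; \<alpha> \<ge> C2 R^2, so that the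
  linear remainder is absorbed into b^2 |Du|^2; and the last two together, so that (2-q) \<tau> -
  (rate + 2) is at least (2-q) \<alpha>/2.\<close>

definition threshold :: real where
  "threshold = 1 + C2 * R\<^sup>2 + hom_dim \<gamma> TYPE('m) TYPE('k) + 2 * (rate + 2) / (2 - q)"

lemma threshold_ge: "1 \<le> threshold"
  using C2_nonneg rate_nonneg q \<gamma> by (simp add: threshold_def hom_dim_def)

text \<open>Here \<open>D\<close> is |Du|^2 and \<open>I\<close> the integral of the primitive. With
  b = 2 \<alpha> + 2 one has b^2 - b \<alpha> \<ge> 2 \<alpha>^2, and the coefficient of
  \<open>I\<close> is at least 4 \<alpha> times (2-q) \<alpha>/2.\<close>

lemma final_arith:
  assumes a: "threshold \<le> \<alpha>" and DI: "0 \<le> D" "0 \<le> I"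
    and main: "(2 * \<alpha> + 2)\<^sup>2 * D + 2 * (2 * \<alpha> + 2) * ((2 - q) * (\<alpha> + 2 - hom_dim \<gamma> TYPE('m) TYPE('k) / 2) - (rate + 2)) * I
      \<le> X + (2 * \<alpha> + 2) * C2 * R\<^sup>2 * D"
  shows "2 * \<alpha>\<^sup>2 * D + 2 * (2 - q) * \<alpha>\<^sup>2 * I \<le> X"
proof -
  define Q where "Q = hom_dim \<gamma> TYPE('m) TYPE('k)"
  have Q: "0 \<le> Q" using \<gamma> by (simp add: Q_def hom_dim_def)
  have a1: "1 \<le> \<alpha>" using a threshold_ge by linarith
  have CR: "0 \<le> C2 * R\<^sup>2" using C2_nonneg by simp
  have rq: "0 \<le> 2 * (rate + 2) / (2 - q)" using rate_nonneg q by simp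
  have a2: "C2 * R\<^sup>2 \<le> \<alpha>" using a Q rq unfolding threshold_def Q_def[symmetric] by linarith
  have a3: "Q + 2 * (rate + 2) / (2 - q) \<le> \<alpha>" using a CR unfolding threshold_def Q_def[symmetric] by linarith
  have k: "(2 - q) * \<alpha> / 2 \<le> (2 - q) * (\<alpha> + 2 - Q / 2) - (rate + 2)"
  proof -
    have "(2 - q) * (Q + 2 * (rate + 2) / (2 - q)) \<le> (2 - q) * \<alpha>" using a3 q by (intro mult_left_mono) auto
    moreover define z where "z = 2 * (rate + 2)"
    ultimately have "(2 - q) * (Q + z / (2 - q)) \<le> (2 - q) * \<alpha>" by (simp only:)
    moreover have "(2 - q) * (Q + z / (2 - q)) = (2 - q) * Q + z" using q by (simp add: distrib_left)
    ultimately have "(2 - q) * Q + 2 * (rate + 2) \<le> (2 - q) * \<alpha>" by (simp only: z_def)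
    then have 1: "(2 - q) * Q / 2 + (rate + 2) \<le> (2 - q) * \<alpha> / 2" by simp
    have "(2 - q) * (\<alpha> + 2 - Q / 2) = (2 - q) * \<alpha> + 2 * (2 - q) - (2 - q) * Q / 2" by (simp add: algebra_simps)
    moreover have "0 \<le> 2 * (2 - q)" using q by simp
    ultimately show ?thesis using 1 by linarith
  qed
  have b: "0 \<le> 2 * (2 * \<alpha> + 2)" "2 * (2 * \<alpha>) \<le> 2 * (2 * \<alpha> + 2)" using a1 by simp_all
  have "2 * (2 - q) * \<alpha>\<^sup>2 * I = 2 * (2 * \<alpha>) * ((2 - q) * \<alpha> / 2) * I" by (simp add: power2_eq_square)
  also have "\<dots> \<le> 2 * (2 * \<alpha> + 2) * ((2 - q) * (\<alpha> + 2 - Q / 2) - (rate + 2)) * I"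
    using a1 q by (intro mult_right_mono[OF mult_mono[OF b(2) k b(1)]] DI) simp
  finally have 2: "2 * (2 - q) * \<alpha>\<^sup>2 * I \<le> 2 * (2 * \<alpha> + 2) * ((2 - q) * (\<alpha> + 2 - Q / 2) - (rate + 2)) * I" .
  have "(2 * \<alpha> + 2) * C2 * R\<^sup>2 * D + 2 * \<alpha>\<^sup>2 * D \<le> (2 * \<alpha> + 2)\<^sup>2 * D"
  proof -
    have "(2 * \<alpha> + 2) * (C2 * R\<^sup>2) \<le> (2 * \<alpha> + 2) * \<alpha>" using a2 a1 by (intro mult_left_mono) auto
    moreover have "(2 * \<alpha> + 2) * \<alpha> + 2 * \<alpha>\<^sup>2 \<le> (2 * \<alpha> + 2)\<^sup>2" using a1 by (simp add: power2_eq_square algebra_simps)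
    ultimately have "(2 * \<alpha> + 2) * (C2 * R\<^sup>2) + 2 * \<alpha>\<^sup>2 \<le> (2 * \<alpha> + 2)\<^sup>2" by linarith
    from mult_right_mono[OF this DI(1)] show ?thesis by (simp add: algebra_simps)
  qed
  with 2 main show ?thesis unfolding Q_def[symmetric] by linarith
qed

text \<open>The estimate for the regularised representative in L2(mu): the Hardy inequality turns
  the bound on |Du|^2 into the first term, and the lower bound for the primitive turns the bound on
  its integral into the second.\<close>

lemma weighted_estimate:
  fixes u :: "(real^'m) \<times> (real^'k) \<Rightarrow> real"
  assumes a: "threshold \<le> \<alpha>" and \<epsilon>: "\<epsilon> > 0"
    and W: "S22_weighted \<gamma> R u g hh A un Dun \<alpha> (\<alpha> + 2 - hom_dim \<gamma> TYPE('m) TYPE('k) / 2) (mu \<gamma> \<alpha>)"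
  defines "S \<equiv> \<lambda>p. indicator B p * (gauge_rho \<gamma> p)\<^sup>2 * ((\<Sum>i\<in>UNIV. hh i p) / angle_fun \<gamma> p + f p (u p))"
  shows "ennreal (\<alpha>\<^sup>2) * (\<integral>\<^sup>+p. ennreal (gauge_rho \<gamma> p powr \<epsilon> * (u p)\<^sup>2 + gauge_rho \<gamma> p powr (2 + \<epsilon>) * \<bar>u p\<bar> powr q) \<partial>mu \<gamma> \<alpha>)
    \<le> ennreal ((2 / \<epsilon>\<^sup>2 + 1 / ((2 - q) * c0)) * R powr \<epsilon>) * (\<integral>\<^sup>+p. ennreal ((S p)\<^sup>2) \<partial>mu \<gamma> \<alpha>)"
proof -
  define \<tau> where "\<tau> = \<alpha> + 2 - hom_dim \<gamma> TYPE('m) TYPE('k) / 2"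
  interpret S22_weighted \<gamma> R u g hh A un Dun \<alpha> \<tau> "mu \<gamma> \<alpha>" using W by (simp add: \<tau>_def)
  let ?M = "mu \<gamma> \<alpha> :: ((real^'m) \<times> (real^'k)) measure"
  have a1: "1 \<le> \<alpha>" using a threshold_ge by linarith
  have \<tau>0: "\<tau> \<ge> 0"
  proof -
    have "0 \<le> C2 * R\<^sup>2" "0 \<le> 2 * (rate + 2) / (2 - q)" "0 \<le> hom_dim \<gamma> TYPE('m) TYPE('k)"
      using C2_nonneg rate_nonneg q \<gamma> by (simp_all add: hom_dim_def)
    then show ?thesis using a unfolding threshold_def \<tau>_def by linarith
  qed
  define N where "N p = indicator A p * ((gauge_rho \<gamma> p)\<^sup>2 * f p (u p))" for p
  have A_B: "p \<in> A \<Longrightarrow> p \<in> B" for p using A_ball by auto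
  have SN: "S p = T1 p + N p" for p
  proof (cases "p \<in> A")
    case True
    then show ?thesis using A_B[OF True] by (simp add: S_def T1_def N_def algebra_simps)
  next
    case False
    then show ?thesis using f_zero[of p] by (cases "p \<in> B") (simp_all add: S_def T1_def N_def u_zero)
  qed
  have Nm: "N \<in> borel_measurable borel"
  proof -
    have "(\<lambda>p. (p, u p)) \<in> borel \<rightarrow>\<^sub>M borel \<Otimes>\<^sub>M borel" by measurable
    from measurable_compose[OF this f_joint_measurable]
    have [measurable]: "(\<lambda>p. indicator B p * f p (u p)) \<in> borel_measurable borel" by simp
    have "N = (\<lambda>p. indicator A p * ((gauge_rho \<gamma> p)\<^sup>2 * (indicator B p * f p (u p))))"
      using A_B by (auto simp: N_def fun_eq_iff indicator_def simp del: split_paired_All)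
    then show ?thesis by simp
  qed
  have Bm [measurable]: "B \<in> sets borel" using B_open by simp
  have Sm [measurable]: "S \<in> borel_measurable borel"
    using Nm unfolding SN[abs_def] T1_def[abs_def] by measurable
  show ?thesis
  \<comment> \<open>An infinite right-hand side makes the claim trivial because the constant is
    positive. Otherwise \<open>S\<close> is square integrable, the hypothesis from which
    \<open>carleman_core\<close> starts.\<close>
  proof (cases "(\<integral>\<^sup>+p. ennreal ((S p)\<^sup>2) \<partial>?M) = \<infinity>")
    case True
    define c where "c = (2 / \<epsilon>\<^sup>2 + 1 / ((2 - q) * c0)) * R powr \<epsilon>"
    have "0 < c" unfolding c_def
      using \<epsilon> q c0 R by (intro mult_pos_pos add_pos_pos) auto
    then show ?thesis unfolding True c_def[symmetric] by (simp add: ennreal_mult_top)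
  next
    case False
    have sS: "sqint ?M S"
      unfolding sqint_def integrable_iff_bounded using False by (simp add: less_top)
    define X where "X = (l2norm ?M S)\<^sup>2"
    have X: "(\<integral>\<^sup>+p. ennreal ((S p)\<^sup>2) \<partial>?M) = ennreal X"
      unfolding X_def l2norm_sq using sS by (intro nn_integral_eq_integral) (auto simp: sqint_def)
    define D where "D = (l2norm ?M Du)\<^sup>2"
    have D: "0 \<le> D" by (simp add: D_def)
    have est: "2 * \<alpha>\<^sup>2 * D + 2 * (2 - q) * \<alpha>\<^sup>2 * (\<integral>p. prim (\<lambda>s. H L (p, s)) (u p) \<partial>?M) \<le> X"
      and pint: "integrable ?M (\<lambda>p. prim (\<lambda>s. H L (p, s)) (u p))" if L: "L > 1 / 2" for L
    proof -
      have L0: "L > 0" using L by simp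
      have N0: "N p = 0" if "p \<notin> A" for p using that by (simp add: N_def)
      have NH: "\<bar>N p - H L (p, u p)\<bar> \<le> C2 * (gauge_rho \<gamma> p)\<^sup>2 * \<bar>u p\<bar>" if "p \<in> A" for p
      proof -
        have "\<bar>N p - H L (p, u p)\<bar> = (gauge_rho \<gamma> p)\<^sup>2 * \<bar>f p (u p) - f1 L p (u p)\<bar>"
          using that A_B[OF that] by (simp add: N_def H_def right_diff_distrib[symmetric] abs_mult)
        also have "\<dots> \<le> (gauge_rho \<gamma> p)\<^sup>2 * (C2 * \<bar>u p\<bar>)"
          by (intro mult_left_mono f_f1 A_B that L) simp
        finally show ?thesis by (simp add: mult_ac)
      qed
      have sT: "sqint ?M (\<lambda>p. T1 p + N p)" using sS unfolding SN[abs_def] .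
      have lim: "((\<lambda>y. H L (dil \<gamma> (- y) p, s)) \<longlongrightarrow> H L (p, s)) (at_right 0)" if "p \<in> A" for p s
        by (rule H_lim[OF A_B[OF that]])
      note core = carleman_core[of "H L" "R\<^sup>2 * (\<kappa> + q * c0 * L powr (q - 1))" "rate + 2" q N C2,
          OF R _ \<tau>0 H_measurable H_bound[OF L0] H_dil[OF _ L] lim H_hom[OF L] Nm N0 NH C2_nonneg sT]
      show "integrable ?M (\<lambda>p. prim (\<lambda>s. H L (p, s)) (u p))" using core(2) a1 by simp
      show "2 * \<alpha>\<^sup>2 * D + 2 * (2 - q) * \<alpha>\<^sup>2 * (\<integral>p. prim (\<lambda>s. H L (p, s)) (u p) \<partial>?M) \<le> X"
      proof (rule final_arith[OF a D])
        show "0 \<le> (\<integral>p. prim (\<lambda>s. H L (p, s)) (u p) \<partial>?M)"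
          by (intro integral_nonneg_AE always_eventually allI prim_H_nonneg L)
        show "(2 * \<alpha> + 2)\<^sup>2 * D + 2 * (2 * \<alpha> + 2) * ((2 - q) * (\<alpha> + 2 - hom_dim \<gamma> TYPE('m) TYPE('k) / 2) - (rate + 2)) * (\<integral>p. prim (\<lambda>s. H L (p, s)) (u p) \<partial>?M)
          \<le> X + (2 * \<alpha> + 2) * C2 * R\<^sup>2 * D"
          using core(1) a1 unfolding D_def X_def SN[abs_def] \<tau>_def by simp
      qed
    qed
    define P1 where "P1 = (l2norm ?M (\<lambda>p. gauge_rho \<gamma> p powr (\<epsilon> / 2) * u p))\<^sup>2"
    have P1: "(\<integral>\<^sup>+p. ennreal (gauge_rho \<gamma> p powr \<epsilon> * (u p)\<^sup>2) \<partial>?M) = ennreal P1"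
    proof -
      have "(\<integral>\<^sup>+p. ennreal (gauge_rho \<gamma> p powr \<epsilon> * (u p)\<^sup>2) \<partial>?M) = (\<integral>\<^sup>+p. ennreal ((gauge_rho \<gamma> p powr (\<epsilon> / 2) * u p)\<^sup>2) \<partial>?M)"
        by (simp add: power_mult_distrib power2_eq_square[of "_ powr _"] powr_add[symmetric])
      also have "\<dots> = ennreal P1" unfolding P1_def l2norm_sq
        using sqint_rho_u[of "\<epsilon> / 2"] \<epsilon> by (intro nn_integral_eq_integral) (auto simp: sqint_def)
      finally show ?thesis .
    qed
    have DX: "2 * \<alpha>\<^sup>2 * D \<le> X" and IX: "2 * (2 - q) * \<alpha>\<^sup>2 * (\<integral>p. prim (\<lambda>s. H L (p, s)) (u p) \<partial>?M) \<le> X" if L: "L > 1 / 2" for L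
    proof -
      have "0 \<le> (\<integral>p. prim (\<lambda>s. H L (p, s)) (u p) \<partial>?M)"
        by (intro integral_nonneg_AE always_eventually allI prim_H_nonneg L)
      then have "0 \<le> 2 * (2 - q) * \<alpha>\<^sup>2 * (\<integral>p. prim (\<lambda>s. H L (p, s)) (u p) \<partial>?M)" using q by simp
      moreover have "0 \<le> 2 * \<alpha>\<^sup>2 * D" using D by simp
      ultimately show "2 * \<alpha>\<^sup>2 * D \<le> X" "2 * (2 - q) * \<alpha>\<^sup>2 * (\<integral>p. prim (\<lambda>s. H L (p, s)) (u p) \<partial>?M) \<le> X"
        using est[OF L] by linarith+
    qed
    have first: "\<alpha>\<^sup>2 * P1 \<le> 2 / \<epsilon>\<^sup>2 * R powr \<epsilon> * X"
    proof -
      have "(\<epsilon> * l2norm ?M (\<lambda>p. gauge_rho \<gamma> p powr (\<epsilon> / 2) * u p))\<^sup>2 \<le> (2 * R powr (\<epsilon> / 2) * l2norm ?M Du)\<^sup>2"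
        using hardy_bound[OF \<epsilon> R] \<epsilon> by (intro power_mono) auto
      then have "\<epsilon>\<^sup>2 * P1 \<le> 4 * R powr \<epsilon> * D"
        by (simp add: power_mult_distrib P1_def D_def power2_eq_square[of "R powr _"] powr_add[symmetric])
      then have "\<alpha>\<^sup>2 * (\<epsilon>\<^sup>2 * P1) \<le> \<alpha>\<^sup>2 * (4 * R powr \<epsilon> * D)" by (rule mult_left_mono) simp
      also have "\<dots> = 2 * R powr \<epsilon> * (2 * \<alpha>\<^sup>2 * D)" by simp
      also have "\<dots> \<le> 2 * R powr \<epsilon> * X" using DX[of 1] by (intro mult_left_mono) auto
      finally show ?thesis using \<epsilon> by (simp add: field_simps)
    qed
    \<comment> \<open>The bound for the truncated sublinear term. It does not contain
      \<open>L\<close>: neither the constants in \<open>est\<close> nor those in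
      \<open>f1_lower\<close> depend on the truncation level.\<close>
    define Z where "Z = R powr \<epsilon> * X / (2 * (2 - q) * c0 * \<alpha>\<^sup>2)"
    have trunc: "(\<integral>\<^sup>+p. ennreal (gauge_rho \<gamma> p powr (2 + \<epsilon>) * min \<bar>u p\<bar> L powr q) \<partial>?M) \<le> ennreal Z" if L: "L > 1 / 2" for L
    proof -
      let ?I = "\<integral>p. prim (\<lambda>s. H L (p, s)) (u p) \<partial>?M"
      have "(\<integral>\<^sup>+p. ennreal (gauge_rho \<gamma> p powr (2 + \<epsilon>) * min \<bar>u p\<bar> L powr q) \<partial>?M)
        \<le> (\<integral>\<^sup>+p. ennreal (R powr \<epsilon> / c0 * prim (\<lambda>s. H L (p, s)) (u p)) \<partial>?M)"
      proof (intro nn_integral_mono ennreal_leI)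
        fix p
        show "gauge_rho \<gamma> p powr (2 + \<epsilon>) * min \<bar>u p\<bar> L powr q \<le> R powr \<epsilon> / c0 * prim (\<lambda>s. H L (p, s)) (u p)"
        proof (cases "p \<in> A")
          case True
          have r: "0 < gauge_rho \<gamma> p" "gauge_rho \<gamma> p < R" using rho_A[OF True] by auto
          have "gauge_rho \<gamma> p powr (2 + \<epsilon>) = gauge_rho \<gamma> p powr \<epsilon> * (gauge_rho \<gamma> p)\<^sup>2"
            using r by (simp add: powr_add powr_numeral)
          also have "\<dots> \<le> R powr \<epsilon> * (gauge_rho \<gamma> p)\<^sup>2"
            using r \<epsilon> by (intro mult_right_mono powr_mono2) auto
          finally have 1: "gauge_rho \<gamma> p powr (2 + \<epsilon>) \<le> R powr \<epsilon> * (gauge_rho \<gamma> p)\<^sup>2" .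
          have 2: "min \<bar>u p\<bar> L powr q \<le> prim (f1 L p) (u p) / c0"
            using f1_lower[OF A_B[OF True] L, of "u p"] c0 by (simp add: field_simps)
          have "gauge_rho \<gamma> p powr (2 + \<epsilon>) * min \<bar>u p\<bar> L powr q \<le> (R powr \<epsilon> * (gauge_rho \<gamma> p)\<^sup>2) * (prim (f1 L p) (u p) / c0)"
            by (rule mult_mono[OF 1 2]) auto
          then show ?thesis using A_B[OF True] by (simp add: prim_H mult_ac)
        qed (use L q in \<open>simp add: u_zero\<close>)
      qed
      also have "\<dots> = ennreal (\<integral>p. R powr \<epsilon> / c0 * prim (\<lambda>s. H L (p, s)) (u p) \<partial>?M)"
      proof (rule nn_integral_eq_integral)
        show "integrable ?M (\<lambda>p. R powr \<epsilon> / c0 * prim (\<lambda>s. H L (p, s)) (u p))" using pint[OF L] by simp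
        show "AE p in ?M. 0 \<le> R powr \<epsilon> / c0 * prim (\<lambda>s. H L (p, s)) (u p)"
          using c0 by (intro always_eventually allI mult_nonneg_nonneg prim_H_nonneg L) simp
      qed
      also have "\<dots> = ennreal (R powr \<epsilon> / c0 * ?I)" by simp
      also have "\<dots> \<le> ennreal Z"
      proof (rule ennreal_leI)
        have "?I \<le> X / (2 * (2 - q) * \<alpha>\<^sup>2)" using IX[OF L] q a1 by (simp add: field_simps)
        then have "R powr \<epsilon> / c0 * ?I \<le> R powr \<epsilon> / c0 * (X / (2 * (2 - q) * \<alpha>\<^sup>2))" using c0 by (intro mult_left_mono) auto
        then show "R powr \<epsilon> / c0 * ?I \<le> Z" by (simp add: Z_def mult_ac)
      qed
      finally show ?thesis .
    qed
    have um [measurable]: "u \<in> borel_measurable borel" by (rule u_meas)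
    have second: "(\<integral>\<^sup>+p. ennreal (gauge_rho \<gamma> p powr (2 + \<epsilon>) * \<bar>u p\<bar> powr q) \<partial>?M) \<le> ennreal Z"
    proof -
      \<comment> \<open>Levels L = n + 1 exceed 1/2 for every n, and Fatou removes the
        truncation.\<close>
      define fn where "fn n p = ennreal (gauge_rho \<gamma> p powr (2 + \<epsilon>) * min \<bar>u p\<bar> (real (Suc n)) powr q)" for n :: nat and p
      have "(\<lambda>n. fn n p) \<longlonglongrightarrow> ennreal (gauge_rho \<gamma> p powr (2 + \<epsilon>) * \<bar>u p\<bar> powr q)" for p
      proof (rule tendsto_eventually)
        obtain N :: nat where Nn: "\<bar>u p\<bar> < real N" using reals_Archimedean2 by blast
        show "\<forall>\<^sub>F n in sequentially. fn n p = ennreal (gauge_rho \<gamma> p powr (2 + \<epsilon>) * \<bar>u p\<bar> powr q)"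
        proof (rule eventually_sequentiallyI[of N])
          fix n assume "N \<le> n"
          then have "min \<bar>u p\<bar> (real (Suc n)) = \<bar>u p\<bar>" using Nn by simp
          then show "fn n p = ennreal (gauge_rho \<gamma> p powr (2 + \<epsilon>) * \<bar>u p\<bar> powr q)" by (simp only: fn_def)
        qed
      qed
      note lim = this
      have "(\<integral>\<^sup>+p. ennreal (gauge_rho \<gamma> p powr (2 + \<epsilon>) * \<bar>u p\<bar> powr q) \<partial>?M) = (\<integral>\<^sup>+p. liminf (\<lambda>n. fn n p) \<partial>?M)"
        by (intro nn_integral_cong) (simp only: lim_imp_Liminf[OF trivial_limit_sequentially lim])
      also have "\<dots> \<le> liminf (\<lambda>n. \<integral>\<^sup>+p. fn n p \<partial>?M)"
        by (rule nn_integral_liminf) (simp add: fn_def)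
      also have "\<dots> \<le> liminf (\<lambda>n. ennreal Z)"
        by (intro Liminf_mono always_eventually allI) (unfold fn_def, rule trunc, simp)
      also have "\<dots> = ennreal Z" by (simp add: Liminf_const)
      finally show ?thesis .
    qed
    have X0: "0 \<le> X" by (simp add: X_def)
    have Z0: "0 \<le> Z" using X0 q c0 by (simp add: Z_def)
    have P10: "0 \<le> P1" by (simp add: P1_def)
    have "(\<integral>\<^sup>+p. ennreal (gauge_rho \<gamma> p powr \<epsilon> * (u p)\<^sup>2 + gauge_rho \<gamma> p powr (2 + \<epsilon>) * \<bar>u p\<bar> powr q) \<partial>?M)
      = ennreal P1 + (\<integral>\<^sup>+p. ennreal (gauge_rho \<gamma> p powr (2 + \<epsilon>) * \<bar>u p\<bar> powr q) \<partial>?M)"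
      unfolding P1[symmetric] by (subst nn_integral_add[symmetric]) simp_all
    also have "\<dots> \<le> ennreal P1 + ennreal Z" by (intro add_left_mono second)
    also have "\<dots> = ennreal (P1 + Z)" using P10 Z0 by simp
    finally have "ennreal (\<alpha>\<^sup>2) * (\<integral>\<^sup>+p. ennreal (gauge_rho \<gamma> p powr \<epsilon> * (u p)\<^sup>2 + gauge_rho \<gamma> p powr (2 + \<epsilon>) * \<bar>u p\<bar> powr q) \<partial>?M)
      \<le> ennreal (\<alpha>\<^sup>2) * ennreal (P1 + Z)" by (rule mult_left_mono) simp
    also have "\<dots> = ennreal (\<alpha>\<^sup>2 * P1 + \<alpha>\<^sup>2 * Z)" using P10 Z0 by (simp add: ennreal_mult[symmetric] distrib_left)
    also have "\<dots> \<le> ennreal ((2 / \<epsilon>\<^sup>2 + 1 / ((2 - q) * c0)) * R powr \<epsilon> * X)"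
    proof (rule ennreal_leI)
      \<comment> \<open>A factor 1/2 is given away here to keep the constant simple.\<close>
      have "\<alpha>\<^sup>2 * Z = 1 / (2 * ((2 - q) * c0)) * R powr \<epsilon> * X" using a1 q c0 by (simp add: Z_def field_simps)
      also have "\<dots> \<le> 1 / ((2 - q) * c0) * R powr \<epsilon> * X"
        using q c0 X0 by (intro mult_right_mono frac_le) auto
      finally have "\<alpha>\<^sup>2 * Z \<le> 1 / ((2 - q) * c0) * R powr \<epsilon> * X" .
      with first show "\<alpha>\<^sup>2 * P1 + \<alpha>\<^sup>2 * Z \<le> (2 / \<epsilon>\<^sup>2 + 1 / ((2 - q) * c0)) * R powr \<epsilon> * X"
        by (simp add: distrib_right)
    qed
    also have "\<dots> = ennreal ((2 / \<epsilon>\<^sup>2 + 1 / ((2 - q) * c0)) * R powr \<epsilon>) * (\<integral>\<^sup>+p. ennreal ((S p)\<^sup>2) \<partial>?M)"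
      unfolding X using X0 q c0 \<epsilon> by (intro ennreal_mult) auto
    finally show ?thesis .
  qed
qed

text \<open>What remains is a translation between the given class and its Borel representative. Both
  integrands agree with their weighted counterparts off the null set z = 0, where the angle function
  is positive and can be inverted.\<close>

lemma carleman_estimate:
  assumes a: "threshold \<le> \<alpha>" and \<epsilon>: "\<epsilon> > 0"
    and u0: "u0 \<in> S22_0 \<gamma> (gauge_ball \<gamma> R - {0})"
    and supp: "ess_support (gauge_ball \<gamma> R - {0}) u0 \<subseteq> gauge_ball \<gamma> R - {0}"
  shows "ennreal (\<alpha>\<^sup>2) *
      (\<integral>\<^sup>+p\<in>gauge_ball \<gamma> R. ennreal (
          gauge_rho \<gamma> p powr (- 2 * \<alpha> - 4 + \<epsilon>) * (u0 p)\<^sup>2 * angle_fun \<gamma> p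
        + gauge_rho \<gamma> p powr (- 2 * \<alpha> - 2 + \<epsilon>) * \<bar>u0 p\<bar> powr q * (angle_fun \<gamma> p)\<^sup>2) \<partial>lebesgue)
    \<le> ennreal ((2 / \<epsilon>\<^sup>2 + 1 / ((2 - q) * c0)) * R powr \<epsilon>) *
      (\<integral>\<^sup>+p\<in>gauge_ball \<gamma> R. ennreal (
          gauge_rho \<gamma> p powr (- 2 * \<alpha>)
        * (baouendi_grushin \<gamma> (gauge_ball \<gamma> R - {0}) u0 p + f p (u0 p) * angle_fun \<gamma> p)\<^sup>2
        * inverse (angle_fun \<gamma> p)) \<partial>lebesgue)"
proof -
  define \<Omega> where "\<Omega> = gauge_ball \<gamma> R - {0 :: (real^'m) \<times> (real^'k)}"
  define h0 where "h0 = XX \<gamma> \<Omega> u0"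
  have "\<exists>h. \<exists>g. S22_element \<gamma> \<Omega> u0 g h" using u0 by (auto simp: S22_0_def \<Omega>_def)
  \<comment> \<open>The approximating sequence is taken for the very second derivatives that
    \<open>XX\<close> selects, so that \<open>hh i\<close> represents the terms of
    \<open>baouendi_grushin\<close>.\<close>
  from someI_ex[OF this] obtain g0 where el: "S22_element \<gamma> \<Omega> u0 g0 h0" unfolding h0_def XX_def by blast
  obtain u g hh A un Dun where ap: "S22_approx \<gamma> R u g hh A un Dun"
    and ae_u: "AE p in lebesgue. p \<in> \<Omega> \<longrightarrow> u p = u0 p" and ae_h: "\<And>i. AE p in lebesgue. p \<in> \<Omega> \<longrightarrow> hh i p = h0 i i p"
    using S22_approximation[OF \<gamma> R, of u0 g0 h0] el supp unfolding \<Omega>_def by blast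
  have W: "S22_weighted \<gamma> R u g hh A un Dun \<alpha> (\<alpha> + 2 - hom_dim \<gamma> TYPE('m) TYPE('k) / 2) (mu \<gamma> \<alpha>)"
    by (rule S22_weighted.intro[OF ap]) (simp add: S22_weighted_axioms_def)
  interpret S22_approx \<gamma> R u g hh A un Dun by (rule ap)
  have um [measurable]: "u \<in> borel_measurable borel" using L2convD(2)[OF conv_un] by (simp add: sqint_def)
  define S where "S p = indicator B p * (gauge_rho \<gamma> p)\<^sup>2 * ((\<Sum>i\<in>UNIV. hh i p) / angle_fun \<gamma> p + f p (u p))" for p
  have Bm [measurable]: "B \<in> sets borel" using B_open by simp
  have hm [measurable]: "hh i \<in> borel_measurable borel" for i using hh by (simp add: sqint_def)
  have Sm [measurable]: "S \<in> borel_measurable borel"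
  proof -
    have "(\<lambda>p. (p, u p)) \<in> borel \<rightarrow>\<^sub>M borel \<Otimes>\<^sub>M borel" by measurable
    from measurable_compose[OF this f_joint_measurable]
    have [measurable]: "(\<lambda>p. indicator B p * f p (u p)) \<in> borel_measurable borel" by simp
    have "S = (\<lambda>p. (gauge_rho \<gamma> p)\<^sup>2 * (indicator B p * ((\<Sum>i\<in>UNIV. hh i p) / angle_fun \<gamma> p) + indicator B p * f p (u p)))"
      by (simp add: S_def fun_eq_iff algebra_simps)
    then show ?thesis by simp
  qed
  have mu_int: "(\<integral>\<^sup>+p. ennreal (F p) \<partial>mu \<gamma> \<alpha>) = (\<integral>\<^sup>+p. ennreal (weight \<gamma> \<alpha> p * F p) \<partial>lebesgue)"
    if [measurable]: "F \<in> borel_measurable borel" for F :: "(real^'m) \<times> (real^'k) \<Rightarrow> real"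
  proof -
    have "(\<integral>\<^sup>+p. ennreal (F p) \<partial>mu \<gamma> \<alpha>) = (\<integral>\<^sup>+p. ennreal (weight \<gamma> \<alpha> p) * ennreal (F p) \<partial>lborel)"
      unfolding mu_def by (rule nn_integral_density) simp_all
    also have "\<dots> = (\<integral>\<^sup>+p. ennreal (weight \<gamma> \<alpha> p * F p) \<partial>lborel)"
      by (intro nn_integral_cong) (simp add: ennreal_mult'[symmetric])
    finally show ?thesis by (simp add: nn_integral_completion)
  qed
  have nz: "AE p in lebesgue. norm (fst (p :: (real^'m) \<times> (real^'k))) \<noteq> 0" by (rule AE_completion[OF null_fst_zero])
  have pos: "p \<noteq> 0" "0 < gauge_rho \<gamma> p" "0 < angle_fun \<gamma> p" if "norm (fst p) \<noteq> 0" for p :: "(real^'m) \<times> (real^'k)"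
  proof -
    show "p \<noteq> 0" using that by auto
    then show r: "0 < gauge_rho \<gamma> p" by (rule gauge_rho_pos[OF \<gamma>])
    show "0 < angle_fun \<gamma> p" using that r by (simp add: angle_fun_def)
  qed
  have L: "(\<integral>\<^sup>+p\<in>B. ennreal (
          gauge_rho \<gamma> p powr (- 2 * \<alpha> - 4 + \<epsilon>) * (u0 p)\<^sup>2 * angle_fun \<gamma> p
        + gauge_rho \<gamma> p powr (- 2 * \<alpha> - 2 + \<epsilon>) * \<bar>u0 p\<bar> powr q * (angle_fun \<gamma> p)\<^sup>2) \<partial>lebesgue)
    \<le> (\<integral>\<^sup>+p. ennreal (gauge_rho \<gamma> p powr \<epsilon> * (u p)\<^sup>2 + gauge_rho \<gamma> p powr (2 + \<epsilon>) * \<bar>u p\<bar> powr q) \<partial>mu \<gamma> \<alpha>)"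
    (is "?l \<le> ?r")
  proof -
    have "?l \<le> (\<integral>\<^sup>+p. ennreal (weight \<gamma> \<alpha> p * (gauge_rho \<gamma> p powr \<epsilon> * (u p)\<^sup>2 + gauge_rho \<gamma> p powr (2 + \<epsilon>) * \<bar>u p\<bar> powr q)) \<partial>lebesgue)"
    proof (rule nn_integral_mono_AE)
      show "AE p in lebesgue. ennreal (
          gauge_rho \<gamma> p powr (- 2 * \<alpha> - 4 + \<epsilon>) * (u0 p)\<^sup>2 * angle_fun \<gamma> p
        + gauge_rho \<gamma> p powr (- 2 * \<alpha> - 2 + \<epsilon>) * \<bar>u0 p\<bar> powr q * (angle_fun \<gamma> p)\<^sup>2) * indicator B p
        \<le> ennreal (weight \<gamma> \<alpha> p * (gauge_rho \<gamma> p powr \<epsilon> * (u p)\<^sup>2 + gauge_rho \<gamma> p powr (2 + \<epsilon>) * \<bar>u p\<bar> powr q))"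
        using nz ae_u
      proof eventually_elim
        case (elim p)
        show ?case
        proof (cases "p \<in> B")
          case True
          then have eq: "u0 p = u p" using elim pos(1)[OF elim(1)] by (simp add: \<Omega>_def)
          \<comment> \<open>The estimate in L2(mu) carries one power of the angle function on |u|^q;
            as the angle function is at most 1, this dominates the second power in the
            claim.\<close>
          have s: "(angle_fun \<gamma> p)\<^sup>2 \<le> angle_fun \<gamma> p"
            using angle_fun_le_1[OF \<gamma>, of p] pos(3)[OF elim(1)] by (simp add: power2_eq_square mult_left_le)
          have e1: "gauge_rho \<gamma> p powr (- 2 * \<alpha> - 4 + \<epsilon>) = gauge_rho \<gamma> p powr (- 2 * \<alpha> - 4) * gauge_rho \<gamma> p powr \<epsilon>"
            and e2: "gauge_rho \<gamma> p powr (- 2 * \<alpha> - 2 + \<epsilon>) = gauge_rho \<gamma> p powr (- 2 * \<alpha> - 4) * gauge_rho \<gamma> p powr (2 + \<epsilon>)"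
            by (simp_all add: powr_add[symmetric] algebra_simps)
          have "gauge_rho \<gamma> p powr (- 2 * \<alpha> - 4) * gauge_rho \<gamma> p powr (2 + \<epsilon>) * \<bar>u p\<bar> powr q * (angle_fun \<gamma> p)\<^sup>2
            \<le> gauge_rho \<gamma> p powr (- 2 * \<alpha> - 4) * gauge_rho \<gamma> p powr (2 + \<epsilon>) * \<bar>u p\<bar> powr q * angle_fun \<gamma> p"
            by (rule mult_left_mono[OF s]) simp
          then show ?thesis using True unfolding eq e1 e2 weight_def
            by (simp add: ennreal_leI algebra_simps)
        qed simp
      qed
    qed
    also have "\<dots> = ?r" by (rule mu_int[symmetric]) simp
    finally show ?thesis .
  qed
  have Rt: "(\<integral>\<^sup>+p. ennreal ((S p)\<^sup>2) \<partial>mu \<gamma> \<alpha>)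
    = (\<integral>\<^sup>+p\<in>B. ennreal (gauge_rho \<gamma> p powr (- 2 * \<alpha>) * (baouendi_grushin \<gamma> \<Omega> u0 p + f p (u0 p) * angle_fun \<gamma> p)\<^sup>2
        * inverse (angle_fun \<gamma> p)) \<partial>lebesgue)"
  proof -
    have ae_h': "AE p in lebesgue. \<forall>i\<in>UNIV. p \<in> \<Omega> \<longrightarrow> hh i p = h0 i i p"
      by (rule AE_finite_allI) (use ae_h in auto)
    have "(\<integral>\<^sup>+p. ennreal ((S p)\<^sup>2) \<partial>mu \<gamma> \<alpha>) = (\<integral>\<^sup>+p. ennreal (weight \<gamma> \<alpha> p * (S p)\<^sup>2) \<partial>lebesgue)"
      by (rule mu_int) simp
    also have "\<dots> = (\<integral>\<^sup>+p\<in>B. ennreal (gauge_rho \<gamma> p powr (- 2 * \<alpha>) * (baouendi_grushin \<gamma> \<Omega> u0 p + f p (u0 p) * angle_fun \<gamma> p)\<^sup>2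
        * inverse (angle_fun \<gamma> p)) \<partial>lebesgue)"
    proof (rule nn_integral_cong_AE)
      show "AE p in lebesgue. ennreal (weight \<gamma> \<alpha> p * (S p)\<^sup>2) = ennreal (gauge_rho \<gamma> p powr (- 2 * \<alpha>)
        * (baouendi_grushin \<gamma> \<Omega> u0 p + f p (u0 p) * angle_fun \<gamma> p)\<^sup>2 * inverse (angle_fun \<gamma> p)) * indicator B p"
        using nz ae_u ae_h'
      proof eventually_elim
        case (elim p)
        show ?case
        proof (cases "p \<in> B")
          case True
          then have p: "p \<in> \<Omega>" using pos(1)[OF elim(1)] by (simp add: \<Omega>_def)
          then have eq: "u0 p = u p" "baouendi_grushin \<gamma> \<Omega> u0 p = (\<Sum>i\<in>UNIV. hh i p)"
            using elim by (simp_all add: baouendi_grushin_def h0_def)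
          define b where "b = (\<Sum>i\<in>UNIV. hh i p)"
          define \<psi> where "\<psi> = angle_fun \<gamma> p"
          define r where "r = gauge_rho \<gamma> p"
          have ps: "\<psi> > 0" "r > 0" using pos[OF elim(1)] by (simp_all add: \<psi>_def r_def)
          have e1: "r powr (- 2 * \<alpha>) = r powr (- 2 * \<alpha> - 4) * (r\<^sup>2)\<^sup>2"
          proof -
            have "(r\<^sup>2)\<^sup>2 = r powr 4" using ps by (simp add: powr_numeral flip: power_mult)
            then show ?thesis by (simp add: powr_add[symmetric])
          qed
          \<comment> \<open>One power of \<psi> comes from the weight, and pulling 1/\<psi> out of
            the square leaves 1/\<psi> in total; e1 likewise matches the powers of \<rho>.\<close>
          have e2: "\<psi> * (b / \<psi> + f p (u p))\<^sup>2 = (b + f p (u p) * \<psi>)\<^sup>2 * inverse \<psi>"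
          proof -
            have "b / \<psi> + f p (u p) = (b + f p (u p) * \<psi>) * inverse \<psi>" using ps by (simp add: field_simps)
            then show ?thesis using ps by (simp add: power_mult_distrib power2_eq_square[of "inverse \<psi>"])
          qed
          have "r powr (- 2 * \<alpha> - 4) * \<psi> * (r\<^sup>2 * (b / \<psi> + f p (u p)))\<^sup>2
            = (r powr (- 2 * \<alpha> - 4) * (r\<^sup>2)\<^sup>2) * (\<psi> * (b / \<psi> + f p (u p))\<^sup>2)"
            by (simp only: power_mult_distrib mult_ac)
          also have "\<dots> = r powr (- 2 * \<alpha>) * (b + f p (u p) * \<psi>)\<^sup>2 * inverse \<psi>"
            by (simp only: e1 e2 mult.assoc)
          finally show ?thesis using True by (simp add: S_def weight_def eq b_def \<psi>_def r_def)
        qed (simp add: S_def)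
      qed
    qed
    finally show ?thesis .
  qed
  have "ennreal (\<alpha>\<^sup>2) * (\<integral>\<^sup>+p. ennreal (gauge_rho \<gamma> p powr \<epsilon> * (u p)\<^sup>2 + gauge_rho \<gamma> p powr (2 + \<epsilon>) * \<bar>u p\<bar> powr q) \<partial>mu \<gamma> \<alpha>)
    \<le> ennreal ((2 / \<epsilon>\<^sup>2 + 1 / ((2 - q) * c0)) * R powr \<epsilon>) * (\<integral>\<^sup>+p. ennreal ((S p)\<^sup>2) \<partial>mu \<gamma> \<alpha>)"
    unfolding S_def by (rule weighted_estimate[OF a \<epsilon> W])
  then show ?thesis
    unfolding Rt \<Omega>_def using mult_left_mono[OF L, of "ennreal (\<alpha>\<^sup>2)"] by (rule order_trans[rotated]) simp
qed

end

text \<open>The constant is explicit in \<epsilon>, q and c0, so it can be chosen before \<gamma>, R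
  and f; these enter through \<open>threshold\<close>, the bound from which on \<alpha> counts as
  large.\<close>

theorem theorem5p1:
  fixes q K \<kappa> :: real
  assumes "1 < q" and "q < 2"
  shows "(\<forall>\<gamma>>0. \<forall>R>0. \<forall>f :: (real^'m::finite) \<times> (real^'k::finite) \<Rightarrow> real \<Rightarrow> real.
            structural_assumptions (gauge_ball \<gamma> R) q K \<kappa> f \<longrightarrow>
            (\<exists>c\<^sub>0>0. primitive_lower_bound (gauge_ball \<gamma> R) q f c\<^sub>0))
       \<and> (\<forall>\<epsilon>>0. \<forall>c\<^sub>0>0. \<exists>C>0. \<forall>\<gamma>>0. \<forall>R>0. \<forall>f :: (real^'m) \<times> (real^'k) \<Rightarrow> real \<Rightarrow> real.
            structural_assumptions (gauge_ball \<gamma> R) q K \<kappa> f \<longrightarrow>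
            primitive_lower_bound (gauge_ball \<gamma> R) q f c\<^sub>0 \<longrightarrow>
            (\<exists>\<alpha>\<^sub>0>0. \<forall>\<alpha>\<ge>\<alpha>\<^sub>0. \<forall>u \<in> S22_0 \<gamma> (gauge_ball \<gamma> R - {0}).
               ess_support (gauge_ball \<gamma> R - {0}) u \<subseteq> gauge_ball \<gamma> R - {0} \<longrightarrow>
               ennreal (\<alpha>\<^sup>2) *
                 (\<integral>\<^sup>+p\<in>gauge_ball \<gamma> R. ennreal (
                    gauge_rho \<gamma> p powr (- 2 * \<alpha> - 4 + \<epsilon>) * (u p)\<^sup>2 * angle_fun \<gamma> p
                  + gauge_rho \<gamma> p powr (- 2 * \<alpha> - 2 + \<epsilon>) * \<bar>u p\<bar> powr q * (angle_fun \<gamma> p)\<^sup>2)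
                  \<partial>lebesgue)
               \<le> ennreal (C * R powr \<epsilon>) *
                 (\<integral>\<^sup>+p\<in>gauge_ball \<gamma> R. ennreal (
                    gauge_rho \<gamma> p powr (- 2 * \<alpha>)
                  * (baouendi_grushin \<gamma> (gauge_ball \<gamma> R - {0}) u p + f p (u p) * angle_fun \<gamma> p)\<^sup>2
                  * inverse (angle_fun \<gamma> p))
                  \<partial>lebesgue)))"
proof (intro conjI allI impI, goal_cases)
  case (1 \<gamma> R f)
  then interpret structural \<gamma> R q K \<kappa> f using assms by unfold_locales
  show ?case by (rule lower_bound_exists)
next
  case (2 \<epsilon> c\<^sub>0)
  note \<epsilon> = this(1) and c0 = this(2)
  show ?case
  proof (rule exI[of _ "2 / \<epsilon>\<^sup>2 + 1 / ((2 - q) * c\<^sub>0)"], intro conjI allI impI, goal_cases)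
    case 1
    show ?case using \<epsilon> c0 assms by (intro add_pos_pos) auto
  next
    case (2 \<gamma> R f)
    then interpret structural_lower \<gamma> R q K \<kappa> f c\<^sub>0 using assms c0 by unfold_locales
    have "0 < threshold" using threshold_ge by linarith
    then show ?case
      by (intro exI[of _ threshold] conjI allI impI ballI carleman_estimate[OF _ \<epsilon>])
  qed
qed

end
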